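(* Fix $\tau\in\mathbb H$. For generic $p\in E_\tau\setminus E_\tau[2]$ (all but finitely many $p$), the non-even log-free component for the data $(1,1,0,0,\tfrac12,\tfrac12)$ has smooth projective model $$W^2=t(t+1)P(t),$$ where $$P(t)=\Bigl(\wp(p)+\wp\bigl(p+\tfrac{\omega_1}2\bigr)+e_1\Bigr)t^2+(2\wp(p)+e_1)t+e_1-\wp\bigl(p+\tfrac{\omega_1}2\bigr),$$ and its genus is one. On the finite locus of $p\in E_\tau\setminus E_\tau[2]$ where the discriminant of $P$ (with respect to $t$) vanishes, this model is nodal and its normalization is rational. The full compactified log-free curve has arithmetic genus two throughout, i.e. for every $p\in E_\tau\setminus E_\tau[2]$.
   Context: Notation: $E_\tau=\mathbb C/(\mathbb Z+\mathbb Z\tau)$, $\omega_1=1$, $e_1=\wp(\tfrac12)$, $\wp,\zeta$ Weierstrass functions of $\mathbb Z+\mathbb Z\tau$. Consider $y''=qy$ with $$q(z)=2\bigl(\wp(z)+\wp(z-\tfrac12)\bigr)+\tfrac34\bigl(\wp(z+p)+\wp(z-p)\bigr)+T_1\bigl(\zeta(z-\tfrac12)-\zeta(z)\bigr)+T_+\bigl(\zeta(z+p)-\zeta(z)\bigr)+T_-\bigl(\zeta(z-p)-\zeta(z)\bigr)+B.$$ The log-free curve is the set of $(T_1,T_+,T_-)\in\mathbb C^3$ for which there is $B\in\mathbb C$ such that no solution has a logarithm at any of $0,\tfrac12,\pm p$ ($B$ is then determined by $(T_1,T_+,T_-)$). Its even component is the part with $T_++T_-=0$ (where $q$ is even); its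 non-even component is the closure of the part with $T_++T_-\ne0$. The compactified log-free curve is the (reduced) closure of the log-free curve in the projective space $\mathbb P^3\supset\mathbb C^3$. "Smooth projective model" means the smooth projective curve birational to the component, given by the displayed affine equation. *)

theory Defs
  imports "HOL-Complex_Analysis.Complex_Analysis" "HOL-Library.Function_Algebras"
begin

section \<open>Weierstrass functions of the lattice Z + Z tau\<close>

definition period_lattice :: "complex \<Rightarrow> complex set" where
  "period_lattice \<tau> = {of_int m + of_int n * \<tau> | m n. True}"

text \<open>Both series converge absolutely off the lattice, so the unordered infinite sum is the
  classical one.  The values at lattice points are irrelevant.\<close>

definition wp :: "complex \<Rightarrow> complex \<Rightarrow> complex" where
  "wp \<tau> z = 1 / z\<^sup>2 + (\<Sum>\<^sub>\<infinity>\<omega>\<in>period_lattice \<tau> - {0}. 1 / (z - \<omega>)\<^sup>2 - 1 / \<omega>\<^sup>2)"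

definition wzeta :: "complex \<Rightarrow> complex \<Rightarrow> complex" where
  "wzeta \<tau> z = 1 / z + (\<Sum>\<^sub>\<infinity>\<omega>\<in>period_lattice \<tau> - {0}. 1 / (z - \<omega>) + 1 / \<omega> + z / \<omega>\<^sup>2)"

definition e1 :: "complex \<Rightarrow> complex" where
  "e1 \<tau> = wp \<tau> (1/2)"

text \<open>The point of the torus represented by a complex number, as a coset of the lattice.\<close>

definition torus_point :: "complex \<Rightarrow> complex \<Rightarrow> complex set" where
  "torus_point \<tau> p = {p + \<omega> | \<omega>. \<omega> \<in> period_lattice \<tau>}"


section \<open>The log-free curve\<close>

definition potential ::
  "complex \<Rightarrow> complex \<Rightarrow> complex \<Rightarrow> complex \<Rightarrow> complex \<Rightarrow> complex \<Rightarrow> complex \<Rightarrow> complex" where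
  "potential \<tau> p T1 Tp Tm B z =
     2 * (wp \<tau> z + wp \<tau> (z - 1/2)) + 3/4 * (wp \<tau> (z + p) + wp \<tau> (z - p))
     + T1 * (wzeta \<tau> (z - 1/2) - wzeta \<tau> z)
     + Tp * (wzeta \<tau> (z + p) - wzeta \<tau> z)
     + Tm * (wzeta \<tau> (z - p) - wzeta \<tau> z)
     + B"

definition slit_disc :: "complex \<Rightarrow> real \<Rightarrow> complex set" where
  "slit_disc a r = {z \<in> ball a r. z - a \<notin> \<real>\<^sub>\<le>\<^sub>0}"

definition solves_on :: "(complex \<Rightarrow> complex) \<Rightarrow> complex set \<Rightarrow> (complex \<Rightarrow> complex) \<Rightarrow> bool" where
  "solves_on q S y \<longleftrightarrow> y holomorphic_on S \<and> (\<forall>z\<in>S. deriv (deriv y) z = q z * y z)"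

text \<open>No solution of \<open>y'' = q y\<close> has a logarithm at \<open>a\<close>: in a punctured disc about \<open>a\<close> without
  further singularities of \<open>q\<close>, every solution (a branch being fixed by the slit) is a sum of
  Frobenius series \<open>(z - a) powr \<rho> * h z\<close>, \<open>h\<close> holomorphic at \<open>a\<close>, without a term
  containing \<open>ln (z - a)\<close>.\<close>

definition log_free_at :: "(complex \<Rightarrow> complex) \<Rightarrow> complex \<Rightarrow> bool" where
  "log_free_at q a \<longleftrightarrow>
     (\<exists>r>0. q holomorphic_on (ball a r - {a}) \<and>
       (\<forall>y. solves_on q (slit_disc a r) y \<longrightarrow>
         (\<exists>\<rho>1 \<rho>2 h1 h2. h1 holomorphic_on ball a r \<and> h2 holomorphic_on ball a r \<and>
            (\<forall>z\<in>slit_disc a r.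
               y z = (z - a) powr \<rho>1 * h1 z + (z - a) powr \<rho>2 * h2 z))))"

text \<open>The coordinates 1, 2, 3 are \<open>T\<^sub>1\<close>, \<open>T\<^sub>+\<close>, \<open>T\<^sub>-\<close>.\<close>

definition log_free_curve :: "complex \<Rightarrow> complex \<Rightarrow> (complex^3) set" where
  "log_free_curve \<tau> p =
     {T. \<exists>B. \<forall>a\<in>{0, 1/2, p, -p}. log_free_at (potential \<tau> p (T$1) (T$2) (T$3) B) a}"


section \<open>Affine and projective algebraic sets over the complex numbers\<close>

definition monom_fun :: "('n::finite \<Rightarrow> nat) \<Rightarrow> complex^'n \<Rightarrow> complex" where
  "monom_fun \<alpha> x = (\<Prod>i\<in>UNIV. (x$i) ^ \<alpha> i)"

definition polys_upto :: "nat \<Rightarrow> (complex^'n::finite \<Rightarrow> complex) set" where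
  "polys_upto d = {(\<lambda>x. \<Sum>\<alpha> | sum \<alpha> UNIV \<le> d. c \<alpha> * monom_fun \<alpha> x) | c. True}"

definition forms :: "nat \<Rightarrow> (complex^'n::finite \<Rightarrow> complex) set" where
  "forms d = {(\<lambda>x. \<Sum>\<alpha> | sum \<alpha> UNIV = d. c \<alpha> * monom_fun \<alpha> x) | c. True}"

definition affine_closure :: "(complex^'n::finite) set \<Rightarrow> (complex^'n) set" where
  "affine_closure A = {x. \<forall>d. \<forall>F\<in>polys_upto d. (\<forall>a\<in>A. F a = 0) \<longrightarrow> F x = 0}"

text \<open>A subset of the projective space of \<open>complex^'n\<close> is represented by the set of all homogeneous
  coordinate vectors of its points, i.e. by a set of nonzero vectors that is stable under nonzero
  scalars.  The Zariski closure of such a set, and the single point with coordinates \<open>x\<close>:\<close>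

definition proj_closure :: "(complex^'n::finite) set \<Rightarrow> (complex^'n) set" where
  "proj_closure A = {x. x \<noteq> 0 \<and> (\<forall>d. \<forall>F\<in>forms d. (\<forall>a\<in>A. F a = 0) \<longrightarrow> F x = 0)}"

definition proj_point :: "complex^'n \<Rightarrow> (complex^'n) set" where
  "proj_point x = {c *s x | c. c \<noteq> 0}"

definition proj_closed :: "(complex^'n::finite) set \<Rightarrow> bool" where
  "proj_closed X \<longleftrightarrow> proj_closure X = X"

definition proj_line :: "(complex^(1 option)) set" where
  "proj_line = {x. x \<noteq> 0}"

text \<open>The standard open embedding of affine n-space; the index \<open>None\<close> is the homogenizing
  coordinate, so the projective n-space is that of \<open>complex^('n option)\<close>.\<close>

definition affine_chart :: "(complex^'n::finite) set \<Rightarrow> (complex^('n option)) set" where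
  "affine_chart A = {x. x$None \<noteq> 0 \<and> (\<chi> i. x$(Some i) / x$None) \<in> A}"

definition proj_irreducible :: "(complex^'n::finite) set \<Rightarrow> bool" where
  "proj_irreducible X \<longleftrightarrow> X \<noteq> {} \<and>
     (\<forall>Z1 Z2. proj_closed Z1 \<and> proj_closed Z2 \<and> X \<subseteq> Z1 \<union> Z2 \<longrightarrow> X \<subseteq> Z1 \<or> X \<subseteq> Z2)"

definition proj_open_in :: "(complex^'n::finite) set \<Rightarrow> (complex^'n) set \<Rightarrow> bool" where
  "proj_open_in X U \<longleftrightarrow> (\<exists>Z. proj_closed Z \<and> U = X - Z)"

text \<open>Irreducible projective curves: Krull dimension one.\<close>

definition projective_curve :: "(complex^'n::finite) set \<Rightarrow> bool" where
  "projective_curve X \<longleftrightarrow> proj_closed X \<and> proj_irreducible X \<and> (\<forall>x. X \<noteq> proj_point x) \<and>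
     (\<forall>Z. proj_closed Z \<and> proj_irreducible Z \<and> Z \<subset> X \<longrightarrow> (\<exists>x. Z = proj_point x))"


subsection \<open>Regular maps and birational equivalence\<close>

text \<open>Maps between projective sets are given on coordinate vectors; \<open>f x\<close> only matters up to a
  nonzero scalar.  Regular means locally given by forms of equal degree without common zero.\<close>

definition regular_on :: "(complex^'n::finite) set \<Rightarrow> (complex^'n \<Rightarrow> complex^'m::finite) \<Rightarrow> bool" where
  "regular_on U f \<longleftrightarrow>
     (\<forall>x\<in>U. \<exists>d F. (\<forall>j. F j \<in> forms d) \<and> (\<exists>j. F j x \<noteq> 0) \<and>
        (\<forall>z\<in>U. (\<exists>j. F j z \<noteq> 0) \<longrightarrow> f z \<in> proj_point (\<chi> j. F j z)))"

definition proj_iso_via ::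
  "(complex^'n::finite \<Rightarrow> complex^'m::finite) \<Rightarrow> (complex^'n) set \<Rightarrow> (complex^'m) set \<Rightarrow> bool" where
  "proj_iso_via f U V \<longleftrightarrow>
     regular_on U f \<and> f ` U \<subseteq> V \<and>
     (\<exists>g. regular_on V g \<and> g ` V \<subseteq> U \<and>
        (\<forall>x\<in>U. g (f x) \<in> proj_point x) \<and> (\<forall>y\<in>V. f (g y) \<in> proj_point y))"

definition birational :: "(complex^'n::finite) set \<Rightarrow> (complex^'m::finite) set \<Rightarrow> bool" where
  "birational X Y \<longleftrightarrow> proj_irreducible X \<and> proj_irreducible Y \<and>
     (\<exists>f U V. U \<noteq> {} \<and> proj_open_in X U \<and> V \<noteq> {} \<and> proj_open_in Y V \<and> proj_iso_via f U V)"


subsection \<open>Smooth and nodal curves, normalization\<close>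

text \<open>The tangent space of the cone over \<open>X\<close>; its dimension is one more than that of the
  Zariski tangent space of \<open>X\<close> at the point.\<close>

definition cone_tangent_space :: "(complex^'n::finite) set \<Rightarrow> complex^'n \<Rightarrow> (complex^'n) set" where
  "cone_tangent_space X x =
     {v. \<forall>d. \<forall>F\<in>forms d. (\<forall>z\<in>X. F z = 0) \<longrightarrow> deriv (\<lambda>s. F (x + s *s v)) 0 = 0}"

definition curve_nonsingular_at :: "(complex^'n::finite) set \<Rightarrow> complex^'n \<Rightarrow> bool" where
  "curve_nonsingular_at X x \<longleftrightarrow> vec.dim (cone_tangent_space X x) = 2"

definition smooth_projective_curve :: "(complex^'n::finite) set \<Rightarrow> bool" where
  "smooth_projective_curve X \<longleftrightarrow> projective_curve X \<and> (\<forall>x\<in>X. curve_nonsingular_at X x)"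

text \<open>A node (ordinary double point) of an affine curve: near \<open>a\<close> the curve consists of two smooth
  analytic branches through \<open>a\<close> with different tangent lines.\<close>

definition velocity :: "(complex \<Rightarrow> complex^'n::finite) \<Rightarrow> complex^'n" where
  "velocity \<phi> = (\<chi> j. deriv (\<lambda>s. \<phi> s $ j) 0)"

definition affine_node :: "(complex^'n::finite) set \<Rightarrow> complex^'n \<Rightarrow> bool" where
  "affine_node A a \<longleftrightarrow>
     (\<exists>\<phi> \<psi> R. 0 < R \<and>
        (\<forall>j. (\<lambda>s. \<phi> s $ j) holomorphic_on ball 0 R) \<and>
        (\<forall>j. (\<lambda>s. \<psi> s $ j) holomorphic_on ball 0 R) \<and>
        \<phi> 0 = a \<and> \<psi> 0 = a \<and>
        (\<forall>b c. b *s velocity \<phi> + c *s velocity \<psi> = 0 \<longrightarrow> b = 0 \<and> c = 0) \<and>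
        (\<forall>r. 0 < r \<and> r \<le> R \<longrightarrow>
           (\<exists>U. open U \<and> a \<in> U \<and> A \<inter> U = (\<phi> ` ball 0 r \<union> \<psi> ` ball 0 r) \<inter> U)))"

definition node_at :: "(complex^'n::finite) set \<Rightarrow> complex^'n \<Rightarrow> bool" where
  "node_at X x \<longleftrightarrow> (\<exists>i. x$i \<noteq> 0 \<and> affine_node {z \<in> X. z$i = 1} ((1 / x$i) *s x))"

definition nodal_curve :: "(complex^'n::finite) set \<Rightarrow> bool" where
  "nodal_curve X \<longleftrightarrow> projective_curve X \<and>
     (\<forall>x\<in>X. curve_nonsingular_at X x \<or> node_at X x) \<and> (\<exists>x\<in>X. node_at X x)"

text \<open>In dimension one normal means nonsingular, and a birational morphism of projective curves
  is automatically finite and surjective.\<close>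

definition normalization ::
  "(complex^'n::finite \<Rightarrow> complex^'m::finite) \<Rightarrow> (complex^'n) set \<Rightarrow> (complex^'m) set \<Rightarrow> bool" where
  "normalization \<nu> X Y \<longleftrightarrow>
     smooth_projective_curve X \<and> projective_curve Y \<and> regular_on X \<nu> \<and> \<nu> ` X \<subseteq> Y \<and>
     (\<exists>U V. U \<noteq> {} \<and> proj_open_in X U \<and> V \<noteq> {} \<and> proj_open_in Y V \<and> proj_iso_via \<nu> U V)"

definition rational_curve :: "(complex^'n::finite) set \<Rightarrow> bool" where
  "rational_curve X \<longleftrightarrow> birational X proj_line"


subsection \<open>Arithmetic genus\<close>

text \<open>The degree \<open>d\<close> part of the homogeneous coordinate ring of \<open>X\<close> (with reduced structure) is
  the space of forms of degree \<open>d\<close> restricted to (the cone over) \<open>X\<close>.\<close>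

definition hilbert_function :: "(complex^'n::finite) set \<Rightarrow> nat \<Rightarrow> nat" where
  "hilbert_function X d =
     vector_space.dim (\<lambda>(c::complex) f x. c * f x)
       ((\<lambda>F x. if x \<in> X then F x else 0) ` (forms d :: (complex^'n \<Rightarrow> complex) set))"

definition hilbert_poly :: "(complex^'n::finite) set \<Rightarrow> real poly" where
  "hilbert_poly X =
     (THE H. eventually (\<lambda>d. real (hilbert_function X d) = poly H (real d)) sequentially)"

text \<open>\<open>(-1)^dim X * (H(0) - 1)\<close>, where \<open>dim X\<close> is the degree of the Hilbert polynomial \<open>H\<close>.  For a
  smooth projective curve this is the genus.\<close>

definition arithmetic_genus :: "(complex^'n::finite) set \<Rightarrow> real" where
  "arithmetic_genus X = (-1) ^ degree (hilbert_poly X) * (poly (hilbert_poly X) 0 - 1)"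


section \<open>The curves of the theorem\<close>

definition noneven_component :: "complex \<Rightarrow> complex \<Rightarrow> (complex^3) set" where
  "noneven_component \<tau> p = affine_closure {T \<in> log_free_curve \<tau> p. T$2 + T$3 \<noteq> 0}"

definition compactified_log_free_curve :: "complex \<Rightarrow> complex \<Rightarrow> (complex^(3 option)) set" where
  "compactified_log_free_curve \<tau> p = proj_closure (affine_chart (log_free_curve \<tau> p))"

definition P_poly :: "complex \<Rightarrow> complex \<Rightarrow> complex poly" where
  "P_poly \<tau> p =
     [: e1 \<tau> - wp \<tau> (p + 1/2), 2 * wp \<tau> p + e1 \<tau>, wp \<tau> p + wp \<tau> (p + 1/2) + e1 \<tau> :]"

text \<open>The discriminant of \<open>P\<close> as a polynomial of formal degree two.\<close>

definition P_disc :: "complex \<Rightarrow> complex \<Rightarrow> complex" where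
  "P_disc \<tau> p =
     (coeff (P_poly \<tau> p) 1)\<^sup>2 - 4 * coeff (P_poly \<tau> p) 2 * coeff (P_poly \<tau> p) 0"

definition model_poly :: "complex \<Rightarrow> complex \<Rightarrow> complex poly" where
  "model_poly \<tau> p = [:0, 1:] * [:1, 1:] * P_poly \<tau> p"

text \<open>The affine plane curve \<open>W\<^sup>2 = g(t)\<close>, coordinates \<open>(t, W)\<close>.\<close>

definition double_cover_affine :: "complex poly \<Rightarrow> (complex^2) set" where
  "double_cover_affine g = {v. (v$2)\<^sup>2 = poly g (v$1)}"

text \<open>The projective model of \<open>W\<^sup>2 = g(t)\<close> for \<open>g\<close> of formal degree four: the closure of the affine
  curve under the embedding \<open>(t, W) \<mapsto> [1 : t : t\<^sup>2 : W]\<close>, i.e. its closure in the weighted projective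
  plane \<open>P(1,1,2)\<close>.  (The closure in the ordinary projective plane is singular at infinity.)\<close>

definition double_cover_model :: "complex poly \<Rightarrow> (complex^(3 option)) set" where
  "double_cover_model g =
     proj_closure (affine_chart {v. v$2 = (v$1)\<^sup>2 \<and> (v$3)\<^sup>2 = poly g (v$1)})"

end

theory Submission
  imports Defs
begin

text \<open>Local analysis: at \<open>0\<close> and \<open>1/2\<close> (exponents \<open>-1, 2\<close>) and at \<open>\<plusminus>p\<close> (exponents \<open>-1/2, 3/2\<close>) the
  absence of logarithms is one polynomial condition on the Laurent coefficients of \<open>q\<close>, namely the
  obstruction to solving the Frobenius recursion at the larger exponent.  With
  \<open>\<kappa> = \<zeta>(p + 1/2) - \<zeta>(p) - \<zeta>(1/2)\<close> and \<open>\<lambda> = \<zeta>(2 p) - 2 \<zeta>(p)\<close>, the addition formula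
  \<open>(\<zeta>(u + v) - \<zeta>(u) - \<zeta>(v))\<^sup>2 = \<wp>(u + v) + \<wp>(u) + \<wp>(v)\<close> and its derivatives express \<open>\<kappa>\<^sup>2\<close>, \<open>\<lambda>\<^sup>2\<close>,
  \<open>\<kappa> \<lambda>\<close> by values of \<open>\<wp>\<close>.  Putting \<open>s = T\<^sub>+ + T\<^sub>-\<close> and \<open>t = - (T\<^sub>+ - T\<^sub>- + \<lambda>) / (2 \<kappa>)\<close>, the four conditions
  say that either \<open>T\<^sub>1 = s = 0\<close>, or \<open>s \<noteq> 0\<close>, \<open>T\<^sub>1 = t s\<close> and \<open>t (t + 1) s\<^sup>2 = 4 P(t)\<close>; then
  \<open>W = t (t + 1) s / 2\<close> satisfies \<open>W\<^sup>2 = t (t + 1) P(t)\<close>.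

  Here \<open>P(0)\<close> and \<open>P(-1)\<close> never vanish and the leading coefficient of \<open>P\<close> is \<open>\<kappa>\<^sup>2 \<noteq> 0\<close>, so the only
  possible singularity of the model is a double root of \<open>P\<close>.  The discriminant of \<open>P\<close> has a pole at
  the lattice points, hence only finitely many zeros on the torus.  The arithmetic genera are read
  off from monomial bases of the homogeneous coordinate rings: the Hilbert function is \<open>4 d\<close> for the
  model and \<open>5 d - 1\<close> for the union of the line and the non-even component.\<close>

text \<open>All nonvanishing facts come from one linear equation: \<wp>'' = 2 \<lambda> \<wp>' off
  the half-lattice, so a single zero of \<wp>' would force \<wp>' = 0 everywhere; and \<wp>' = 2
  \<kappa> (\<wp> - e1) passes this on to \<kappa>, P(0) and P(-1). On the algebraic side, closures,
  irreducibility and dimension are phrased through vanishing of forms. They are controlled by a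
  finiteness argument: on each double cover a form becomes a(t) + W b(t), and its norm a^2 - g b^2
  has finitely many zeros unless a = b = 0, because g has a simple zero at t = 0. The arithmetic
  genus two needs no case distinction on the discriminant. In the coordinates w, a = T_1, s, t the
  closure of the non-even part is the intersection of the quadrics a w = t s and a^2 + a s = 4 (A
  t^2 + b t w + c w^2), where P = A t^2 + b t + c. The even line a = s = 0 lies on the first quadric
  and meets the second in the two roots of P, counted with multiplicity. This gives the Hilbert
  polynomial 4 d + (d + 1) - 2.\<close>

no_notation fps_nth (infixl "$" 75)

section \<open>Logarithms at regular singular points\<close>

text \<open>Weight the coefficients as a_n = |c_n| s^n with t < s < R. The recursion gives n (n - m)
  a_n \<le> M T_n, where T_n is one plus the sum of the earlier a_k. Once n - m exceeds M this
  yields a_n \<le> T_n / n, so T grows at most linearly and a stays bounded, which suffices at the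
  smaller radius t.\<close>

lemma frobenius_conv_radius:
  fixes Q F :: "complex fps" and c :: "nat \<Rightarrow> complex" and R :: ereal
  assumes QF: "fps_conv_radius Q \<ge> R" "fps_conv_radius F \<ge> R"
    and rec: "\<And>n. n > m \<Longrightarrow> of_nat n * (of_nat n - of_nat m) * c n = (\<Sum>k<n. fps_nth Q (n - k) * c k) + fps_nth F n"
  shows "fps_conv_radius (Abs_fps c) \<ge> R"
  unfolding fps_conv_radius_def fps_nth_Abs_fps
proof (rule conv_radius_geI_ex')
  fix t :: real assume t: "0 < t" "ereal t < R"
  then obtain s where s: "t < s" "ereal s < R" using ereal_dense2[of "ereal t" R] by auto
  have s0: "s > 0" using s t by simp
  have bdd: "\<exists>M. \<forall>n. norm (fps_nth G n) * s ^ n \<le> M" if "fps_conv_radius G \<ge> R" for G :: "complex fps"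
  proof -
    have "summable (\<lambda>n. fps_nth G n * of_real s ^ n)"
      using s s0 that by (intro summable_fps) (auto intro: less_le_trans)
    hence "Bseq (\<lambda>n. fps_nth G n * of_real s ^ n)" 
      by (intro convergent_imp_Bseq) (use summable_LIMSEQ_zero convergent_def in blast)
    thus ?thesis using s0 by (auto simp: Bseq_def norm_mult norm_power)
  qed
  obtain M1 M2 where M12: "\<And>n. norm (fps_nth Q n) * s ^ n \<le> M1" "\<And>n. norm (fps_nth F n) * s ^ n \<le> M2"
    using bdd[OF QF(1)] bdd[OF QF(2)] by blast
  define M where "M = max M1 M2"
  have M: "norm (fps_nth Q n) * s ^ n \<le> M" "norm (fps_nth F n) * s ^ n \<le> M" for n
    using M12[of n] by (auto simp: M_def)
  have M0: "M \<ge> 0" using M(1)[of 0] by (smt (verit) mult_nonneg_nonneg norm_ge_zero power_0 zero_le_one)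
  define a where "a = (\<lambda>n. norm (c n) * s ^ n)"
  have a0: "a n \<ge> 0" for n using s0 by (simp add: a_def)
  \<comment> \<open>The leading 1 absorbs the contribution of the inhomogeneous term
    \<open>F\<close>.\<close>
  define T where "T = (\<lambda>n. 1 + (\<Sum>k<n. a k))"
  have T1: "T n \<ge> 1" for n by (simp add: T_def sum_nonneg a0)
  have step: "real n * (real n - real m) * a n \<le> M * T n" if n: "n > m" for n
  proof -
    have "real n * (real n - real m) * norm (c n) = norm (of_nat n * (of_nat n - of_nat m) * c n)"
    proof -
      have "(of_nat n - of_nat m :: complex) = of_real (real n - real m)" by simp
      hence "norm (of_nat n - of_nat m :: complex) = \<bar>real n - real m\<bar>" by (simp only: norm_of_real)
      thus ?thesis using n by (simp add: norm_mult)
    qed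
    also have "\<dots> \<le> (\<Sum>k<n. norm (fps_nth Q (n - k) * c k)) + norm (fps_nth F n)"
      unfolding rec[OF n] by (intro order_trans[OF norm_triangle_ineq] add_right_mono norm_sum)
    finally have "real n * (real n - real m) * norm (c n) * s ^ n 
       \<le> ((\<Sum>k<n. norm (fps_nth Q (n - k) * c k)) + norm (fps_nth F n)) * s ^ n"
      using s0 by (intro mult_right_mono) auto
    also have "\<dots> = (\<Sum>k<n. (norm (fps_nth Q (n - k)) * s ^ (n - k)) * a k) + norm (fps_nth F n) * s ^ n"
      unfolding distrib_right sum_distrib_right
    proof (intro arg_cong2[of _ _ _ _ "(+)"] sum.cong refl)
      fix k assume "k \<in> {..<n}"
      hence "s ^ n = s ^ (n - k) * s ^ k" by (simp add: power_add[symmetric])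
      thus "norm (fps_nth Q (n - k) * c k) * s ^ n = norm (fps_nth Q (n - k)) * s ^ (n - k) * a k"
        by (simp add: a_def norm_mult)
    qed
    also have "\<dots> \<le> (\<Sum>k<n. M * a k) + M"
      using M a0 by (intro add_mono sum_mono mult_right_mono) auto
    also have "\<dots> = M * T n" by (simp add: T_def sum_distrib_left distrib_left)
    finally show ?thesis by (simp add: a_def mult_ac)
  qed
  \<comment> \<open>Beyond this index n - m is at least M and at least 1, so the factor n - m can be
    traded for the constant M.\<close>
  define N where "N = Suc (m + nat \<lceil>M\<rceil>)"
  have N: "n > m" "real n - real m \<ge> M" "real n - real m \<ge> 1" "n > 0" if "n \<ge> N" for n
  proof -
    have "real n \<ge> 1 + real m + real (nat \<lceil>M\<rceil>)" using that unfolding N_def by linarith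
    thus "real n - real m \<ge> M" "real n - real m \<ge> 1" by linarith+
    show "n > m" "n > 0" using that by (auto simp: N_def)
  qed
  have a_le: "a n \<le> T n / n" if n: "n \<ge> N" for n
  proof -
    have "real n * (M * a n) \<le> real n * ((real n - real m) * a n)"
      using N(2)[OF n] a0 by (intro mult_left_mono mult_right_mono) auto
    show ?thesis
    proof (cases "M = 0")
      case True
      have "real n * (real n - real m) * a n \<le> 0" using step[OF N(1)[OF n]] True by simp
      moreover have "real n * (real n - real m) > 0" using N[OF n] by (intro mult_pos_pos) auto
      ultimately have "a n \<le> 0" by (metis mult_pos_pos not_le)
      also have "0 \<le> T n / n" using T1[of n] by simp
      finally show ?thesis .
    next
      case False
      have "real n * (M * a n) \<le> M * T n"
        using \<open>real n * (M * a n) \<le> _\<close> step[OF N(1)[OF n]] by (simp add: mult_ac)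
      hence "M * (real n * a n) \<le> M * T n" by (simp add: mult_ac)
      hence "real n * a n \<le> T n" using False M0 by simp
      thus ?thesis using N(4)[OF n] by (simp add: field_simps)
    qed
  qed
  define C where "C = T N / N"
  \<comment> \<open>Linear growth reproduces itself: T (n + 1) = T n + a n \<le> C n + C.\<close>
  have T_le: "T n \<le> C * n" if n: "n \<ge> N" for n
    using n
  proof (induction n rule: dec_induct)
    case base thus ?case using N(4)[of N] by (simp add: C_def)
  next
    case (step n)
    have "T (Suc n) = T n + a n" by (simp add: T_def)
    also have "\<dots> \<le> C * n + T n / n" using step a_le by (intro add_mono) auto
    also have "T n / n \<le> (C * n) / n" using step by (intro divide_right_mono) auto
    also have "(C * n) / n = C" using N(4)[of n] step by simp
    finally show ?case by (simp add: algebra_simps)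
  qed
  have "a n \<le> max C (Max (a ` {..N}))" for n
  proof (cases "n \<ge> N")
    case True
    have "a n \<le> T n / n" using a_le[OF True] .
    also have "\<dots> \<le> (C * n) / n" using T_le[OF True] by (intro divide_right_mono) auto
    also have "\<dots> = C" using N(4)[OF True] by simp
    finally show ?thesis by simp
  next
    case False
    hence "a n \<le> Max (a ` {..N})" by (intro Max_ge) auto
    thus ?thesis by simp
  qed
  hence "summable (\<lambda>n. norm (c n) * t ^ n)"
    unfolding a_def by (intro Abel_lemma[of t s]) (use t s in auto)
  thus "summable (\<lambda>n. c n * of_real t ^ n)"
    by (intro summable_norm_cancel[of "\<lambda>n. c n * of_real t ^ n"]) (use t in \<open>simp add: norm_mult norm_power\<close>)
qed

text \<open>At n = 0 and n = m the indicial factor n (n - m) vanishes and the recursion determines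
  nothing; these two values are free and come from \<open>ini\<close>.\<close>

fun frobenius_coeff :: "(nat \<Rightarrow> complex) \<Rightarrow> (nat \<Rightarrow> complex) \<Rightarrow> nat \<Rightarrow> (nat \<Rightarrow> complex) \<Rightarrow> nat \<Rightarrow> complex" where
  "frobenius_coeff Q F m ini n = (if n = 0 \<or> n = m then ini n else
     ((\<Sum>k<n. Q (n - k) * frobenius_coeff Q F m ini k) + F n) / (of_nat n * (of_nat n - of_nat m)))"

declare frobenius_coeff.simps [simp del]

lemma theta_nth: "fps_nth (fps_X * fps_deriv G) n = of_nat n * fps_nth (G :: complex fps) n"
  by (cases n) auto

text \<open>For y = z^\<rho> H with 2 \<rho> = 1 - m, multiplying y'' = q y by z^2 gives an operator
  on H whose n-th coefficient is n (n - m) H_n minus a combination of lower ones. Every equation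
  except the resonant one at n = m can be solved, so the defect is a single multiple of X^m, and its
  coefficient is the obstruction.\<close>

lemma frobenius_series:
  fixes Q F :: "complex fps" and R :: ereal
  assumes QF: "fps_conv_radius Q \<ge> R" "fps_conv_radius F \<ge> R" and F0: "fps_nth F 0 = 0" and m: "m > 0"
  obtains H where "fps_conv_radius H \<ge> R" "fps_nth H 0 = a" "fps_nth H m = b"
    "\<And>n. n \<noteq> 0 \<Longrightarrow> n \<noteq> m \<Longrightarrow> fps_nth H n = ((\<Sum>k<n. fps_nth Q (n - k) * fps_nth H k) + fps_nth F n) / (of_nat n * (of_nat n - of_nat m))"
    "fps_X^2 * fps_deriv (fps_deriv H) + fps_const (1 - of_nat m) * (fps_X * fps_deriv H) + (fps_const (fps_nth Q 0) - Q) * H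
       = F + fps_const (- (\<Sum>k<m. fps_nth Q (m - k) * fps_nth H k) - fps_nth F m) * fps_X ^ m"
proof -
  define c where "c = frobenius_coeff (fps_nth Q) (fps_nth F) m (\<lambda>n. if n = 0 then a else b)"
  define H where "H = Abs_fps c"
  have c0: "c 0 = a" by (simp add: c_def frobenius_coeff.simps)
  have cm: "c m = b" using m by (simp add: c_def frobenius_coeff.simps)
  have cn: "c n = ((\<Sum>k<n. fps_nth Q (n - k) * c k) + fps_nth F n) / (of_nat n * (of_nat n - of_nat m))"
    if "n \<noteq> 0" "n \<noteq> m" for n
    using that unfolding c_def by (subst frobenius_coeff.simps) simp
  have rec: "of_nat n * (of_nat n - of_nat m) * c n = (\<Sum>k<n. fps_nth Q (n - k) * c k) + fps_nth F n"
    if "n \<noteq> 0" "n \<noteq> m" for n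
    using that by (subst cn) auto
  have rad: "fps_conv_radius H \<ge> R"
    unfolding H_def by (rule frobenius_conv_radius[OF QF, of m]) (use rec in auto)
  \<comment> \<open>In terms of the Euler operator X d/dX, which multiplies the n-th coefficient by
    n, the left side is diagonal up to the product with \<open>Q\<close>.\<close>
  have eq: "fps_X^2 * fps_deriv (fps_deriv H) = fps_X * fps_deriv (fps_X * fps_deriv H) - fps_X * fps_deriv H"
    by (simp add: algebra_simps power2_eq_square)
  have "fps_X^2 * fps_deriv (fps_deriv H) + fps_const (1 - of_nat m) * (fps_X * fps_deriv H) + (fps_const (fps_nth Q 0) - Q) * H
       = F + fps_const (- (\<Sum>k<m. fps_nth Q (m - k) * fps_nth H k) - fps_nth F m) * fps_X ^ m" (is "?L = ?R")
  proof (rule fps_ext)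
    fix n
    have "(\<Sum>i=0..n. fps_nth Q i * c (n - i)) = (\<Sum>i=0..n. fps_nth Q (n - i) * c i)"
      by (rule sum.reindex_bij_witness[of _ "\<lambda>i. n - i" "\<lambda>i. n - i"]) auto
    also have "\<dots> = (\<Sum>i\<in>insert n {..<n}. fps_nth Q (n - i) * c i)"
      by (intro sum.cong) auto
    also have "\<dots> = fps_nth Q 0 * c n + (\<Sum>i<n. fps_nth Q (n - i) * c i)" by simp
    finally have prod: "fps_nth (Q * H) n = fps_nth Q 0 * c n + (\<Sum>i<n. fps_nth Q (n - i) * c i)"
      by (simp add: fps_mult_nth H_def)
    have "fps_nth ?L n = of_nat n * (of_nat n * c n) - of_nat n * c n + (1 - of_nat m) * (of_nat n * c n) + fps_nth Q 0 * c n - fps_nth (Q * H) n"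
      unfolding eq by (simp only: fps_add_nth fps_sub_nth theta_nth fps_mult_left_const_nth left_diff_distrib) (simp add: H_def)
    hence L: "fps_nth ?L n = of_nat n * (of_nat n - of_nat m) * c n - (\<Sum>i<n. fps_nth Q (n - i) * c i)"
      unfolding prod by (simp add: algebra_simps)
    show "fps_nth ?L n = fps_nth ?R n"
    proof (cases "n = m")
      case True
      thus ?thesis unfolding L by (simp add: fps_X_power_iff H_def)
    next
      case False
      thus ?thesis
        unfolding L using rec[of n] F0 by (cases "n = 0") (auto simp: fps_X_power_iff)
    qed
  qed
  with rad show ?thesis using that[of H] c0 cm cn by (simp add: H_def)
qed

lemma frobenius_eval:
  fixes Q F H :: "complex fps" and R :: ereal
  assumes QF: "fps_conv_radius Q \<ge> R" "fps_conv_radius F \<ge> R" "fps_conv_radius H \<ge> R"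
    and eq: "fps_X^2 * fps_deriv (fps_deriv H) + fps_const \<alpha> * (fps_X * fps_deriv H) + (fps_const \<beta> - Q) * H
       = F + fps_const e * fps_X ^ m" and z: "ereal (norm z) < R"
  shows "z^2 * eval_fps (fps_deriv (fps_deriv H)) z + \<alpha> * z * eval_fps (fps_deriv H) z + (\<beta> - eval_fps Q z) * eval_fps H z
       = eval_fps F z + e * z ^ m"
proof -
  have r: "norm z < fps_conv_radius Q" "norm z < fps_conv_radius F" "norm z < fps_conv_radius H"
    using QF z by (auto intro: less_le_trans)
  have r1: "norm z < fps_conv_radius (fps_deriv H)"
    using r(3) fps_conv_radius_deriv by (rule less_le_trans)
  have r2: "norm z < fps_conv_radius (fps_deriv (fps_deriv H))"
    using r1 fps_conv_radius_deriv by (rule less_le_trans)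
  have mult: "norm z < fps_conv_radius (f * g)" if "norm z < fps_conv_radius f" "norm z < fps_conv_radius g" for f g :: "complex fps"
    using that fps_conv_radius_mult[of f g] by (metis less_le_trans min_less_iff_conj)
  have add: "norm z < fps_conv_radius (f + g)" if "norm z < fps_conv_radius f" "norm z < fps_conv_radius g" for f g :: "complex fps"
    using that fps_conv_radius_add[of f g] by (metis less_le_trans min_less_iff_conj)
  have diff: "norm z < fps_conv_radius (f - g)" if "norm z < fps_conv_radius f" "norm z < fps_conv_radius g" for f g :: "complex fps"
    using that fps_conv_radius_diff[of f g] by (metis less_le_trans min_less_iff_conj)
  have "eval_fps (fps_X^2 * fps_deriv (fps_deriv H) + fps_const \<alpha> * (fps_X * fps_deriv H) + (fps_const \<beta> - Q) * H) z
      = eval_fps (F + fps_const e * fps_X ^ m) z" using eq by simp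
  thus ?thesis
    by (simp add: eval_fps_add eval_fps_mult eval_fps_diff mult add diff r r1 r2 mult_ac)
qed

lemma powr_mult_has_field_derivative:
  fixes z \<rho> k' :: complex
  assumes "z \<notin> \<real>\<^sub>\<le>\<^sub>0" "(k has_field_derivative k') (at z)"
  shows "((\<lambda>z. z powr \<rho> * k z) has_field_derivative (z powr \<rho> * (\<rho> * k z / z + k'))) (at z)"
proof -
  have "z \<noteq> 0" using assms(1) by auto
  hence "z powr (\<rho> - 1) = z powr \<rho> / z" by (simp add: powr_diff powr_def[of z 1])
  hence "((\<lambda>z. z powr \<rho>) has_field_derivative \<rho> * (z powr \<rho> / z)) (at z)"
    using has_field_derivative_powr[OF assms(1), of \<rho>] by simp
  from DERIV_mult[OF this assms(2)] show ?thesis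
    by (rule DERIV_cong) (simp add: algebra_simps)
qed

section \<open>The slit disc and solutions on it\<close>

lemma slit_disc_0: "slit_disc 0 r = ball 0 r - \<real>\<^sub>\<le>\<^sub>0"
  by (auto simp: slit_disc_def)

lemma slit_disc_D:
  assumes "z \<in> slit_disc 0 r"
  shows "norm z < r" "z \<noteq> 0" "z \<notin> \<real>\<^sub>\<le>\<^sub>0"
  using assms by (auto simp: slit_disc_0)

lemma open_slit_disc_0: "open (slit_disc 0 r)"
  by (simp add: slit_disc_0 open_Diff closed_nonpos_Reals_complex)

lemma exp_in_slit_disc:
  assumes "r > 0" "Re w < ln r" "-pi < Im w" "Im w < pi"
  shows "exp w \<in> slit_disc 0 r"
proof -
  have "norm (exp w) < r"
  proof -
    have "exp (Re w) < exp (ln r)" using assms(2) by simp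
    thus ?thesis using assms(1) by simp
  qed
  moreover have "exp w \<notin> \<real>\<^sub>\<le>\<^sub>0"
  proof
    assume a: "exp w \<in> \<real>\<^sub>\<le>\<^sub>0"
    hence "Re (exp w) < 0 \<and> Im (exp w) = 0"
      by (metis complex_eq_iff complex_nonpos_Reals_iff exp_not_eq_zero less_eq_real_def zero_complex.simps)
    hence "Im (Ln (exp w)) = pi" by (subst Im_Ln_eq_pi) auto
    thus False using assms by simp
  qed
  ultimately show ?thesis by (simp add: slit_disc_0)
qed

text \<open>The principal logarithm straightens the slit disc to a half-strip. That strip is convex,
  which is how connectedness of the slit disc, and with it constancy of Wronskians, is
  obtained.\<close>

lemma slit_disc_eq_exp_image:
  assumes r: "r > 0"
  shows "slit_disc 0 r = exp ` {w. Re w < ln r \<and> -pi < Im w \<and> Im w < pi}"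
proof (intro equalityI subsetI)
  fix z assume z: "z \<in> slit_disc 0 r"
  hence z': "norm z < r" "z \<notin> \<real>\<^sub>\<le>\<^sub>0" by (auto simp: slit_disc_0)
  hence "z \<noteq> 0" by auto
  moreover have "Im (Ln z) \<noteq> pi"
    using z' Im_Ln_eq_pi[OF \<open>z \<noteq> 0\<close>] by (auto simp: complex_nonpos_Reals_iff)
  ultimately show "z \<in> exp ` {w. Re w < ln r \<and> -pi < Im w \<and> Im w < pi}"
    using z' mpi_less_Im_Ln[of z] Im_Ln_le_pi[of z] r
    by (intro image_eqI[of _ _ "Ln z"]) auto
next
  fix z assume "z \<in> exp ` {w. Re w < ln r \<and> -pi < Im w \<and> Im w < pi}"
  thus "z \<in> slit_disc 0 r" using exp_in_slit_disc[OF r] by auto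
qed

lemma convex_strip: "convex {w. Re w < a \<and> b < Im w \<and> Im w < c}"
  using convex_Int[OF convex_halfspace_Re_lt[of a] convex_Int[OF convex_halfspace_Im_gt[of b] convex_halfspace_Im_lt[of c]]]
  by (simp add: Int_def)

lemma open_strip: "open {w. Re w < a \<and> b < Im w \<and> Im w < c}"
  using open_Int[OF open_halfspace_Re_lt[of a] open_Int[OF open_halfspace_Im_gt[of b] open_halfspace_Im_lt[of c]]]
  by (simp add: Int_def)

lemma connected_slit_disc_0:
  assumes "r > 0" shows "connected (slit_disc 0 r)"
  unfolding slit_disc_eq_exp_image[OF assms]
  by (intro connected_continuous_image convex_connected convex_strip continuous_intros)

lemma solves_onI:
  assumes S: "open S" and "\<And>z. z \<in> S \<Longrightarrow> (y has_field_derivative y' z) (at z)"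
    "\<And>z. z \<in> S \<Longrightarrow> (y' has_field_derivative q z * y z) (at z)"
  shows "solves_on q S y"
proof -
  have "(deriv y has_field_derivative q z * y z) (at z)" if "z \<in> S" for z
    by (rule has_field_derivative_transform_within_open[OF assms(3)[OF that] S that])
       (use assms(2) DERIV_imp_deriv in metis)
  thus ?thesis unfolding solves_on_def
    using assms DERIV_imp_deriv by (metis holomorphic_on_open)
qed

lemma solves_onD:
  assumes S: "open S" and y: "solves_on q S y" and z: "z \<in> S"
  shows "(y has_field_derivative deriv y z) (at z)" "(deriv y has_field_derivative q z * y z) (at z)"
proof -
  have h: "y holomorphic_on S" "deriv (deriv y) z = q z * y z" using y z by (auto simp: solves_on_def)
  show "(y has_field_derivative deriv y z) (at z)" using holomorphic_derivI[OF h(1) S z] .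
  show "(deriv y has_field_derivative q z * y z) (at z)"
    using holomorphic_derivI[OF holomorphic_deriv[OF h(1) S] S z] h(2) by simp
qed

text \<open>The factor \<open>k\<close> is only differentiated on the slit disc, so it may itself
  contain \<open>Ln\<close>; the same computation thus serves pure Frobenius solutions and
  logarithmic ones.\<close>

lemma powr_solves_on:
  assumes S: "S = slit_disc 0 r"
    and k: "\<And>z. z \<in> S \<Longrightarrow> (k has_field_derivative k1 z) (at z)"
    and k1: "\<And>z. z \<in> S \<Longrightarrow> (k1 has_field_derivative k2 z) (at z)"
    and eq: "\<And>z. z \<in> S \<Longrightarrow> z\<^sup>2 * k2 z + 2 * \<rho> * z * k1 z + (\<rho> * (\<rho> - 1) - Q z) * k z = 0"
    and q: "\<And>z. z \<in> S \<Longrightarrow> q z = Q z / z\<^sup>2"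
  shows "solves_on q S (\<lambda>z. z powr \<rho> * k z)"
proof (rule solves_onI)
  show "open S" using S open_slit_disc_0 by simp
  fix z assume z: "z \<in> S"
  hence z': "z \<notin> \<real>\<^sub>\<le>\<^sub>0" "z \<noteq> 0" using S by (auto simp: slit_disc_0)
  show "((\<lambda>z. z powr \<rho> * k z) has_field_derivative (z powr \<rho> * (\<rho> * k z / z + k1 z))) (at z)"
    by (rule powr_mult_has_field_derivative[OF z'(1) k[OF z]])
  have "((\<lambda>z. \<rho> * k z / z + k1 z) has_field_derivative (\<rho> * k1 z / z - \<rho> * k z / z\<^sup>2 + k2 z)) (at z)"
    using z'(2) by (auto intro!: derivative_eq_intros k[OF z] k1[OF z] simp: power2_eq_square field_simps)
  from powr_mult_has_field_derivative[OF z'(1) this]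
  have d: "((\<lambda>z. z powr \<rho> * (\<rho> * k z / z + k1 z)) has_field_derivative 
     z powr \<rho> * (\<rho> * (\<rho> * k z / z + k1 z) / z + (\<rho> * k1 z / z - \<rho> * k z / z\<^sup>2 + k2 z))) (at z)" .
  have "\<rho> * (\<rho> * k z / z + k1 z) / z + (\<rho> * k1 z / z - \<rho> * k z / z\<^sup>2 + k2 z) = 
      (z\<^sup>2 * k2 z + 2 * \<rho> * z * k1 z + (\<rho> * (\<rho> - 1)) * k z) / z\<^sup>2"
    using z'(2) by (simp add: field_simps power2_eq_square)
  also have "z\<^sup>2 * k2 z + 2 * \<rho> * z * k1 z + (\<rho> * (\<rho> - 1)) * k z = Q z * k z"
    using eq[OF z] by (simp add: algebra_simps)
  finally show "((\<lambda>z. z powr \<rho> * (\<rho> * k z / z + k1 z)) has_field_derivative q z * (z powr \<rho> * k z)) (at z)"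
    using d q[OF z] by (simp add: mult_ac)
qed

text \<open>The right side obeys the second-order recursion with characteristic roots u and v. A
  progression with K nonzero obeys it only if 1 is a double root, but for u = v = 1 the right side
  is constant.\<close>

lemma arithmetic_geometric_zero:
  fixes P K u v x y :: complex
  assumes s: "\<And>n. P + of_nat n * K = u ^ n * x + v ^ n * y"
  shows "K = 0"
proof (rule ccontr)
  assume K: "K \<noteq> 0"
  define s where "s = (\<lambda>n. P + of_nat n * K)"
  have rec: "s (n + 2) - (u + v) * s (n + 1) + u * v * s n = 0" for n
    unfolding s_def s by (simp add: algebra_simps)
  have "(1 - u) * (1 - v) * K = 0" using rec[of 0] rec[of 1] by (simp add: s_def) algebra
  hence uv: "u = 1 \<or> v = 1" using K by auto
  have "(1 - u) * (1 - v) * P + K * (2 - u - v) = 0" using rec[of 0] by (simp add: s_def) algebra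
  hence "2 - u - v = 0" using uv K by auto
  hence "u = 1" "v = 1" using uv by auto
  thus False using s[of 0] s[of 1] K by simp
qed

text \<open>In the coordinate \<open>w\<close> with \<open>z = exp w\<close> the identity extends from a strip to a half-plane.
  Compare its values at \<open>w + 2 n pi i\<close>: the left side is an arithmetic progression in \<open>n\<close>, the right
  side a combination of two geometric ones.\<close>

lemma no_log_sum_of_powers:
  assumes r: "r > 0" and hol: "b holomorphic_on ball 0 r" "g holomorphic_on ball 0 r"
      "h1 holomorphic_on ball 0 r" "h2 holomorphic_on ball 0 r"
    and eq: "\<And>z. z \<in> slit_disc 0 r \<Longrightarrow> 
       z powr \<rho> * (C * Ln z * b z + g z) = z powr \<rho>1 * h1 z + z powr \<rho>2 * h2 z"
    and C: "C \<noteq> 0" and z: "z \<in> ball 0 r" "z \<noteq> 0"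
  shows "b z = 0"
proof -
  define HP where "HP = {w. Re w < ln r}"
  define St where "St = {w. Re w < ln r \<and> -pi < Im w \<and> Im w < pi}"
  define L where "L = (\<lambda>w. C * w * b (exp w) + g (exp w))"
  define Rt where "Rt = (\<lambda>w. exp ((\<rho>1 - \<rho>) * w) * h1 (exp w) + exp ((\<rho>2 - \<rho>) * w) * h2 (exp w))"
  have expb: "exp w \<in> ball 0 r" if "w \<in> HP" for w
  proof -
    have "exp (Re w) < exp (ln r)" using that by (simp add: HP_def)
    thus ?thesis using r by simp
  qed
  have comp: "(\<lambda>w. f (exp w)) holomorphic_on HP" if "f holomorphic_on ball 0 r" for f :: "complex \<Rightarrow> complex"
  proof -
    have "exp ` HP \<subseteq> ball 0 r" using expb by blast
    from holomorphic_on_compose_gen[OF holomorphic_on_exp that this] show ?thesis by (simp add: o_def)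
  qed
  have LR: "L w = Rt w" if w: "w \<in> HP" for w
  proof (rule analytic_continuation_open[of St HP L Rt w])
    show "open St" unfolding St_def by (rule open_strip)
    show "open HP" unfolding HP_def by (rule open_halfspace_Re_lt)
    show "connected HP" unfolding HP_def by (intro convex_connected convex_halfspace_Re_lt)
    show "St \<subseteq> HP" by (auto simp: St_def HP_def)
    have "of_real (ln r - 1) \<in> St" by (simp add: St_def)
    thus "St \<noteq> {}" by blast
    show "L holomorphic_on HP" "Rt holomorphic_on HP"
      unfolding L_def Rt_def using hol comp by (auto intro!: holomorphic_intros)
    fix w assume w: "w \<in> St"
    have "exp w \<in> slit_disc 0 r" using exp_in_slit_disc[OF r] w by (simp add: St_def)
    moreover have Ln: "Ln (exp w) = w" using w by (simp add: St_def)
    ultimately have "exp w powr \<rho> * L w = exp w powr \<rho>1 * h1 (exp w) + exp w powr \<rho>2 * h2 (exp w)"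
      using eq[of "exp w"] by (simp add: L_def)
    hence "exp (\<rho> * w) * L w = exp (\<rho>1 * w) * h1 (exp w) + exp (\<rho>2 * w) * h2 (exp w)"
      by (simp add: powr_def Ln)
    also have "\<dots> = exp (\<rho> * w) * Rt w"
      by (simp add: Rt_def distrib_left mult.assoc[symmetric] exp_add[symmetric] algebra_simps)
    finally show "L w = Rt w" by simp
  qed (use w in auto)
  define w where "w = Ln z"
  have ew: "exp w = z" using z by (simp add: w_def)
  define c where "c = 2 * of_real pi * \<i>"
  have per: "exp (w + of_nat n * c) = z" for n
  proof -
    have "exp (w + of_nat n * c) = exp w * exp c ^ n" by (simp add: exp_add exp_of_nat_mult)
    thus ?thesis by (simp add: c_def ew)
  qed
  have "Re (w + of_nat n * c) < ln r" for n
    using z r by (simp add: w_def c_def)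
  hence "L (w + of_nat n * c) = Rt (w + of_nat n * c)" for n using LR by (simp add: HP_def)
  hence "(C * w * b z + g z) + of_nat n * (C * c * b z) = 
       exp ((\<rho>1 - \<rho>) * c) ^ n * (exp ((\<rho>1 - \<rho>) * w) * h1 z) + exp ((\<rho>2 - \<rho>) * c) ^ n * (exp ((\<rho>2 - \<rho>) * w) * h2 z)" for n
    unfolding L_def Rt_def per by (simp add: exp_of_nat_mult[symmetric] exp_add[symmetric] algebra_simps mult_exp_exp)
  hence "C * c * b z = 0" by (rule arithmetic_geometric_zero)
  thus "b z = 0" using C by (simp add: c_def)
qed

lemma zero_in_closure_slit_disc:
  assumes "r > 0" shows "0 \<in> closure (slit_disc 0 r)"
proof (subst closure_approachable, intro allI impI)
  fix e :: real assume e: "e > 0"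
  define x where "x = min (r/2) (e/2)"
  have x: "0 < x" "x < r" "x < e" using assms e by (auto simp: x_def)
  show "\<exists>y\<in>slit_disc 0 r. dist y 0 < e"
    using x by (intro bexI[of _ "of_real x"]) (auto simp: slit_disc_0 complex_nonpos_Reals_iff)
qed

lemma wronskian_constant:
  assumes S: "open S" "connected S" and f: "solves_on q S f" and g: "solves_on q S g"
  obtains c where "\<And>z. z \<in> S \<Longrightarrow> f z * deriv g z - deriv f z * g z = c"
proof -
  have "(\<lambda>z. f z * deriv g z - deriv f z * g z) constant_on S"
  proof (rule has_field_derivative_0_imp_constant_on[OF _ S(2,1)])
    fix z assume z: "z \<in> S"
    show "((\<lambda>z. f z * deriv g z - deriv f z * g z) has_field_derivative 0) (at z)"
      using solves_onD[OF S(1) f z] solves_onD[OF S(1) g z] 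
      by (auto intro!: derivative_eq_intros simp: algebra_simps)
  qed
  thus ?thesis using that by (auto simp: constant_on_def)
qed

text \<open>The indicial equation x (x - 1) = Q(0) has the roots \<rho> and 1 - \<rho> = \<rho> + m,
  so these assumptions describe two exponents that differ by the positive integer m.\<close>

locale frobenius =
  fixes r :: real and Q :: "complex \<Rightarrow> complex" and m :: nat and \<rho> :: complex
  assumes r: "r > 0" and holQ: "Q holomorphic_on ball 0 r" and m: "m > 0"
    and \<rho>: "2 * \<rho> = 1 - of_nat m" and Q0: "Q 0 = \<rho> * (\<rho> - 1)"
begin

definition QF :: "complex fps" where "QF = fps_expansion Q 0"

lemma QF_eval:
  shows "fps_conv_radius QF \<ge> ereal r" "norm z < r \<Longrightarrow> eval_fps QF z = Q z" "fps_nth QF 0 = Q 0"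
proof -
  have h: "Q holomorphic_on eball 0 (ereal r)" using holQ by simp
  show "fps_conv_radius QF \<ge> ereal r" unfolding QF_def by (rule conv_radius_fps_expansion[OF h])
  show "norm z < r \<Longrightarrow> eval_fps QF z = Q z" for z
    unfolding QF_def using eval_fps_expansion'[OF h, of z] by simp
  from this[of 0] show "fps_nth QF 0 = Q 0" using r by (simp add: eval_fps_at_0)
qed

lemma series_deriv:
  assumes H: "fps_conv_radius H \<ge> ereal r" and z: "z \<in> slit_disc 0 r"
  shows "(eval_fps H has_field_derivative eval_fps (fps_deriv H) z) (at z)"
    "(eval_fps (fps_deriv H) has_field_derivative eval_fps (fps_deriv (fps_deriv H)) z) (at z)"
proof -
  have "ereal (norm z) < ereal r" using z by (simp add: slit_disc_0)
  hence 1: "norm z < fps_conv_radius H" using H by (rule less_le_trans)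
  hence 2: "norm z < fps_conv_radius (fps_deriv H)"
    using fps_conv_radius_deriv less_le_trans by blast
  show "(eval_fps H has_field_derivative eval_fps (fps_deriv H) z) (at z)"
    "(eval_fps (fps_deriv H) has_field_derivative eval_fps (fps_deriv (fps_deriv H)) z) (at z)"
    by (rule has_field_derivative_eval_fps[OF 1], rule has_field_derivative_eval_fps[OF 2])
qed

lemma series_holomorphic:
  assumes H: "fps_conv_radius H \<ge> ereal r"
  shows "eval_fps H holomorphic_on ball 0 r"
proof (rule holomorphic_on_eval_fps)
  have "eball (0::complex) (ereal r) \<subseteq> eball 0 (fps_conv_radius H)"
  proof
    fix x :: complex assume "x \<in> eball 0 (ereal r)"
    hence "ereal (norm x) < ereal r" by simp
    also note H
    finally show "x \<in> eball 0 (fps_conv_radius H)" by simp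
  qed
  thus "ball 0 r \<subseteq> eball (0::complex) (fps_conv_radius H)" by simp
qed

text \<open>Starting from the value 0, the recursion keeps every coefficient below m at zero, so the
  defect at order m vanishes by itself. This is the solution for the larger exponent \<rho> + m,
  which always exists.\<close>

lemma upper_solution:
  obtains H \<beta> where "fps_conv_radius H \<ge> ereal r" "fps_nth H m = 1"
    "\<And>z. norm z < r \<Longrightarrow> z^2 * eval_fps (fps_deriv (fps_deriv H)) z + 2 * \<rho> * z * eval_fps (fps_deriv H) z
         + (\<rho> * (\<rho> - 1) - Q z) * eval_fps H z = 0"
    "\<beta> holomorphic_on ball 0 r" "\<beta> 0 = 1" "\<And>z. norm z < r \<Longrightarrow> eval_fps H z = z ^ m * \<beta> z" 
    "\<And>n. n < m \<Longrightarrow> fps_nth H n = 0"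
proof -
  obtain H where H: "fps_conv_radius H \<ge> ereal r" "fps_nth H 0 = 0" "fps_nth H m = 1"
    "\<And>n. n \<noteq> 0 \<Longrightarrow> n \<noteq> m \<Longrightarrow> fps_nth H n = ((\<Sum>k<n. fps_nth QF (n - k) * fps_nth H k) + fps_nth 0 n) / (of_nat n * (of_nat n - of_nat m))"
    "fps_X^2 * fps_deriv (fps_deriv H) + fps_const (1 - of_nat m) * (fps_X * fps_deriv H) + (fps_const (fps_nth QF 0) - QF) * H
       = 0 + fps_const (- (\<Sum>k<m. fps_nth QF (m - k) * fps_nth H k) - fps_nth 0 m) * fps_X ^ m"
    by (rule frobenius_series[OF QF_eval(1), of 0 m 0 1]) (use m in auto)
  have z: "fps_nth H n = 0" if "n < m" for n
    using that
  proof (induction n rule: less_induct)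
    case (less n)
    show ?case using H(2) H(4)[of n] less by (cases "n = 0") auto
  qed
  have e0: "- (\<Sum>k<m. fps_nth QF (m - k) * fps_nth H k) - fps_nth (0 :: complex fps) m = 0"
    using z by simp
  have sub: "subdegree H \<ge> m" using z H(3) by (metis subdegree_geI zero_neq_one fps_nonzero_nth)
  define G where "G = fps_shift m H"
  have radG: "fps_conv_radius G \<ge> ereal r" using H(1) by (simp add: G_def fps_conv_radius_shift)
  have HG: "H = fps_X ^ m * G"
    using sub by (simp add: G_def fps_shift_times_fps_X_power mult.commute)
  show ?thesis
  proof (rule that[OF H(1,3), of "eval_fps G"])
    fix z :: complex assume nz: "norm z < r"
    show "z^2 * eval_fps (fps_deriv (fps_deriv H)) z + 2 * \<rho> * z * eval_fps (fps_deriv H) z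
         + (\<rho> * (\<rho> - 1) - Q z) * eval_fps H z = 0"
      using frobenius_eval[OF QF_eval(1) _ H(1) H(5)[unfolded e0], of z] nz QF_eval Q0 \<rho> by simp
    have "norm z < fps_conv_radius G" using nz radG by (metis ereal_less_eq(3) less_le_trans less_ereal.simps(1))
    thus "eval_fps H z = z ^ m * eval_fps G z"
      by (subst HG) (simp add: eval_fps_mult)
  next
    show "eval_fps G 0 = 1" by (simp add: eval_fps_at_0 G_def H(3))
  qed (use series_holomorphic[OF radG] z in auto)
qed

text \<open>At the smaller exponent the defect of order m survives; it is kept on the right side,
  and its vanishing decides whether z^\<rho> A is a solution.\<close>

lemma lower_solution:
  obtains A where "fps_conv_radius A \<ge> ereal r" "fps_nth A 0 = 1"
    "\<And>n. n \<noteq> 0 \<Longrightarrow> n \<noteq> m \<Longrightarrow> fps_nth A n = (\<Sum>k<n. fps_nth QF (n - k) * fps_nth A k) / (of_nat n * (of_nat n - of_nat m))"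
    "\<And>z. norm z < r \<Longrightarrow> z^2 * eval_fps (fps_deriv (fps_deriv A)) z + 2 * \<rho> * z * eval_fps (fps_deriv A) z
         + (\<rho> * (\<rho> - 1) - Q z) * eval_fps A z = - (\<Sum>k<m. fps_nth QF (m - k) * fps_nth A k) * z ^ m"
proof -
  obtain A where A: "fps_conv_radius A \<ge> ereal r" "fps_nth A 0 = 1" "fps_nth A m = 0"
    "\<And>n. n \<noteq> 0 \<Longrightarrow> n \<noteq> m \<Longrightarrow> fps_nth A n = ((\<Sum>k<n. fps_nth QF (n - k) * fps_nth A k) + fps_nth 0 n) / (of_nat n * (of_nat n - of_nat m))"
    "fps_X^2 * fps_deriv (fps_deriv A) + fps_const (1 - of_nat m) * (fps_X * fps_deriv A) + (fps_const (fps_nth QF 0) - QF) * A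
       = 0 + fps_const (- (\<Sum>k<m. fps_nth QF (m - k) * fps_nth A k) - fps_nth 0 m) * fps_X ^ m"
    by (rule frobenius_series[OF QF_eval(1), of 0 m 1 0]) (use m in auto)
  show ?thesis
  proof (rule that[OF A(1,2)])
    fix z :: complex assume nz: "norm z < r"
    show "z^2 * eval_fps (fps_deriv (fps_deriv A)) z + 2 * \<rho> * z * eval_fps (fps_deriv A) z
         + (\<rho> * (\<rho> - 1) - Q z) * eval_fps A z = - (\<Sum>k<m. fps_nth QF (m - k) * fps_nth A k) * z ^ m"
      using frobenius_eval[OF QF_eval(1) _ A(1) A(5), of z] nz QF_eval Q0 \<rho> by simp
  qed (use A(4) in simp)
qed

text \<open>For a logarithmic solution \<open>z powr \<rho> * (C * Ln z * b z + g z)\<close> the operator applied to \<open>g\<close> has to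
  cancel the terms in which the logarithm is differentiated; at order \<open>m\<close> this fixes \<open>C\<close>.\<close>

lemma log_solution:
  assumes A0: "fps_nth A 0 = 1"
    and A: "\<And>n. n \<noteq> 0 \<Longrightarrow> n \<noteq> m \<Longrightarrow> fps_nth A n = (\<Sum>k<n. fps_nth QF (n - k) * fps_nth A k) / (of_nat n * (of_nat n - of_nat m))"
    and C: "C = (\<Sum>k<m. fps_nth QF (m - k) * fps_nth A k) / of_nat m"
    and B: "fps_conv_radius B \<ge> ereal r" "fps_nth B m = 1" "\<And>n. n < m \<Longrightarrow> fps_nth B n = 0"
    "\<And>z. norm z < r \<Longrightarrow> z^2 * eval_fps (fps_deriv (fps_deriv B)) z + 2 * \<rho> * z * eval_fps (fps_deriv B) z
         + (\<rho> * (\<rho> - 1) - Q z) * eval_fps B z = 0"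
    and q: "\<And>z. z \<in> ball 0 r - {0} \<Longrightarrow> q z = Q z / z\<^sup>2"
  obtains G where "fps_conv_radius G \<ge> ereal r" 
    "solves_on q (slit_disc 0 r) (\<lambda>z. z powr \<rho> * (C * Ln z * eval_fps B z + eval_fps G z))"
proof -
  \<comment> \<open>Differentiating the logarithm produces 2 z B' + (2 \<rho> - 1) B = 2 z B' - m B;
    these terms are moved to the right side with the factor - C.\<close>
  define F where "F = fps_const (- C) * (fps_const (- of_nat m) * B + fps_const 2 * (fps_X * fps_deriv B))"
  have radF: "fps_conv_radius F \<ge> ereal r"
  proof -
    have *: "fps_conv_radius (f * g) \<ge> ereal r" if "fps_conv_radius f \<ge> ereal r" "fps_conv_radius g \<ge> ereal r" for f g :: "complex fps"
      using that fps_conv_radius_mult[of f g] by (metis min.bounded_iff order_trans)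
    have **: "fps_conv_radius (f + g) \<ge> ereal r" if "fps_conv_radius f \<ge> ereal r" "fps_conv_radius g \<ge> ereal r" for f g :: "complex fps"
      using that fps_conv_radius_add[of f g] by (metis min.bounded_iff order_trans)
    have "fps_conv_radius (fps_deriv B) \<ge> ereal r" using B(1) fps_conv_radius_deriv order_trans by blast
    thus ?thesis unfolding F_def using B(1) by (intro * **) auto
  qed
  have Fn: "fps_nth F n = - C * (2 * of_nat n - of_nat m) * fps_nth B n" for n
    unfolding F_def by (simp only: fps_mult_left_const_nth fps_add_nth theta_nth) (simp add: algebra_simps)
  have F0: "fps_nth F 0 = 0" using B(3) m by (simp add: Fn)
  obtain G where G: "fps_conv_radius G \<ge> ereal r" "fps_nth G 0 = 1" "fps_nth G m = 0"
    "\<And>n. n \<noteq> 0 \<Longrightarrow> n \<noteq> m \<Longrightarrow> fps_nth G n = ((\<Sum>k<n. fps_nth QF (n - k) * fps_nth G k) + fps_nth F n) / (of_nat n * (of_nat n - of_nat m))"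
    "fps_X^2 * fps_deriv (fps_deriv G) + fps_const (1 - of_nat m) * (fps_X * fps_deriv G) + (fps_const (fps_nth QF 0) - QF) * G
       = F + fps_const (- (\<Sum>k<m. fps_nth QF (m - k) * fps_nth G k) - fps_nth F m) * fps_X ^ m"
    by (rule frobenius_series[OF QF_eval(1) radF F0 m, of 1 0]) blast
  \<comment> \<open>\<open>F\<close> has no terms below order m, so there G satisfies the same
    recursion as the series A.\<close>
  have GA: "fps_nth G n = fps_nth A n" if "n < m" for n
    using that
  proof (induction n rule: less_induct)
    case (less n)
    show ?case
    proof (cases "n = 0")
      case False
      have "(\<Sum>k<n. fps_nth QF (n - k) * fps_nth G k) = (\<Sum>k<n. fps_nth QF (n - k) * fps_nth A k)"
        using less by (intro sum.cong) auto
      thus ?thesis using A[of n] G(4)[of n] False less B(3)[of n] by (simp add: Fn)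
    qed (use G(2) A0 in simp)
  qed
  have "(\<Sum>k<m. fps_nth QF (m - k) * fps_nth G k) = of_nat m * C"
    using GA m by (simp add: C)
  \<comment> \<open>The m-th coefficient of \<open>F\<close> is - C (2 m - m), which cancels the
    obstruction m C.\<close>
  hence e0: "- (\<Sum>k<m. fps_nth QF (m - k) * fps_nth G k) - fps_nth F m = 0"
    by (simp add: Fn B(2) algebra_simps)
  show ?thesis
  proof (rule that[OF G(1)], rule powr_solves_on[OF refl, where Q = Q])
    fix z assume z: "z \<in> slit_disc 0 r"
    hence z': "z \<notin> \<real>\<^sub>\<le>\<^sub>0" "z \<noteq> 0" "norm z < r" by (auto simp: slit_disc_0)
    have nz: "ereal (norm z) < ereal r" using z' by simp
    have n: "norm z < fps_conv_radius B" "norm z < fps_conv_radius G"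
      by (rule less_le_trans[OF nz B(1)], rule less_le_trans[OF nz G(1)])
    have n': "norm z < fps_conv_radius (fps_deriv B)" "norm z < fps_conv_radius (fps_deriv G)"
      by (rule less_le_trans[OF n(1) fps_conv_radius_deriv], rule less_le_trans[OF n(2) fps_conv_radius_deriv])
    note dB = series_deriv[OF B(1) z] and dG = series_deriv[OF G(1) z]
    show "((\<lambda>z. C * Ln z * eval_fps B z + eval_fps G z) has_field_derivative 
       C * eval_fps B z / z + C * Ln z * eval_fps (fps_deriv B) z + eval_fps (fps_deriv G) z) (at z)"
      using z' n n' by (auto intro!: derivative_eq_intros dB dG simp: field_simps)
    show "((\<lambda>z. C * eval_fps B z / z + C * Ln z * eval_fps (fps_deriv B) z + eval_fps (fps_deriv G) z) has_field_derivative 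
       - C * eval_fps B z / z\<^sup>2 + 2 * C * eval_fps (fps_deriv B) z / z + C * Ln z * eval_fps (fps_deriv (fps_deriv B)) z
          + eval_fps (fps_deriv (fps_deriv G)) z) (at z)"
      using z' n n' by (auto intro!: derivative_eq_intros dB dG simp: field_simps power2_eq_square)
    show "q z = Q z / z\<^sup>2" using q z' by auto
    have 1: "z^2 * eval_fps (fps_deriv (fps_deriv G)) z + 2 * \<rho> * z * eval_fps (fps_deriv G) z
         + (\<rho> * (\<rho> - 1) - Q z) * eval_fps G z = eval_fps F z"
      using frobenius_eval[OF QF_eval(1) radF G(1) G(5)[unfolded e0], of z] z' QF_eval Q0 \<rho> by simp
    have 2: "eval_fps F z = - C * (- of_nat m * eval_fps B z + 2 * z * eval_fps (fps_deriv B) z)"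
    proof -
      have mult: "norm z < fps_conv_radius (f * g)" if "norm z < fps_conv_radius f" "norm z < fps_conv_radius g" for f g :: "complex fps"
        using that fps_conv_radius_mult[of f g] by (metis less_le_trans min_less_iff_conj)
      have add: "norm z < fps_conv_radius (f + g)" if "norm z < fps_conv_radius f" "norm z < fps_conv_radius g" for f g :: "complex fps"
        using that fps_conv_radius_add[of f g] by (metis less_le_trans min_less_iff_conj)
      show ?thesis unfolding F_def
        by (simp add: eval_fps_add eval_fps_mult mult add n n')
    qed
    have 3: "of_nat m = 1 - 2 * \<rho>" using \<rho> by simp
    define b b1 b2 where "b = eval_fps B z" "b1 = eval_fps (fps_deriv B) z" "b2 = eval_fps (fps_deriv (fps_deriv B)) z"
    define g g1 g2 where "g = eval_fps G z" "g1 = eval_fps (fps_deriv G) z" "g2 = eval_fps (fps_deriv (fps_deriv G)) z"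
    have Beq: "z^2 * b2 + 2 * \<rho> * z * b1 + (\<rho> * (\<rho> - 1) - Q z) * b = 0"
      using B(4)[OF z'(3)] by (simp add: b_b1_b2_def)
    have Geq: "z^2 * g2 + 2 * \<rho> * z * g1 + (\<rho> * (\<rho> - 1) - Q z) * g = - C * (- (1 - 2 * \<rho>) * b + 2 * z * b1)"
      using 1[unfolded 2 3] by (simp add: b_b1_b2_def g_g1_g2_def)
    have "z\<^sup>2 * (- C * b / z\<^sup>2 + 2 * C * b1 / z + C * Ln z * b2 + g2) + 2 * \<rho> * z * (C * b / z + C * Ln z * b1 + g1)
       + (\<rho> * (\<rho> - 1) - Q z) * (C * Ln z * b + g) = 
       C * Ln z * (z^2 * b2 + 2 * \<rho> * z * b1 + (\<rho> * (\<rho> - 1) - Q z) * b)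
       + (z^2 * g2 + 2 * \<rho> * z * g1 + (\<rho> * (\<rho> - 1) - Q z) * g) - C * b + 2 * C * z * b1 + 2 * \<rho> * C * b"
      using z'(2) by (simp add: field_simps power2_eq_square)
    also have "\<dots> = 0" unfolding Beq Geq by (simp add: algebra_simps)
    finally show "z\<^sup>2 * (- C * eval_fps B z / z\<^sup>2 + 2 * C * eval_fps (fps_deriv B) z / z + C * Ln z * eval_fps (fps_deriv (fps_deriv B)) z
          + eval_fps (fps_deriv (fps_deriv G)) z) + 2 * \<rho> * z * (C * eval_fps B z / z + C * Ln z * eval_fps (fps_deriv B) z + eval_fps (fps_deriv G) z)
       + (\<rho> * (\<rho> - 1) - Q z) * (C * Ln z * eval_fps B z + eval_fps G z) = 0"
      by (simp add: b_b1_b2_def g_g1_g2_def)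
  qed
qed

text \<open>Without defect, z^\<rho> A and z^\<rho> B both solve the equation. Their Wronskian is a
  nonzero constant, so Cramer's rule expresses every solution through them, with the common factor
  z^\<rho> taken out.\<close>

lemma solution_form:
  assumes A: "fps_conv_radius A \<ge> ereal r" "fps_nth A 0 = 1" 
    "\<And>z. norm z < r \<Longrightarrow> z^2 * eval_fps (fps_deriv (fps_deriv A)) z + 2 * \<rho> * z * eval_fps (fps_deriv A) z
         + (\<rho> * (\<rho> - 1) - Q z) * eval_fps A z = 0"
    and q: "\<And>z. z \<in> ball 0 r - {0} \<Longrightarrow> q z = Q z / z\<^sup>2"
    and y: "solves_on q (slit_disc 0 r) y"
  obtains h where "h holomorphic_on ball 0 r" "\<And>z. z \<in> slit_disc 0 r \<Longrightarrow> y z = z powr \<rho> * h z"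
proof -
  let ?S = "slit_disc 0 r"
  note S = open_slit_disc_0[of r] connected_slit_disc_0[OF r]
  obtain B \<beta> where B: "fps_conv_radius B \<ge> ereal r" "fps_nth B m = 1"
    "\<And>z. norm z < r \<Longrightarrow> z^2 * eval_fps (fps_deriv (fps_deriv B)) z + 2 * \<rho> * z * eval_fps (fps_deriv B) z
         + (\<rho> * (\<rho> - 1) - Q z) * eval_fps B z = 0"
    "\<beta> holomorphic_on ball 0 r" "\<beta> 0 = 1" "\<And>z. norm z < r \<Longrightarrow> eval_fps B z = z ^ m * \<beta> z"
    by (rule upper_solution) blast
  define ya where "ya = (\<lambda>z. z powr \<rho> * eval_fps A z)"
  define yb where "yb = (\<lambda>z. z powr \<rho> * eval_fps B z)"
  have sol: "solves_on q ?S (\<lambda>z. z powr \<rho> * eval_fps H z)" if "fps_conv_radius H \<ge> ereal r"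
    "\<And>z. norm z < r \<Longrightarrow> z^2 * eval_fps (fps_deriv (fps_deriv H)) z + 2 * \<rho> * z * eval_fps (fps_deriv H) z
         + (\<rho> * (\<rho> - 1) - Q z) * eval_fps H z = 0" for H
    by (rule powr_solves_on[OF refl series_deriv[OF that(1)], where Q = Q]) (use that(2) q slit_disc_D in auto)
  have ya: "solves_on q ?S ya" and yb: "solves_on q ?S yb"
    unfolding ya_def yb_def using sol A B by auto
  obtain w where w: "\<And>z. z \<in> ?S \<Longrightarrow> ya z * deriv yb z - deriv ya z * yb z = w"
    using wronskian_constant[OF S ya yb] by metis
  have "w \<noteq> 0"
  proof
    assume w0: "w = 0"
    \<comment> \<open>This is the Wronskian divided by z^(2 \<rho>) z^(m - 1). It extends
      holomorphically to 0, where its value is m A(0) \<beta>(0) = m.\<close>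
    define f where "f = (\<lambda>z. eval_fps A z * (of_nat m * \<beta> z + z * deriv \<beta> z) - deriv (eval_fps A) z * z * \<beta> z)"
    have hA: "eval_fps A holomorphic_on ball 0 r" by (rule series_holomorphic[OF A(1)])
    have hf: "f holomorphic_on ball 0 r"
      unfolding f_def 
      by (intro holomorphic_on_diff holomorphic_on_mult holomorphic_on_add holomorphic_on_const 
          holomorphic_on_ident holomorphic_deriv hA B(4)) auto
    have "f z = 0" if z: "z \<in> ?S" for z
    proof -
      have z': "z \<notin> \<real>\<^sub>\<le>\<^sub>0" "z \<noteq> 0" "z \<in> ball 0 r" using z by (auto simp: slit_disc_0)
      have dA: "(eval_fps A has_field_derivative deriv (eval_fps A) z) (at z)"
        using holomorphic_derivI[OF hA open_ball z'(3)] .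
      have d\<beta>: "(\<beta> has_field_derivative deriv \<beta> z) (at z)"
        using holomorphic_derivI[OF B(4) open_ball z'(3)] .
      have dB: "(eval_fps B has_field_derivative (of_nat m * z ^ (m - 1) * \<beta> z + z ^ m * deriv \<beta> z)) (at z)"
      proof (rule has_field_derivative_transform_within_open[of _ _ _ "ball 0 r"])
        show "((\<lambda>z. z ^ m * \<beta> z) has_field_derivative (of_nat m * z ^ (m - 1) * \<beta> z + z ^ m * deriv \<beta> z)) (at z)"
          by (auto intro!: derivative_eq_intros d\<beta>)
      qed (use z' B(6) in auto)
      have da: "deriv ya z = z powr \<rho> * (\<rho> * eval_fps A z / z + deriv (eval_fps A) z)"
        unfolding ya_def by (rule DERIV_imp_deriv[OF powr_mult_has_field_derivative[OF z'(1) dA]])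
      have db: "deriv yb z = z powr \<rho> * (\<rho> * eval_fps B z / z + (of_nat m * z ^ (m - 1) * \<beta> z + z ^ m * deriv \<beta> z))"
        unfolding yb_def by (rule DERIV_imp_deriv[OF powr_mult_has_field_derivative[OF z'(1) dB]])
      have zm: "z ^ m = z * z ^ (m - 1)" using m by (metis Suc_pred' power_Suc)
      have Bz: "eval_fps B z = z * z ^ (m - 1) * \<beta> z" using B(6)[of z] z' zm by simp
      have "(z powr \<rho>)\<^sup>2 * z ^ (m - 1) * f z = ya z * deriv yb z - deriv ya z * yb z"
        unfolding da db unfolding ya_def yb_def f_def zm Bz by (simp add: algebra_simps power2_eq_square)
      hence "(z powr \<rho>)\<^sup>2 * z ^ (m - 1) * f z = 0" using w[OF z] w0 by simp
      thus ?thesis using z' by simp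
    qed
    moreover have "continuous_on (closure (?S \<inter> ball 0 (r/2))) f"
    proof (rule continuous_on_subset[OF holomorphic_on_imp_continuous_on[OF hf]])
      have "closure (?S \<inter> ball 0 (r/2)) \<subseteq> closure (ball 0 (r/2))" by (intro closure_mono) auto
      also have "\<dots> \<subseteq> ball 0 r" using r by auto
      finally show "closure (?S \<inter> ball 0 (r/2)) \<subseteq> ball 0 r" .
    qed
    moreover have "?S \<inter> ball 0 (r/2) = slit_disc 0 (r/2)" using r by (auto simp: slit_disc_0)
    hence "0 \<in> closure (?S \<inter> ball 0 (r/2))" using zero_in_closure_slit_disc[of "r/2"] r by simp
    ultimately have "f 0 = 0" by (intro continuous_constant_on_closure[of "?S \<inter> ball 0 (r/2)" f 0 0]) auto
    thus False using A(2) B(5) m by (simp add: f_def eval_fps_at_0)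
  qed
  obtain c1 where c1: "\<And>z. z \<in> ?S \<Longrightarrow> y z * deriv yb z - deriv y z * yb z = c1"
    using wronskian_constant[OF S y yb] by metis
  obtain c2 where c2: "\<And>z. z \<in> ?S \<Longrightarrow> ya z * deriv y z - deriv ya z * y z = c2"
    using wronskian_constant[OF S ya y] by metis
  show ?thesis
  \<comment> \<open>Cramer's rule: \<open>c1\<close> and \<open>c2\<close> are the Wronskians of y
    with the two basic solutions.\<close>
  proof (rule that[of "\<lambda>z. (c1 * eval_fps A z + c2 * eval_fps B z) / w"])
    show "(\<lambda>z. (c1 * eval_fps A z + c2 * eval_fps B z) / w) holomorphic_on ball 0 r"
      by (intro holomorphic_on_divide holomorphic_on_mult holomorphic_on_add holomorphic_on_const 
          series_holomorphic A(1) B(1)) (use \<open>w \<noteq> 0\<close> in auto)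
    fix z assume z: "z \<in> ?S"
    have "y z * w = ya z * c1 + yb z * c2"
      unfolding w[OF z, symmetric] c1[OF z, symmetric] c2[OF z, symmetric] by (simp add: algebra_simps)
    hence "y z = (ya z * c1 + yb z * c2) / w" using \<open>w \<noteq> 0\<close> by (simp add: field_simps)
    thus "y z = z powr \<rho> * ((c1 * eval_fps A z + c2 * eval_fps B z) / w)"
      by (simp add: ya_def yb_def algebra_simps add_divide_distrib)
  qed
qed

end

text \<open>Only coefficients below m enter the obstruction, so it can be evaluated on any explicit
  finite sequence obeying the recursion. If it vanishes, all solutions are z^\<rho> times a
  holomorphic function; if not, the logarithmic solution exists, and by the monodromy argument it is
  no sum of two powers.\<close>

lemma (in frobenius) log_free_at_iff:
  assumes q: "\<And>z. z \<in> ball 0 r - {0} \<Longrightarrow> q z = Q z / z\<^sup>2"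
    and a0: "a 0 = 1"
    and a: "\<And>n. n \<noteq> 0 \<Longrightarrow> n < m \<Longrightarrow> a n = (\<Sum>k<n. fps_nth QF (n - k) * a k) / (of_nat n * (of_nat n - of_nat m))"
  shows "log_free_at q 0 \<longleftrightarrow> (\<Sum>k<m. fps_nth QF (m - k) * a k) = 0"
proof -
  have uniq: "fps_nth A n = a n" if "n < m" "fps_nth A 0 = 1" 
    "\<And>n. n \<noteq> 0 \<Longrightarrow> n \<noteq> m \<Longrightarrow> fps_nth A n = (\<Sum>k<n. fps_nth QF (n - k) * fps_nth A k) / (of_nat n * (of_nat n - of_nat m))"
    for A n
    using that(1)
  proof (induction n rule: less_induct)
    case (less n)
    show ?case
    proof (cases "n = 0")
      case False
      have "(\<Sum>k<n. fps_nth QF (n - k) * fps_nth A k) = (\<Sum>k<n. fps_nth QF (n - k) * a k)"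
        using less by (intro sum.cong) auto
      thus ?thesis using a[of n] that(3)[of n] False less by simp
    qed (use that(2) a0 in simp)
  qed
  define R where "R = (\<Sum>k<m. fps_nth QF (m - k) * a k)"
  have "log_free_at q 0" if R0: "R = 0"
  proof -
    obtain A where A: "fps_conv_radius A \<ge> ereal r" "fps_nth A 0 = 1"
      "\<And>n. n \<noteq> 0 \<Longrightarrow> n \<noteq> m \<Longrightarrow> fps_nth A n = (\<Sum>k<n. fps_nth QF (n - k) * fps_nth A k) / (of_nat n * (of_nat n - of_nat m))"
      "\<And>z. norm z < r \<Longrightarrow> z^2 * eval_fps (fps_deriv (fps_deriv A)) z + 2 * \<rho> * z * eval_fps (fps_deriv A) z
           + (\<rho> * (\<rho> - 1) - Q z) * eval_fps A z = - (\<Sum>k<m. fps_nth QF (m - k) * fps_nth A k) * z ^ m"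
      by (rule lower_solution) blast
    have "(\<Sum>k<m. fps_nth QF (m - k) * fps_nth A k) = R"
      unfolding R_def using uniq[OF _ A(2,3)] by (intro sum.cong) auto
    hence A4: "z^2 * eval_fps (fps_deriv (fps_deriv A)) z + 2 * \<rho> * z * eval_fps (fps_deriv A) z
           + (\<rho> * (\<rho> - 1) - Q z) * eval_fps A z = 0" if "norm z < r" for z
      using A(4)[OF that] R0 by simp
    show ?thesis
      unfolding log_free_at_def
    proof (intro exI[of _ r] conjI r allI impI)
      have "(\<lambda>z. Q z / z\<^sup>2) holomorphic_on ball 0 r - {0}"
        by (intro holomorphic_intros holomorphic_on_subset[OF holQ]) auto
      thus "q holomorphic_on ball 0 r - {0}"
        by (rule holomorphic_transform) (use q in auto)
    next
      fix y assume "solves_on q (slit_disc 0 r) y"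
      then obtain h where h: "h holomorphic_on ball 0 r" "\<And>z. z \<in> slit_disc 0 r \<Longrightarrow> y z = z powr \<rho> * h z"
        using solution_form[OF A(1,2) A4 q] by blast
      show "\<exists>\<rho>1 \<rho>2 h1 h2. h1 holomorphic_on ball 0 r \<and> h2 holomorphic_on ball 0 r \<and>
            (\<forall>z\<in>slit_disc 0 r. y z = (z - 0) powr \<rho>1 * h1 z + (z - 0) powr \<rho>2 * h2 z)"
        by (rule exI[of _ \<rho>], rule exI[of _ 0], rule exI[of _ h], rule exI[of _ "\<lambda>_. 0"]) (use h in auto)
    qed
  qed
  moreover have "R = 0" if lf: "log_free_at q 0"
  proof (rule ccontr)
    assume R: "R \<noteq> 0"
    obtain r1 where r1: "r1 > 0" "q holomorphic_on ball 0 r1 - {0}" and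
      form: "\<And>y. solves_on q (slit_disc 0 r1) y \<Longrightarrow> \<exists>\<rho>1 \<rho>2 h1 h2. h1 holomorphic_on ball 0 r1 \<and> h2 holomorphic_on ball 0 r1 \<and>
            (\<forall>z\<in>slit_disc 0 r1. y z = z powr \<rho>1 * h1 z + z powr \<rho>2 * h2 z)"
      using lf unfolding log_free_at_def by auto
    \<comment> \<open>\<open>log_free_at\<close> supplies its own radius \<open>r1\<close>, possibly
      larger than \<open>r\<close>. There Q is replaced by z^2 q, which agrees with Q near 0 and so
      has the same Taylor series.\<close>
    define Q1 where "Q1 = (\<lambda>z. if z = 0 then Q 0 else z\<^sup>2 * q z)"
    have Q1Q: "Q1 z = Q z" if "z \<in> ball 0 r" for z
      using q[of z] that by (auto simp: Q1_def)
    have "Q1 holomorphic_on (ball 0 r1 - {0}) \<union> ball 0 (min r r1)"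
    proof (rule holomorphic_on_Un)
      have "(\<lambda>z. z\<^sup>2 * q z) holomorphic_on ball 0 r1 - {0}"
        using r1 by (intro holomorphic_intros)
      thus "Q1 holomorphic_on ball 0 r1 - {0}"
        by (rule holomorphic_transform) (auto simp: Q1_def)
      have "Q holomorphic_on ball 0 (min r r1)" by (rule holomorphic_on_subset[OF holQ]) auto
      thus "Q1 holomorphic_on ball 0 (min r r1)"
        by (rule holomorphic_transform) (use Q1Q in auto)
    qed (auto intro: open_Diff)
    moreover have "(ball 0 r1 - {0}) \<union> ball 0 (min r r1) = ball (0::complex) r1"
      using r r1 by auto
    ultimately have holQ1: "Q1 holomorphic_on ball 0 r1" by simp
    interpret F1: frobenius r1 Q1 m \<rho>
      by unfold_locales (use r1 holQ1 m \<rho> Q0 in \<open>auto simp: Q1_def\<close>)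
    have "eventually (\<lambda>z. Q1 z = Q z) (nhds 0)"
      using eventually_nhds_in_open[of "ball 0 r" "0::complex"] r by (auto elim!: eventually_mono simp: Q1Q)
    hence QF1: "F1.QF = QF" unfolding F1.QF_def QF_def by (rule fps_expansion_cong)
    have q1: "q z = Q1 z / z\<^sup>2" if "z \<in> ball 0 r1 - {0}" for z
      using that by (simp add: Q1_def)
    obtain A where A: "fps_nth A 0 = 1"
      "\<And>n. n \<noteq> 0 \<Longrightarrow> n \<noteq> m \<Longrightarrow> fps_nth A n = (\<Sum>k<n. fps_nth QF (n - k) * fps_nth A k) / (of_nat n * (of_nat n - of_nat m))"
      unfolding QF1[symmetric] by (rule F1.lower_solution) blast
    have AR: "(\<Sum>k<m. fps_nth QF (m - k) * fps_nth A k) = R"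
      unfolding R_def using uniq[OF _ A] by (intro sum.cong) auto
    obtain B \<beta> where B: "fps_conv_radius B \<ge> ereal r1" "fps_nth B m = 1"
      "\<And>z. norm z < r1 \<Longrightarrow> z^2 * eval_fps (fps_deriv (fps_deriv B)) z + 2 * \<rho> * z * eval_fps (fps_deriv B) z
         + (\<rho> * (\<rho> - 1) - Q1 z) * eval_fps B z = 0"
      "\<beta> holomorphic_on ball 0 r1" "\<beta> 0 = 1" "\<And>z. norm z < r1 \<Longrightarrow> eval_fps B z = z ^ m * \<beta> z"
      "\<And>n. n < m \<Longrightarrow> fps_nth B n = 0"
      by (rule F1.upper_solution) blast
    define C where "C = R / of_nat m"
    have C: "C \<noteq> 0" using R m by (simp add: C_def)
    obtain G where G: "fps_conv_radius G \<ge> ereal r1" 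
      "solves_on q (slit_disc 0 r1) (\<lambda>z. z powr \<rho> * (C * Ln z * eval_fps B z + eval_fps G z))"
      by (rule F1.log_solution[OF A(1) A(2)[folded QF1] _ B(1,2,7,3) q1, of C]) (auto simp: C_def AR QF1)
    obtain \<rho>1 \<rho>2 h1 h2 where h: "h1 holomorphic_on ball 0 r1" "h2 holomorphic_on ball 0 r1"
      "\<And>z. z \<in> slit_disc 0 r1 \<Longrightarrow> z powr \<rho> * (C * Ln z * eval_fps B z + eval_fps G z) = z powr \<rho>1 * h1 z + z powr \<rho>2 * h2 z"
      using form[OF G(2)] by blast
    \<comment> \<open>The coefficient of the logarithm would have to vanish, although B = z^m
      \<beta> with \<beta>(0) = 1.\<close>
    have B0: "eval_fps B z = 0" if "z \<in> ball 0 r1" "z \<noteq> 0" for z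
      by (rule no_log_sum_of_powers[OF r1(1) F1.series_holomorphic[OF B(1)] F1.series_holomorphic[OF G(1)] h C that])
    have "eventually (\<lambda>z. z \<in> ball 0 r1 - {0}) (at (0::complex))"
      using r1(1) by (intro eventually_at_in_open) auto
    hence "eventually (\<lambda>z. \<beta> z = 0) (at 0)"
      by eventually_elim (use B0 B(6) in auto)
    moreover have "isCont \<beta> 0"
      using r1(1) by (intro DERIV_isCont[OF holomorphic_derivI[OF B(4) open_ball]]) auto
    hence "\<beta> \<midarrow>0\<rightarrow> 1" using B(5) by (simp add: isCont_def)
    ultimately have "(\<lambda>_::complex. 0::complex) \<midarrow>0\<rightarrow> 1"
      by (rule Lim_transform_eventually[rotated])
    hence "(0::complex) = 1" by (rule LIM_const_eq)
    thus False by simp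
  qed
  ultimately show ?thesis unfolding R_def by blast
qed

section \<open>Translation of the singular point to 0\<close>

lemma deriv_shift: "deriv (\<lambda>z. y (z + a)) z = deriv y (z + a)"
  for y :: "complex \<Rightarrow> complex"
  unfolding deriv_def by (simp add: DERIV_shift)

lemma slit_disc_shift: "z + a \<in> slit_disc a r \<longleftrightarrow> z \<in> slit_disc 0 r"
  by (auto simp: slit_disc_def dist_norm)

lemma solves_on_shift:
  "solves_on (\<lambda>z. q (z + a)) (slit_disc 0 r) (\<lambda>z. y (z + a)) \<longleftrightarrow> solves_on q (slit_disc a r) y"
proof -
  have im: "slit_disc a r = (\<lambda>z. z + a) ` slit_disc 0 r"
  proof (intro equalityI subsetI)
    fix x assume "x \<in> slit_disc a r"
    thus "x \<in> (\<lambda>z. z + a) ` slit_disc 0 r"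
      using slit_disc_shift[of "x - a" a r] by (intro image_eqI[of _ _ "x - a"]) auto
  qed (auto simp: slit_disc_shift)
  have "y holomorphic_on slit_disc a r" if "(\<lambda>z. y (z + a)) holomorphic_on slit_disc 0 r"
  proof -
    have "(\<lambda>z. y (z + a)) \<circ> (\<lambda>z. z - a) holomorphic_on slit_disc a r"
      by (rule holomorphic_on_compose_gen[OF _ that]) (auto simp: im intro!: holomorphic_intros)
    thus ?thesis by (simp add: o_def)
  qed
  moreover have "(\<lambda>z. y (z + a)) holomorphic_on slit_disc 0 r" if "y holomorphic_on slit_disc a r"
  proof -
    have "y \<circ> (\<lambda>z. z + a) holomorphic_on slit_disc 0 r"
      by (rule holomorphic_on_compose_gen[OF _ that]) (auto simp: im intro!: holomorphic_intros)
    thus ?thesis by (simp add: o_def)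
  qed
  moreover have "deriv (deriv (\<lambda>z. y (z + a))) z = deriv (deriv y) (z + a)" for z
  proof -
    have "deriv (\<lambda>z. y (z + a)) = (\<lambda>z. deriv y (z + a))" by (intro ext deriv_shift)
    thus ?thesis by (simp add: deriv_shift)
  qed
  ultimately show ?thesis unfolding solves_on_def im by auto
qed

lemma holomorphic_on_ball_shift:
  assumes "f holomorphic_on ball (a::complex) r"
  shows "(\<lambda>z. f (z + a)) holomorphic_on ball 0 r"
proof -
  have "f \<circ> (\<lambda>z. z + a) holomorphic_on ball 0 r"
    by (rule holomorphic_on_compose_gen[OF _ assms]) (auto simp: dist_norm intro!: holomorphic_intros)
  thus ?thesis by (simp add: o_def)
qed

lemma log_free_at_shift_aux:
  assumes "log_free_at q a" shows "log_free_at (\<lambda>z. q (z + b)) (a - b)"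
proof -
  obtain r where r: "r > 0" "q holomorphic_on ball a r - {a}" and
    form: "\<And>y. solves_on q (slit_disc a r) y \<Longrightarrow> \<exists>\<rho>1 \<rho>2 h1 h2. h1 holomorphic_on ball a r \<and> h2 holomorphic_on ball a r \<and>
          (\<forall>z\<in>slit_disc a r. y z = (z - a) powr \<rho>1 * h1 z + (z - a) powr \<rho>2 * h2 z)"
    using assms unfolding log_free_at_def by blast
  have ball: "z + b \<in> ball a r \<longleftrightarrow> z \<in> ball (a - b) r" for z
    by (simp add: dist_norm algebra_simps)
  have slit: "z + b \<in> slit_disc a r \<longleftrightarrow> z \<in> slit_disc (a - b) r" for z
    by (simp add: slit_disc_def dist_norm algebra_simps)
  have sh: "(\<lambda>z. f (z + b)) holomorphic_on B" if "f holomorphic_on A" "\<And>z. z \<in> B \<Longrightarrow> z + b \<in> A" for f :: "complex \<Rightarrow> complex" and A B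
  proof -
    have "f \<circ> (\<lambda>z. z + b) holomorphic_on B"
      by (rule holomorphic_on_compose_gen[OF _ that(1)]) (use that(2) in \<open>auto intro!: holomorphic_intros\<close>)
    thus ?thesis by (simp add: o_def)
  qed
  show ?thesis unfolding log_free_at_def
  proof (intro exI[of _ r] conjI r allI impI)
    show "(\<lambda>z. q (z + b)) holomorphic_on ball (a - b) r - {a - b}"
      by (rule sh[OF r(2)]) (auto simp: dist_norm algebra_simps)
    fix y assume y: "solves_on (\<lambda>z. q (z + b)) (slit_disc (a - b) r) y"
    have "solves_on q (slit_disc a r) (\<lambda>z. y (z - b))"
    proof -
      have "solves_on (\<lambda>z. q (z + a)) (slit_disc 0 r) (\<lambda>z. y (z + (a - b)))"
        using solves_on_shift[of "\<lambda>z. q (z + b)" "a - b" r y] y by (simp add: algebra_simps)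
      moreover have "(\<lambda>z. y (z + (a - b))) = (\<lambda>z. (\<lambda>z. y (z - b)) (z + a))" by (simp add: algebra_simps)
      ultimately show ?thesis using solves_on_shift[of q a r "\<lambda>z. y (z - b)"] by simp
    qed
    then obtain \<rho>1 \<rho>2 h1 h2 where h: "h1 holomorphic_on ball a r" "h2 holomorphic_on ball a r"
      "\<And>z. z \<in> slit_disc a r \<Longrightarrow> y (z - b) = (z - a) powr \<rho>1 * h1 z + (z - a) powr \<rho>2 * h2 z"
      using form by blast
    show "\<exists>\<rho>1 \<rho>2 h1 h2. h1 holomorphic_on ball (a - b) r \<and> h2 holomorphic_on ball (a - b) r \<and>
          (\<forall>z\<in>slit_disc (a - b) r. y z = (z - (a - b)) powr \<rho>1 * h1 z + (z - (a - b)) powr \<rho>2 * h2 z)"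
    proof (rule exI[of _ \<rho>1], rule exI[of _ \<rho>2], rule exI[of _ "\<lambda>z. h1 (z + b)"], rule exI[of _ "\<lambda>z. h2 (z + b)"], intro conjI ballI)
      show "(\<lambda>z. h1 (z + b)) holomorphic_on ball (a - b) r"
        by (rule sh[OF h(1)]) (simp only: ball)
      show "(\<lambda>z. h2 (z + b)) holomorphic_on ball (a - b) r"
        by (rule sh[OF h(2)]) (simp only: ball)
      fix z assume "z \<in> slit_disc (a - b) r"
      thus "y z = (z - (a - b)) powr \<rho>1 * h1 (z + b) + (z - (a - b)) powr \<rho>2 * h2 (z + b)"
        using h(3)[of "z + b"] slit[of z] by (simp add: algebra_simps)
    qed
  qed
qed

lemma log_free_at_shift: "log_free_at q a \<longleftrightarrow> log_free_at (\<lambda>z. q (z + a)) 0"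
  using log_free_at_shift_aux[of q a a] log_free_at_shift_aux[of "\<lambda>z. q (z + a)" 0 "- a"] by auto

section \<open>The obstruction in terms of Laurent coefficients\<close>

lemma fps_expansion_quadratic_shift:
  fixes f :: "complex \<Rightarrow> complex"
  assumes r: "r > 0" and f: "f holomorphic_on ball 0 r"
  shows "fps_expansion (\<lambda>z. c + \<alpha> * z + z\<^sup>2 * f z) 0 =
     fps_const c + fps_const \<alpha> * fps_X + fps_X ^ 2 * fps_expansion f 0"
proof -
  have hf: "f has_fps_expansion fps_expansion f 0"
    by (rule has_fps_expansion_fps_expansion[of "ball 0 r"]) (use r f in auto)
  have 1: "(\<lambda>z. c + \<alpha> * z + z\<^sup>2 * f z) has_fps_expansion
      (fps_const c + fps_const \<alpha> * fps_X + fps_X ^ 2 * fps_expansion f 0)"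
    by (intro fps_expansion_intros hf)
  have 2: "(\<lambda>z. c + \<alpha> * z + z\<^sup>2 * f z) has_fps_expansion fps_expansion (\<lambda>z. c + \<alpha> * z + z\<^sup>2 * f z) 0"
    by (rule has_fps_expansion_fps_expansion[of "ball 0 r"]) (use r f in \<open>auto intro!: holomorphic_intros\<close>)
  show ?thesis
    by (rule fps_ext) (simp only: fps_nth_fps_expansion[OF 1] fps_nth_fps_expansion[OF 2])
qed

lemma quadratic_shift_nth:
  fixes f :: "complex \<Rightarrow> complex"
  assumes r: "r > 0" and f: "f holomorphic_on ball 0 r"
    and Q_def: "Q = fps_expansion (\<lambda>z. c + \<alpha> * z + z\<^sup>2 * f z) 0"
  shows "fps_nth Q (Suc 0) = \<alpha>" "fps_nth Q 2 = f 0" "fps_nth Q 3 = deriv f 0"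
  unfolding Q_def fps_expansion_quadratic_shift[OF r f]
  by (simp_all add: fps_X_power_mult_nth fps_expansion_def)

text \<open>The indicial equation x (x - 1) = 2 has the roots -1 and 2, so m = 3 and three
  coefficients enter: 1, -\<alpha>/2 and (\<alpha>^2/2 - f(a))/2. The stated polynomial is four
  times the resulting obstruction.\<close>

theorem log_free_at_exponents_minus1_2:
  fixes f :: "complex \<Rightarrow> complex"
  assumes r: "r > 0" and f: "f holomorphic_on ball a r"
    and q: "\<And>z. z \<in> ball a r - {a} \<Longrightarrow> q z = 2 / (z - a)\<^sup>2 + \<alpha> / (z - a) + f z"
  shows "log_free_at q a \<longleftrightarrow> \<alpha> ^ 3 - 4 * \<alpha> * f a + 4 * deriv f a = 0"
proof -
  define f0 where "f0 = (\<lambda>z. f (z + a))"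
  have f0: "f0 holomorphic_on ball 0 r" unfolding f0_def by (rule holomorphic_on_ball_shift[OF f])
  define Q where "Q = (\<lambda>z. 2 + \<alpha> * z + z\<^sup>2 * f0 z)"
  have "Q holomorphic_on ball 0 r" unfolding Q_def using f0 by (intro holomorphic_intros)
  then interpret frobenius r Q 3 "-1"
    by unfold_locales (use r in \<open>auto simp: Q_def\<close>)
  have q0: "q (z + a) = Q z / z\<^sup>2" if "z \<in> ball 0 r - {0}" for z
  proof -
    have "z + a \<in> ball a r - {a}" using that by (simp add: dist_norm)
    thus ?thesis using q[of "z + a"] that by (simp add: Q_def f0_def field_simps power2_eq_square)
  qed
  have QF: "fps_nth QF (Suc 0) = \<alpha>" "fps_nth QF 2 = f a" "fps_nth QF 3 = deriv f a"
    using quadratic_shift_nth[OF r f0 refl, of 2 \<alpha>] deriv_shift[of f a 0]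
    unfolding QF_def unfolding Q_def by (simp_all add: f0_def)
  define b where "b = (\<lambda>n::nat. if n = 0 then 1 else if n = 1 then - \<alpha> / 2 else - (f a - \<alpha>\<^sup>2 / 2) / 2)"
  have "log_free_at (\<lambda>z. q (z + a)) 0 \<longleftrightarrow> (\<Sum>k<3. fps_nth QF (3 - k) * b k) = 0"
  proof (rule log_free_at_iff[OF q0])
    fix n :: nat assume "n \<noteq> 0" "n < 3"
    hence "n = 1 \<or> n = 2" by auto
    thus "b n = (\<Sum>k<n. fps_nth QF (n - k) * b k) / (of_nat n * (of_nat n - of_nat 3))"
    proof
      assume n: "n = 2"
      have "{..<2::nat} = {0, 1}" by auto
      thus ?thesis unfolding n by (simp add: b_def QF power2_eq_square field_simps)
    qed (simp add: b_def QF field_simps)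
  qed (auto simp: b_def)
  also have "(\<Sum>k<3. fps_nth QF (3 - k) * b k) = (\<alpha> ^ 3 - 4 * \<alpha> * f a + 4 * deriv f a) / 4"
  proof -
    have "{..<3::nat} = {0, 1, 2}" by auto
    thus ?thesis by (simp add: b_def QF power2_eq_square power3_eq_cube field_simps)
  qed
  finally show ?thesis by (subst log_free_at_shift) simp
qed

text \<open>Here x (x - 1) = 3/4 has the roots -1/2 and 3/2, so m = 2; the coefficients are 1 and
  -\<alpha>, and the obstruction is f(a) - \<alpha>^2.\<close>

theorem log_free_at_exponents_minus_half:
  fixes f :: "complex \<Rightarrow> complex"
  assumes r: "r > 0" and f: "f holomorphic_on ball a r"
    and q: "\<And>z. z \<in> ball a r - {a} \<Longrightarrow> q z = (3/4) / (z - a)\<^sup>2 + \<alpha> / (z - a) + f z"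
  shows "log_free_at q a \<longleftrightarrow> \<alpha>\<^sup>2 = f a"
proof -
  define f0 where "f0 = (\<lambda>z. f (z + a))"
  have f0: "f0 holomorphic_on ball 0 r" unfolding f0_def by (rule holomorphic_on_ball_shift[OF f])
  define Q where "Q = (\<lambda>z. 3/4 + \<alpha> * z + z\<^sup>2 * f0 z)"
  have "Q holomorphic_on ball 0 r" unfolding Q_def using f0 by (intro holomorphic_intros)
  then interpret frobenius r Q 2 "-1/2"
    by unfold_locales (use r in \<open>auto simp: Q_def\<close>)
  have q0: "q (z + a) = Q z / z\<^sup>2" if "z \<in> ball 0 r - {0}" for z
  proof -
    have "z + a \<in> ball a r - {a}" using that by (simp add: dist_norm)
    thus ?thesis using q[of "z + a"] that by (simp add: Q_def f0_def field_simps power2_eq_square)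
  qed
  have QF: "fps_nth QF (Suc 0) = \<alpha>" "fps_nth QF 2 = f a"
    using quadratic_shift_nth[OF r f0 refl, of "3/4" \<alpha>]
    unfolding QF_def unfolding Q_def by (simp_all add: f0_def)
  define b where "b = (\<lambda>n::nat. if n = 0 then 1 else - \<alpha>)"
  have "log_free_at (\<lambda>z. q (z + a)) 0 \<longleftrightarrow> (\<Sum>k<2. fps_nth QF (2 - k) * b k) = 0"
  proof (rule log_free_at_iff[OF q0])
    fix n :: nat assume "n \<noteq> 0" "n < 2"
    hence "n = 1" by auto
    thus "b n = (\<Sum>k<n. fps_nth QF (n - k) * b k) / (of_nat n * (of_nat n - of_nat 2))"
      by (simp add: b_def QF)
  qed (auto simp: b_def)
  also have "(\<Sum>k<2. fps_nth QF (2 - k) * b k) = f a - \<alpha>\<^sup>2"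
  proof -
    have "{..<2::nat} = {0, 1}" by auto
    thus ?thesis by (simp add: b_def QF power2_eq_square)
  qed
  finally show ?thesis by (subst log_free_at_shift) auto
qed

section \<open>Weierstrass functions\<close>

text \<open>The exponent 3/2 is half of 3: the lattice sum of inverse cubes will be dominated by a
  product of two such series.\<close>

lemma summable_on_int_powr:
  "(\<lambda>m::int. (1 + real_of_int \<bar>m\<bar>) powr (-3/2)) summable_on UNIV"
proof -
  have "summable (\<lambda>n. real n powr (-3/2))"
    by (subst summable_real_powr_iff) auto
  hence "summable (\<lambda>n. real (Suc n) powr (-3/2))"
    by (subst summable_Suc_iff)
  hence nat: "(\<lambda>n. (1 + real n) powr (-3/2)) summable_on (UNIV :: nat set)"
    by (subst summable_on_UNIV_nonneg_real_iff) (auto simp: add_ac)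
  have 1: "(\<lambda>m::int. (1 + real_of_int \<bar>m\<bar>) powr (-3/2)) summable_on (range int)"
    using nat by (subst summable_on_reindex) (auto simp: o_def)
  have 2: "(\<lambda>m::int. (1 + real_of_int \<bar>m\<bar>) powr (-3/2)) summable_on (range (\<lambda>n. - int n))"
    using nat by (subst summable_on_reindex) (auto simp: o_def inj_def)
  have "(UNIV :: int set) = range int \<union> range (\<lambda>n. - int n)"
    by (auto intro: int_cases2)
  thus ?thesis
    using summable_on_union[OF 1 2] by simp
qed

section \<open>The period lattice\<close>

locale lattice =
  fixes \<tau> :: complex
  assumes Im_pos: "Im \<tau> > 0"
begin

abbreviation \<Lambda> :: "complex set" where "\<Lambda> \<equiv> period_lattice \<tau>"

lemma lattice_pointE:
  assumes "\<omega> \<in> \<Lambda>"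
  obtains m n where "\<omega> = of_int m + of_int n * \<tau>"
  using assms by (auto simp: period_lattice_def)

lemma lattice_0 [simp]: "0 \<in> \<Lambda>"
  unfolding period_lattice_def by (auto intro: exI[of _ 0])

lemma lattice_1 [simp]: "1 \<in> \<Lambda>"
  unfolding period_lattice_def mem_Collect_eq by (rule exI[of _ 1], rule exI[of _ 0]) auto

lemma lattice_\<tau> [simp]: "\<tau> \<in> \<Lambda>"
  unfolding period_lattice_def mem_Collect_eq by (rule exI[of _ 0], rule exI[of _ 1]) auto

lemma lattice_add [intro]: 
  assumes "x \<in> \<Lambda>" "y \<in> \<Lambda>" shows "x + y \<in> \<Lambda>"
proof -
  obtain m n m' n' where "x = of_int m + of_int n * \<tau>" "y = of_int m' + of_int n' * \<tau>"
    using assms by (metis lattice_pointE)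
  hence "x + y = of_int (m + m') + of_int (n + n') * \<tau>"
    by (simp add: algebra_simps)
  thus ?thesis unfolding period_lattice_def by blast
qed

lemma lattice_minus [intro]: 
  assumes "x \<in> \<Lambda>" shows "-x \<in> \<Lambda>"
proof -
  obtain m n where "x = of_int m + of_int n * \<tau>"
    using assms by (metis lattice_pointE)
  hence "- x = of_int (-m) + of_int (-n) * \<tau>"
    by (simp add: algebra_simps)
  thus ?thesis unfolding period_lattice_def by blast
qed

lemma lattice_minus_iff [simp]: "-x \<in> \<Lambda> \<longleftrightarrow> x \<in> \<Lambda>"
  using lattice_minus[of x] lattice_minus[of "-x"] by auto

lemma lattice_diff [intro]: "x \<in> \<Lambda> \<Longrightarrow> y \<in> \<Lambda> \<Longrightarrow> x - y \<in> \<Lambda>"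
  using lattice_add[of x "-y"] by auto

lemma lattice_add_right_iff: "y \<in> \<Lambda> \<Longrightarrow> x + y \<in> \<Lambda> \<longleftrightarrow> x \<in> \<Lambda>"
  using lattice_add[of x y] lattice_diff[of "x+y" y] by auto

lemma lattice_diff_right_iff: "y \<in> \<Lambda> \<Longrightarrow> x - y \<in> \<Lambda> \<longleftrightarrow> x \<in> \<Lambda>"
  using lattice_diff[of x y] lattice_add[of "x-y" y] by auto

text \<open>The imaginary part n Im \<tau> controls n, and then m = \<omega> - n \<tau> is
  controlled as well.\<close>

lemma norm_lattice_ge:
  "\<exists>c>0. \<forall>m n. c * (\<bar>real_of_int m\<bar> + \<bar>real_of_int n\<bar>) \<le> norm (of_int m + of_int n * \<tau>)"
proof -
  define K where "K = 1 + norm \<tau> / Im \<tau> + 1 / Im \<tau>"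
  have K: "K > 0" using Im_pos by (simp add: K_def add_pos_nonneg)
  have "\<bar>real_of_int m\<bar> + \<bar>real_of_int n\<bar> \<le> K * norm (of_int m + of_int n * \<tau>)" for m n
  proof -
    define z where "z = of_int m + of_int n * \<tau>"
    have "\<bar>real_of_int n\<bar> * Im \<tau> = \<bar>Im z\<bar>"
      using Im_pos by (simp add: z_def abs_mult)
    hence "\<bar>real_of_int n\<bar> * Im \<tau> \<le> norm z" by (metis abs_Im_le_cmod)
    hence n: "\<bar>real_of_int n\<bar> \<le> norm z / Im \<tau>" using Im_pos by (simp add: field_simps)
    have "complex_of_int m = z - of_int n * \<tau>" by (simp add: z_def)
    hence "norm (complex_of_int m) \<le> norm z + \<bar>real_of_int n\<bar> * norm \<tau>"
      by (metis norm_triangle_ineq4 norm_mult norm_of_int)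
    also have "\<dots> \<le> norm z + norm z / Im \<tau> * norm \<tau>"
      using n by (intro add_left_mono mult_right_mono) auto
    finally have "\<bar>real_of_int m\<bar> \<le> norm z + norm z / Im \<tau> * norm \<tau>" by simp
    with n show ?thesis
      unfolding z_def [symmetric] by (simp add: K_def algebra_simps)
  qed
  thus ?thesis using K by (intro exI[of _ "1/K"]) (auto simp: field_simps)
qed

lemma bij_betw_lattice: "bij_betw (\<lambda>(m,n). of_int m + of_int n * \<tau>) (UNIV :: (int \<times> int) set) \<Lambda>"
proof -
  have "inj (\<lambda>(m,n). complex_of_int m + of_int n * \<tau>)"
  proof (rule injI, clarsimp)
    fix m n m' n' assume eq: "complex_of_int m + of_int n * \<tau> = of_int m' + of_int n' * \<tau>"
    have "Im (complex_of_int m + of_int n * \<tau>) = Im (of_int m' + of_int n' * \<tau>)" using eq by simp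
    hence "n = n'" using Im_pos by simp
    thus "m = m' \<and> n = n'" using eq by simp
  qed
  thus ?thesis by (auto simp: bij_betw_def period_lattice_def)
qed

text \<open>For |m| + |n| \<ge> 1 one has (1 + |m|) (1 + |n|) \<le> 4 (|m| + |n|)^2. Raised to the
  power 3/2, this bounds the inverse cube of |\<omega>| by a product of a function of m and a
  function of n, each summable.\<close>

lemma summable_on_lattice: "(\<lambda>\<omega>. 1 / norm \<omega> ^ 3) summable_on \<Lambda>"
proof -
  obtain c where c: "c > 0"
    "\<And>m n. c * (\<bar>real_of_int m\<bar> + \<bar>real_of_int n\<bar>) \<le> norm (of_int m + of_int n * \<tau>)"
    using norm_lattice_ge by blast
  define f where "f = (\<lambda>m::int. (1 + real_of_int \<bar>m\<bar>) powr (-3/2))"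
  have f_nonneg: "f m \<ge> 0" for m by (simp add: f_def)
  have f: "f summable_on UNIV"
    unfolding f_def by (rule summable_on_int_powr)
  have ff: "(\<lambda>(m,n). f m * f n) summable_on UNIV \<times> UNIV"
  proof (rule summable_on_SigmaI)
    show "((\<lambda>n. case (m, n) of (m, n) \<Rightarrow> f m * f n) has_sum f m * infsum f UNIV) UNIV" for m
      using f by (auto intro!: has_sum_cmult_right has_sum_infsum)
    show "(\<lambda>m. f m * infsum f UNIV) summable_on UNIV"
      using f by (rule summable_on_cmult_left)
  qed (auto simp: f_nonneg)
  have le: "norm (1 / norm (of_int m + of_int n * \<tau>) ^ 3) \<le> (8/c^3) * (f m * f n)" for m n
  proof (cases "m = 0 \<and> n = 0")
    \<comment> \<open>At the lattice point 0 the summand is 1/0 = 0.\<close>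
    case True thus ?thesis using c(1) by (simp add: f_nonneg)
  next
    case False
    define a where "a = \<bar>real_of_int m\<bar>"
    define b where "b = \<bar>real_of_int n\<bar>"
    have ab: "a + b \<ge> 1" "a \<ge> 0" "b \<ge> 0"
    proof -
      have "\<bar>m\<bar> + \<bar>n\<bar> \<ge> 1" using False by linarith
      hence "real_of_int (\<bar>m\<bar> + \<bar>n\<bar>) \<ge> 1" by linarith
      thus "a + b \<ge> 1" by (simp add: a_def b_def)
    qed (auto simp: a_def b_def)
    have "(1 + a) * (1 + b) \<le> (2 * (a + b))\<^sup>2"
    proof -
      have "(1 + a) * (1 + b) \<le> (2 * (a + b)) * (2 * (a + b))"
        using ab by (intro mult_mono) auto
      thus ?thesis by (simp add: power2_eq_square)
    qed
    hence "((1 + a) * (1 + b)) powr (3/2) \<le> ((2 * (a + b))\<^sup>2) powr (3/2)"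
      using ab by (intro powr_mono2) auto
    also have "((2 * (a + b))\<^sup>2) powr (3/2) = (2 * (a + b)) ^ 3"
    proof -
      have "((2 * (a + b))\<^sup>2) powr (3/2) = ((2 * (a + b)) powr 2) powr (3/2)"
        using ab by (subst powr_numeral) auto
      also have "\<dots> = (2 * (a + b)) powr 3" by (simp add: powr_powr)
      also have "\<dots> = (2 * (a + b)) ^ 3" using ab by (subst powr_numeral) auto
      finally show ?thesis .
    qed
    finally have *: "(1 + a) powr (3/2) * (1 + b) powr (3/2) \<le> 8 * (a + b) ^ 3"
      using ab by (simp only: power_mult_distrib) (simp add: powr_mult)
    have ff_eq: "f m * f n = 1 / ((1 + a) powr (3/2) * (1 + b) powr (3/2))"
      by (simp add: f_def a_def b_def powr_minus field_simps)
    have pos: "(1 + a) powr (3/2) * (1 + b) powr (3/2) > 0" using ab by auto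
    have "norm (of_int m + of_int n * \<tau>) ^ 3 \<ge> (c * (a + b)) ^ 3"
      using c(2)[of m n] c(1) ab by (intro power_mono) (auto simp: a_def b_def)
    hence "1 / norm (of_int m + of_int n * \<tau>) ^ 3 \<le> 1 / (c * (a + b)) ^ 3"
      using c(1) ab by (intro frac_le zero_less_power mult_pos_pos) auto
    also have "\<dots> = (8 / c^3) * (1 / (8 * (a+b)^3))" 
      by (simp add: power_mult_distrib)
    also have "\<dots> \<le> (8 / c^3) * (f m * f n)"
      unfolding ff_eq using * pos c(1) ab
      by (intro mult_left_mono divide_left_mono mult_pos_pos) auto
    finally show ?thesis by simp
  qed
  have "(\<lambda>x. (8/c^3) * (case x of (m,n) \<Rightarrow> f m * f n)) summable_on UNIV"
    using summable_on_cmult_right[OF ff, of "8/c^3"] by simp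
  hence "(\<lambda>(m,n). 1 / norm (of_int m + of_int n * \<tau>) ^ 3) summable_on UNIV"
    by (rule summable_on_comparison_test) (use le in auto)
  thus ?thesis
    by (subst summable_on_reindex_bij_betw[OF bij_betw_lattice, symmetric]) (simp add: case_prod_unfold)
qed

lemma finite_lattice_ball: "finite {\<omega> \<in> \<Lambda>. norm \<omega> \<le> R}"
proof -
  obtain c where c: "c > 0"
    "\<And>m n. c * (\<bar>real_of_int m\<bar> + \<bar>real_of_int n\<bar>) \<le> norm (of_int m + of_int n * \<tau>)"
    using norm_lattice_ge by blast
  define N where "N = \<lceil>R / c\<rceil>"
  have "{\<omega> \<in> \<Lambda>. norm \<omega> \<le> R} \<subseteq> (\<lambda>(m,n). of_int m + of_int n * \<tau>) ` ({-N..N} \<times> {-N..N})"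
  proof safe
    fix \<omega> assume "\<omega> \<in> \<Lambda>" "norm \<omega> \<le> R"
    then obtain m n where \<omega>: "\<omega> = of_int m + of_int n * \<tau>" by (metis lattice_pointE)
    have "c * (\<bar>real_of_int m\<bar> + \<bar>real_of_int n\<bar>) \<le> R"
      using c(2)[of m n] \<open>norm \<omega> \<le> R\<close> \<omega> by simp
    hence *: "\<bar>real_of_int m\<bar> + \<bar>real_of_int n\<bar> \<le> R / c" using c(1) by (simp add: field_simps)
    hence "\<bar>m\<bar> \<le> N" "\<bar>n\<bar> \<le> N" unfolding N_def by linarith+
    thus "\<omega> \<in> (\<lambda>(m,n). of_int m + of_int n * \<tau>) ` ({-N..N} \<times> {-N..N})"
      using \<omega> by (intro image_eqI[of _ _ "(m,n)"]) auto
  qed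
  thus ?thesis by (rule finite_subset) auto
qed

lemma eventually_not_lattice_ball: 
  obtains r where "r > 0" "\<And>\<omega>. \<omega> \<in> \<Lambda> \<Longrightarrow> norm \<omega> < r \<Longrightarrow> \<omega> = 0"
proof -
  define A where "A = {\<omega> \<in> \<Lambda>. norm \<omega> \<le> 1} - {0}"
  have "finite A" unfolding A_def using finite_lattice_ball by auto
  hence "\<exists>r>0. \<forall>\<omega>\<in>A. r \<le> dist 0 \<omega>"
    using finite_set_avoid[of A 0] by (auto simp: A_def)
  then obtain r where r: "r > 0" "\<forall>\<omega>\<in>A. r \<le> norm \<omega>" by auto
  show ?thesis
  proof (rule that[of "min r 1"])
    fix \<omega> assume "\<omega> \<in> \<Lambda>" "norm \<omega> < min r 1"
    thus "\<omega> = 0" using r by (force simp: A_def)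
  qed (use r in auto)
qed

lemma closed_lattice: "closed \<Lambda>"
proof -
  obtain r where r: "r > 0" "\<And>\<omega>. \<omega> \<in> \<Lambda> \<Longrightarrow> norm \<omega> < r \<Longrightarrow> \<omega> = 0"
    using eventually_not_lattice_ball by blast
  show ?thesis
  proof (rule discrete_imp_closed[OF r(1)], intro ballI impI)
    fix x y assume "x \<in> \<Lambda>" "y \<in> \<Lambda>" "dist y x < r"
    thus "y = x" using r(2)[of "y - x"] by (auto simp: dist_norm)
  qed
qed

lemma countable_lattice: "countable \<Lambda>"
  using bij_betw_lattice by (metis countableI_type countable_image bij_betw_imp_surj_on)

section \<open>The series of \<zeta> and \<wp>\<close>

definition zeta_term :: "complex \<Rightarrow> complex \<Rightarrow> complex" where
  "zeta_term \<omega> z = 1 / (z - \<omega>) + 1 / \<omega> + z / \<omega>\<^sup>2"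

definition wp_term :: "complex \<Rightarrow> complex \<Rightarrow> complex" where
  "wp_term \<omega> z = 1 / (z - \<omega>)\<^sup>2 - 1 / \<omega>\<^sup>2"

lemma has_field_derivative_zeta_term:
  assumes "z \<noteq> \<omega>" 
  shows "((zeta_term \<omega>) has_field_derivative (- wp_term \<omega> z)) (at z)"
proof (cases "\<omega> = 0")
  case True
  thus ?thesis unfolding zeta_term_def wp_term_def using assms
    by (auto intro!: derivative_eq_intros simp: power2_eq_square)
next
  case False
  thus ?thesis unfolding zeta_term_def wp_term_def using assms
    by (auto intro!: derivative_eq_intros simp: power2_eq_square field_simps)
qed

text \<open>Lattice points with |\<omega>| > 2 R satisfy |z - \<omega>| \<ge> |\<omega>|/2 for |z|
  \<le> R. Their terms z^2 / (\<omega>^2 (z - \<omega>)) are at most 2 R^2 / |\<omega>|^3, so the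
  M-test gives a holomorphic tail H that may be differentiated termwise; the finitely many remaining
  terms carry the poles.\<close>

lemma local_series:
  assumes R: "R > 0"
  obtains H where "H holomorphic_on ball 0 R"
    "\<And>z. z \<in> ball 0 R \<Longrightarrow>
       ((\<lambda>\<omega>. zeta_term \<omega> z) has_sum ((\<Sum>\<omega>\<in>{\<omega>\<in>\<Lambda>. norm \<omega> \<le> 2 * R}. zeta_term \<omega> z) + H z)) \<Lambda>"
    "\<And>z. z \<in> ball 0 R \<Longrightarrow>
       ((\<lambda>\<omega>. wp_term \<omega> z) has_sum ((\<Sum>\<omega>\<in>{\<omega>\<in>\<Lambda>. norm \<omega> \<le> 2 * R}. wp_term \<omega> z) - deriv H z)) \<Lambda>"
proof -
  define F where "F = {\<omega>\<in>\<Lambda>. norm \<omega> \<le> 2 * R}"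
  define A where "A = \<Lambda> - F"
  have fin: "finite F" unfolding F_def by (rule finite_lattice_ball)
  define H where "H = (\<lambda>z. \<Sum>\<^sub>\<infinity>\<omega>\<in>A. zeta_term \<omega> z)"
  define M where "M = (\<lambda>\<omega>::complex. (2 * R\<^sup>2) * (1 / norm \<omega> ^ 3))"
  have M: "M summable_on A"
    unfolding M_def A_def
    by (intro summable_on_cmult_right summable_on_subset_banach[OF summable_on_lattice]) auto
  have bd: "norm (zeta_term \<omega> z) \<le> M \<omega>" if \<omega>: "\<omega> \<in> A" and z: "z \<in> cball 0 R" for \<omega> z
  proof -
    have n\<omega>: "norm \<omega> > 2 * R" using \<omega> by (auto simp: A_def F_def)
    have nz: "norm z \<le> R" using z by simp
    have ne: "\<omega> \<noteq> 0" "z \<noteq> \<omega>" using n\<omega> nz R by auto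
    have d: "norm (z - \<omega>) \<ge> norm \<omega> / 2"
      using n\<omega> nz norm_triangle_ineq2[of \<omega> z] by (simp add: norm_minus_commute)
    have eq: "zeta_term \<omega> z = z\<^sup>2 / (\<omega>\<^sup>2 * (z - \<omega>))"
      using ne by (simp add: zeta_term_def field_simps power2_eq_square)
    have "norm (zeta_term \<omega> z) = (norm z)\<^sup>2 / ((norm \<omega>)\<^sup>2 * norm (z - \<omega>))"
      by (simp add: eq norm_divide norm_mult norm_power)
    also have "\<dots> \<le> R\<^sup>2 / ((norm \<omega>)\<^sup>2 * (norm \<omega> / 2))"
      using d nz ne R by (intro frac_le mult_left_mono power_mono mult_pos_pos) auto
    also have "\<dots> = M \<omega>" by (simp add: M_def power2_eq_square power3_eq_cube)
    finally show ?thesis .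
  qed
  have ulim: "uniform_limit (cball 0 R) (\<lambda>X z. \<Sum>\<omega>\<in>X. zeta_term \<omega> z) H (finite_subsets_at_top A)"
    unfolding H_def by (rule Weierstrass_m_test_general[OF bd M])
  have hterm: "zeta_term \<omega> holomorphic_on cball 0 R" if "\<omega> \<in> A" for \<omega>
    unfolding zeta_term_def using that R by (intro holomorphic_intros) (auto simp: A_def F_def)
  have cont: "eventually (\<lambda>X. continuous_on (cball 0 R) (\<lambda>z. \<Sum>\<omega>\<in>X. zeta_term \<omega> z) \<and> 
                 (\<lambda>z. \<Sum>\<omega>\<in>X. zeta_term \<omega> z) holomorphic_on ball 0 R) (finite_subsets_at_top A)"
  proof (rule eventually_finite_subsets_at_top_weakI, intro conjI)
    fix X assume X: "finite X" "X \<subseteq> A"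
    show "continuous_on (cball 0 R) (\<lambda>z. \<Sum>\<omega>\<in>X. zeta_term \<omega> z)"
      using X hterm by (intro continuous_intros holomorphic_on_imp_continuous_on) auto
    show "(\<lambda>z. \<Sum>\<omega>\<in>X. zeta_term \<omega> z) holomorphic_on ball 0 R"
      using X hterm holomorphic_on_subset[OF _ ball_subset_cball] by (intro holomorphic_intros) auto
  qed
  have hH: "H holomorphic_on ball 0 R"
    using holomorphic_uniform_limit[OF cont ulim finite_subsets_at_top_neq_bot] by blast
  have derH: "((\<lambda>\<omega>. wp_term \<omega> z) has_sum (- deriv H z)) A" if z: "z \<in> ball 0 R" for z
  proof -
    have "((\<lambda>X. (deriv ^^ 1) (\<lambda>z. \<Sum>\<omega>\<in>X. zeta_term \<omega> z) z) \<longlongrightarrow> (deriv ^^ 1) H z) (finite_subsets_at_top A)"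
      using uniform_limit_on_subset[OF ulim ball_subset_cball] eventually_mono[OF cont]
      by (intro higher_deriv_complex_uniform_limit[where A = "ball 0 R"]) (use z in auto)
    moreover have "eventually (\<lambda>X. (deriv ^^ 1) (\<lambda>z. \<Sum>\<omega>\<in>X. zeta_term \<omega> z) z = (\<Sum>\<omega>\<in>X. - wp_term \<omega> z)) (finite_subsets_at_top A)"
    proof (rule eventually_finite_subsets_at_top_weakI)
      fix X assume X: "finite X" "X \<subseteq> A"
      have "((\<lambda>z. \<Sum>\<omega>\<in>X. zeta_term \<omega> z) has_field_derivative (\<Sum>\<omega>\<in>X. - wp_term \<omega> z)) (at z)"
        using X z R by (intro DERIV_sum has_field_derivative_zeta_term) (auto simp: A_def F_def)
      thus "(deriv ^^ 1) (\<lambda>z. \<Sum>\<omega>\<in>X. zeta_term \<omega> z) z = (\<Sum>\<omega>\<in>X. - wp_term \<omega> z)"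
        by (simp add: DERIV_imp_deriv)
    qed
    ultimately have "((\<lambda>X. \<Sum>\<omega>\<in>X. - wp_term \<omega> z) \<longlongrightarrow> deriv H z) (finite_subsets_at_top A)"
      by (simp add: tendsto_cong)
    hence "((\<lambda>\<omega>. - wp_term \<omega> z) has_sum deriv H z) A"
      by (simp add: has_sum_def)
    thus ?thesis using has_sum_uminusI by force
  qed
  have sumH: "((\<lambda>\<omega>. zeta_term \<omega> z) has_sum H z) A" if z: "z \<in> ball 0 R" for z
  proof -
    have "(\<lambda>\<omega>. norm (zeta_term \<omega> z)) summable_on A"
      using bd z by (intro Infinite_Sum.abs_summable_on_comparison_test'[OF M]) auto
    from abs_summable_summable[OF this] show ?thesis unfolding H_def by (rule has_sum_infsum)
  qed
  have eqA: "F \<union> A = \<Lambda>" by (auto simp: A_def F_def)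
  show ?thesis
  proof (rule that[OF hH], fold F_def)
    fix z :: complex assume z: "z \<in> ball 0 R"
    show "((\<lambda>\<omega>. zeta_term \<omega> z) has_sum ((\<Sum>\<omega>\<in>F. zeta_term \<omega> z) + H z)) \<Lambda>"
      using has_sum_Un_disjoint[OF has_sum_finite[OF fin] sumH[OF z]] eqA by (auto simp: A_def)
    show "((\<lambda>\<omega>. wp_term \<omega> z) has_sum ((\<Sum>\<omega>\<in>F. wp_term \<omega> z) - deriv H z)) \<Lambda>"
      using has_sum_Un_disjoint[OF has_sum_finite[OF fin] derH[OF z]] eqA by (auto simp: A_def)
  qed
qed

lemma summable_on_zeta_term: "(\<lambda>\<omega>. zeta_term \<omega> z) summable_on \<Lambda>"
proof -
  obtain R where R: "R > 0" "z \<in> ball 0 R" using that[of "norm z + 1"] by (auto simp: add_nonneg_pos)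
  obtain H where "((\<lambda>\<omega>. zeta_term \<omega> z) has_sum ((\<Sum>\<omega>\<in>{\<omega>\<in>\<Lambda>. norm \<omega> \<le> 2 * R}. zeta_term \<omega> z) + H z)) \<Lambda>"
    using local_series[OF R(1)] R(2) by metis
  thus ?thesis by (rule has_sum_imp_summable)
qed

lemma summable_on_wp_term: "(\<lambda>\<omega>. wp_term \<omega> z) summable_on \<Lambda>"
proof -
  obtain R where R: "R > 0" "z \<in> ball 0 R" using that[of "norm z + 1"] by (auto simp: add_nonneg_pos)
  obtain H where "((\<lambda>\<omega>. wp_term \<omega> z) has_sum ((\<Sum>\<omega>\<in>{\<omega>\<in>\<Lambda>. norm \<omega> \<le> 2 * R}. wp_term \<omega> z) - deriv H z)) \<Lambda>"
    using local_series[OF R(1)] R(2) by metis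
  thus ?thesis by (rule has_sum_imp_summable)
qed

text \<open>Under 1/0 = 0 the term at \<omega> = 0 is exactly 1/z. The sum then runs over the whole
  lattice, which negation and translation by a period map onto itself.\<close>

lemma wzeta_eq: "wzeta \<tau> z = (\<Sum>\<^sub>\<infinity>\<omega>\<in>\<Lambda>. zeta_term \<omega> z)"
proof -
  have "(\<Sum>\<^sub>\<infinity>\<omega>\<in>insert 0 (\<Lambda> - {0}). zeta_term \<omega> z) = zeta_term 0 z + (\<Sum>\<^sub>\<infinity>\<omega>\<in>\<Lambda> - {0}. zeta_term \<omega> z)"
    by (rule infsum_insert) (auto intro: summable_on_subset_banach[OF summable_on_zeta_term])
  also have "insert 0 (\<Lambda> - {0}) = \<Lambda>" by auto
  finally show ?thesis by (simp add: wzeta_def zeta_term_def)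
qed

lemma wp_eq: "wp \<tau> z = (\<Sum>\<^sub>\<infinity>\<omega>\<in>\<Lambda>. wp_term \<omega> z)"
proof -
  have "(\<Sum>\<^sub>\<infinity>\<omega>\<in>insert 0 (\<Lambda> - {0}). wp_term \<omega> z) = wp_term 0 z + (\<Sum>\<^sub>\<infinity>\<omega>\<in>\<Lambda> - {0}. wp_term \<omega> z)"
    by (rule infsum_insert) (auto intro: summable_on_subset_banach[OF summable_on_wp_term])
  also have "insert 0 (\<Lambda> - {0}) = \<Lambda>" by auto
  finally show ?thesis by (simp add: wp_def wp_term_def)
qed

lemma has_sum_zeta: "((\<lambda>\<omega>. zeta_term \<omega> z) has_sum wzeta \<tau> z) \<Lambda>"
  using summable_on_zeta_term by (simp add: wzeta_eq)

lemma has_sum_wp: "((\<lambda>\<omega>. wp_term \<omega> z) has_sum wp \<tau> z) \<Lambda>"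
  using summable_on_wp_term by (simp add: wp_eq)

section \<open>Parity and periods\<close>

lemma bij_uminus_lattice: "bij_betw uminus \<Lambda> \<Lambda>"
  by (rule bij_betwI[of _ _ _ uminus]) auto

lemma wzeta_minus: "wzeta \<tau> (-z) = - wzeta \<tau> z"
proof -
  have "((\<lambda>\<omega>. zeta_term (-\<omega>) (-z)) has_sum wzeta \<tau> (-z)) \<Lambda>"
    using has_sum_zeta[of "-z"] has_sum_reindex_bij_betw[OF bij_uminus_lattice, of "\<lambda>\<omega>. zeta_term \<omega> (-z)"] by simp
  moreover have "zeta_term (-\<omega>) (-z) = - zeta_term \<omega> z" for \<omega>
  proof -
    have "1 / (- z - - \<omega>) = - (1 / (z - \<omega>))"
      by (metis minus_diff_minus minus_divide_right)
    thus ?thesis by (simp add: zeta_term_def)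
  qed
  ultimately have "((\<lambda>\<omega>. - zeta_term \<omega> z) has_sum wzeta \<tau> (-z)) \<Lambda>" by simp
  moreover have "((\<lambda>\<omega>. - zeta_term \<omega> z) has_sum - wzeta \<tau> z) \<Lambda>"
    using has_sum_zeta by (simp add: has_sum_uminus)
  ultimately show ?thesis by (rule has_sum_unique)
qed

lemma wp_minus [simp]: "wp \<tau> (-z) = wp \<tau> z"
proof -
  have "((\<lambda>\<omega>. wp_term (-\<omega>) (-z)) has_sum wp \<tau> (-z)) \<Lambda>"
    using has_sum_wp[of "-z"] has_sum_reindex_bij_betw[OF bij_uminus_lattice, of "\<lambda>\<omega>. wp_term \<omega> (-z)"] by simp
  moreover have "wp_term (-\<omega>) (-z) = wp_term \<omega> z" for \<omega>
    by (simp add: wp_term_def power2_commute)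
  ultimately have "((\<lambda>\<omega>. wp_term \<omega> z) has_sum wp \<tau> (-z)) \<Lambda>" by simp
  from has_sum_unique[OF this has_sum_wp] show ?thesis .
qed

lemma bij_shift_lattice: "w \<in> \<Lambda> \<Longrightarrow> bij_betw (\<lambda>\<omega>. \<omega> + w) \<Lambda> \<Lambda>"
  by (rule bij_betwI[of _ _ _ "\<lambda>\<omega>. \<omega> - w"]) auto

text \<open>Reindexing the sum at z + w by \<omega> + w cancels z from every term, so the increment
  does not depend on z. It can therefore be computed at z = - w/2, where parity settles it.\<close>

lemma wp_shift_aux:
  assumes w: "w \<in> \<Lambda>"
  shows "((\<lambda>\<omega>. 1 / \<omega>\<^sup>2 - 1 / (\<omega> + w)\<^sup>2) has_sum (wp \<tau> (z + w) - wp \<tau> z)) \<Lambda>"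
proof -
  have "((\<lambda>\<omega>. wp_term (\<omega> + w) (z + w)) has_sum wp \<tau> (z + w)) \<Lambda>"
    using has_sum_wp[of "z + w"] has_sum_reindex_bij_betw[OF bij_shift_lattice[OF w], of "\<lambda>\<omega>. wp_term \<omega> (z + w)"] by simp
  from has_sum_add[OF this has_sum_uminusI[OF has_sum_wp[of z]]]
  show ?thesis by (simp add: wp_term_def)
qed

lemma wp_shift_const:
  assumes w: "w \<in> \<Lambda>"
  shows "wp \<tau> (z + w) - wp \<tau> z = 0"
  using has_sum_unique[OF wp_shift_aux[OF w, of z] wp_shift_aux[OF w, of "-w/2"]] wp_minus[of "w/2"] by simp

lemma wp_period [simp]: "w \<in> \<Lambda> \<Longrightarrow> wp \<tau> (z + w) = wp \<tau> z"
  using wp_shift_const by simp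

text \<open>Now a part linear in z remains in each term; its coefficients are, up to sign, those of
  the series just shown to have sum 0.\<close>

lemma wzeta_shift_aux:
  assumes w: "w \<in> \<Lambda>"
  shows "((\<lambda>\<omega>. 1 / (\<omega> + w) - 1 / \<omega> + w / (\<omega> + w)\<^sup>2) has_sum (wzeta \<tau> (z + w) - wzeta \<tau> z)) \<Lambda>"
proof -
  have "((\<lambda>\<omega>. zeta_term (\<omega> + w) (z + w)) has_sum wzeta \<tau> (z + w)) \<Lambda>"
    using has_sum_zeta[of "z + w"] has_sum_reindex_bij_betw[OF bij_shift_lattice[OF w], of "\<lambda>\<omega>. zeta_term \<omega> (z + w)"] by simp
  from has_sum_add[OF this has_sum_uminusI[OF has_sum_zeta[of z]]]
  have "((\<lambda>\<omega>. 1 / (\<omega> + w) - 1 / \<omega> + w / (\<omega> + w)\<^sup>2 + z / (\<omega> + w)\<^sup>2 - z / \<omega>\<^sup>2) has_sum (wzeta \<tau> (z + w) - wzeta \<tau> z)) \<Lambda>"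
    by (simp add: zeta_term_def add_divide_distrib algebra_simps)
  moreover have "((\<lambda>\<omega>. 1 / \<omega>\<^sup>2 - 1 / (\<omega> + w)\<^sup>2) has_sum 0) \<Lambda>"
    using wp_shift_aux[OF w] wp_shift_const[OF w] by simp
  from has_sum_cmult_right[OF this, of z]
  have "((\<lambda>\<omega>. z / \<omega>\<^sup>2 - z / (\<omega> + w)\<^sup>2) has_sum 0) \<Lambda>" by (simp add: algebra_simps)
  ultimately have "((\<lambda>\<omega>. (1 / (\<omega> + w) - 1 / \<omega> + w / (\<omega> + w)\<^sup>2 + z / (\<omega> + w)\<^sup>2 - z / \<omega>\<^sup>2) +
       (z / \<omega>\<^sup>2 - z / (\<omega> + w)\<^sup>2)) has_sum (wzeta \<tau> (z + w) - wzeta \<tau> z + 0)) \<Lambda>"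
    by (rule has_sum_add)
  moreover have "(\<lambda>\<omega>. (1 / (\<omega> + w) - 1 / \<omega> + w / (\<omega> + w)\<^sup>2 + z / (\<omega> + w)\<^sup>2 - z / \<omega>\<^sup>2) +
       (z / \<omega>\<^sup>2 - z / (\<omega> + w)\<^sup>2)) = (\<lambda>\<omega>. 1 / (\<omega> + w) - 1 / \<omega> + w / (\<omega> + w)\<^sup>2)"
    by (auto simp: fun_eq_iff)
  ultimately show ?thesis by (simp only: add_0_right)
qed

lemma wzeta_period_const:
  assumes w: "w \<in> \<Lambda>"
  shows "wzeta \<tau> (z + w) - wzeta \<tau> z = 2 * wzeta \<tau> (w / 2)"
  using has_sum_unique[OF wzeta_shift_aux[OF w, of z] wzeta_shift_aux[OF w, of "-w/2"]] wzeta_minus[of "w/2"] by simp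

section \<open>Derivatives and the expansion at 0\<close>

lemma has_field_derivative_wzeta:
  assumes z: "z \<notin> \<Lambda>"
  shows "(wzeta \<tau> has_field_derivative (- wp \<tau> z)) (at z)"
proof -
  obtain R where R: "R > 0" "z \<in> ball 0 R" using that[of "norm z + 1"] by (auto simp: add_nonneg_pos)
  define F where "F = {\<omega>\<in>\<Lambda>. norm \<omega> \<le> 2 * R}"
  obtain H where H: "H holomorphic_on ball 0 R"
    "\<And>z. z \<in> ball 0 R \<Longrightarrow> ((\<lambda>\<omega>. zeta_term \<omega> z) has_sum ((\<Sum>\<omega>\<in>F. zeta_term \<omega> z) + H z)) \<Lambda>"
    "\<And>z. z \<in> ball 0 R \<Longrightarrow> ((\<lambda>\<omega>. wp_term \<omega> z) has_sum ((\<Sum>\<omega>\<in>F. wp_term \<omega> z) - deriv H z)) \<Lambda>"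
    unfolding F_def by (rule local_series[OF R(1)]) blast
  have zeta: "wzeta \<tau> x = (\<Sum>\<omega>\<in>F. zeta_term \<omega> x) + H x" if "x \<in> ball 0 R" for x
    using has_sum_unique[OF has_sum_zeta H(2)[OF that]] .
  have wp: "wp \<tau> z = (\<Sum>\<omega>\<in>F. wp_term \<omega> z) - deriv H z"
    using has_sum_unique[OF has_sum_wp H(3)[OF R(2)]] .
  have "((\<lambda>x. (\<Sum>\<omega>\<in>F. zeta_term \<omega> x) + H x) has_field_derivative ((\<Sum>\<omega>\<in>F. - wp_term \<omega> z) + deriv H z)) (at z)"
    using z R(2) by (intro DERIV_add DERIV_sum has_field_derivative_zeta_term holomorphic_derivI[OF H(1)]) (auto simp: F_def)
  hence "((\<lambda>x. (\<Sum>\<omega>\<in>F. zeta_term \<omega> x) + H x) has_field_derivative (- wp \<tau> z)) (at z)"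
    by (simp add: wp sum_negf)
  thus ?thesis
    by (rule has_field_derivative_transform_within_open[of _ _ _ "ball 0 R"]) (use R zeta in auto)
qed

lemma open_compl_lattice: "open (- \<Lambda>)"
  using closed_lattice by auto

lemma holomorphic_wzeta: "wzeta \<tau> holomorphic_on - \<Lambda>"
  by (subst holomorphic_on_open[OF open_compl_lattice]) (use has_field_derivative_wzeta in auto)

lemma holomorphic_wp: "wp \<tau> holomorphic_on - \<Lambda>"
proof -
  have "(\<lambda>z. - deriv (wzeta \<tau>) z) holomorphic_on - \<Lambda>"
    by (intro holomorphic_intros holomorphic_wzeta open_compl_lattice)
  thus ?thesis
    by (rule holomorphic_transform) (use has_field_derivative_wzeta DERIV_imp_deriv in force)
qed

text \<open>The three vanishing values of H make sure that the \<zeta> and \<wp> terms centred at a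
  pole contribute nothing to the value and derivative of the regular part of the potential
  there.\<close>

lemma wzeta_near_0:
  obtains H r where "r > 0" "H holomorphic_on ball 0 r" "H 0 = 0" "deriv H 0 = 0" "deriv (deriv H) 0 = 0"
    "\<And>z. z \<in> ball 0 r \<Longrightarrow> wzeta \<tau> z = 1 / z + H z"
    "\<And>z. z \<in> ball 0 r \<Longrightarrow> wp \<tau> z = 1 / z\<^sup>2 - deriv H z"
    "\<And>z. z \<in> ball 0 r \<Longrightarrow> z \<in> \<Lambda> \<Longrightarrow> z = 0"
proof -
  obtain r where r: "r > 0" "\<And>\<omega>. \<omega> \<in> \<Lambda> \<Longrightarrow> norm \<omega> < r \<Longrightarrow> \<omega> = 0"
    using eventually_not_lattice_ball by blast
  define R where "R = r / 4"
  have R: "R > 0" using r by (simp add: R_def)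
  have F: "{\<omega>\<in>\<Lambda>. norm \<omega> \<le> 2 * R} = {0}"
  proof (intro equalityI subsetI)
    fix \<omega> assume "\<omega> \<in> {\<omega>\<in>\<Lambda>. norm \<omega> \<le> 2 * R}"
    thus "\<omega> \<in> {0}" using r(2)[of \<omega>] r(1) by (simp add: R_def)
  qed (use R in simp)
  obtain H where H: "H holomorphic_on ball 0 R"
    "\<And>z. z \<in> ball 0 R \<Longrightarrow> ((\<lambda>\<omega>. zeta_term \<omega> z) has_sum (zeta_term 0 z + H z)) \<Lambda>"
    "\<And>z. z \<in> ball 0 R \<Longrightarrow> ((\<lambda>\<omega>. wp_term \<omega> z) has_sum (wp_term 0 z - deriv H z)) \<Lambda>"
    by (rule local_series[OF R, unfolded F]) simp
  have zeta: "wzeta \<tau> z = 1 / z + H z" if "z \<in> ball 0 R" for z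
    using has_sum_unique[OF has_sum_zeta H(2)[OF that]] by (simp add: zeta_term_def)
  have wp: "wp \<tau> z = 1 / z\<^sup>2 - deriv H z" if "z \<in> ball 0 R" for z
    using has_sum_unique[OF has_sum_wp H(3)[OF that]] by (simp add: wp_term_def)
  \<comment> \<open>At z = 0 the formula reads \<zeta>(0) = 1/0 + H(0) = H(0), and oddness gives
    \<zeta>(0) = 0.\<close>
  have "H 0 = 0" using zeta[of 0] R wzeta_minus[of 0] by simp
  \<comment> \<open>Under 1/0 = 0 every term of the series for \<wp>(0) cancels.\<close>
  have "wp \<tau> 0 = 0" by (simp add: wp_def)
  hence "deriv H 0 = 0" using wp[of 0] R by simp
  have even: "deriv H (-z) = deriv H z" if "z \<in> ball 0 R" for z
    using wp[of z] wp[of "-z"] that by simp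
  have hd: "deriv H holomorphic_on ball 0 R" using H(1) by (intro holomorphic_deriv) auto
  have d: "(deriv H has_field_derivative deriv (deriv H) 0) (at 0)"
    using holomorphic_derivI[OF hd] R by auto
  have "((\<lambda>z. deriv H (-z)) has_field_derivative (deriv (deriv H) (-0) * (-1))) (at 0)"
    by (rule DERIV_chain2) (use d in \<open>auto intro!: derivative_eq_intros\<close>)
  hence "(deriv H has_field_derivative (deriv (deriv H) (-0) * (-1))) (at 0)"
    by (rule has_field_derivative_transform_within_open[of _ _ _ "ball 0 R"]) (use R even in auto)
  from DERIV_unique[OF d this] have "deriv (deriv H) 0 + deriv (deriv H) 0 = 0"
    by (simp only: minus_zero mult_minus_right mult_1_right add_eq_0_iff)
  hence d2: "deriv (deriv H) 0 = 0" by (simp only: double_zero_sym flip: mult_2) simp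
  show ?thesis
  proof (rule that[OF R H(1) \<open>H 0 = 0\<close> \<open>deriv H 0 = 0\<close> d2 zeta wp])
    show "z = 0" if "z \<in> ball 0 R" "z \<in> \<Lambda>" for z
      using r(2)[of z] r(1) that by (simp add: R_def)
  qed
qed

end

section \<open>The addition formula\<close>

text \<open>On a ball around p, g has a primitive G and f exp(-G) is constant, equal to its value 0
  at p. The identity theorem extends f = 0 from the ball to all of S.\<close>

lemma linear_ode_zero:
  fixes f g :: "complex \<Rightarrow> complex"
  assumes S: "open S" "connected S" and f: "f holomorphic_on S" and g: "g holomorphic_on S"
    and ode: "\<And>z. z \<in> S \<Longrightarrow> deriv f z = g z * f z"
    and p: "p \<in> S" "f p = 0" and w: "w \<in> S"
  shows "f w = 0"
proof -
  obtain r where r: "r > 0" "ball p r \<subseteq> S" using S(1) p(1) openE by blast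
  have gb: "g holomorphic_on ball p r" using g r(2) holomorphic_on_subset by blast
  obtain G where G: "\<And>z. z \<in> ball p r \<Longrightarrow> (G has_field_derivative g z) (at z within ball p r)"
    using holomorphic_convex_primitive'[OF convex_ball open_ball gb] by blast
  have "\<exists>c. \<forall>z\<in>ball p r. f z * exp (- G z) = c"
  proof (rule has_field_derivative_zero_constant)
    fix z assume z: "z \<in> ball p r"
    have zS: "z \<in> S" using z r by blast
    have "(f has_field_derivative deriv f z) (at z within ball p r)"
      using holomorphic_derivI[OF f S(1) zS] .
    thus "((\<lambda>z. f z * exp (- G z)) has_field_derivative 0) (at z within ball p r)"
      by (auto intro!: derivative_eq_intros G z simp: ode[OF zS])
  qed simp
  then obtain c where c: "\<And>z. z \<in> ball p r \<Longrightarrow> f z * exp (- G z) = c" by blast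
  have "c = 0" using c[of p] p r by simp
  hence "f z = 0" if "z \<in> ball p r" for z using c[OF that] by simp
  thus ?thesis
    using analytic_continuation_open[of "ball p r" S f "\<lambda>_. 0" w] S f r w by auto
qed

context lattice
begin

lemma half_not_lattice [simp]: "1 / 2 \<notin> \<Lambda>"
proof
  assume "1 / 2 \<in> \<Lambda>"
  then obtain m n where mn: "1 / 2 = of_int m + of_int n * \<tau>" by (metis lattice_pointE)
  have "Im (1 / 2) = Im (of_int m + of_int n * \<tau>)" by (simp only: mn)
  hence "n = 0" using Im_pos by simp
  hence "complex_of_int (2 * m) = of_int 1" using mn by (simp add: field_simps)
  hence "2 * m = 1" by (metis of_int_eq_iff)
  thus False by presburger
qed

text \<open>Subtracting the integer parts of the coordinates leaves a remainder in a bounded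
  parallelogram. Values of periodic functions are thus all attained on one compact ball.\<close>

lemma lattice_not_dense_shift:
  obtains B where "B > 0" "\<And>z. \<exists>\<omega>\<in>\<Lambda>. norm (z - \<omega>) \<le> B"
proof -
  define B where "B = 2 + norm \<tau>"
  have "\<exists>\<omega>\<in>\<Lambda>. norm (z - \<omega>) \<le> B" for z
  proof -
    define n where "n = \<lfloor>Im z / Im \<tau>\<rfloor>"
    define m where "m = \<lfloor>Re (z - of_int n * \<tau>)\<rfloor>"
    define t where "t = Im z / Im \<tau> - of_int n"
    define w where "w = z - (of_int m + of_int n * \<tau>)"
    have t: "0 \<le> t" "t < 1" unfolding t_def n_def by linarith+
    have Im: "Im w = t * Im \<tau>" using Im_pos by (simp add: w_def t_def field_simps)
    have "Re w = Re (z - of_int n * \<tau>) - of_int m" by (simp add: w_def)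
    hence "0 \<le> Re w" "Re w < 1" unfolding m_def by linarith+
    hence "\<bar>Re w\<bar> \<le> 1" by linarith
    moreover have "\<bar>Im w\<bar> \<le> norm \<tau>"
    proof -
      have "\<bar>Im w\<bar> = t * Im \<tau>" using t Im_pos by (simp add: Im)
      also have "\<dots> \<le> 1 * Im \<tau>" using t Im_pos by (intro mult_right_mono) auto
      also have "\<dots> \<le> norm \<tau>" using abs_Im_le_cmod[of \<tau>] by simp
      finally show ?thesis .
    qed
    ultimately have "norm w \<le> B" using cmod_le[of w] by (simp add: B_def)
    thus ?thesis by (intro bexI[of _ "of_int m + of_int n * \<tau>"]) (auto simp: w_def period_lattice_def)
  qed
  thus ?thesis by (rule that[rotated]) (simp add: B_def add_pos_nonneg)
qed

lemma shifted_lattice: "{u. u + v \<in> \<Lambda>} = (\<lambda>u. u - v) ` \<Lambda>"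
proof (intro equalityI subsetI)
  fix u assume "u \<in> {u. u + v \<in> \<Lambda>}"
  thus "u \<in> (\<lambda>u. u - v) ` \<Lambda>" by (intro image_eqI[of _ _ "u + v"]) auto
qed auto

text \<open>The defect of additivity of \<zeta>. Unlike \<zeta> it is periodic in each argument,
  because the additive constants of \<zeta>(u + v) and \<zeta>(u) cancel.\<close>

definition phi :: "complex \<Rightarrow> complex \<Rightarrow> complex" where
  "phi u v = wzeta \<tau> (u + v) - wzeta \<tau> u - wzeta \<tau> v"

lemma phi_commute: "phi u v = phi v u"
  by (simp add: phi_def add.commute)

lemma phi_period [simp]: "\<omega> \<in> \<Lambda> \<Longrightarrow> phi (u + \<omega>) v = phi u v"
  using wzeta_period_const[of \<omega> u] wzeta_period_const[of \<omega> "u + v"]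
  by (simp add: phi_def algebra_simps)

lemma wp_minus_half: "wp \<tau> (p - 1/2) = wp \<tau> (p + 1/2)"
  using wp_period[of 1 "p - 1/2"] by (simp add: algebra_simps)

text \<open>As a function of \<open>u\<close>, the difference of the two sides is elliptic, and it tends to zero at its
  only possible singularities \<open>0\<close> and \<open>-v\<close>.\<close>

lemma addition_formula:
  assumes uv: "u \<notin> \<Lambda>" "v \<notin> \<Lambda>" "u + v \<notin> \<Lambda>"
  shows "phi u v ^ 2 = wp \<tau> (u + v) + wp \<tau> u + wp \<tau> v"
proof -
  define f where "f = (\<lambda>u. phi u v ^ 2 - wp \<tau> (u + v) - wp \<tau> u - wp \<tau> v)"
  define S where "S = {u. u \<in> \<Lambda> \<or> u + v \<in> \<Lambda>}"
  define g where "g = (\<lambda>u. if u \<in> S then 0 else f u)"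
  have f_per: "f (u + \<omega>) = f u" if "\<omega> \<in> \<Lambda>" for u \<omega>
  proof -
    have "wp \<tau> (u + \<omega> + v) = wp \<tau> (u + v)"
      using wp_period[OF that, of "u + v"] by (simp add: algebra_simps)
    thus ?thesis using that by (simp add: f_def)
  qed
  have S_per: "u + \<omega> \<in> S \<longleftrightarrow> u \<in> S" if "\<omega> \<in> \<Lambda>" for u \<omega>
    unfolding S_def using lattice_add_right_iff[OF that, of u] lattice_add_right_iff[OF that, of "u+v"]
    by (simp add: algebra_simps)
  \<comment> \<open>The reflection u to -v - u exchanges the singular points 0 and -v, so one limit
    computation serves both.\<close>
  have f_sym: "f (- v - u) = f u" for u
  proof -
    have "- v - u = - (u + v)" "- v - u + v = - u" by auto
    hence "wp \<tau> (- v - u) = wp \<tau> (u + v)" "wzeta \<tau> (- v - u) = - wzeta \<tau> (u + v)"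
      "wp \<tau> (- v - u + v) = wp \<tau> u" "wzeta \<tau> (- v - u + v) = - wzeta \<tau> u"
      using wzeta_minus wp_minus by metis+
    thus ?thesis by (simp add: f_def phi_def power2_eq_square algebra_simps)
  qed
  have lim0: "f \<midarrow>0\<rightarrow> 0"
  proof -
    obtain H r where Hr: "r > 0" "H holomorphic_on ball 0 r" "H 0 = 0" "deriv H 0 = 0" 
      "\<And>z. z \<in> ball 0 r \<Longrightarrow> wzeta \<tau> z = 1 / z + H z"
      "\<And>z. z \<in> ball 0 r \<Longrightarrow> wp \<tau> z = 1 / z\<^sup>2 - deriv H z"
      using wzeta_near_0 by metis
    \<comment> \<open>Near 0, \<open>phi u v\<close> is K(u) - 1/u with K(0) = 0 and K'(0) =
      -\<wp>(v). Squaring, the 1/u^2 cancels against \<wp>(u), and the cross term -2 K(u)/u tends to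
      2 \<wp>(v).\<close>
    define K where "K = (\<lambda>u. wzeta \<tau> (u + v) - wzeta \<tau> v - H u)"
    have dH: "(H has_field_derivative 0) (at 0)"
      using holomorphic_derivI[OF Hr(2), of 0] Hr by auto
    have dz: "((\<lambda>u. wzeta \<tau> (u + v)) has_field_derivative (- wp \<tau> v)) (at 0)"
      using has_field_derivative_wzeta[OF uv(2)] DERIV_shift[of "wzeta \<tau>" "- wp \<tau> v" 0 v] by simp
    have dK: "(K has_field_derivative (- wp \<tau> v)) (at 0)"
      unfolding K_def by (auto intro!: derivative_eq_intros dz dH)
    have K0: "K 0 = 0" by (simp add: K_def Hr)
    have l1: "(\<lambda>u. K u / u) \<midarrow>0\<rightarrow> - wp \<tau> v"
      using dK K0 by (simp add: has_field_derivative_iff)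
    have l2: "K \<midarrow>0\<rightarrow> 0"
      using DERIV_isCont[OF dK] K0 by (simp add: isCont_def)
    have "(deriv H) holomorphic_on ball 0 r" using Hr by (intro holomorphic_deriv) auto
    hence "isCont (deriv H) 0" using Hr(1)
      by (intro DERIV_isCont[OF holomorphic_derivI[OF _ open_ball]]) auto
    hence l3: "deriv H \<midarrow>0\<rightarrow> 0" using Hr by (simp add: isCont_def)
    have "isCont (wp \<tau>) v"
      using holomorphic_on_imp_continuous_on[OF holomorphic_wp] uv(2) open_compl_lattice
      by (metis ComplI continuous_on_eq_continuous_at)
    hence l4: "(\<lambda>u. wp \<tau> (u + v)) \<midarrow>0\<rightarrow> wp \<tau> v"
      using LIM_offset_zero[of "wp \<tau>" "wp \<tau> v" v] by (simp add: isCont_def add.commute)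
    have "(\<lambda>u. K u ^ 2 - 2 * (K u / u) + deriv H u - wp \<tau> (u + v) - wp \<tau> v) \<midarrow>0\<rightarrow>
       0 ^ 2 - 2 * (- wp \<tau> v) + 0 - wp \<tau> v - wp \<tau> v"
      by (intro tendsto_intros l1 l2 l3 l4)
    hence "(\<lambda>u. K u ^ 2 - 2 * (K u / u) + deriv H u - wp \<tau> (u + v) - wp \<tau> v) \<midarrow>0\<rightarrow> 0"
      by simp
    moreover have "eventually (\<lambda>u. K u ^ 2 - 2 * (K u / u) + deriv H u - wp \<tau> (u + v) - wp \<tau> v = f u) (at 0)"
    proof -
      have "eventually (\<lambda>u. u \<in> ball 0 r - {0}) (at (0::complex))"
        using Hr(1) by (intro eventually_at_in_open) auto
      thus ?thesis
      proof eventually_elim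
        case (elim u)
        hence 1: "phi u v = K u - 1 / u" using Hr(5)[of u] by (simp add: phi_def K_def)
        have 2: "wp \<tau> u = 1 / u\<^sup>2 - deriv H u" using elim Hr(6)[of u] by simp
        show ?case unfolding f_def 1 2
          by (simp add: power2_eq_square algebra_simps)
      qed
    qed
    ultimately show ?thesis by (rule Lim_transform_eventually)
  qed
  have limv: "f \<midarrow>-v\<rightarrow> 0"
  proof -
    have "(\<lambda>u. f (- v - u)) \<midarrow>-v - 0\<rightarrow> 0"
    proof (rule LIM_compose2[where f = "\<lambda>u. - v - u" and b = 0])
      show "(\<lambda>u. - v - u) \<midarrow>- v - 0\<rightarrow> 0" by (auto intro!: tendsto_eq_intros)
      show "\<exists>d>0. \<forall>x. x \<noteq> - v - 0 \<and> norm (x - (- v - 0)) < d \<longrightarrow> - v - x \<noteq> 0"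
        by (intro exI[of _ 1]) (auto simp: algebra_simps eq_neg_iff_add_eq_0)
    qed (rule lim0)
    thus ?thesis by (simp add: f_sym)
  qed
  have limS: "f \<midarrow>s\<rightarrow> 0" if s: "s \<in> S" for s
  proof -
    have shift: "f \<midarrow>a + \<omega>\<rightarrow> 0" if "f \<midarrow>a\<rightarrow> 0" "\<omega> \<in> \<Lambda>" for a \<omega>
    proof -
      have "(\<lambda>x. f (x + (- \<omega>))) \<midarrow>a - (- \<omega>)\<rightarrow> 0" by (rule LIM_offset[OF that(1)])
      moreover have "(\<lambda>x. f (x + (- \<omega>))) = f" using f_per[of "-\<omega>"] that by auto
      ultimately show ?thesis by simp
    qed
    from s consider "s \<in> \<Lambda>" | "s + v \<in> \<Lambda>" by (auto simp: S_def)
    thus ?thesis using shift[OF lim0, of s] shift[OF limv, of "s + v"] by cases auto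
  qed
  have S_eq: "S = \<Lambda> \<union> (\<lambda>u. u - v) ` \<Lambda>"
    unfolding S_def shifted_lattice[symmetric] by auto
  have Sclosed: "closed S"
  proof -
    show ?thesis unfolding S_eq using closed_lattice closed_translation_subtract by (auto intro!: closed_Un)
  qed
  have holf: "f holomorphic_on - S"
    unfolding f_def phi_def
    by (intro holomorphic_intros holomorphic_on_compose_gen[OF _ holomorphic_wzeta, unfolded o_def]
        holomorphic_on_compose_gen[OF _ holomorphic_wp, unfolded o_def]
        holomorphic_on_subset[OF holomorphic_wzeta] holomorphic_on_subset[OF holomorphic_wp])
       (auto simp: S_def)
  obtain r0 where r0: "r0 > 0" "\<And>\<omega>. \<omega> \<in> \<Lambda> \<Longrightarrow> norm \<omega> < r0 \<Longrightarrow> \<omega> = 0"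
    using eventually_not_lattice_ball by blast
  have holg: "g holomorphic_on UNIV"
  proof -
    have "g field_differentiable at s" for s
    proof (cases "s \<in> S")
      case False
      have "open (- S)" using Sclosed by auto
      moreover have "g holomorphic_on - S"
        using holf by (rule holomorphic_transform) (simp add: g_def)
      ultimately show ?thesis using False by (auto intro: holomorphic_on_imp_differentiable_at)
    next
      case True
      have "\<not> s islimpt S"
      proof
        assume "s islimpt S"
        hence "s islimpt \<Lambda> \<or> s islimpt ((\<lambda>u. u - v) ` \<Lambda>)"
          unfolding S_eq islimpt_Un .
        moreover have "\<not> s islimpt \<Lambda>"
          by (rule discrete_imp_not_islimpt[OF r0(1)]) 
             (metis dist_norm r0(2) lattice_diff eq_iff_diff_eq_0)
        moreover have "\<not> s islimpt ((\<lambda>u. u - v) ` \<Lambda>)"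
        proof (rule discrete_imp_not_islimpt[OF r0(1)])
          fix x y assume "x \<in> (\<lambda>u. u - v) ` \<Lambda>" "y \<in> (\<lambda>u. u - v) ` \<Lambda>" "dist y x < r0"
          then obtain a b where ab: "a \<in> \<Lambda>" "b \<in> \<Lambda>" "x = a - v" "y = b - v" by blast
          hence "norm (b - a) < r0" using \<open>dist y x < r0\<close> by (simp add: dist_norm)
          thus "y = x" using r0(2)[of "b - a"] ab by auto
        qed
        ultimately show False by blast
      qed
      then obtain U where U: "s \<in> U" "open U" "\<forall>y\<in>S. y \<in> U \<longrightarrow> y = s"
        by (auto simp: islimpt_def)
      have "g holomorphic_on U"
      proof (rule no_isolated_singularity'[where K = "{s}"])
        show "g holomorphic_on U - {s}"
          using holomorphic_on_subset[OF holf, of "U - {s}"] U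
          by (subst holomorphic_cong[OF refl, of _ g f]) (auto simp: g_def)
        show "(g \<longlongrightarrow> g z) (at z within U)" if "z \<in> {s}" for z
        proof -
          have "eventually (\<lambda>x. f x = g x) (at s)"
            using eventually_at_in_open[OF U(2,1)] U(3) by (auto elim!: eventually_mono simp: g_def)
          hence "g \<midarrow>s\<rightarrow> 0" using limS[OF True] by (rule Lim_transform_eventually[rotated])
          hence "(g \<longlongrightarrow> 0) (at s within U)" by (rule tendsto_within_subset) auto
          thus ?thesis using that True by (simp add: g_def)
        qed
      qed (use U in auto)
      thus ?thesis using U by (simp add: holomorphic_on_open field_differentiable_def)
    qed
    thus ?thesis by (simp add: holomorphic_on_def)
  qed
  obtain B where B: "B > 0" "\<And>z. \<exists>\<omega>\<in>\<Lambda>. norm (z - \<omega>) \<le> B"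
    using lattice_not_dense_shift by blast
  have g_per: "g (u + \<omega>) = g u" if "\<omega> \<in> \<Lambda>" for u \<omega>
    using S_per[OF that] f_per[OF that] by (simp add: g_def)
  \<comment> \<open>By periodicity all values of the entire function g are attained on a compact
    ball, so Liouville's theorem makes g constant.\<close>
  have "range g \<subseteq> g ` cball 0 B"
  proof safe
    fix z obtain \<omega> where \<omega>: "\<omega> \<in> \<Lambda>" "norm (z - \<omega>) \<le> B" using B by blast
    have "g z = g (z - \<omega>)" using g_per[of "\<omega>" "z - \<omega>"] \<omega> by auto
    thus "g z \<in> g ` cball 0 B" using \<omega> by auto
  qed
  moreover have "bounded (g ` cball 0 B)"
    by (intro compact_imp_bounded compact_continuous_image holomorphic_on_imp_continuous_on
        holomorphic_on_subset[OF holg]) auto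
  ultimately have "bounded (range g)" by (metis bounded_subset)
  hence "g constant_on UNIV" using Liouville_theorem[OF holg] by blast
  hence "g u = g 0" by (auto simp: constant_on_def)
  moreover have "g 0 = 0" by (simp add: g_def S_def)
  ultimately have "f u = 0" using uv by (simp add: g_def S_def add.commute)
  thus ?thesis by (simp add: f_def algebra_simps)
qed

end

context lattice
begin

section \<open>Differentiated addition formulas\<close>

lemma has_field_derivative_wp:
  "z \<notin> \<Lambda> \<Longrightarrow> (wp \<tau> has_field_derivative deriv (wp \<tau>) z) (at z)"
  using holomorphic_derivI[OF holomorphic_wp open_compl_lattice] by auto

lemma has_field_derivative_phi:
  assumes "u \<notin> \<Lambda>" "u + v \<notin> \<Lambda>"
  shows "((\<lambda>u. phi u v) has_field_derivative (wp \<tau> u - wp \<tau> (u + v))) (at u)"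
proof -
  have "((\<lambda>x. wzeta \<tau> (x + v)) has_field_derivative (- wp \<tau> (u + v))) (at u)"
    using has_field_derivative_wzeta[OF assms(2)] by (simp add: DERIV_shift)
  thus ?thesis unfolding phi_def
    using has_field_derivative_wzeta[OF assms(1)] by (auto intro!: derivative_eq_intros)
qed

lemma open_addition_domain: "open {u. u \<notin> \<Lambda> \<and> u + v \<notin> \<Lambda>}"
proof -
  have "{u. u \<notin> \<Lambda> \<and> u + v \<notin> \<Lambda>} = - \<Lambda> \<inter> (\<lambda>u. u + v) -` (- \<Lambda>)" by auto
  also have "open \<dots>" by (intro open_Int open_vimage open_compl_lattice continuous_intros)
  finally show ?thesis .
qed

lemma addition_formula_deriv:
  assumes uv: "u \<notin> \<Lambda>" "v \<notin> \<Lambda>" "u + v \<notin> \<Lambda>"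
  shows "2 * phi u v * (wp \<tau> u - wp \<tau> (u + v)) = deriv (wp \<tau>) (u + v) + deriv (wp \<tau>) u"
proof -
  have "((\<lambda>x. wp \<tau> (x + v)) has_field_derivative (deriv (wp \<tau>) (u + v))) (at u)"
    using has_field_derivative_wp[OF uv(3)] by (simp add: DERIV_shift)
  hence "((\<lambda>u. wp \<tau> (u + v) + wp \<tau> u + wp \<tau> v) has_field_derivative 
      (deriv (wp \<tau>) (u + v) + deriv (wp \<tau>) u)) (at u)"
    using has_field_derivative_wp[OF uv(1)] by (auto intro!: derivative_eq_intros)
  moreover have "((\<lambda>u. phi u v ^ 2) has_field_derivative (2 * phi u v * (wp \<tau> u - wp \<tau> (u + v)))) (at u)"
    using has_field_derivative_phi[OF uv(1,3)] by (auto intro!: derivative_eq_intros)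
  hence "((\<lambda>u. wp \<tau> (u + v) + wp \<tau> u + wp \<tau> v) has_field_derivative 
      (2 * phi u v * (wp \<tau> u - wp \<tau> (u + v)))) (at u)"
    by (rule has_field_derivative_transform_within_open[OF _ open_addition_domain[of v]])
       (use uv addition_formula in auto)
  ultimately show ?thesis using DERIV_unique by blast
qed

text \<open>Differentiating the addition formula in u and in v gives two identities with the same
  terms at u + v; subtracting them leaves only values at u and v.\<close>

lemma phi_wp_deriv:
  assumes uv: "u \<notin> \<Lambda>" "v \<notin> \<Lambda>" "u + v \<notin> \<Lambda>"
  shows "2 * phi u v * (wp \<tau> u - wp \<tau> v) = deriv (wp \<tau>) u - deriv (wp \<tau>) v"
  using addition_formula_deriv[OF uv] addition_formula_deriv[of v u] uv
  by (simp add: phi_commute[of v u] algebra_simps add.commute[of v u])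

lemma wp_deriv_half: "deriv (wp \<tau>) (1/2) = 0"
proof -
  have "((\<lambda>x. wp \<tau> (1 - x)) has_field_derivative (deriv (wp \<tau>) (1 - 1/2) * (-1))) (at (1/2))"
    by (rule DERIV_chain2[of "wp \<tau>"]) 
       (use has_field_derivative_wp[OF half_not_lattice] in \<open>auto intro!: derivative_eq_intros\<close>)
  moreover have "wp \<tau> (1 - x) = wp \<tau> x" for x
    using wp_period[of 1 "-x"] wp_minus[of x] by (simp add: algebra_simps)
  ultimately have "(wp \<tau> has_field_derivative (- deriv (wp \<tau>) (1/2))) (at (1/2))" by simp
  hence "- deriv (wp \<tau>) (1/2) = deriv (wp \<tau>) (1/2)"
    using has_field_derivative_wp[OF half_not_lattice] DERIV_unique by blast
  hence "2 * deriv (wp \<tau>) (1/2) = 0" by (simp add: neg_eq_iff_add_eq_0)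
  thus ?thesis by simp
qed

lemma double_not_lattice:
  assumes "2 * p \<notin> \<Lambda>"
  shows "p \<notin> \<Lambda>" "p + 1/2 \<notin> \<Lambda>" "p + p \<notin> \<Lambda>" "2 * (p + 1/2) \<notin> \<Lambda>" "p - 1/2 \<notin> \<Lambda>"
proof -
  have d: "2 * x = x + x" for x :: complex by simp
  show "p + p \<notin> \<Lambda>" using assms unfolding d .
  thus "p \<notin> \<Lambda>" by blast
  have eq: "2 * (p + 1/2) = 2 * p + 1" by simp
  show h: "2 * (p + 1/2) \<notin> \<Lambda>" using assms lattice_add_right_iff[OF lattice_1, of "2 * p"] unfolding eq by simp
  show "p + 1/2 \<notin> \<Lambda>" using h lattice_add[of "p + 1/2" "p + 1/2"] unfolding d by blast
  thus "p - 1/2 \<notin> \<Lambda>" using lattice_add_right_iff[OF lattice_1, of "p - 1/2"] by (simp add: algebra_simps)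
qed

definition kap :: "complex \<Rightarrow> complex" where "kap p = phi p (1/2)"
definition lam :: "complex \<Rightarrow> complex" where "lam p = phi p p"

lemma kap_squared:
  assumes "2 * p \<notin> \<Lambda>"
  shows "kap p ^ 2 = wp \<tau> p + wp \<tau> (p + 1/2) + e1 \<tau>"
  using addition_formula[of p "1/2"] double_not_lattice[OF assms] by (simp add: kap_def e1_def)

lemma lam_squared:
  assumes "2 * p \<notin> \<Lambda>"
  shows "lam p ^ 2 = wp \<tau> (2 * p) + 2 * wp \<tau> p"
proof -
  have "2 * p = p + p" by simp
  thus ?thesis
    using addition_formula[of p p] double_not_lattice[OF assms] by (simp add: lam_def)
qed

text \<open>The previous identity at v = 1/2, where \<wp>' vanishes by symmetry.\<close>

lemma wp_deriv_eq:
  assumes "p \<notin> \<Lambda>" "p + 1/2 \<notin> \<Lambda>"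
  shows "deriv (wp \<tau>) p = 2 * kap p * (wp \<tau> p - e1 \<tau>)"
  using phi_wp_deriv[of p "1/2"] assms by (simp add: kap_def e1_def wp_deriv_half)

text \<open>Differentiate \<wp>' = 2 \<kappa> (\<wp> - e1), using \<kappa>' = \<wp>(p) - \<wp>(p +
  1/2), and eliminate \<kappa>^2.\<close>

lemma wp_deriv2:
  assumes "2 * p \<notin> \<Lambda>"
  shows "deriv (deriv (wp \<tau>)) p = 2 * (wp \<tau> p - e1 \<tau>) * (3 * wp \<tau> p + wp \<tau> (p + 1/2) + 2 * e1 \<tau>)"
proof -
  note n = double_not_lattice[OF assms]
  have "((\<lambda>p. 2 * kap p * (wp \<tau> p - e1 \<tau>)) has_field_derivative 
      (2 * (wp \<tau> p - wp \<tau> (p + 1/2)) * (wp \<tau> p - e1 \<tau>) + 2 * kap p * deriv (wp \<tau>) p)) (at p)"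
    unfolding kap_def
    by (auto intro!: derivative_eq_intros has_field_derivative_phi has_field_derivative_wp n)
  hence "(deriv (wp \<tau>) has_field_derivative 
      (2 * (wp \<tau> p - wp \<tau> (p + 1/2)) * (wp \<tau> p - e1 \<tau>) + 2 * kap p * deriv (wp \<tau>) p)) (at p)"
    by (rule has_field_derivative_transform_within_open[OF _ open_addition_domain[of "1/2"]])
       (use n wp_deriv_eq in auto)
  hence "deriv (deriv (wp \<tau>)) p = 2 * (wp \<tau> p - wp \<tau> (p + 1/2)) * (wp \<tau> p - e1 \<tau>) + 2 * kap p * deriv (wp \<tau>) p"
    by (rule DERIV_imp_deriv)
  also have "\<dots> = 2 * (wp \<tau> p - wp \<tau> (p + 1/2)) * (wp \<tau> p - e1 \<tau>) + 4 * kap p ^ 2 * (wp \<tau> p - e1 \<tau>)"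
    using wp_deriv_eq n by (simp add: power2_eq_square)
  also have "\<dots> = 2 * (wp \<tau> p - e1 \<tau>) * (3 * wp \<tau> p + wp \<tau> (p + 1/2) + 2 * e1 \<tau>)"
    unfolding kap_squared[OF assms] by (simp add: algebra_simps)
  finally show ?thesis .
qed

text \<open>Differentiate \<open>phi_wp_deriv\<close> in u and set u = v = p: the term with the
  derivative of \<open>phi\<close> has the factor \<wp>(p) - \<wp>(p) = 0. The result is both a
  formula for \<lambda> and a linear differential equation for \<wp>'.\<close>

lemma lam_wp_deriv:
  assumes p: "2 * p \<notin> \<Lambda>"
  shows "deriv (deriv (wp \<tau>)) p = 2 * lam p * deriv (wp \<tau>) p"
proof -
  note n = double_not_lattice[OF p]
  have hd: "deriv (wp \<tau>) holomorphic_on - \<Lambda>"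
    by (intro holomorphic_deriv holomorphic_wp open_compl_lattice)
  have "((\<lambda>u. deriv (wp \<tau>) u - deriv (wp \<tau>) p) has_field_derivative deriv (deriv (wp \<tau>)) p) (at p)"
    using holomorphic_derivI[OF hd open_compl_lattice, of p] n by (auto intro!: derivative_eq_intros)
  moreover have "((\<lambda>u. 2 * phi u p * (wp \<tau> u - wp \<tau> p)) has_field_derivative (2 * lam p * deriv (wp \<tau>) p)) (at p)"
    unfolding lam_def
    by (rule derivative_eq_intros has_field_derivative_phi has_field_derivative_wp n refl)+ simp
  hence "((\<lambda>u. deriv (wp \<tau>) u - deriv (wp \<tau>) p) has_field_derivative (2 * lam p * deriv (wp \<tau>) p)) (at p)"
    by (rule has_field_derivative_transform_within_open[OF _ open_addition_domain[of p]])
       (use n phi_wp_deriv in auto)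
  ultimately show ?thesis using DERIV_unique by blast
qed

section \<open>Nonvanishing of \<wp>' off the half-lattice\<close>

lemma countable_half_lattice: "countable {z. 2 * z \<in> \<Lambda>}"
proof -
  have "{z. 2 * z \<in> \<Lambda>} = (\<lambda>z. z / 2) ` \<Lambda>"
  proof (intro equalityI subsetI)
    fix z assume "z \<in> {z. 2 * z \<in> \<Lambda>}"
    thus "z \<in> (\<lambda>z. z / 2) ` \<Lambda>" by (intro image_eqI[of _ _ "2 * z"]) auto
  qed auto
  thus ?thesis using countable_lattice by simp
qed

lemma connected_half_lattice_compl: "connected {z. 2 * z \<notin> \<Lambda>}"
proof -
  have "path_connected (- {z. 2 * z \<in> \<Lambda>})"
    by (rule path_connected_complement_countable) (auto simp: countable_half_lattice)
  moreover have "- {z. 2 * z \<in> \<Lambda>} = {z. 2 * z \<notin> \<Lambda>}" by auto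
  ultimately show ?thesis using path_connected_imp_connected by metis
qed

lemma open_half_lattice_compl: "open {z. 2 * z \<notin> \<Lambda>}"
proof -
  have "{z. 2 * z \<notin> \<Lambda>} = (\<lambda>z. 2 * z) -` (- \<Lambda>)" by auto
  also have "open \<dots>" by (intro open_vimage open_compl_lattice continuous_intros)
  finally show ?thesis .
qed

text \<open>A zero of \<wp>' would spread through the linear equation \<wp>'' = 2 \<lambda> \<wp>'
  over the connected complement of the half-lattice, contradicting the double pole of \<wp> at
  0.\<close>

lemma wp_deriv_nonzero:
  assumes p: "2 * p \<notin> \<Lambda>"
  shows "deriv (wp \<tau>) p \<noteq> 0"
proof
  assume zero: "deriv (wp \<tau>) p = 0"
  let ?S = "{z. 2 * z \<notin> \<Lambda>}"
  have sub: "?S \<subseteq> - \<Lambda>" using double_not_lattice(1) by auto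
  have hd: "deriv (wp \<tau>) holomorphic_on ?S"
    using sub by (intro holomorphic_on_subset[OF holomorphic_deriv[OF holomorphic_wp open_compl_lattice]])
  have "(\<lambda>z. 2 * lam z) holomorphic_on ?S"
    unfolding lam_def phi_def
    using double_not_lattice
    by (intro holomorphic_intros holomorphic_on_compose_gen[OF _ holomorphic_wzeta, unfolded o_def]
        holomorphic_on_subset[OF holomorphic_wzeta]) auto
  hence z: "deriv (wp \<tau>) w = 0" if "w \<in> ?S" for w
    using linear_ode_zero[OF open_half_lattice_compl connected_half_lattice_compl hd, of "\<lambda>z. 2 * lam z" p w]
      lam_wp_deriv zero p that by auto
  obtain H r where Hr: "r > 0" "H holomorphic_on ball 0 r"
      "\<And>z. z \<in> ball 0 r \<Longrightarrow> wp \<tau> z = 1 / z\<^sup>2 - deriv H z"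
      "\<And>z. z \<in> ball 0 r \<Longrightarrow> z \<in> \<Lambda> \<Longrightarrow> z = 0"
    using wzeta_near_0 by metis
  have h1: "deriv H holomorphic_on ball 0 r" and h2: "deriv (deriv H) holomorphic_on ball 0 r"
    using Hr(2) by (auto intro!: holomorphic_deriv)
  \<comment> \<open>With \<wp>' = 0 near 0, differentiating \<wp> = 1/z^2 - H' makes H'' equal to
    -2/x^3, which is unbounded although H'' is continuous at 0.\<close>
  have eq: "x ^ 3 * deriv (deriv H) x = - 2" if x: "x \<in> ball 0 (r/2) - {0}" for x
  proof -
    have xr: "x \<in> ball 0 r" "2 * x \<in> ball 0 r" "x \<noteq> 0" using x Hr(1) by (auto simp: norm_mult)
    hence "2 * x \<notin> \<Lambda>" using Hr(4)[of "2 * x"] by auto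
    hence d0: "deriv (wp \<tau>) x = 0" and nl: "x \<notin> \<Lambda>" using z double_not_lattice by auto
    have "((\<lambda>z. 1 / z\<^sup>2 - deriv H z) has_field_derivative (- 2 / x ^ 3 - deriv (deriv H) x)) (at x)"
      using xr by (auto intro!: derivative_eq_intros holomorphic_derivI[OF h1] simp: power2_eq_square power3_eq_cube)
    hence "(wp \<tau> has_field_derivative (- 2 / x ^ 3 - deriv (deriv H) x)) (at x)"
      by (rule has_field_derivative_transform_within_open[of _ _ _ "ball 0 r"]) (use xr Hr in auto)
    hence "- 2 / x ^ 3 - deriv (deriv H) x = 0"
      using has_field_derivative_wp[OF nl] DERIV_unique d0 by metis
    thus ?thesis using xr by (simp add: field_simps)
  qed
  have "continuous_on (ball 0 r) (deriv (deriv H))" using h2 by (rule holomorphic_on_imp_continuous_on)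
  hence "isCont (deriv (deriv H)) 0" using Hr(1) by (simp add: continuous_on_eq_continuous_at)
  hence "(\<lambda>x. x ^ 3 * deriv (deriv H) x) \<midarrow>0\<rightarrow> 0 ^ 3 * deriv (deriv H) 0"
    unfolding isCont_def by (intro tendsto_intros)
  moreover have "eventually (\<lambda>x. x \<in> ball 0 (r/2) - {0}) (at (0::complex))"
    using Hr(1) by (intro eventually_at_in_open) auto
  hence "eventually (\<lambda>x. x ^ 3 * deriv (deriv H) x = - 2) (at 0)"
    by eventually_elim (rule eq)
  ultimately have "(\<lambda>x::complex. - 2 :: complex) \<midarrow>0\<rightarrow> 0 ^ 3 * deriv (deriv H) 0"
    by (rule Lim_transform_eventually)
  hence "- 2 = (0::complex) ^ 3 * deriv (deriv H) 0"
    by (rule LIM_const_eq)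
  thus False by simp
qed

text \<open>Both factors of \<wp>' = 2 \<kappa> (\<wp> - e1) are nonzero at p; the last claim is the
  same fact at p + 1/2.\<close>

lemma nonzero_facts:
  assumes p: "2 * p \<notin> \<Lambda>"
  shows "kap p \<noteq> 0" "wp \<tau> p \<noteq> e1 \<tau>" "wp \<tau> (p + 1/2) \<noteq> e1 \<tau>"
proof -
  note n = double_not_lattice[OF p]
  show "kap p \<noteq> 0" "wp \<tau> p \<noteq> e1 \<tau>"
    using wp_deriv_nonzero[OF p] wp_deriv_eq[OF n(1,2)] by auto
  have "p + 1/2 + 1/2 \<notin> \<Lambda>" using n(1) lattice_add_right_iff[OF lattice_1, of p] by (simp add: add.assoc)
  thus "wp \<tau> (p + 1/2) \<noteq> e1 \<tau>"
    using wp_deriv_nonzero[OF n(4)] wp_deriv_eq[OF n(2)] by auto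
qed

text \<open>Two expressions for \<wp>'' are now available; comparing them and cancelling \<wp>(p) -
  e1 leaves the product \<lambda> \<kappa>.\<close>

lemma lam_kap:
  assumes p: "2 * p \<notin> \<Lambda>"
  shows "2 * lam p * kap p = 3 * wp \<tau> p + wp \<tau> (p + 1/2) + 2 * e1 \<tau>"
proof -
  note n = double_not_lattice[OF p]
  have "(2 * (wp \<tau> p - e1 \<tau>)) * (2 * lam p * kap p) = (2 * (wp \<tau> p - e1 \<tau>)) * (3 * wp \<tau> p + wp \<tau> (p + 1/2) + 2 * e1 \<tau>)"
    using wp_deriv2[OF p] lam_wp_deriv[OF p] wp_deriv_eq[OF n(1,2)] by (simp add: algebra_simps)
  thus ?thesis using nonzero_facts(2)[OF p] by simp
qed

section \<open>Zeros of the discriminant on the torus\<close>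

lemma P_disc_eq:
  "P_disc \<tau> p = 4 * (wp \<tau> p)\<^sup>2 + 4 * wp \<tau> p * wp \<tau> (p + 1/2) + 4 * (wp \<tau> (p + 1/2))\<^sup>2 - 3 * (e1 \<tau>)\<^sup>2"
  by (simp add: P_disc_def P_poly_def numeral_2_eq_2 power2_eq_square algebra_simps)

lemma P_disc_period: "\<omega> \<in> \<Lambda> \<Longrightarrow> P_disc \<tau> (p + \<omega>) = P_disc \<tau> p"
  using wp_period[of \<omega> p] wp_period[of \<omega> "p + 1/2"] by (simp add: P_disc_eq algebra_simps)

lemma P_disc_half_period: "P_disc \<tau> (p + 1/2) = P_disc \<tau> p"
  using wp_period[of 1 p] by (simp add: P_disc_eq algebra_simps)

text \<open>The square of \<wp>(z) dominates at 0: multiplied by z^4, the discriminant tends to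
  4.\<close>

lemma P_disc_near_0:
  obtains r where "r > 0" "\<And>z. z \<noteq> 0 \<Longrightarrow> norm z < r \<Longrightarrow> P_disc \<tau> z \<noteq> 0"
proof -
  obtain H r where Hr: "r > 0" "H holomorphic_on ball 0 r"
      "\<And>z. z \<in> ball 0 r \<Longrightarrow> wp \<tau> z = 1 / z\<^sup>2 - deriv H z"
    using wzeta_near_0 by metis
  have "deriv H holomorphic_on ball 0 r" using Hr by (intro holomorphic_deriv) auto
  hence "isCont (deriv H) 0" using Hr(1)
    by (intro DERIV_isCont[OF holomorphic_derivI[OF _ open_ball]]) auto
  hence l1: "deriv H \<midarrow>0\<rightarrow> deriv H 0" by (simp add: isCont_def)
  have "isCont (wp \<tau>) (1/2)"
    using DERIV_isCont[OF has_field_derivative_wp[OF half_not_lattice]] .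
  hence l2: "(\<lambda>u. wp \<tau> (u + 1/2)) \<midarrow>0\<rightarrow> wp \<tau> (1/2)"
    using LIM_offset_zero[of "wp \<tau>" "wp \<tau> (1/2)" "1/2"] by (simp add: isCont_def add.commute)
  have "(\<lambda>z. 4 * (1 - z\<^sup>2 * deriv H z)\<^sup>2 + 4 * z\<^sup>2 * (1 - z\<^sup>2 * deriv H z) * wp \<tau> (z + 1/2) 
          + 4 * z ^ 4 * (wp \<tau> (z + 1/2))\<^sup>2 - 3 * z ^ 4 * (e1 \<tau>)\<^sup>2) \<midarrow>0\<rightarrow>
       4 * (1 - 0\<^sup>2 * deriv H 0)\<^sup>2 + 4 * 0\<^sup>2 * (1 - 0\<^sup>2 * deriv H 0) * wp \<tau> (1/2) 
          + 4 * 0 ^ 4 * (wp \<tau> (1/2))\<^sup>2 - 3 * 0 ^ 4 * (e1 \<tau>)\<^sup>2" (is "?F \<midarrow>0\<rightarrow> _")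
    by (intro tendsto_intros l1 l2)
  hence "?F \<midarrow>0\<rightarrow> 4" by simp
  hence "eventually (\<lambda>z. ?F z \<noteq> 0) (at 0)"
    by (rule tendsto_imp_eventually_ne) simp
  moreover have "eventually (\<lambda>x. x \<in> ball 0 r - {0}) (at (0::complex))"
    using Hr(1) by (intro eventually_at_in_open) auto
  ultimately have "eventually (\<lambda>z. P_disc \<tau> z \<noteq> 0) (at 0)"
  proof eventually_elim
    case (elim z)
    define Q where "Q = wp \<tau> (z + 1/2)"
    have eq: "z\<^sup>2 * wp \<tau> z = 1 - z\<^sup>2 * deriv H z"
      using elim Hr(3)[of z] by (simp add: field_simps)
    have "?F z = 4 * (z\<^sup>2 * wp \<tau> z)\<^sup>2 + 4 * z\<^sup>2 * (z\<^sup>2 * wp \<tau> z) * Q + 4 * z ^ 4 * Q\<^sup>2 - 3 * z ^ 4 * (e1 \<tau>)\<^sup>2"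
      unfolding eq Q_def ..
    also have "\<dots> = z ^ 4 * P_disc \<tau> z"
      unfolding P_disc_eq Q_def[symmetric] by (simp add: algebra_simps power2_eq_square power4_eq_xxxx)
    finally show ?case using elim by auto
  qed
  then obtain d where "d > 0" "\<forall>z. z \<noteq> 0 \<and> dist z 0 < d \<longrightarrow> P_disc \<tau> z \<noteq> 0"
    unfolding eventually_at by auto
  thus ?thesis by (intro that[of d]) auto
qed

text \<open>Modulo the lattice the zeros lie in a compact ball, so infinitely many would accumulate.
  They cannot do so at a pole, around which there are no zeros; anywhere else the identity theorem
  would make the discriminant vanish on the connected complement of the poles.\<close>

lemma finite_P_disc_zeros:
  "finite (torus_point \<tau> ` {p. 2 * p \<notin> \<Lambda> \<and> P_disc \<tau> p = 0})"
proof -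
  obtain B where B: "B > 0" "\<And>z. \<exists>\<omega>\<in>\<Lambda>. norm (z - \<omega>) \<le> B"
    using lattice_not_dense_shift by blast
  obtain r where r: "r > 0" "\<And>z. z \<noteq> 0 \<Longrightarrow> norm z < r \<Longrightarrow> P_disc \<tau> z \<noteq> 0"
    using P_disc_near_0 by blast
  define Z where "Z = {p. 2 * p \<notin> \<Lambda> \<and> P_disc \<tau> p = 0}"
  \<comment> \<open>The poles of \<wp>(z) and of \<wp>(z + 1/2); the half-period symmetry of the
    discriminant reduces the second kind to the first.\<close>
  define S where "S = \<Lambda> \<union> {z. z + 1/2 \<in> \<Lambda>}"
  have near: "P_disc \<tau> z \<noteq> 0" if s: "s \<in> S" and z: "z \<noteq> s" "norm (z - s) < r" for s z
  proof -
    from s consider "s \<in> \<Lambda>" | "s + 1/2 \<in> \<Lambda>" by (auto simp: S_def)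
    thus ?thesis
    proof cases
      case 1
      have "P_disc \<tau> z = P_disc \<tau> (z - s)" using P_disc_period[OF 1, of "z - s"] by simp
      thus ?thesis using r z by simp
    next
      case 2
      have "P_disc \<tau> z = P_disc \<tau> (z + 1/2)" by (simp add: P_disc_half_period)
      also have "\<dots> = P_disc \<tau> (z - s)" using P_disc_period[OF 2, of "z - s"] by (simp add: algebra_simps)
      finally show ?thesis using r z by simp
    qed
  qed
  have hol: "P_disc \<tau> holomorphic_on - S"
    unfolding P_disc_eq S_def
    by (intro holomorphic_intros holomorphic_on_compose_gen[OF _ holomorphic_wp, unfolded o_def]
        holomorphic_on_subset[OF holomorphic_wp]) auto
  have opS: "open (- S)"
  proof -
    have "- S = {u. u \<notin> \<Lambda> \<and> u + 1/2 \<notin> \<Lambda>}" by (auto simp: S_def)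
    thus ?thesis using open_addition_domain[of "1/2"] by simp
  qed
  have countS: "countable (insert 0 S)"
  proof -
    have "S = \<Lambda> \<union> (\<lambda>z. z - 1/2) ` \<Lambda>" unfolding S_def shifted_lattice ..
    thus ?thesis using countable_lattice by simp
  qed
  have conS: "connected (- S)"
    using countS by (intro path_connected_imp_connected path_connected_complement_countable) auto
  have "finite (Z \<inter> cball 0 B)"
  proof (rule ccontr)
    assume inf: "infinite (Z \<inter> cball 0 B)"
    obtain l where l: "l islimpt (Z \<inter> cball 0 B)"
      using compact_cball[of "0::complex" B] inf unfolding compact_eq_Bolzano_Weierstrass by (metis Int_lower2)
    have lZ: "l islimpt Z" using l by (rule islimpt_subset) auto
    show False
    proof (cases "l \<in> S")
      case True
      obtain z where "z \<in> Z" "z \<noteq> l" "dist z l < r"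
        using lZ r(1) by (auto simp: islimpt_approachable)
      thus False using near[OF True, of z] by (auto simp: Z_def dist_norm)
    next
      case False
      have "Z \<subseteq> - S" using double_not_lattice by (auto simp: Z_def S_def)
      have zero: "P_disc \<tau> w = 0" if "w \<in> - S" for w
        using analytic_continuation[OF hol opS conS \<open>Z \<subseteq> - S\<close> _ lZ _ that] False by (auto simp: Z_def)
      have "\<not> ball 0 r \<subseteq> insert 0 S"
        using uncountable_ball[OF r(1), of "0::complex"] countS countable_subset by blast
      then obtain z where "z \<in> ball 0 r" "z \<notin> insert 0 S" by blast
      hence "z \<in> - S" "z \<noteq> 0" "norm z < r" by auto
      thus False using zero[of z] r(2)[of z] by auto
    qed
  qed
  moreover have "torus_point \<tau> ` Z \<subseteq> torus_point \<tau> ` (Z \<inter> cball 0 B)"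
  proof safe
    fix z assume z: "z \<in> Z"
    obtain \<omega> where \<omega>: "\<omega> \<in> \<Lambda>" "norm (z - \<omega>) \<le> B" using B by blast
    have "torus_point \<tau> z = torus_point \<tau> (z - \<omega>)"
    proof (intro equalityI subsetI)
      fix x assume "x \<in> torus_point \<tau> z"
      then obtain w where "w \<in> \<Lambda>" "x = z + w" by (auto simp: torus_point_def)
      thus "x \<in> torus_point \<tau> (z - \<omega>)" unfolding torus_point_def mem_Collect_eq
        using \<omega> by (intro exI[of _ "w + \<omega>"]) auto
    next
      fix x assume "x \<in> torus_point \<tau> (z - \<omega>)"
      then obtain w where "w \<in> \<Lambda>" "x = z - \<omega> + w" by (auto simp: torus_point_def)
      thus "x \<in> torus_point \<tau> z" unfolding torus_point_def mem_Collect_eq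
        using \<omega> by (intro exI[of _ "w - \<omega>"]) auto
    qed
    moreover have "z - \<omega> \<in> Z"
    proof -
      have "P_disc \<tau> (z - \<omega>) = P_disc \<tau> z" using P_disc_period[OF \<omega>(1), of "z - \<omega>"] by simp
      moreover have "2 * (z - \<omega>) \<notin> \<Lambda>"
      proof -
        have eq: "2 * (z - \<omega>) = 2 * z - (\<omega> + \<omega>)" by (simp add: algebra_simps)
        show ?thesis
          unfolding eq lattice_diff_right_iff[OF lattice_add[OF \<omega>(1) \<omega>(1)]] using z by (simp add: Z_def)
      qed
      ultimately show ?thesis using z by (simp add: Z_def)
    qed
    ultimately show "torus_point \<tau> z \<in> torus_point \<tau> ` (Z \<inter> cball 0 B)"
      using \<omega> by auto
  qed
  ultimately show ?thesis unfolding Z_def by (meson finite_imageI finite_subset)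
qed

end

section \<open>Equations of the log-free curve\<close>

text \<open>The last equation determines B. Given it, the third becomes 2 k (T1 - t s) = 0, which is
  what the choice of t achieves. After substituting B and T1, the left sides of the first two are -
  s (t + 2) X and s (t - 1) X, where X = 0 is the equation of the curve. As t + 2 and t - 1 have no
  common zero, either s = 0, and then T1 = 0, or X = 0.\<close>

lemma log_free_system_algebra:
  fixes P Q e k l h Z W T1 Tp Tm :: complex
  assumes kk: "k\<^sup>2 = P + Q + e" and ll: "l\<^sup>2 = W + 2 * P" and kl: "2 * l * k = 3 * P + Q + 2 * e"
    and k0: "k \<noteq> 0"
    and s: "s = Tp + Tm" and t: "t = - (Tp - Tm + l) / (2 * k)" and C: "C = - (T1 + Tp + Tm)"
  shows "(\<exists>B. C ^ 3 - 4 * C * (2 * e + 3/4 * P + 3/4 * P - T1 * h + Tp * Z - Tm * Z + B) + 4 * (- T1 * e - Tp * P - Tm * P) = 0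
        \<and> T1 ^ 3 - 4 * T1 * (2 * e + 3/4 * Q + 3/4 * Q + C * h + Tp * (Z + h + k) - Tm * (Z - h + k) + B) + 4 * (- C * e - Tp * Q - Tm * Q) = 0
        \<and> Tp\<^sup>2 = 2 * P + 2 * Q + 3/4 * W - C * Z - T1 * (Z + h + k) - Tm * (2 * Z + l) + B
        \<and> Tm\<^sup>2 = 2 * P + 2 * Q + 3/4 * W + C * Z + T1 * (Z - h + k) + Tp * (2 * Z + l) + B)
     \<longleftrightarrow> T1 = 0 \<and> s = 0 \<or> s \<noteq> 0 \<and> T1 = t * s \<and> t * (t + 1) * s\<^sup>2 = 4 * (k\<^sup>2 * t\<^sup>2 + (2 * P + e) * t + (e - Q))"
proof -
  define E0 where "E0 = (\<lambda>B. C ^ 3 - 4 * C * (2 * e + 3/4 * P + 3/4 * P - T1 * h + Tp * Z - Tm * Z + B) + 4 * (- T1 * e - Tp * P - Tm * P))"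
  define E1 where "E1 = (\<lambda>B. T1 ^ 3 - 4 * T1 * (2 * e + 3/4 * Q + 3/4 * Q + C * h + Tp * (Z + h + k) - Tm * (Z - h + k) + B) + 4 * (- C * e - Tp * Q - Tm * Q))"
  define E2 where "E2 = (\<lambda>B. Tp\<^sup>2 = 2 * P + 2 * Q + 3/4 * W - C * Z - T1 * (Z + h + k) - Tm * (2 * Z + l) + B)"
  define E3 where "E3 = (\<lambda>B. Tm\<^sup>2 = 2 * P + 2 * Q + 3/4 * W + C * Z + T1 * (Z - h + k) + Tp * (2 * Z + l) + B)"
  define X where "X = t * (t + 1) * s\<^sup>2 - 4 * (k\<^sup>2 * t\<^sup>2 + (2 * P + e) * t + (e - Q))"
  have d: "Tp - Tm = - 2 * k * t - l" using k0 by (simp add: t field_simps)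
  have Tpm: "Tp = (s - 2 * k * t - l) / 2" "Tm = (s + 2 * k * t + l) / 2"
    using d s by algebra+
  have W: "W = l\<^sup>2 - 2 * P" using ll by simp
  have E23: "E2 B \<longleftrightarrow> T1 = t * s" if "E3 B" for B
  proof -
    have "Tp\<^sup>2 - (2 * P + 2 * Q + 3/4 * W - C * Z - T1 * (Z + h + k) - Tm * (2 * Z + l) + B) = 2 * k * (T1 - t * s)"
      using that unfolding E3_def C Tpm by (simp add: field_simps) algebra
    thus ?thesis unfolding E2_def using k0 by auto
  qed
  have core: "E0 B = - (s * (t + 2) * X)" "E1 B = s * (t - 1) * X"
    if "E3 B" and T1: "T1 = t * s" for B
  proof -
    have B: "B = Tm\<^sup>2 - (2 * P + 2 * Q + 3/4 * W + C * Z + T1 * (Z - h + k) + Tp * (2 * Z + l))"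
      using that by (simp add: E3_def)
    \<comment> \<open>The values h and Z of \<zeta> and the square of l cancel; what remains of k
      and l enters through k^2 and 2 l k, which are known in terms of \<wp>.\<close>
    have b0: "2 * e + 3/4 * P + 3/4 * P - T1 * h + Tp * Z - Tm * Z + B = 
        2 * e + P - 2 * Q + s\<^sup>2 / 4 + k\<^sup>2 * t\<^sup>2 + (2 * l * k) * t"
      unfolding B W C T1 Tpm by (simp add: field_simps power2_eq_square)
    have b1: "2 * e + 3/4 * Q + 3/4 * Q + C * h + Tp * (Z + h + k) - Tm * (Z - h + k) + B = 
        2 * e - P/2 - Q/2 + s\<^sup>2 / 4 + k\<^sup>2 * t\<^sup>2 + (2 * l * k) * t - 2 * k\<^sup>2 * t - (2 * l * k) / 2"
      unfolding B W C T1 Tpm by (simp add: field_simps power2_eq_square)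
    have C': "C = - (t + 1) * s" using C T1 s by (simp add: algebra_simps)
    have s': "Tp * P + Tm * P = s * P" "Tp * Q + Tm * Q = s * Q" using s by (simp_all add: algebra_simps)
    have "E0 B = C ^ 3 - 4 * C * (2 * e + P - 2 * Q + s\<^sup>2 / 4 + (P + Q + e) * t\<^sup>2 + (3 * P + Q + 2 * e) * t) + 4 * (- T1 * e - s * P)"
      unfolding E0_def b0 kl kk using s'(1) by (simp add: algebra_simps)
    also have "\<dots> = - (s * (t + 2) * X)"
      unfolding X_def kk C' T1 by (simp add: field_simps power2_eq_square power3_eq_cube)
    finally show "E0 B = - (s * (t + 2) * X)" .
    have "E1 B = T1 ^ 3 - 4 * T1 * (2 * e - P/2 - Q/2 + s\<^sup>2 / 4 + (P + Q + e) * t\<^sup>2 + (3 * P + Q + 2 * e) * t - 2 * (P + Q + e) * t - (3 * P + Q + 2 * e) / 2)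
       + 4 * (- C * e - s * Q)"
      unfolding E1_def b1 kl kk using s'(2) by (simp add: algebra_simps)
    also have "\<dots> = s * (t - 1) * X"
      unfolding X_def kk C' T1 by (simp add: field_simps power2_eq_square power3_eq_cube)
    finally show "E1 B = s * (t - 1) * X" .
  qed
  define B0 where "B0 = Tm\<^sup>2 - (2 * P + 2 * Q + 3/4 * W + C * Z + T1 * (Z - h + k) + Tp * (2 * Z + l))"
  have B0: "E3 B0" by (simp add: E3_def B0_def)
  have "(\<exists>B. E0 B = 0 \<and> E1 B = 0 \<and> E2 B \<and> E3 B) \<longleftrightarrow> T1 = 0 \<and> s = 0 \<or> s \<noteq> 0 \<and> T1 = t * s \<and> X = 0"
  proof
    assume "\<exists>B. E0 B = 0 \<and> E1 B = 0 \<and> E2 B \<and> E3 B"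
    then obtain B where B: "E0 B = 0" "E1 B = 0" "E2 B" "E3 B" by blast
    have T1: "T1 = t * s" using E23 B by blast
    have "s * (t + 2) * X = 0" "s * (t - 1) * X = 0" using core[OF B(4) T1] B by auto
    have "s = 0 \<or> X = 0"
    proof (rule ccontr)
      assume "\<not> (s = 0 \<or> X = 0)"
      hence t2: "t + 2 = 0" and t1: "t = 1"
        using \<open>s * (t + 2) * X = 0\<close> \<open>s * (t - 1) * X = 0\<close> by auto
      from t2 show False unfolding t1 by simp
    qed
    thus "T1 = 0 \<and> s = 0 \<or> s \<noteq> 0 \<and> T1 = t * s \<and> X = 0" using T1 by auto
  next
    assume a: "T1 = 0 \<and> s = 0 \<or> s \<noteq> 0 \<and> T1 = t * s \<and> X = 0"
    hence T1: "T1 = t * s" by auto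
    have "s = 0 \<or> X = 0" using a by auto
    thus "\<exists>B. E0 B = 0 \<and> E1 B = 0 \<and> E2 B \<and> E3 B"
      using core[OF B0 T1] E23[OF B0] T1 B0 by (intro exI[of _ B0]) auto
  qed
  thus ?thesis by (simp add: E0_def E1_def E2_def E3_def X_def)
qed

context lattice
begin

section \<open>From the local criteria to the four equations\<close>

lemma avoid_lattice_ball:
  assumes "x \<notin> \<Lambda>" obtains r where "r > 0" "\<And>z. norm z < r \<Longrightarrow> z + x \<notin> \<Lambda>"
proof -
  obtain r where r: "r > 0" "ball x r \<subseteq> - \<Lambda>"
    using open_compl_lattice assms openE by (metis ComplI)
  show ?thesis
  proof (rule that[OF r(1)])
    fix z :: complex assume "norm z < r"
    hence "z + x \<in> ball x r" by (simp add: dist_norm)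
    thus "z + x \<notin> \<Lambda>" using r by auto
  qed
qed

text \<open>Near \<open>a\<close> the regular part of \<open>q\<close> consists of the three other
  poles together with H and H' from the pole at \<open>a\<close>. Since H, H' and H'' vanish at 0,
  its value and derivative at \<open>a\<close> are \<open>g0\<close> and \<open>g1\<close>.\<close>

lemma log_free_at_wp_wzeta_sum:
  assumes b: "a - b1 \<notin> \<Lambda>" "a - b2 \<notin> \<Lambda>" "a - b3 \<notin> \<Lambda>"
    and q: "\<And>z. q z = A * wp \<tau> (z - a) + C * wzeta \<tau> (z - a) + A1 * wp \<tau> (z - b1) + C1 * wzeta \<tau> (z - b1)
       + A2 * wp \<tau> (z - b2) + C2 * wzeta \<tau> (z - b2) + A3 * wp \<tau> (z - b3) + C3 * wzeta \<tau> (z - b3) + B"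
    and g0: "g0 = A1 * wp \<tau> (a - b1) + C1 * wzeta \<tau> (a - b1) + A2 * wp \<tau> (a - b2) + C2 * wzeta \<tau> (a - b2)
        + A3 * wp \<tau> (a - b3) + C3 * wzeta \<tau> (a - b3) + B"
    and g1: "g1 = A1 * deriv (wp \<tau>) (a - b1) - C1 * wp \<tau> (a - b1) + A2 * deriv (wp \<tau>) (a - b2) - C2 * wp \<tau> (a - b2)
        + A3 * deriv (wp \<tau>) (a - b3) - C3 * wp \<tau> (a - b3)"
  shows "A = 2 \<Longrightarrow> log_free_at q a \<longleftrightarrow> C ^ 3 - 4 * C * g0 + 4 * g1 = 0"
    and "A = 3/4 \<Longrightarrow> log_free_at q a \<longleftrightarrow> C\<^sup>2 = g0"
proof -
  obtain H r0 where H: "r0 > 0" "H holomorphic_on ball 0 r0" "H 0 = 0" "deriv H 0 = 0" "deriv (deriv H) 0 = 0"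
    "\<And>z. z \<in> ball 0 r0 \<Longrightarrow> wzeta \<tau> z = 1 / z + H z"
    "\<And>z. z \<in> ball 0 r0 \<Longrightarrow> wp \<tau> z = 1 / z\<^sup>2 - deriv H z"
    by (rule wzeta_near_0) blast
  obtain r1 where r1: "r1 > 0" "\<And>z. norm z < r1 \<Longrightarrow> z + (a - b1) \<notin> \<Lambda>" using avoid_lattice_ball[OF b(1)] by blast
  obtain r2 where r2: "r2 > 0" "\<And>z. norm z < r2 \<Longrightarrow> z + (a - b2) \<notin> \<Lambda>" using avoid_lattice_ball[OF b(2)] by blast
  obtain r3 where r3: "r3 > 0" "\<And>z. norm z < r3 \<Longrightarrow> z + (a - b3) \<notin> \<Lambda>" using avoid_lattice_ball[OF b(3)] by blast
  define r where "r = Min {r0, r1, r2, r3}"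
  have r: "r > 0" "r \<le> r0" "r \<le> r1" "r \<le> r2" "r \<le> r3" using H(1) r1 r2 r3 by (auto simp: r_def)
  have av: "z - b1 \<notin> \<Lambda>" "z - b2 \<notin> \<Lambda>" "z - b3 \<notin> \<Lambda>" if "z \<in> ball a r" for z
  proof -
    have "norm (z - a) < r" using that by (simp add: dist_norm norm_minus_commute)
    thus "z - b1 \<notin> \<Lambda>" "z - b2 \<notin> \<Lambda>" "z - b3 \<notin> \<Lambda>" 
      using r1(2)[of "z - a"] r2(2)[of "z - a"] r3(2)[of "z - a"] r by auto
  qed
  have in0: "z - a \<in> ball 0 r0" if "z \<in> ball a r" for z
    using that r by (simp add: dist_norm norm_minus_commute)
  define f where "f = (\<lambda>z. - A * deriv H (z - a) + C * H (z - a) + A1 * wp \<tau> (z - b1) + C1 * wzeta \<tau> (z - b1)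
       + A2 * wp \<tau> (z - b2) + C2 * wzeta \<tau> (z - b2) + A3 * wp \<tau> (z - b3) + C3 * wzeta \<tau> (z - b3) + B)"
  have hd: "deriv H holomorphic_on ball 0 r0" using H by (intro holomorphic_deriv) auto
  have sh: "((\<lambda>z. g (z - c)) has_field_derivative g' (z - c)) (at z)" 
    if "(g has_field_derivative g' (z - c)) (at (z - c))" for g g' :: "complex \<Rightarrow> complex" and c z
    using that DERIV_shift[of g "g' (z - c)" z "- c"] by simp
  have der: "(f has_field_derivative (- A * deriv (deriv H) (z - a) + C * deriv H (z - a) + A1 * deriv (wp \<tau>) (z - b1) + C1 * (- wp \<tau> (z - b1))
       + A2 * deriv (wp \<tau>) (z - b2) + C2 * (- wp \<tau> (z - b2)) + A3 * deriv (wp \<tau>) (z - b3) + C3 * (- wp \<tau> (z - b3)) + 0)) (at z)"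
    if z: "z \<in> ball a r" for z
    unfolding f_def
    by (intro DERIV_add DERIV_cmult sh[of _ "deriv _"] sh[of _ "\<lambda>z. - wp \<tau> z"] has_field_derivative_wp has_field_derivative_wzeta av z
        holomorphic_derivI[OF hd open_ball in0[OF z]] holomorphic_derivI[OF H(2) open_ball in0[OF z]] DERIV_const)
  have holf: "f holomorphic_on ball a r"
    unfolding holomorphic_on_open[OF open_ball] using der by blast
  have fa: "f a = g0" by (simp add: f_def g0 H)
  have dfa: "deriv f a = g1"
    using DERIV_imp_deriv[OF der[of a]] r(1) by (simp add: g1 H)
  have eq: "q z = A / (z - a)\<^sup>2 + C / (z - a) + f z" if "z \<in> ball a r - {a}" for z
  proof -
    have w: "wzeta \<tau> (z - a) = 1 / (z - a) + H (z - a)" "wp \<tau> (z - a) = 1 / (z - a)\<^sup>2 - deriv H (z - a)"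
      using H(6,7)[OF in0[of z]] that by auto
    show ?thesis unfolding q f_def w by (simp add: algebra_simps)
  qed
  show "A = 2 \<Longrightarrow> log_free_at q a \<longleftrightarrow> C ^ 3 - 4 * C * g0 + 4 * g1 = 0"
    using log_free_at_exponents_minus1_2[OF r(1) holf, of q C] eq by (simp add: fa dfa)
  show "A = 3/4 \<Longrightarrow> log_free_at q a \<longleftrightarrow> C\<^sup>2 = g0"
  proof -
    assume A: "A = 3/4"
    show ?thesis by (rule log_free_at_exponents_minus_half[OF r(1) holf eq[unfolded A], unfolded fa])
  qed
qed

lemma wp_deriv_minus:
  assumes "z \<notin> \<Lambda>" shows "deriv (wp \<tau>) (- z) = - deriv (wp \<tau>) z"
proof -
  have "((\<lambda>x. wp \<tau> (- x)) has_field_derivative (deriv (wp \<tau>) (- z) * (-1))) (at z)"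
    by (rule DERIV_chain2[of "wp \<tau>"]) (use has_field_derivative_wp[of "-z"] assms in \<open>auto intro!: derivative_eq_intros\<close>)
  hence "(wp \<tau> has_field_derivative (- deriv (wp \<tau>) (- z))) (at z)" by simp
  from DERIV_unique[OF this has_field_derivative_wp[OF assms]] show ?thesis by (metis minus_equation_iff)
qed

lemma wp_deriv_period:
  assumes "\<omega> \<in> \<Lambda>" shows "deriv (wp \<tau>) (z + \<omega>) = deriv (wp \<tau>) z"
  using deriv_shift[of "wp \<tau>" \<omega> z] assms by simp

definition curve_param :: "complex \<Rightarrow> complex^3 \<Rightarrow> complex" where
  "curve_param p T = - (T$2 - T$3 + lam p) / (2 * kap p)"

lemma poly_P_poly:
  assumes "2 * p \<notin> \<Lambda>"
  shows "poly (P_poly \<tau> p) t = (kap p)\<^sup>2 * t\<^sup>2 + (2 * wp \<tau> p + e1 \<tau>) * t + (e1 \<tau> - wp \<tau> (p + 1/2))"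
  unfolding kap_squared[OF assms] by (simp add: P_poly_def algebra_simps power2_eq_square)

theorem log_free_curve_iff:
  assumes p: "2 * p \<notin> \<Lambda>"
  shows "T \<in> log_free_curve \<tau> p \<longleftrightarrow> T$1 = 0 \<and> T$2 + T$3 = 0 \<or>
     T$2 + T$3 \<noteq> 0 \<and> T$1 = curve_param p T * (T$2 + T$3) \<and> 
     curve_param p T * (curve_param p T + 1) * (T$2 + T$3)\<^sup>2 = 4 * poly (P_poly \<tau> p) (curve_param p T)"
proof -
  note n = double_not_lattice[OF p]
  define P Q e k l h Z W where "P = wp \<tau> p" "Q = wp \<tau> (p + 1/2)" "e = e1 \<tau>" "k = kap p" "l = lam p"
    "h = wzeta \<tau> (1/2)" "Z = wzeta \<tau> p" "W = wp \<tau> (2 * p)"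
  note defs = this
  define T1 Tp Tm where "T1 = T$1" "Tp = T$2" "Tm = T$3"
  \<comment> \<open>The residue at 0: collecting the \<zeta> terms, the four coefficients add up to
    zero.\<close>
  define C where "C = - (T1 + Tp + Tm)"
  have zs: "wzeta \<tau> (p + 1/2) = Z + h + k" "wzeta \<tau> (p - 1/2) = Z - h + k" "wzeta \<tau> (2 * p) = 2 * Z + l"
  proof -
    show 1: "wzeta \<tau> (p + 1/2) = Z + h + k" by (simp add: defs kap_def phi_def)
    show "wzeta \<tau> (p - 1/2) = Z - h + k"
      using wzeta_period_const[of 1 "p - 1/2"] 1 by (simp add: defs algebra_simps)
    have "2 * p = p + p" by simp
    thus "wzeta \<tau> (2 * p) = 2 * Z + l" by (simp add: defs lam_def phi_def)
  qed
  have zm: "wzeta \<tau> (- p) = - Z" "wzeta \<tau> (- (1/2)) = - h" "wzeta \<tau> (- p - 1/2) = - (Z + h + k)" 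
     "wzeta \<tau> (1/2 - p) = - (Z - h + k)" "wzeta \<tau> (- p - p) = - (2 * Z + l)" "wzeta \<tau> (p + p) = 2 * Z + l" "wzeta \<tau> (1/2 + p) = Z + h + k"
    using wzeta_minus[of p] wzeta_minus[of "1/2"] wzeta_minus[of "p + 1/2"] wzeta_minus[of "p - 1/2"] wzeta_minus[of "2 * p"] zs
    by (simp_all add: defs algebra_simps)
  have ps: "wp \<tau> (- p - 1/2) = Q" "wp \<tau> (1/2 - p) = Q" "wp \<tau> (- p - p) = W" "wp \<tau> (p + p) = W" "wp \<tau> (p - 1/2) = Q" "wp \<tau> (1/2 + p) = Q"
     "wp \<tau> (1/2) = e" "wp \<tau> (-p) = P"
    using wp_minus[of "p + 1/2"] wp_minus[of "p - 1/2"] wp_minus[of "2 * p"] wp_minus_half[of p] wp_minus[of "1/2"] wp_minus[of p]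
    by (simp_all add: defs e1_def algebra_simps)
  have dps: "deriv (wp \<tau>) (- (1/2)) = 0" "deriv (wp \<tau>) (- p) = - deriv (wp \<tau>) p" "deriv (wp \<tau>) (1/2 - p) = - deriv (wp \<tau>) (1/2 + p)"
  proof -
    show "deriv (wp \<tau>) (- (1/2)) = 0" using wp_deriv_minus[OF half_not_lattice] wp_deriv_half by simp
    show "deriv (wp \<tau>) (- p) = - deriv (wp \<tau>) p" by (rule wp_deriv_minus[OF n(1)])
    have "deriv (wp \<tau>) (1/2 - p) = - deriv (wp \<tau>) (p - 1/2)" using wp_deriv_minus[OF n(5)] by simp
    also have "deriv (wp \<tau>) (p - 1/2) = deriv (wp \<tau>) (1/2 + p)"
      using wp_deriv_period[of 1 "p - 1/2"] by (simp add: algebra_simps)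
    finally show "deriv (wp \<tau>) (1/2 - p) = - deriv (wp \<tau>) (1/2 + p)" .
  qed
  have nl: "- (1/2) \<notin> \<Lambda>" "- p \<notin> \<Lambda>" "1/2 + p \<notin> \<Lambda>" "1/2 - p \<notin> \<Lambda>" "- p - 1/2 \<notin> \<Lambda>" "- p - p \<notin> \<Lambda>"
    using n half_not_lattice lattice_minus_iff[of "1/2"] lattice_minus_iff[of "p + 1/2"] lattice_minus_iff[of "p - 1/2"] lattice_minus_iff[of "p + p"]
    by (simp_all add: add.commute)
  have q: "potential \<tau> p T1 Tp Tm B z = 2 * wp \<tau> z + C * wzeta \<tau> z + 2 * wp \<tau> (z - 1/2) + T1 * wzeta \<tau> (z - 1/2)
      + 3/4 * wp \<tau> (z + p) + Tp * wzeta \<tau> (z + p) + 3/4 * wp \<tau> (z - p) + Tm * wzeta \<tau> (z - p) + B" for B z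
    by (simp add: potential_def C_def algebra_simps)
  have L0: "log_free_at (potential \<tau> p T1 Tp Tm B) 0 \<longleftrightarrow> 
     C ^ 3 - 4 * C * (2 * e + 3/4 * P + 3/4 * P - T1 * h + Tp * Z - Tm * Z + B) + 4 * (- T1 * e - Tp * P - Tm * P) = 0" for B
    by (rule log_free_at_wp_wzeta_sum(1)[of 0 "1/2" "-p" p _ 2 C 2 T1 "3/4" Tp "3/4" Tm B])
       (use n nl q in \<open>simp_all add: zm ps dps defs\<close>)
  have L1: "log_free_at (potential \<tau> p T1 Tp Tm B) (1/2) \<longleftrightarrow> 
     T1 ^ 3 - 4 * T1 * (2 * e + 3/4 * Q + 3/4 * Q + C * h + Tp * (Z + h + k) - Tm * (Z - h + k) + B) + 4 * (- C * e - Tp * Q - Tm * Q) = 0" for B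
    by (rule log_free_at_wp_wzeta_sum(1)[of "1/2" 0 "-p" p _ 2 T1 2 C "3/4" Tp "3/4" Tm B])
       (use n nl q in \<open>simp_all add: zm ps dps wp_deriv_half defs right_diff_distrib distrib_left\<close>)
  have L2: "log_free_at (potential \<tau> p T1 Tp Tm B) (-p) \<longleftrightarrow> 
     Tp\<^sup>2 = 2 * P + 2 * Q + 3/4 * W - C * Z - T1 * (Z + h + k) - Tm * (2 * Z + l) + B" for B
    by (rule log_free_at_wp_wzeta_sum(2)[of "-p" 0 "1/2" p _ "3/4" Tp 2 C 2 T1 "3/4" Tm B])
       (use n nl q in \<open>simp_all add: zm zs ps defs wzeta_minus right_diff_distrib distrib_left\<close>)
  have L3: "log_free_at (potential \<tau> p T1 Tp Tm B) p \<longleftrightarrow> 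
     Tm\<^sup>2 = 2 * P + 2 * Q + 3/4 * W + C * Z + T1 * (Z - h + k) + Tp * (2 * Z + l) + B" for B
    by (rule log_free_at_wp_wzeta_sum(2)[of p 0 "1/2" "-p" _ "3/4" Tm 2 C 2 T1 "3/4" Tp B])
       (use n nl q in \<open>simp_all add: zm zs ps defs\<close>)
  have "T \<in> log_free_curve \<tau> p \<longleftrightarrow> (\<exists>B. C ^ 3 - 4 * C * (2 * e + 3/4 * P + 3/4 * P - T1 * h + Tp * Z - Tm * Z + B) + 4 * (- T1 * e - Tp * P - Tm * P) = 0
        \<and> T1 ^ 3 - 4 * T1 * (2 * e + 3/4 * Q + 3/4 * Q + C * h + Tp * (Z + h + k) - Tm * (Z - h + k) + B) + 4 * (- C * e - Tp * Q - Tm * Q) = 0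
        \<and> Tp\<^sup>2 = 2 * P + 2 * Q + 3/4 * W - C * Z - T1 * (Z + h + k) - Tm * (2 * Z + l) + B
        \<and> Tm\<^sup>2 = 2 * P + 2 * Q + 3/4 * W + C * Z + T1 * (Z - h + k) + Tp * (2 * Z + l) + B)"
    unfolding log_free_curve_def T1_Tp_Tm_def[symmetric] mem_Collect_eq L0[symmetric] L1[symmetric] L2[symmetric] L3[symmetric]
    by blast
  also have "\<dots> \<longleftrightarrow> T1 = 0 \<and> Tp + Tm = 0 \<or> Tp + Tm \<noteq> 0 \<and> T1 = curve_param p T * (Tp + Tm) \<and> 
     curve_param p T * (curve_param p T + 1) * (Tp + Tm)\<^sup>2 = 4 * (k\<^sup>2 * (curve_param p T)\<^sup>2 + (2 * P + e) * curve_param p T + (e - Q))"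
  proof (rule log_free_system_algebra)
    show "k\<^sup>2 = P + Q + e" "l\<^sup>2 = W + 2 * P" "2 * l * k = 3 * P + Q + 2 * e" "k \<noteq> 0"
      unfolding defs using kap_squared[OF p] lam_squared[OF p] lam_kap[OF p] nonzero_facts[OF p] by auto
    show "curve_param p T = - (Tp - Tm + l) / (2 * k)" by (simp add: curve_param_def defs T1_Tp_Tm_def)
  qed (auto simp: C_def)
  finally show ?thesis unfolding poly_P_poly[OF p] by (simp add: defs T1_Tp_Tm_def)
qed

end

section \<open>Forms and projective sets\<close>

lemma finite_bounded_exponents: "finite {\<alpha> :: 'n::finite \<Rightarrow> nat. sum \<alpha> UNIV \<le> d}"
proof (rule finite_subset)
  show "{\<alpha> :: 'n \<Rightarrow> nat. sum \<alpha> UNIV \<le> d} \<subseteq> PiE UNIV (\<lambda>_. {..d})"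
  proof
    fix \<alpha> :: "'n \<Rightarrow> nat" assume a: "\<alpha> \<in> {\<alpha>. sum \<alpha> UNIV \<le> d}"
    have "\<alpha> i \<le> d" for i
      using a member_le_sum[of i UNIV \<alpha>] by auto
    thus "\<alpha> \<in> PiE UNIV (\<lambda>_. {..d})" by auto
  qed
qed (auto intro: finite_PiE)

lemma finite_exponents: "finite {\<alpha> :: 'n::finite \<Rightarrow> nat. sum \<alpha> UNIV = d}"
  by (rule finite_subset[OF _ finite_bounded_exponents[of d]]) auto

lemma forms_0 [intro]: "(\<lambda>x. 0) \<in> forms d"
  unfolding forms_def by (auto intro!: exI[of _ "\<lambda>_. 0"])

lemma forms_add [intro]:
  assumes "F \<in> forms d" "G \<in> forms d" shows "(\<lambda>x. F x + G x) \<in> forms d"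
proof -
  obtain a b where "F = (\<lambda>x. \<Sum>\<alpha> | sum \<alpha> UNIV = d. a \<alpha> * monom_fun \<alpha> x)"
    "G = (\<lambda>x. \<Sum>\<alpha> | sum \<alpha> UNIV = d. b \<alpha> * monom_fun \<alpha> x)"
    using assms unfolding forms_def by blast
  thus ?thesis unfolding forms_def mem_Collect_eq
    by (intro exI[of _ "\<lambda>\<alpha>. a \<alpha> + b \<alpha>"]) (auto simp: distrib_right sum.distrib)
qed

lemma forms_scale [intro]:
  assumes "F \<in> forms d" shows "(\<lambda>x. c * F x) \<in> forms d"
proof -
  obtain a where "F = (\<lambda>x. \<Sum>\<alpha> | sum \<alpha> UNIV = d. a \<alpha> * monom_fun \<alpha> x)"
    using assms unfolding forms_def by blast
  thus ?thesis unfolding forms_def mem_Collect_eq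
    by (intro exI[of _ "\<lambda>\<alpha>. c * a \<alpha>"]) (auto simp: sum_distrib_left mult.assoc)
qed

lemma forms_uminus [intro]: "F \<in> forms d \<Longrightarrow> (\<lambda>x. - F x) \<in> forms d"
  using forms_scale[of F d "-1"] by simp

lemma forms_diff [intro]:
  assumes "F \<in> forms d" "G \<in> forms d" shows "(\<lambda>x. F x - G x) \<in> forms d"
  using forms_add[OF assms(1) forms_uminus[OF assms(2)]] by simp

lemma forms_sum [intro]:
  assumes "\<And>i. i \<in> I \<Longrightarrow> F i \<in> forms d" shows "(\<lambda>x. \<Sum>i\<in>I. F i x) \<in> forms d"
  using assms by (induction I rule: infinite_finite_induct) auto

lemma monom_fun_in_forms: "sum \<alpha> UNIV = d \<Longrightarrow> monom_fun \<alpha> \<in> forms d"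
proof -
  assume d: "sum \<alpha> UNIV = d"
  have "(\<Sum>\<beta> | sum \<beta> UNIV = d. (if \<beta> = \<alpha> then 1 else 0) * monom_fun \<beta> x) = monom_fun \<alpha> x" for x
  proof -
    have "(\<Sum>\<beta> | sum \<beta> UNIV = d. (if \<beta> = \<alpha> then 1 else 0) * monom_fun \<beta> x) =
        (\<Sum>\<beta> | sum \<beta> UNIV = d. if \<beta> = \<alpha> then monom_fun \<beta> x else 0)"
      by (intro sum.cong) auto
    thus ?thesis using d by (simp add: sum.delta finite_exponents)
  qed
  thus ?thesis unfolding forms_def mem_Collect_eq
    by (intro exI[of _ "\<lambda>\<beta>. if \<beta> = \<alpha> then 1 else 0"]) (auto simp: fun_eq_iff)
qed

lemma forms_induct [consumes 1, case_names sum]: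
  assumes F: "F \<in> forms d"
    and "\<And>c. P (\<lambda>x. \<Sum>\<alpha> | sum \<alpha> UNIV = d. c \<alpha> * monom_fun \<alpha> x)"
  shows "P F"
  using assms unfolding forms_def by blast

lemma monom_fun_mult: "monom_fun \<alpha> x * monom_fun \<beta> x = monom_fun (\<lambda>i. \<alpha> i + \<beta> i) x"
  by (simp add: monom_fun_def prod.distrib[symmetric] power_add)

lemma forms_mult [intro]:
  assumes "F \<in> forms d" "G \<in> forms e" shows "(\<lambda>x. F x * G x) \<in> forms (d + e)"
proof -
  obtain a b where FG: "F = (\<lambda>x. \<Sum>\<alpha> | sum \<alpha> UNIV = d. a \<alpha> * monom_fun \<alpha> x)"
    "G = (\<lambda>x. \<Sum>\<alpha> | sum \<alpha> UNIV = e. b \<alpha> * monom_fun \<alpha> x)"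
    using assms unfolding forms_def by blast
  have eq: "(\<lambda>x. F x * G x) = (\<lambda>x. \<Sum>\<alpha> | sum \<alpha> UNIV = d. \<Sum>\<beta> | sum \<beta> UNIV = e. (a \<alpha> * b \<beta>) * monom_fun (\<lambda>i. \<alpha> i + \<beta> i) x)"
    unfolding FG by (auto simp: sum_product monom_fun_mult[symmetric] fun_eq_iff mult_ac)
  show ?thesis unfolding eq
    by (intro forms_sum forms_scale monom_fun_in_forms) (auto simp: sum.distrib)
qed

lemma forms_const: "(\<lambda>x. c) \<in> forms 0"
proof -
  have "(\<lambda>x. c * monom_fun (\<lambda>_. 0) x) \<in> forms 0"
    by (intro forms_scale monom_fun_in_forms) auto
  thus ?thesis by (simp add: monom_fun_def)
qed

lemma forms_power [intro]: "F \<in> forms d \<Longrightarrow> (\<lambda>x. F x ^ k) \<in> forms (k * d)"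
proof (induction k)
  case (Suc k)
  thus ?case using forms_mult[of F d "\<lambda>x. F x ^ k" "k * d"] by (simp add: algebra_simps)
qed (use forms_const[of 1] in simp)

lemma forms_coord [intro]: "(\<lambda>x. x $ i) \<in> forms 1"
proof -
  have "monom_fun (\<lambda>j. if j = i then 1 else 0) \<in> (forms 1 :: (complex^'a::finite \<Rightarrow> complex) set)"
    by (intro monom_fun_in_forms) simp
  moreover have "monom_fun (\<lambda>j. if j = i then 1 else 0) = (\<lambda>x :: complex^'a. x $ i)"
  proof
    fix x :: "complex^'a"
    have "(\<Prod>j\<in>UNIV. x $ j ^ (if j = i then 1 else 0)) = (\<Prod>j\<in>UNIV. if j = i then x $ j else 1)"
      by (intro prod.cong) auto
    thus "monom_fun (\<lambda>j. if j = i then 1 else 0) x = x $ i"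
      by (simp add: monom_fun_def prod.delta)
  qed
  ultimately show ?thesis by simp
qed

lemma forms_prod [intro]:
  assumes "\<And>i. i \<in> I \<Longrightarrow> F i \<in> forms (e i)" "finite I"
  shows "(\<lambda>x. \<Prod>i\<in>I. F i x) \<in> forms (sum e I)"
  using assms(2,1)
proof (induction I rule: finite_induct)
  case (insert i I)
  thus ?case using forms_mult[of "F i" "e i" "\<lambda>x. \<Prod>i\<in>I. F i x" "sum e I"] by simp
qed (use forms_const[of 1] in simp)

lemma forms_compose:
  assumes "F \<in> forms d" "\<And>i. G i \<in> forms e"
  shows "(\<lambda>x. F (\<chi> i. G i x)) \<in> forms (d * e)"
proof -
  obtain a where F: "F = (\<lambda>x. \<Sum>\<alpha> | sum \<alpha> UNIV = d. a \<alpha> * monom_fun \<alpha> x)"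
    using assms unfolding forms_def by blast
  show ?thesis unfolding F monom_fun_def
  proof (intro forms_sum forms_scale)
    fix \<alpha> :: "'a \<Rightarrow> nat" assume "\<alpha> \<in> {\<alpha>. sum \<alpha> UNIV = d}"
    hence "(\<Sum>i\<in>UNIV. \<alpha> i * e) = d * e" by (simp add: sum_distrib_right[symmetric])
    moreover have "(\<lambda>x. \<Prod>i\<in>UNIV. (G i x) ^ \<alpha> i) \<in> forms (\<Sum>i\<in>UNIV. \<alpha> i * e)"
      using assms(2) by (intro forms_prod forms_power) auto
    ultimately show "(\<lambda>x. \<Prod>i\<in>UNIV. (\<chi> i. G i x) $ i ^ \<alpha> i) \<in> forms (d * e)" by simp
  qed
qed

lemma forms_homogeneous:
  assumes "F \<in> forms d" shows "F (c *s x) = c ^ d * F x"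
  using assms
proof (induction rule: forms_induct)
  case (sum a)
  have "monom_fun \<alpha> (c *s x) = c ^ d * monom_fun \<alpha> x" if "sum \<alpha> UNIV = d" for \<alpha>
    using that power_sum[of c \<alpha> UNIV] by (simp add: monom_fun_def power_mult_distrib prod.distrib)
  thus ?case by (auto simp: sum_distrib_left intro!: sum.cong)
qed

lemma polys_upto_add:
  assumes "F \<in> polys_upto d" "G \<in> polys_upto d" shows "(\<lambda>x. F x + G x) \<in> polys_upto d"
proof -
  obtain a b where "F = (\<lambda>x. \<Sum>\<alpha> | sum \<alpha> UNIV \<le> d. a \<alpha> * monom_fun \<alpha> x)"
    "G = (\<lambda>x. \<Sum>\<alpha> | sum \<alpha> UNIV \<le> d. b \<alpha> * monom_fun \<alpha> x)"
    using assms unfolding polys_upto_def by blast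
  thus ?thesis unfolding polys_upto_def mem_Collect_eq
    by (intro exI[of _ "\<lambda>\<alpha>. a \<alpha> + b \<alpha>"]) (auto simp: distrib_right sum.distrib)
qed

lemma polys_upto_scale:
  assumes "F \<in> polys_upto d" shows "(\<lambda>x. c * F x) \<in> polys_upto d"
proof -
  obtain a where "F = (\<lambda>x. \<Sum>\<alpha> | sum \<alpha> UNIV \<le> d. a \<alpha> * monom_fun \<alpha> x)"
    using assms unfolding polys_upto_def by blast
  thus ?thesis unfolding polys_upto_def mem_Collect_eq
    by (intro exI[of _ "\<lambda>\<alpha>. c * a \<alpha>"]) (auto simp: sum_distrib_left mult.assoc)
qed

lemma polys_upto_0: "(\<lambda>x. 0) \<in> polys_upto d"
  unfolding polys_upto_def by (auto intro!: exI[of _ "\<lambda>_. 0"])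

lemma polys_upto_sum:
  assumes "\<And>i. i \<in> I \<Longrightarrow> F i \<in> polys_upto d" shows "(\<lambda>x. \<Sum>i\<in>I. F i x) \<in> polys_upto d"
  using assms by (induction I rule: infinite_finite_induct) (auto intro: polys_upto_0 polys_upto_add)

lemma monom_fun_in_polys_upto: "sum \<alpha> UNIV \<le> d \<Longrightarrow> monom_fun \<alpha> \<in> polys_upto d"
proof -
  assume d: "sum \<alpha> UNIV \<le> d"
  have "(\<Sum>\<beta> | sum \<beta> UNIV \<le> d. (if \<beta> = \<alpha> then 1 else 0) * monom_fun \<beta> x) = monom_fun \<alpha> x" for x
  proof -
    have "(\<Sum>\<beta> | sum \<beta> UNIV \<le> d. (if \<beta> = \<alpha> then 1 else 0) * monom_fun \<beta> x) =
        (\<Sum>\<beta> | sum \<beta> UNIV \<le> d. if \<beta> = \<alpha> then monom_fun \<beta> x else 0)"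
      by (intro sum.cong) auto
    thus ?thesis using d by (simp add: sum.delta finite_bounded_exponents)
  qed
  thus ?thesis unfolding polys_upto_def mem_Collect_eq
    by (intro exI[of _ "\<lambda>\<beta>. if \<beta> = \<alpha> then 1 else 0"]) (auto simp: fun_eq_iff)
qed

section \<open>Homogeneous coordinates and affine charts\<close>

definition lift_affine :: "complex^'n::finite \<Rightarrow> complex^('n option)" where
  "lift_affine v = (\<chi> j. case j of None \<Rightarrow> 1 | Some i \<Rightarrow> v $ i)"

lemma lift_affine_nth [simp]: "lift_affine v $ None = 1" "lift_affine v $ Some i = v $ i"
  by (simp_all add: lift_affine_def)

lemma prod_UNIV_option: "(\<Prod>j\<in>UNIV. f j) = f None * (\<Prod>i\<in>UNIV. f (Some i))"
  for f :: "'n::finite option \<Rightarrow> 'b::comm_monoid_mult"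
  by (simp add: UNIV_option_conv prod.reindex)

lemma sum_UNIV_option: "(\<Sum>j\<in>UNIV. f j) = f None + (\<Sum>i\<in>UNIV. f (Some i))"
  for f :: "'n::finite option \<Rightarrow> 'b::comm_monoid_add"
  by (simp add: UNIV_option_conv sum.reindex)

text \<open>This links the two closures: \<open>affine_closure\<close> tests polynomials,
  \<open>proj_closure\<close> tests forms, and a form vanishing on the cone over an affine set
  restricts to a polynomial vanishing on the set.\<close>

lemma dehomogenize:
  assumes "F \<in> forms d" shows "(\<lambda>v. F (lift_affine v)) \<in> polys_upto d"
  using assms
proof (induction rule: forms_induct)
  case (sum a)
  show ?case
  proof (intro polys_upto_sum polys_upto_scale)
    fix \<alpha> :: "'a option \<Rightarrow> nat" assume a: "\<alpha> \<in> {\<alpha>. sum \<alpha> UNIV = d}"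
    have "(\<lambda>v. monom_fun \<alpha> (lift_affine v)) = monom_fun (\<lambda>i. \<alpha> (Some i))"
      by (simp add: monom_fun_def prod_UNIV_option fun_eq_iff)
    moreover have "(\<Sum>i\<in>UNIV. \<alpha> (Some i)) \<le> d" using a by (auto simp: sum_UNIV_option)
    ultimately show "(\<lambda>v. monom_fun \<alpha> (lift_affine v)) \<in> polys_upto d"
      using monom_fun_in_polys_upto[of "\<lambda>i. \<alpha> (Some i)" d] by simp
  qed
qed

lemma affine_chart_iff: "x \<in> affine_chart A \<longleftrightarrow> (\<exists>c v. c \<noteq> 0 \<and> v \<in> A \<and> x = c *s lift_affine v)"
proof
  assume x: "x \<in> affine_chart A"
  define v where "v = (\<chi> i. x $ Some i / x $ None)"
  have "x = (x $ None) *s lift_affine v"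
    using x by (simp add: vec_eq_iff v_def lift_affine_def affine_chart_def split: option.split)
  thus "\<exists>c v. c \<noteq> 0 \<and> v \<in> A \<and> x = c *s lift_affine v"
    using x by (auto simp: affine_chart_def v_def)
next
  assume "\<exists>c v. c \<noteq> 0 \<and> v \<in> A \<and> x = c *s lift_affine v"
  then obtain c v where c: "c \<noteq> 0" "v \<in> A" "x = c *s lift_affine v" by blast
  have "(\<chi> i. x $ Some i / x $ None) = v" using c by (simp add: vec_eq_iff)
  thus "x \<in> affine_chart A" using c by (simp add: affine_chart_def)
qed

lemma lift_in_affine_chart: "v \<in> A \<Longrightarrow> lift_affine v \<in> affine_chart A"
  unfolding affine_chart_iff by (rule exI[of _ 1]) auto

lemma forms_vanish_affine_chart:
  assumes "F \<in> forms d" "\<And>v. v \<in> A \<Longrightarrow> F (lift_affine v) = 0" "x \<in> affine_chart A"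
  shows "F x = 0"
  using assms(3) unfolding affine_chart_iff by (auto simp: forms_homogeneous[OF assms(1)] assms(2))

section \<open>Zariski closed subsets of projective space\<close>

lemma proj_closureI:
  assumes "x \<noteq> 0" "\<And>d F. F \<in> forms d \<Longrightarrow> (\<And>a. a \<in> A \<Longrightarrow> F a = 0) \<Longrightarrow> F x = 0"
  shows "x \<in> proj_closure A"
  using assms by (auto simp: proj_closure_def)

lemma proj_closure_vanish:
  assumes "F \<in> forms d" "\<And>a. a \<in> A \<Longrightarrow> F a = 0" "x \<in> proj_closure A" shows "F x = 0"
  using assms by (auto simp: proj_closure_def)

lemma proj_closure_extensive: "x \<in> A \<Longrightarrow> x \<noteq> 0 \<Longrightarrow> x \<in> proj_closure A"
  by (rule proj_closureI) auto

lemma proj_closure_nonzero: "x \<in> proj_closure A \<Longrightarrow> x \<noteq> 0"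
  by (simp add: proj_closure_def)

lemma proj_closure_scale:
  assumes "x \<in> proj_closure A" "c \<noteq> 0" shows "c *s x \<in> proj_closure A"
proof (rule proj_closureI)
  show "c *s x \<noteq> 0" using assms proj_closure_nonzero[OF assms(1)] by (simp add: vec_eq_iff)
  show "F (c *s x) = 0" if "F \<in> forms d" "\<And>a. a \<in> A \<Longrightarrow> F a = 0" for d F
    using forms_homogeneous[OF that(1)] proj_closure_vanish[OF that assms(1)] by simp
qed

lemma proj_closed_closure: "proj_closed (proj_closure A)"
  unfolding proj_closed_def
proof (intro equalityI subsetI)
  fix x assume x: "x \<in> proj_closure (proj_closure A)"
  show "x \<in> proj_closure A"
  proof (rule proj_closureI)
    show "F x = 0" if F: "F \<in> forms d" "\<And>a. a \<in> A \<Longrightarrow> F a = 0" for d F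
      by (rule proj_closure_vanish[OF F(1) _ x]) (rule proj_closure_vanish[OF F])
  qed (rule proj_closure_nonzero[OF x])
next
  fix x assume x: "x \<in> proj_closure A"
  show "x \<in> proj_closure (proj_closure A)"
    by (rule proj_closure_extensive[OF x proj_closure_nonzero[OF x]])
qed

lemma proj_closed_nonzero: "proj_closed Z \<Longrightarrow> x \<in> Z \<Longrightarrow> x \<noteq> 0"
  unfolding proj_closed_def using proj_closure_nonzero by blast

lemma proj_closed_scale: "proj_closed Z \<Longrightarrow> x \<in> Z \<Longrightarrow> c \<noteq> 0 \<Longrightarrow> c *s x \<in> Z"
  unfolding proj_closed_def using proj_closure_scale by metis

lemma proj_closed_separate:
  assumes "proj_closed Z" "x \<noteq> 0" "x \<notin> Z"
  obtains d F where "F \<in> forms d" "\<And>z. z \<in> Z \<Longrightarrow> F z = 0" "F x \<noteq> 0"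
proof -
  have "x \<notin> proj_closure Z" using assms by (simp add: proj_closed_def)
  then obtain d F where "F \<in> forms d" "\<forall>a\<in>Z. F a = 0" "F x \<noteq> 0"
    using assms(2) unfolding proj_closure_def mem_Collect_eq by blast
  thus ?thesis using that by blast
qed

lemma proj_closed_zero_set:
  assumes "\<And>F. F \<in> S \<Longrightarrow> \<exists>d. F \<in> forms d"
  shows "proj_closed {x. x \<noteq> 0 \<and> (\<forall>F\<in>S. F x = 0)}" (is "proj_closed ?Z")
  unfolding proj_closed_def
proof (intro equalityI subsetI)
  fix x assume x: "x \<in> proj_closure ?Z"
  have "F x = 0" if "F \<in> S" for F
  proof -
    obtain d where "F \<in> forms d" using assms \<open>F \<in> S\<close> by blast
    thus ?thesis by (rule proj_closure_vanish[OF _ _ x]) (use \<open>F \<in> S\<close> in auto)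
  qed
  thus "x \<in> ?Z" using proj_closure_nonzero[OF x] by blast
qed (auto intro: proj_closure_extensive)

lemma proj_closed_empty: "proj_closed {}"
proof -
  have "{} = {x. x \<noteq> 0 \<and> (\<forall>F\<in>{\<lambda>x. 1 :: complex}. F x = 0)}" by auto
  thus ?thesis using proj_closed_zero_set[of "{\<lambda>x. 1}"] forms_const[of 1] by auto
qed

lemma proj_closed_hypersurface: "F \<in> forms d \<Longrightarrow> proj_closed {x. x \<noteq> 0 \<and> F x = 0}"
  using proj_closed_zero_set[of "{F}"] by auto

lemma proj_open_in_self: "proj_open_in X X"
  unfolding proj_open_in_def by (intro exI[of _ "{}"]) (auto simp: proj_closed_empty)

lemma proj_open_in_nonvanishing:
  assumes "F \<in> forms d" "\<And>x. x \<in> X \<Longrightarrow> x \<noteq> 0"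
  shows "proj_open_in X {x \<in> X. F x \<noteq> 0}"
  unfolding proj_open_in_def
  by (rule exI[of _ "{x. x \<noteq> 0 \<and> F x = 0}"]) (use assms proj_closed_hypersurface in auto)

lemma proj_closed_Un:
  assumes "proj_closed A" "proj_closed B" shows "proj_closed (A \<union> B)"
  unfolding proj_closed_def
proof (intro equalityI subsetI)
  fix x assume x: "x \<in> proj_closure (A \<union> B)"
  show "x \<in> A \<union> B"
  proof (rule ccontr)
    assume "x \<notin> A \<union> B"
    hence nA: "x \<notin> A" and nB: "x \<notin> B" by auto
    have x0: "x \<noteq> 0" using proj_closure_nonzero[OF x] .
    obtain d F where F: "F \<in> forms d" "\<And>z. z \<in> A \<Longrightarrow> F z = 0" "F x \<noteq> 0"
      by (rule proj_closed_separate[OF assms(1) x0 nA]) blast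
    obtain e G where G: "G \<in> forms e" "\<And>z. z \<in> B \<Longrightarrow> G z = 0" "G x \<noteq> 0"
      by (rule proj_closed_separate[OF assms(2) x0 nB]) blast
    have "F x * G x = 0"
      by (rule proj_closure_vanish[OF forms_mult[OF F(1) G(1)] _ x]) (use F G in auto)
    thus False using F G by simp
  qed
qed (use assms proj_closed_nonzero in \<open>auto intro!: proj_closure_extensive\<close>)

lemma proj_point_self: "x \<in> proj_point x"
  unfolding proj_point_def by (auto intro!: exI[of _ 1])

lemma proj_point_scale: "c \<noteq> 0 \<Longrightarrow> proj_point (c *s x) = proj_point x"
proof -
  assume c: "c \<noteq> 0"
  show ?thesis unfolding proj_point_def
  proof (intro equalityI subsetI)
    fix y assume "y \<in> {a *s (c *s x) |a. a \<noteq> 0}"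
    then obtain a where "a \<noteq> 0" "y = a *s (c *s x)" by blast
    thus "y \<in> {c *s x |c. c \<noteq> 0}" using c by (auto intro!: exI[of _ "a * c"] simp: vector_smult_assoc)
  next
    fix y assume "y \<in> {c *s x |c. c \<noteq> 0}"
    then obtain a where "a \<noteq> 0" "y = a *s x" by blast
    thus "y \<in> {a *s (c *s x) |a. a \<noteq> 0}" using c by (auto intro!: exI[of _ "a / c"] simp: vector_smult_assoc)
  qed
qed

lemma proj_point_eqI: "y \<in> proj_point x \<Longrightarrow> proj_point y = proj_point x"
proof -
  assume "y \<in> proj_point x"
  then obtain c where "c \<noteq> 0" "y = c *s x" unfolding proj_point_def by blast
  thus ?thesis by (simp add: proj_point_scale)
qed

lemma proj_closed_point:
  assumes x: "x \<noteq> 0" shows "proj_closed (proj_point x)"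
proof -
  \<comment> \<open>The two-by-two minors of the pair (x, y); they vanish exactly when y is
    proportional to x.\<close>
  define S where "S = {(\<lambda>y :: complex^'a. x $ i * y $ j - x $ j * y $ i) | i j. True}"
  have eq: "proj_point x = {y. y \<noteq> 0 \<and> (\<forall>F\<in>S. F y = 0)}"
  proof (intro equalityI subsetI)
    fix y assume "y \<in> proj_point x"
    then obtain c where "c \<noteq> 0" "y = c *s x" by (auto simp: proj_point_def)
    thus "y \<in> {y. y \<noteq> 0 \<and> (\<forall>F\<in>S. F y = 0)}" using x by (auto simp: S_def vec_eq_iff)
  next
    fix y assume y: "y \<in> {y. y \<noteq> 0 \<and> (\<forall>F\<in>S. F y = 0)}"
    obtain i where i: "x $ i \<noteq> 0" using x by (auto simp: vec_eq_iff)
    have e: "x $ i * y $ j = x $ j * y $ i" for j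
    proof -
      have "(\<lambda>y :: complex^'a. x $ i * y $ j - x $ j * y $ i) \<in> S" unfolding S_def by blast
      thus ?thesis using y by fastforce
    qed
    hence eq: "y = (y $ i / x $ i) *s x" using i by (simp add: vec_eq_iff field_simps)
    moreover have "y $ i / x $ i \<noteq> 0"
    proof
      assume "y $ i / x $ i = 0"
      hence "y = 0 *s x" using eq by (simp only:)
      hence "y = 0" by simp
      thus False using y by simp
    qed
    ultimately show "y \<in> proj_point x" by (auto simp: proj_point_def)
  qed
  show ?thesis unfolding eq
  proof (rule proj_closed_zero_set)
    fix F assume "F \<in> S"
    then obtain i j where F: "F = (\<lambda>y :: complex^'a. x $ i * y $ j - x $ j * y $ i)" by (auto simp: S_def)
    have "F \<in> forms 1" unfolding F by (intro forms_diff forms_scale forms_coord)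
    thus "\<exists>d. F \<in> forms d" by blast
  qed
qed

lemma proj_closed_finite_points:
  assumes "finite (proj_point ` Z)" "\<And>z. z \<in> Z \<Longrightarrow> z \<noteq> 0" "\<And>z c. z \<in> Z \<Longrightarrow> c \<noteq> 0 \<Longrightarrow> c *s z \<in> Z"
  shows "proj_closed Z"
proof -
  have "Z = \<Union> (proj_point ` Z)"
    using assms(3) proj_point_self by (fastforce simp: proj_point_def)
  moreover have "proj_closed (\<Union> B)" if "finite B" "B \<subseteq> proj_point ` Z" for B
    using that
  proof (induction B rule: finite_induct)
    case (insert b B)
    thus ?case using proj_closed_point assms(2) by (auto intro!: proj_closed_Un)
  qed (simp add: proj_closed_empty)
  ultimately show ?thesis using assms(1) by (metis order_refl)
qed

text \<open>Infinitely many points, but finitely many zeros for each form that does not vanish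
  identically. From this irreducibility and Krull dimension one follow by counting points.
  Closedness is left out so that the notion also applies to dense affine parts.\<close>

definition curve_like :: "(complex^'n::finite) set \<Rightarrow> bool" where
  "curve_like X \<longleftrightarrow> (\<forall>x\<in>X. x \<noteq> 0) \<and> (\<forall>x\<in>X. \<forall>c. c \<noteq> 0 \<longrightarrow> c *s x \<in> X) \<and> infinite (proj_point ` X) \<and>
     (\<forall>d. \<forall>F\<in>forms d. (\<exists>x\<in>X. F x \<noteq> 0) \<longrightarrow> finite (proj_point ` {x\<in>X. F x = 0}))"

lemma curve_likeD:
  assumes "curve_like X"
  shows "\<And>x. x \<in> X \<Longrightarrow> x \<noteq> 0" "\<And>x c. x \<in> X \<Longrightarrow> c \<noteq> 0 \<Longrightarrow> c *s x \<in> X" "infinite (proj_point ` X)"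
    "\<And>F d x. F \<in> forms d \<Longrightarrow> x \<in> X \<Longrightarrow> F x \<noteq> 0 \<Longrightarrow> finite (proj_point ` {x\<in>X. F x = 0})"
  using assms unfolding curve_like_def by blast+

lemma curve_like_closed_subset:
  assumes X: "curve_like X" and Z: "proj_closed Z" and n: "\<not> X \<subseteq> Z"
  shows "finite (proj_point ` (X \<inter> Z))"
proof -
  obtain x where x: "x \<in> X" "x \<notin> Z" using n by blast
  obtain d F where F: "F \<in> forms d" "\<And>z. z \<in> Z \<Longrightarrow> F z = 0" "F x \<noteq> 0"
    by (rule proj_closed_separate[OF Z curve_likeD(1)[OF X x(1)] x(2)]) blast
  have "finite (proj_point ` {x\<in>X. F x = 0})" by (rule curve_likeD(4)[OF X F(1) x(1) F(3)])
  thus ?thesis by (rule finite_subset[rotated]) (use F(2) in auto)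
qed

text \<open>A closed set not containing X meets it in finitely many points, and X is not a union of
  two finite sets of points.\<close>

lemma curve_like_irreducible:
  assumes X: "curve_like X" shows "proj_irreducible X"
  unfolding proj_irreducible_def
proof (intro conjI allI impI)
  show "X \<noteq> {}" using curve_likeD(3)[OF X] by auto
  fix Z1 Z2 assume Z: "proj_closed Z1 \<and> proj_closed Z2 \<and> X \<subseteq> Z1 \<union> Z2"
  show "X \<subseteq> Z1 \<or> X \<subseteq> Z2"
  proof (rule ccontr)
    assume "\<not> (X \<subseteq> Z1 \<or> X \<subseteq> Z2)"
    hence "finite (proj_point ` (X \<inter> Z1) \<union> proj_point ` (X \<inter> Z2))"
      using curve_like_closed_subset[OF X] Z by auto
    moreover have "proj_point ` X \<subseteq> proj_point ` (X \<inter> Z1) \<union> proj_point ` (X \<inter> Z2)"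
      using Z by blast
    ultimately show False using curve_likeD(3)[OF X] finite_subset by blast
  qed
qed

text \<open>A proper closed subset has finitely many points. Taking one of them away leaves a closed
  set again, so an irreducible such subset is a single point.\<close>

lemma curve_like_projective_curve:
  assumes X: "curve_like X" and cl: "proj_closed X" shows "projective_curve X"
  unfolding projective_curve_def
proof (intro conjI allI impI)
  show "X \<noteq> proj_point x" for x
  proof
    assume "X = proj_point x"
    hence "proj_point ` X \<subseteq> {proj_point x}" using proj_point_eqI by auto
    thus False using curve_likeD(3)[OF X] finite_subset by blast
  qed
  fix Z assume Z: "proj_closed Z \<and> proj_irreducible Z \<and> Z \<subset> X"
  hence "finite (proj_point ` (X \<inter> Z))" by (intro curve_like_closed_subset[OF X]) auto
  moreover have "X \<inter> Z = Z" using Z by auto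
  ultimately have fin: "finite (proj_point ` Z)" by simp
  obtain z where z: "z \<in> Z" using Z by (auto simp: proj_irreducible_def)
  have z0: "z \<noteq> 0" using Z z proj_closed_nonzero by blast
  have "proj_closed (Z - proj_point z)"
  proof (rule proj_closed_finite_points)
    show "finite (proj_point ` (Z - proj_point z))" using fin by (rule finite_subset[rotated]) auto
    show "y \<noteq> 0" if "y \<in> Z - proj_point z" for y using that Z proj_closed_nonzero by blast
    show "c *s y \<in> Z - proj_point z" if "y \<in> Z - proj_point z" "c \<noteq> 0" for y c
    proof -
      have "c *s y \<in> Z" using Z that proj_closed_scale by blast
      moreover have "c *s y \<notin> proj_point z"
      proof
        assume "c *s y \<in> proj_point z"
        hence "proj_point y = proj_point z" using proj_point_eqI proj_point_scale[OF that(2)] by metis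
        thus False using that proj_point_self by blast
      qed
      ultimately show ?thesis by blast
    qed
  qed
  hence "Z \<subseteq> proj_point z \<or> Z \<subseteq> Z - proj_point z"
    using Z proj_closed_point[OF z0] unfolding proj_irreducible_def by blast
  hence "Z \<subseteq> proj_point z" using z proj_point_self by blast
  moreover have "proj_point z \<subseteq> Z"
    using Z z proj_closed_scale unfolding proj_point_def by blast
  ultimately show "\<exists>x. Z = proj_point x" by blast
qed (use cl curve_like_irreducible[OF X] in auto)

text \<open>Used to pass from an affine part to its closure: finitely many points are added, and no
  form that vanishes on the part can fail to vanish on the added points.\<close>

lemma curve_like_superset:
  assumes X0: "curve_like X0" and sub: "X0 \<subseteq> X" and nz: "\<And>x. x \<in> X \<Longrightarrow> x \<noteq> 0"
    and sc: "\<And>x c. x \<in> X \<Longrightarrow> c \<noteq> 0 \<Longrightarrow> c *s x \<in> X" 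
    and fin: "finite (proj_point ` (X - X0))"
    and dense: "\<And>d F x. F \<in> forms d \<Longrightarrow> (\<And>x. x \<in> X0 \<Longrightarrow> F x = 0) \<Longrightarrow> x \<in> X \<Longrightarrow> F x = 0"
  shows "curve_like X"
  unfolding curve_like_def
proof (intro conjI allI ballI impI)
  show "infinite (proj_point ` X)"
    using curve_likeD(3)[OF X0] sub by (meson finite_subset image_mono)
  fix d F assume F: "F \<in> forms d" and "\<exists>x\<in>X. F x \<noteq> 0"
  then obtain x where x: "x \<in> X0" "F x \<noteq> 0" using dense by metis
  have "finite (proj_point ` {x\<in>X0. F x = 0} \<union> proj_point ` (X - X0))"
    using curve_likeD(4)[OF X0 F x] fin by simp
  thus "finite (proj_point ` {x\<in>X. F x = 0})" by (rule finite_subset[rotated]) auto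
qed (use nz sc in auto)

section \<open>Maps given by forms\<close>

lemma regular_on_forms:
  assumes "\<And>j. F j \<in> forms d" "\<And>x. x \<in> U \<Longrightarrow> (\<chi> j. F j x) \<noteq> 0"
  shows "regular_on U (\<lambda>x. \<chi> j. F j x)"
  unfolding regular_on_def
proof (intro ballI)
  fix x assume "x \<in> U"
  hence "\<exists>j. F j x \<noteq> 0" using assms(2)[of x] by (auto simp: vec_eq_iff)
  thus "\<exists>d F'. (\<forall>j. F' j \<in> forms d) \<and> (\<exists>j. F' j x \<noteq> 0) \<and>
        (\<forall>z\<in>U. (\<exists>j. F' j z \<noteq> 0) \<longrightarrow> (\<chi> j. F j z) \<in> proj_point (\<chi> j. F' j z))"
    using assms(1) by (intro exI[of _ d] exI[of _ F]) (auto intro: proj_point_self)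
qed

lemma proj_iso_viaI:
  assumes "\<And>j. F j \<in> forms d" "\<And>j. G j \<in> forms e"
    and "\<And>x. x \<in> U \<Longrightarrow> (\<chi> j. F j x) \<in> V" "\<And>y. y \<in> V \<Longrightarrow> (\<chi> j. G j y) \<in> U"
    and "\<And>x. x \<in> U \<Longrightarrow> (\<chi> j. G j (\<chi> j. F j x)) \<in> proj_point x" 
    and "\<And>y. y \<in> V \<Longrightarrow> (\<chi> j. F j (\<chi> j. G j y)) \<in> proj_point y"
    and "\<And>x. x \<in> U \<Longrightarrow> x \<noteq> 0" "\<And>y. y \<in> V \<Longrightarrow> y \<noteq> 0"
  shows "proj_iso_via (\<lambda>x. \<chi> j. F j x) U V"
  unfolding proj_iso_via_def
proof (intro conjI exI[of _ "\<lambda>y. \<chi> j. G j y"] ballI)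
  show "regular_on U (\<lambda>x. \<chi> j. F j x)"
    by (rule regular_on_forms[OF assms(1)]) (rule assms(8)[OF assms(3)])
  show "regular_on V (\<lambda>y. \<chi> j. G j y)"
    by (rule regular_on_forms[OF assms(2)]) (rule assms(7)[OF assms(4)])
  show "(\<lambda>x. \<chi> j. F j x) ` U \<subseteq> V" "(\<lambda>y. \<chi> j. G j y) ` V \<subseteq> U"
    using assms(3,4) by blast+
qed (fact assms(5), fact assms(6))

lemma forms_poly_comp:
  fixes A :: "'n::finite \<Rightarrow> complex poly"
  assumes "F \<in> forms d" shows "\<exists>p. \<forall>t. F (\<chi> i. poly (A i) t) = poly p t"
  using assms
proof (induction rule: forms_induct)
  case (sum a)
  have "(\<Sum>\<alpha> | sum \<alpha> UNIV = d. a \<alpha> * monom_fun \<alpha> (\<chi> i. poly (A i) t)) =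
     poly (\<Sum>\<alpha> | sum \<alpha> UNIV = d. smult (a \<alpha>) (\<Prod>i\<in>UNIV. A i ^ \<alpha> i)) t" for t
    by (simp add: poly_sum poly_prod monom_fun_def)
  thus ?case by blast
qed

lemma infinite_complex_UNIV: "infinite (UNIV :: complex set)"
  using uncountable_UNIV_complex countable_finite by blast

lemma poly_zero_of_cofinite:
  fixes p :: "complex poly"
  assumes "finite S" "\<And>t. t \<notin> S \<Longrightarrow> poly p t = 0" shows "p = 0"
proof (rule ccontr)
  assume "p \<noteq> 0"
  hence "finite ({t. poly p t = 0} \<union> S)" using poly_roots_finite assms(1) by blast
  moreover have "UNIV = {t. poly p t = 0} \<union> S" using assms(2) by blast
  ultimately show False using infinite_complex_UNIV by simp
qed

section \<open>Functions on a double cover of the line\<close>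

text \<open>The order of vanishing at 0 is even on the left and odd on the right, unless both sides
  are zero. In other words t h(t) is not a square of a rational function.\<close>

lemma square_eq_odd_order:
  fixes a b h :: "complex poly"
  assumes h: "poly h 0 \<noteq> 0" and eq: "a * a = [:0, 1:] * h * (b * b)"
  shows "a = 0" "b = 0"
proof -
  have h0: "h \<noteq> 0" using h by auto
  have "b = 0"
  proof (rule ccontr)
    assume b: "b \<noteq> 0"
    have nz: "[:0, 1:] * h * (b * b) \<noteq> 0" using b h0 by simp
    hence a: "a \<noteq> 0" using eq by auto
    have oh: "order 0 h = 0" using h by (rule order_0I)
    have ox: "order 0 [:0, 1 :: complex:] = 1" using order_power_n_n[of "0::complex" 1] by simp
    have "order 0 (a * a) = 2 * order 0 a" using a by (subst order_mult) auto
    moreover have "order 0 ([:0, 1:] * h * (b * b)) = 1 + 2 * order 0 b"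
      using nz b h0 by (simp add: order_mult ox oh del: mult_pCons_left)
    ultimately have "2 * order 0 a = 1 + 2 * order 0 b" using eq by simp
    thus False by presburger
  qed
  moreover from this have "a * a = 0" using eq by simp
  ultimately show "a = 0" "b = 0" by auto
qed

definition cover_points :: "complex poly \<Rightarrow> complex set \<Rightarrow> (complex \<times> complex) set" where
  "cover_points g S = {(t, W). W\<^sup>2 = poly g t \<and> t \<notin> S}"

lemma infinite_cover_points:
  assumes "finite S" shows "infinite (cover_points g S)"
proof
  assume "finite (cover_points g S)"
  hence "finite (fst ` cover_points g S)" by simp
  moreover have "- S \<subseteq> fst ` cover_points g S"
  proof
    fix t assume "t \<in> - S"
    hence "(t, csqrt (poly g t)) \<in> cover_points g S" by (simp add: cover_points_def)
    thus "t \<in> fst ` cover_points g S" by force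
  qed
  ultimately have "finite (- S)" using finite_subset by blast
  thus False using assms infinite_complex_UNIV by (metis finite_Un Compl_partition)
qed

text \<open>Multiplying a + W b by its conjugate a - W b gives the polynomial a^2 - g b^2 in t
  alone. With infinitely many zeros it is identically zero, and parity of the order at 0 forces a =
  b = 0.\<close>

lemma cover_function_zero:
  fixes a b h :: "complex poly"
  assumes h: "poly h 0 \<noteq> 0" and g: "g = [:0, 1:] * h"
    and inf: "infinite {(t, W) \<in> cover_points g S. poly a t + W * poly b t = 0}"
  shows "a = 0" "b = 0"
proof -
  define Z where "Z = {(t, W) \<in> cover_points g S. poly a t + W * poly b t = 0}"
  \<comment> \<open>Each t carries at most two values of W, so an infinite zero set has infinitely
    many t.\<close>
  have sub: "Z \<subseteq> (\<Union>t \<in> fst ` Z. {(t, csqrt (poly g t)), (t, - csqrt (poly g t))})"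
  proof
    fix z assume z: "z \<in> Z"
    obtain t W where tW: "z = (t, W)" by (cases z)
    have "W\<^sup>2 = (csqrt (poly g t))\<^sup>2" using z tW by (simp add: Z_def cover_points_def)
    hence "W = csqrt (poly g t) \<or> W = - csqrt (poly g t)" by (simp only: power2_eq_iff)
    thus "z \<in> (\<Union>t \<in> fst ` Z. {(t, csqrt (poly g t)), (t, - csqrt (poly g t))})"
      using z tW by force
  qed
  have "infinite (fst ` Z)"
  proof
    assume "finite (fst ` Z)"
    hence "finite (\<Union>t \<in> fst ` Z. {(t, csqrt (poly g t)), (t, - csqrt (poly g t))})"
      by (rule finite_UN_I) simp
    from finite_subset[OF sub this] show False using inf unfolding Z_def by simp
  qed
  moreover have "fst ` Z \<subseteq> {t. poly (a * a - g * (b * b)) t = 0}"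
  proof
    fix t assume "t \<in> fst ` Z"
    then obtain W where W: "W\<^sup>2 = poly g t" "poly a t + W * poly b t = 0"
      by (auto simp: Z_def cover_points_def)
    have "poly a t = - W * poly b t" using W(2) by (simp add: eq_neg_iff_add_eq_0)
    hence "poly a t * poly a t = W\<^sup>2 * (poly b t * poly b t)" by (simp add: power2_eq_square algebra_simps)
    thus "t \<in> {t. poly (a * a - g * (b * b)) t = 0}" by (simp add: W(1))
  qed
  ultimately have "infinite {t. poly (a * a - g * (b * b)) t = 0}" using finite_subset by blast
  hence "a * a - g * (b * b) = 0" by (metis poly_roots_finite)
  hence "a * a = [:0, 1:] * h * (b * b)" using g by simp
  from square_eq_odd_order[OF h this] show "a = 0" "b = 0" by auto
qed

definition cover_map :: "('n::finite \<Rightarrow> complex poly) \<Rightarrow> ('n \<Rightarrow> complex poly) \<Rightarrow> complex \<times> complex \<Rightarrow> complex^'n" where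
  "cover_map A B = (\<lambda>(t, W). \<chi> i. poly (A i) t + W * poly (B i) t)"

text \<open>The functions a(t) + W b(t) form a ring on the curve, because W^2 = g(t) removes squares
  of W; it contains the coordinates and hence every form in them.\<close>

lemma forms_cover_map:
  fixes A B :: "'n::finite \<Rightarrow> complex poly"
  assumes "F \<in> forms d"
  shows "\<exists>a b. \<forall>t W. (t, W) \<in> cover_points g {} \<longrightarrow> F (cover_map A B (t, W)) = poly a t + W * poly b t"
proof -
  define R where "R = (\<lambda>\<phi> :: complex \<times> complex \<Rightarrow> complex. \<exists>a b. \<forall>t W. (t, W) \<in> cover_points g {} \<longrightarrow> \<phi> (t, W) = poly a t + W * poly b t)"
  have R_const: "R (\<lambda>z. c)" for c
    unfolding R_def by (rule exI[of _ "[:c:]"], rule exI[of _ 0]) auto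
  have R_add: "R (\<lambda>z. f z + k z)" if f: "R f" and k: "R k" for f k
  proof -
    obtain a b where ab: "\<forall>t W. (t, W) \<in> cover_points g {} \<longrightarrow> f (t, W) = poly a t + W * poly b t" using f[unfolded R_def] by (elim exE)
    obtain a' b' where ab': "\<forall>t W. (t, W) \<in> cover_points g {} \<longrightarrow> k (t, W) = poly a' t + W * poly b' t" using k[unfolded R_def] by (elim exE)
    show ?thesis unfolding R_def
      by (rule exI[of _ "a + a'"], rule exI[of _ "b + b'"]) (simp add: ab ab' algebra_simps)
  qed
  have R_mult: "R (\<lambda>z. f z * k z)" if f: "R f" and k: "R k" for f k
  proof -
    obtain a b where ab: "\<forall>t W. (t, W) \<in> cover_points g {} \<longrightarrow> f (t, W) = poly a t + W * poly b t" using f[unfolded R_def] by (elim exE)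
    obtain a' b' where ab': "\<forall>t W. (t, W) \<in> cover_points g {} \<longrightarrow> k (t, W) = poly a' t + W * poly b' t" using k[unfolded R_def] by (elim exE)
    show ?thesis unfolding R_def
    proof (rule exI[of _ "a * a' + g * b * b'"], rule exI[of _ "a * b' + a' * b"], intro allI impI)
      fix t W assume tW: "(t, W) \<in> cover_points g {}"
      hence W: "poly g t = W * W" by (simp add: cover_points_def power2_eq_square)
      have "f (t, W) = poly a t + W * poly b t" "k (t, W) = poly a' t + W * poly b' t" using ab ab' tW by auto
      thus "f (t, W) * k (t, W) = poly (a * a' + g * b * b') t + W * poly (a * b' + a' * b) t"
        by (simp add: W algebra_simps)
    qed
  qed
  have R_sum: "R (\<lambda>z. \<Sum>i\<in>I. f i z)" if "\<And>i. i \<in> I \<Longrightarrow> R (f i)" for f and I :: "'k set"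
    using that by (induction I rule: infinite_finite_induct) (auto intro: R_const R_add)
  have R_pow: "R (\<lambda>z. f z ^ k)" if "R f" for f k
    using that by (induction k) (auto intro: R_const R_mult)
  have R_prod: "R (\<lambda>z. \<Prod>i\<in>I. f i z)" if "\<And>i. i \<in> I \<Longrightarrow> R (f i)" for f and I :: "'n set"
    using that by (induction I rule: infinite_finite_induct) (auto intro: R_const R_mult)
  have R_coord: "R (\<lambda>z. cover_map A B z $ i)" for i
    unfolding R_def by (rule exI[of _ "A i"], rule exI[of _ "B i"]) (auto simp: cover_map_def)
  obtain a where F: "F = (\<lambda>x. \<Sum>\<alpha> | sum \<alpha> UNIV = d. a \<alpha> * monom_fun \<alpha> x)"
    using assms unfolding forms_def by blast
  have R_sum': "R (\<lambda>z. \<Sum>i\<in>I. f i z)" if "\<And>i. i \<in> I \<Longrightarrow> R (f i)" for f and I :: "('n \<Rightarrow> nat) set"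
    using that by (induction I rule: infinite_finite_induct) (auto intro: R_const R_add)
  have "R (\<lambda>z. F (cover_map A B z))"
    unfolding F monom_fun_def by (intro R_sum' R_mult R_const R_prod R_pow R_coord)
  thus ?thesis unfolding R_def .
qed

text \<open>Injectivity makes the image infinite, and the zeros of a form correspond to those of
  some a(t) + W b(t), of which there are finitely many. The finite set \<open>S\<close> allows
  parameters to be left out where the coordinate formulas degenerate.\<close>

lemma curve_like_cover:
  fixes A B :: "'n::finite \<Rightarrow> complex poly"
  assumes h: "poly h 0 \<noteq> 0" and g: "g = [:0, 1:] * h" and S: "finite S"
    and nz: "\<And>z. z \<in> cover_points g S \<Longrightarrow> cover_map A B z \<noteq> 0"
    and inj: "\<And>z z'. z \<in> cover_points g S \<Longrightarrow> z' \<in> cover_points g S \<Longrightarrow> 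
       cover_map A B z \<in> proj_point (cover_map A B z') \<Longrightarrow> z = z'"
    and X: "X = {c *s cover_map A B z | c z. c \<noteq> 0 \<and> z \<in> cover_points g S}"
  shows "curve_like X"
  unfolding curve_like_def
proof (intro conjI ballI allI impI)
  show "x \<noteq> 0" if "x \<in> X" for x
    using that nz unfolding X by auto
  show "c *s x \<in> X" if x: "x \<in> X" and "c \<noteq> 0" for x c
  proof -
    obtain c' z where "x = c' *s cover_map A B z" "c' \<noteq> 0" "z \<in> cover_points g S" using x unfolding X by blast
    thus ?thesis unfolding X mem_Collect_eq using \<open>c \<noteq> 0\<close>
      by (intro exI[of _ "c * c'"], intro exI[of _ z]) (simp add: vector_smult_assoc)
  qed
  have inX: "cover_map A B z \<in> X" if "z \<in> cover_points g S" for z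
    unfolding X mem_Collect_eq using that by (intro exI[of _ 1], intro exI[of _ z]) simp
  have "inj_on (\<lambda>z. proj_point (cover_map A B z)) (cover_points g S)"
  proof (rule inj_onI)
    fix z z' assume z: "z \<in> cover_points g S" "z' \<in> cover_points g S"
      and eq: "proj_point (cover_map A B z) = proj_point (cover_map A B z')"
    have "cover_map A B z \<in> proj_point (cover_map A B z')" unfolding eq[symmetric] by (rule proj_point_self)
    thus "z = z'" by (rule inj[OF z])
  qed
  hence "infinite ((\<lambda>z. proj_point (cover_map A B z)) ` cover_points g S)"
    using infinite_cover_points[OF S] finite_imageD by blast
  thus "infinite (proj_point ` X)"
    by (rule contrapos_nn) (rule finite_subset[rotated], assumption, use inX in auto)
  fix d F assume F: "F \<in> forms d" and ex: "\<exists>x\<in>X. F x \<noteq> 0"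
  obtain a b where ab: "\<And>t W. (t, W) \<in> cover_points g {} \<Longrightarrow> F (cover_map A B (t, W)) = poly a t + W * poly b t"
    using forms_cover_map[OF F, of g A B] by blast
  have sub: "cover_points g S \<subseteq> cover_points g {}" by (auto simp: cover_points_def)
  define Z where "Z = {(t, W) \<in> cover_points g S. poly a t + W * poly b t = 0}"
  have "finite Z"
  proof (rule ccontr)
    assume "infinite Z"
    hence inf: "infinite {(t, W) \<in> cover_points g S. poly a t + W * poly b t = 0}" unfolding Z_def .
    have "a = 0" "b = 0" by (rule cover_function_zero[OF h g inf])+
    hence "F (cover_map A B z) = 0" if "z \<in> cover_points g S" for z
      using ab that sub by (cases z) auto
    hence "F x = 0" if "x \<in> X" for x
      using that forms_homogeneous[OF F] unfolding X by auto
    thus False using ex by blast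
  qed
  moreover have "proj_point ` {x \<in> X. F x = 0} \<subseteq> (\<lambda>z. proj_point (cover_map A B z)) ` Z"
  proof clarify
    fix x assume x: "x \<in> X" "F x = 0"
    then obtain c t W where c: "c \<noteq> 0" "(t, W) \<in> cover_points g S" "x = c *s cover_map A B (t, W)"
      unfolding X by auto
    have "F (cover_map A B (t, W)) = 0" using x(2) c forms_homogeneous[OF F] by simp
    hence "(t, W) \<in> Z" using c(2) ab[of t W] sub by (auto simp: Z_def)
    moreover have "proj_point x = proj_point (cover_map A B (t, W))" using c by (simp add: proj_point_scale)
    ultimately show "proj_point x \<in> (\<lambda>z. proj_point (cover_map A B z)) ` Z" by blast
  qed
  ultimately show "finite (proj_point ` {x \<in> X. F x = 0})"
    using finite_subset by blast
qed

section \<open>Lines\<close>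

definition coord_line :: "'n::finite \<Rightarrow> 'n \<Rightarrow> (complex^'n) set" where
  "coord_line i j = {x. x \<noteq> 0 \<and> (\<forall>k. k \<noteq> i \<and> k \<noteq> j \<longrightarrow> x $ k = 0)}"

lemma proj_closed_coord_line: "proj_closed (coord_line i j)"
proof -
  have "coord_line i j = {x. x \<noteq> 0 \<and> (\<forall>F\<in>{\<lambda>x. x $ k | k. k \<noteq> i \<and> k \<noteq> j}. F x = 0)}"
    unfolding coord_line_def by auto
  also have "proj_closed \<dots>" by (rule proj_closed_zero_set) auto
  finally show ?thesis .
qed

text \<open>On the chart (1 : t) a form is a polynomial in t, and only the point (0 : 1) is
  missed.\<close>

lemma curve_like_coord_line:
  assumes ij: "i \<noteq> j" shows "curve_like (coord_line i j)"
  unfolding curve_like_def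
proof (intro conjI ballI allI impI)
  let ?X = "coord_line i j"
  define e where "e = (\<lambda>a b. (\<chi> k. if k = i then a else if k = j then b else 0) :: complex^'a)"
  have e_in: "e a b \<in> ?X" if "a \<noteq> 0 \<or> b \<noteq> 0" for a b
    using that ij by (auto simp: coord_line_def e_def vec_eq_iff)
  have X_e: "x = e (x $ i) (x $ j)" if "x \<in> ?X" for x
    using that by (auto simp: coord_line_def e_def vec_eq_iff)
  have e_scale: "c *s e a b = e (c * a) (c * b)" for a b c
    by (simp add: e_def vec_eq_iff)
  show "x \<noteq> 0" if "x \<in> ?X" for x using that by (simp add: coord_line_def)
  show "c *s x \<in> ?X" if "x \<in> ?X" "c \<noteq> 0" for x c using that by (auto simp: coord_line_def vec_eq_iff)
  have "inj_on (\<lambda>s. proj_point (e 1 s)) UNIV"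
  proof (rule inj_onI)
    fix s s' assume "proj_point (e 1 s) = proj_point (e 1 s')"
    hence "e 1 s \<in> proj_point (e 1 s')" using proj_point_self by metis
    then obtain c where c: "e 1 s = c *s e 1 s'" by (auto simp: proj_point_def)
    have "e 1 s $ i = c" "e 1 s $ j = c * s'" unfolding c e_scale using ij by (auto simp: e_def)
    thus "s = s'" using ij by (simp add: e_def)
  qed
  hence "infinite ((\<lambda>s. proj_point (e 1 s)) ` UNIV)"
    using infinite_complex_UNIV finite_imageD by blast
  moreover have "(\<lambda>s. proj_point (e 1 s)) ` UNIV \<subseteq> proj_point ` ?X" using e_in by auto
  ultimately show "infinite (proj_point ` ?X)" using finite_subset by blast
  fix d F assume F: "F \<in> forms d" and ex: "\<exists>x\<in>?X. F x \<noteq> 0"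
  have pc: "\<exists>p. \<forall>t. F (e (poly p1 t) (poly p2 t)) = poly p t" for p1 p2
  proof -
    have "e (poly p1 t) (poly p2 t) = (\<chi> k. poly (if k = i then p1 else if k = j then p2 else 0) t)" for t
      by (simp add: e_def vec_eq_iff)
    thus ?thesis using forms_poly_comp[OF F, of "\<lambda>k. if k = i then p1 else if k = j then p2 else 0"] by simp
  qed
  obtain p where p: "\<And>t. F (e 1 t) = poly p t" using pc[of 1 "[:0,1:]"] by auto
  obtain q where q: "\<And>t. F (e t 1) = poly q t" using pc[of "[:0,1:]" 1] by auto
  have "p \<noteq> 0"
  proof
    assume p0: "p = 0"
    have 1: "F (e a b) = 0" if "a \<noteq> 0" for a b
    proof -
      have "F (a *s e 1 (b / a)) = 0" using p[of "b/a"] p0 by (simp add: forms_homogeneous[OF F])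
      thus ?thesis using that by (simp add: e_scale)
    qed
    \<comment> \<open>The point (0 : 1) lies outside the chart of p. The other chart shares all its
      points but t = 0 with it, so q vanishes identically and therefore also at 0.\<close>
    have "q = 0" by (rule poly_zero_of_cofinite[of "{0}"]) (use 1 q in \<open>auto simp flip: q\<close>)
    hence 2: "F (e 0 1) = 0" using q[of 0] by simp
    have "F (e a b) = 0" for a b
    proof (cases "a = 0")
      case True
      have "F (b *s e 0 1) = 0" using 2 by (simp add: forms_homogeneous[OF F])
      thus ?thesis using True by (simp add: e_scale)
    qed (rule 1)
    hence "F x = 0" if "x \<in> ?X" for x using X_e[OF that] by metis
    thus False using ex by blast
  qed
  hence fin: "finite {t. poly p t = 0}" by (rule poly_roots_finite)
  have "proj_point ` {x\<in>?X. F x = 0} \<subseteq> (\<lambda>t. proj_point (e 1 t)) ` {t. poly p t = 0} \<union> {proj_point (e 0 1)}"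
  proof clarify
    fix x assume x: "x \<in> ?X" "F x = 0" and n: "proj_point x \<notin> (\<lambda>t. proj_point (e 1 t)) ` {t. poly p t = 0}"
    show "proj_point x = proj_point (e 0 1)"
    proof (cases "x $ i = 0")
      case True
      hence xe: "x = x $ j *s e 0 1" using X_e[OF x(1)] by (simp add: e_scale)
      have "x $ j \<noteq> 0" 
      proof
        assume "x $ j = 0"
        hence "x = 0 *s e 0 1" using xe by metis
        thus False using x(1) by (simp add: coord_line_def)
      qed
      thus ?thesis using proj_point_scale xe by metis
    next
      case False
      hence xe: "x = x $ i *s e 1 (x $ j / x $ i)" using X_e[OF x(1)] by (simp add: e_scale)
      have "F x = (x $ i) ^ d * poly p (x $ j / x $ i)" using p forms_homogeneous[OF F] xe by metis
      hence "poly p (x $ j / x $ i) = 0" using x(2) False by simp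
      moreover have "proj_point x = proj_point (e 1 (x $ j / x $ i))" using proj_point_scale[OF False] xe by metis
      ultimately show ?thesis using n by blast
    qed
  qed
  thus "finite (proj_point ` {x\<in>?X. F x = 0})"
    by (rule finite_subset) (use fin in simp)
qed

section \<open>Hilbert functions\<close>

interpretation fun_vs: vector_space "\<lambda>(c::complex) (f :: 'a \<Rightarrow> complex) x. c * f x"
  by unfold_locales (auto simp: fun_eq_iff algebra_simps)

lemma fun_sum_apply: "(\<Sum>i\<in>I. f i) x = (\<Sum>i\<in>I. f i (x :: 'a) :: complex)"
  by (induction I rule: infinite_finite_induct) auto

text \<open>A form vanishing on A vanishes on the closure. Expansions and linear relations among
  restricted forms can therefore be checked on the explicitly parametrized set A.\<close>

lemma hilbert_function_closure:
  fixes A :: "(complex^'n::finite) set" and M :: "'i \<Rightarrow> complex^'n \<Rightarrow> complex"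
  assumes nz: "\<And>x. x \<in> A \<Longrightarrow> x \<noteq> 0" and I: "finite I" and M: "\<And>i. i \<in> I \<Longrightarrow> M i \<in> forms d"
    and span: "\<And>F. F \<in> forms d \<Longrightarrow> \<exists>c. \<forall>x\<in>A. F x = (\<Sum>i\<in>I. c i * M i x)"
    and indep: "\<And>c. (\<And>x. x \<in> A \<Longrightarrow> (\<Sum>i\<in>I. c i * M i x) = 0) \<Longrightarrow> \<forall>i\<in>I. c i = 0"
  shows "hilbert_function (proj_closure A) d = card I"
proof -
  define X where "X = proj_closure A"
  define \<rho> where "\<rho> = (\<lambda>(F :: complex^'n \<Rightarrow> complex) x. if x \<in> X then F x else 0)"
  define V where "V = \<rho> ` forms d"
  have AX: "A \<subseteq> X" unfolding X_def using proj_closure_extensive nz by blast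
  have eq0: "F x = 0" if "F \<in> forms d" "\<And>x. x \<in> A \<Longrightarrow> F x = 0" "x \<in> X" for F x
    using proj_closure_vanish[OF that(1,2)] that(3) unfolding X_def by blast
  have \<rho>_sum: "\<rho> (\<lambda>x. \<Sum>i\<in>J. c i * M i x) = (\<Sum>i\<in>J. (\<lambda>x. c i * \<rho> (M i) x))" for c J
    by (auto simp: \<rho>_def fun_eq_iff fun_sum_apply)
  have inj: "inj_on (\<lambda>i. \<rho> (M i)) I"
  proof (rule inj_onI, rule ccontr)
    fix i j assume ij: "i \<in> I" "j \<in> I" "\<rho> (M i) = \<rho> (M j)" "i \<noteq> j"
    define c where "c = (\<lambda>k. if k = i then 1 else if k = j then - 1 else 0 :: complex)"
    have "(\<Sum>k\<in>I. c k * M k x) = 0" if x: "x \<in> A" for x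
    proof -
      have "(\<Sum>k\<in>I. c k * M k x) = (\<Sum>k\<in>{i, j}. c k * M k x)"
        using I ij by (intro sum.mono_neutral_right) (auto simp: c_def)
      also have "\<dots> = M i x - M j x" using ij(4) by (simp add: c_def)
      also have "\<dots> = 0" using fun_cong[OF ij(3), of x] x AX by (auto simp: \<rho>_def)
      finally show ?thesis .
    qed
    hence "c i = 0" using indep[of c] ij(1) by blast
    thus False by (simp add: c_def)
  qed
  have "fun_vs.dim V = card ((\<lambda>i. \<rho> (M i)) ` I)"
  proof (rule fun_vs.dim_unique[of "(\<lambda>i. \<rho> (M i)) ` I"])
    show "(\<lambda>i. \<rho> (M i)) ` I \<subseteq> V" using M by (auto simp: V_def)
    show "V \<subseteq> fun_vs.span ((\<lambda>i. \<rho> (M i)) ` I)"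
    proof
      fix f assume "f \<in> V"
      then obtain F where F: "F \<in> forms d" "f = \<rho> F" by (auto simp: V_def)
      obtain c where c: "\<forall>x\<in>A. F x = (\<Sum>i\<in>I. c i * M i x)" using span[OF F(1)] by blast
      have "(\<lambda>x. F x - (\<Sum>i\<in>I. c i * M i x)) \<in> forms d"
        using F(1) M by (intro forms_diff forms_sum forms_scale) auto
      from eq0[OF this] have "F x = (\<Sum>i\<in>I. c i * M i x)" if "x \<in> X" for x using c that by auto
      hence "f = (\<Sum>i\<in>I. (\<lambda>x. c i * \<rho> (M i) x))"
        unfolding F(2) \<rho>_sum[symmetric] by (auto simp: \<rho>_def fun_eq_iff)
      also have "\<dots> \<in> fun_vs.span ((\<lambda>i. \<rho> (M i)) ` I)"
        by (intro fun_vs.span_sum fun_vs.span_scale fun_vs.span_base) auto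
      finally show "f \<in> fun_vs.span ((\<lambda>i. \<rho> (M i)) ` I)" .
    qed
    show "fun_vs.independent ((\<lambda>i. \<rho> (M i)) ` I)"
    proof (rule fun_vs.independent_if_scalars_zero)
      show "finite ((\<lambda>i. \<rho> (M i)) ` I)" using I by simp
      fix f g assume s: "(\<Sum>h\<in>(\<lambda>i. \<rho> (M i)) ` I. (\<lambda>x. f h * h x)) = 0" and g: "g \<in> (\<lambda>i. \<rho> (M i)) ` I"
      define c where "c = (\<lambda>i. f (\<rho> (M i)))"
      have "(\<Sum>h\<in>(\<lambda>i. \<rho> (M i)) ` I. (\<lambda>x. f h * h x)) = (\<Sum>i\<in>I. (\<lambda>x. c i * \<rho> (M i) x))"
        by (subst sum.reindex[OF inj]) (simp add: c_def)
      hence z: "\<rho> (\<lambda>x. \<Sum>i\<in>I. c i * M i x) = 0" using s \<rho>_sum by simp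
      have "\<forall>i\<in>I. c i = 0"
      proof (rule indep)
        fix x assume "x \<in> A"
        thus "(\<Sum>i\<in>I. c i * M i x) = 0" using fun_cong[OF z, of x] AX by (auto simp: \<rho>_def)
      qed
      thus "f g = 0" using g by (auto simp: c_def)
    qed
  qed simp
  also have "\<dots> = card I" by (rule card_image[OF inj])
  finally show ?thesis unfolding hilbert_function_def V_def \<rho>_def X_def .
qed

text \<open>Infinitely many common values identify the Hilbert polynomial as a d + b. It has degree
  one since a is nonzero, so the genus is - (b - 1).\<close>

lemma arithmetic_genus_linear:
  assumes H: "\<And>d. d \<ge> N \<Longrightarrow> real (hilbert_function X d) = a * real d + b" and a: "a \<noteq> 0"
  shows "arithmetic_genus X = 1 - b"
proof -
  have "hilbert_poly X = [:b, a:]"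
    unfolding hilbert_poly_def
  proof (rule the_equality)
    show ev: "eventually (\<lambda>d. real (hilbert_function X d) = poly [:b, a:] (real d)) sequentially"
      using eventually_ge_at_top[of N] by eventually_elim (simp add: H algebra_simps)
    fix p assume "eventually (\<lambda>d. real (hilbert_function X d) = poly p (real d)) sequentially"
    hence "eventually (\<lambda>d. poly (p - [:b, a:]) (real d) = 0) sequentially"
      using ev by eventually_elim simp
    then obtain M where M: "\<And>d. d \<ge> M \<Longrightarrow> poly (p - [:b, a:]) (real d) = 0"
      by (auto simp: eventually_sequentially)
    show "p = [:b, a:]"
    proof (rule ccontr)
      assume "p \<noteq> [:b, a:]"
      hence "finite {x. poly (p - [:b, a:]) x = 0}" by (intro poly_roots_finite) simp
      moreover have "real ` {M..} \<subseteq> {x. poly (p - [:b, a:]) x = 0}" using M by auto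
      moreover have "infinite (real ` {M..})" using infinite_Ici[of M] finite_imageD[of real "{M..}"] by (auto simp: inj_on_def)
      ultimately show False using finite_subset by blast
    qed
  qed
  thus ?thesis using a by (simp add: arithmetic_genus_def)
qed

section \<open>Tangent spaces\<close>

text \<open>The functions \<open>D i\<close> are the partial derivatives. They depend on F alone, so
  curves with the same position and velocity give the same derivative of F.\<close>

lemma form_chain_rule:
  fixes F :: "complex^'n::finite \<Rightarrow> complex"
  assumes "F \<in> forms d"
  obtains D where "\<And>\<gamma> (\<gamma>' :: complex^'n) s. (\<And>i. ((\<lambda>s. \<gamma> s $ i) has_field_derivative \<gamma>' $ i) (at s)) \<Longrightarrow>
     ((\<lambda>s. F (\<gamma> s)) has_field_derivative (\<Sum>i\<in>UNIV. D i (\<gamma> s) * \<gamma>' $ i)) (at (s :: complex))"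
proof -
  obtain a where F: "F = (\<lambda>x. \<Sum>\<alpha> | sum \<alpha> UNIV = d. a \<alpha> * monom_fun \<alpha> x)"
    using assms unfolding forms_def by blast
  define D where "D = (\<lambda>i (x :: complex^'n). \<Sum>\<alpha> | sum \<alpha> UNIV = d. a \<alpha> * (of_nat (\<alpha> i) * x $ i ^ (\<alpha> i - 1) * (\<Prod>j\<in>UNIV - {i}. x $ j ^ \<alpha> j)))"
  show ?thesis
  proof (rule that[of D])
    fix \<gamma> :: "complex \<Rightarrow> complex^'n" and \<gamma>' :: "complex^'n" and s :: complex assume g: "\<And>i. ((\<lambda>s. \<gamma> s $ i) has_field_derivative \<gamma>' $ i) (at s)"
    have "((\<lambda>s. monom_fun \<alpha> (\<gamma> s)) has_field_derivative 
       (\<Sum>i\<in>UNIV. (of_nat (\<alpha> i) * \<gamma> s $ i ^ (\<alpha> i - 1) * \<gamma>' $ i) * (\<Prod>j\<in>UNIV - {i}. \<gamma> s $ j ^ \<alpha> j))) (at s)" for \<alpha>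
      unfolding monom_fun_def
      by (rule has_field_derivative_prod) (auto intro!: derivative_eq_intros g)
    hence "((\<lambda>s. F (\<gamma> s)) has_field_derivative 
       (\<Sum>\<alpha> | sum \<alpha> UNIV = d. a \<alpha> * (\<Sum>i\<in>UNIV. (of_nat (\<alpha> i) * \<gamma> s $ i ^ (\<alpha> i - 1) * \<gamma>' $ i) * (\<Prod>j\<in>UNIV - {i}. \<gamma> s $ j ^ \<alpha> j)))) (at s)"
      unfolding F by (intro DERIV_sum DERIV_cmult)
    also have "(\<Sum>\<alpha> | sum \<alpha> UNIV = d. a \<alpha> * (\<Sum>i\<in>UNIV. (of_nat (\<alpha> i) * \<gamma> s $ i ^ (\<alpha> i - 1) * \<gamma>' $ i) * (\<Prod>j\<in>UNIV - {i}. \<gamma> s $ j ^ \<alpha> j)))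
       = (\<Sum>i\<in>UNIV. D i (\<gamma> s) * \<gamma>' $ i)"
      unfolding D_def sum_distrib_left sum_distrib_right by (subst sum.swap) (simp add: mult_ac)
    finally show "((\<lambda>s. F (\<gamma> s)) has_field_derivative (\<Sum>i\<in>UNIV. D i (\<gamma> s) * \<gamma>' $ i)) (at s)" .
  qed
qed

lemma forms_deriv_along:
  fixes F :: "complex^'n::finite \<Rightarrow> complex" and \<gamma> :: "complex \<Rightarrow> complex^'n" and v x :: "complex^'n"
  assumes F: "F \<in> forms d" and g: "\<And>i. ((\<lambda>s. \<gamma> s $ i) has_field_derivative v $ i) (at (0::complex))" and x: "\<gamma> 0 = x"
  shows "((\<lambda>s. F (\<gamma> s)) has_field_derivative deriv (\<lambda>s. F (x + s *s v)) 0) (at 0)"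
proof -
  obtain D where D: "\<And>\<gamma> (\<gamma>' :: complex^'n) s. (\<And>i. ((\<lambda>s. \<gamma> s $ i) has_field_derivative \<gamma>' $ i) (at s)) \<Longrightarrow>
     ((\<lambda>s. F (\<gamma> s)) has_field_derivative (\<Sum>i\<in>UNIV. D i (\<gamma> s) * \<gamma>' $ i)) (at (s :: complex))"
    by (rule form_chain_rule[OF F]) blast
  have 1: "((\<lambda>s. F (\<gamma> s)) has_field_derivative (\<Sum>i\<in>UNIV. D i x * v $ i)) (at 0)"
    using D[of \<gamma> v 0] g x by simp
  have "((\<lambda>s. F (x + s *s v)) has_field_derivative (\<Sum>i\<in>UNIV. D i (x + 0 *s v) * v $ i)) (at 0)"
    by (rule D) (auto intro!: derivative_eq_intros)
  hence "deriv (\<lambda>s. F (x + s *s v)) 0 = (\<Sum>i\<in>UNIV. D i x * v $ i)" by (simp add: DERIV_imp_deriv)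
  thus ?thesis using 1 by simp
qed

text \<open>Membership in X is required only for small nonzero parameters; continuity supplies F = 0
  at the base point. This suits arcs that approach a point at infinity from the affine part.\<close>

lemma tangent_arc:
  fixes \<gamma> :: "complex \<Rightarrow> complex^'n::finite" and v x :: "complex^'n"
  assumes g: "\<And>i. ((\<lambda>s. \<gamma> s $ i) has_field_derivative v $ i) (at (0::complex))" and x: "\<gamma> 0 = x"
    and X: "eventually (\<lambda>s. \<gamma> s \<in> X) (at 0)"
  shows "v \<in> cone_tangent_space X x"
  unfolding cone_tangent_space_def mem_Collect_eq
proof (intro allI ballI impI)
  fix d and F :: "complex^'n \<Rightarrow> complex" assume F: "F \<in> forms d" "\<forall>z\<in>X. F z = 0"
  have d: "((\<lambda>s. F (\<gamma> s)) has_field_derivative deriv (\<lambda>s. F (x + s *s v)) 0) (at 0)"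
    by (rule forms_deriv_along[OF F(1) g x])
  have ev: "eventually (\<lambda>s. 0 = F (\<gamma> s)) (at 0)" using X by eventually_elim (use F in auto)
  have "(\<lambda>s. F (\<gamma> s)) \<midarrow>0\<rightarrow> F (\<gamma> 0)" using DERIV_isCont[OF d] by (simp add: isCont_def)
  moreover have "(\<lambda>s. F (\<gamma> s)) \<midarrow>0\<rightarrow> 0" using ev by (rule Lim_transform_eventually[OF tendsto_const])
  ultimately have F0: "F (\<gamma> 0) = 0" using LIM_unique by blast
  have "((\<lambda>s. (F (\<gamma> s) - F (\<gamma> 0)) / (s - 0)) \<longlongrightarrow> deriv (\<lambda>s. F (x + s *s v)) 0) (at 0)"
    using d by (simp add: has_field_derivative_iff)
  moreover have "((\<lambda>s. (F (\<gamma> s) - F (\<gamma> 0)) / (s - 0)) \<longlongrightarrow> 0) (at 0)"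
    by (rule Lim_transform_eventually[OF tendsto_const]) (use ev F0 in \<open>auto elim: eventually_mono\<close>)
  ultimately show "deriv (\<lambda>s. F (x + s *s v)) 0 = 0" using LIM_unique by blast
qed

text \<open>Along the ray through x a form is (1 + s)^d F(x) = 0, so the position vector is always
  tangent to the cone.\<close>

lemma tangent_self:
  assumes "x \<in> X" shows "x \<in> cone_tangent_space X x"
  unfolding cone_tangent_space_def mem_Collect_eq
proof (intro allI ballI impI)
  fix d and F :: "complex^'a \<Rightarrow> complex" assume F: "F \<in> forms d" "\<forall>z\<in>X. F z = 0"
  have "F (x + s *s x) = 0" for s
  proof -
    have "x + s *s x = (1 + s) *s x" by (simp add: vec_eq_iff algebra_simps)
    thus ?thesis using F(2) assms by (simp only: forms_homogeneous[OF F(1)]) simp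
  qed
  thus "deriv (\<lambda>s. F (x + s *s x)) 0 = 0" by simp
qed

lemma curve_nonsingularI:
  assumes x: "x \<in> cone_tangent_space X x" and v: "v \<in> cone_tangent_space X x"
    and ind: "\<And>a b. a *s x + b *s v = 0 \<Longrightarrow> a = 0 \<and> b = 0"
    and span: "\<And>w. w \<in> cone_tangent_space X x \<Longrightarrow> \<exists>a b. w = a *s x + b *s v"
  shows "curve_nonsingular_at X x"
proof -
  have xv: "x \<noteq> v" using ind[of 1 "-1"] by auto
  have "vec.dim (cone_tangent_space X x) = card {x, v}"
  proof (rule vec.dim_unique[of "{x, v}"])
    show "{x, v} \<subseteq> cone_tangent_space X x" using x v by auto
    show "cone_tangent_space X x \<subseteq> vec.span {x, v}"
    proof
      fix w assume "w \<in> cone_tangent_space X x"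
      then obtain a b where "w = a *s x + b *s v" using span by blast
      moreover have "a *s x + b *s v \<in> vec.span {x, v}"
        by (intro vec.span_add vec.span_scale vec.span_base) auto
      ultimately show "w \<in> vec.span {x, v}" by simp
    qed
    show "vec.independent {x, v}"
    proof (rule vec.independent_if_scalars_zero)
      fix f y assume s: "(\<Sum>y\<in>{x, v}. f y *s y) = 0" and y: "y \<in> {x, v}"
      have "f x *s x + f v *s v = 0" using s xv by simp
      hence "f x = 0 \<and> f v = 0" by (rule ind)
      thus "f y = 0" using y by auto
    qed simp
  qed simp
  thus ?thesis using xv by (simp add: curve_nonsingular_at_def)
qed

section \<open>Coordinates and linear algebra in small dimension\<close>

lemma neq_3 [simp]: "(1::3) \<noteq> 2" "(2::3) \<noteq> 1" "(1::3) \<noteq> 3" "(3::3) \<noteq> 1" "(2::3) \<noteq> 3" "(3::3) \<noteq> 2"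
  by simp_all

lemma forall_3_option: "(\<forall>j :: 3 option. P j) \<longleftrightarrow> P None \<and> P (Some 1) \<and> P (Some 2) \<and> P (Some 3)"
  by (simp add: split_option_all forall_3)

lemma forall_2_option: "(\<forall>j :: 2 option. P j) \<longleftrightarrow> P None \<and> P (Some 1) \<and> P (Some 2)"
  by (simp add: split_option_all forall_2)

definition vec3 :: "complex \<Rightarrow> complex \<Rightarrow> complex \<Rightarrow> complex \<Rightarrow> complex^(3 option)" where
  "vec3 w a b c = (\<chi> j. case j of None \<Rightarrow> w | Some i \<Rightarrow> if i = 1 then a else if i = 2 then b else c)"

definition vec2 :: "complex \<Rightarrow> complex \<Rightarrow> complex \<Rightarrow> complex^(2 option)" where
  "vec2 w a b = (\<chi> j. case j of None \<Rightarrow> w | Some i \<Rightarrow> if i = 1 then a else b)"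

lemma vec3_nth [simp]: "vec3 w a b c $ None = w" "vec3 w a b c $ Some 1 = a" "vec3 w a b c $ Some 2 = b" "vec3 w a b c $ Some 3 = c"
  by (simp_all add: vec3_def)

lemma vec2_nth [simp]: "vec2 w a b $ None = w" "vec2 w a b $ Some 1 = a" "vec2 w a b $ Some 2 = b"
  by (simp_all add: vec2_def)

lemma vec3_eq_iff: "x = y \<longleftrightarrow> x $ None = y $ None \<and> x $ Some 1 = y $ Some 1 \<and> x $ Some 2 = y $ Some 2 \<and> x $ Some 3 = y $ Some 3"
  for x y :: "complex^(3 option)"
  by (simp add: vec_eq_iff forall_3_option)

lemma vec2_eq_iff: "x = y \<longleftrightarrow> x $ None = y $ None \<and> x $ Some 1 = y $ Some 1 \<and> x $ Some 2 = y $ Some 2"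
  for x y :: "complex^(2 option)"
  by (simp add: vec_eq_iff forall_2_option)

lemma forms_vec3:
  assumes "f0 \<in> forms d" "f1 \<in> forms d" "f2 \<in> forms d" "f3 \<in> forms d"
  shows "(\<lambda>x. vec3 (f0 x) (f1 x) (f2 x) (f3 x) $ j) \<in> forms d"
proof -
  have "\<forall>j. (\<lambda>x. vec3 (f0 x) (f1 x) (f2 x) (f3 x) $ j) \<in> forms d"
    unfolding forall_3_option using assms by simp
  thus ?thesis by blast
qed

lemma forms_vec2:
  assumes "f0 \<in> forms d" "f1 \<in> forms d" "f2 \<in> forms d"
  shows "(\<lambda>x. vec2 (f0 x) (f1 x) (f2 x) $ j) \<in> forms d"
proof -
  have "\<forall>j. (\<lambda>x. vec2 (f0 x) (f1 x) (f2 x) $ j) \<in> forms d"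
    unfolding forall_2_option using assms by simp
  thus ?thesis by blast
qed

lemma forms_times:
  assumes "F \<in> forms a" "G \<in> forms b" "a + b = d" shows "(\<lambda>x. F x * G x) \<in> forms d"
  using forms_mult[OF assms(1,2)] assms(3) by simp

lemma forms_1_1: "F \<in> forms 1 \<Longrightarrow> G \<in> forms 1 \<Longrightarrow> (\<lambda>x. F x * G x) \<in> forms 2"
  by (rule forms_times) auto

lemma forms_2_2: "F \<in> forms 2 \<Longrightarrow> G \<in> forms 2 \<Longrightarrow> (\<lambda>x. F x * G x) \<in> forms 4"
  by (rule forms_times) auto

lemma proj_iso_via_vectors:
  fixes f :: "complex^'n::finite \<Rightarrow> complex^'m::finite" and g :: "complex^'m \<Rightarrow> complex^'n"
  assumes "\<And>j. (\<lambda>x. f x $ j) \<in> forms d" "\<And>j. (\<lambda>x. g x $ j) \<in> forms e"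
    and "\<And>x. x \<in> U \<Longrightarrow> f x \<in> V" "\<And>y. y \<in> V \<Longrightarrow> g y \<in> U"
    and "\<And>x. x \<in> U \<Longrightarrow> g (f x) \<in> proj_point x" "\<And>y. y \<in> V \<Longrightarrow> f (g y) \<in> proj_point y"
    and "\<And>x. x \<in> U \<Longrightarrow> x \<noteq> 0" "\<And>y. y \<in> V \<Longrightarrow> y \<noteq> 0"
  shows "proj_iso_via f U V"
  using proj_iso_viaI[where F = "\<lambda>j x. f x $ j" and G = "\<lambda>j y. g y $ j" and U = U and V = V, OF assms(1,2)]
    assms(3-8) by (simp add: vec_lambda_eta)

lemma proj_pointI: "c \<noteq> 0 \<Longrightarrow> y = c *s x \<Longrightarrow> y \<in> proj_point x"
  by (auto simp: proj_point_def)

lemma lift_affine_3: "lift_affine v = vec3 1 (v$1) (v$2) (v$3)"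
  by (simp add: vec3_eq_iff)

lemma lift_affine_2: "lift_affine v = vec2 1 (v$1) (v$2)"
  by (simp add: vec2_eq_iff)

lemma vec3_scale: "k *s vec3 w a b c = vec3 (k * w) (k * a) (k * b) (k * c)"
  by (simp add: vec3_eq_iff)

lemma vec2_scale: "k *s vec2 w a b = vec2 (k * w) (k * a) (k * b)"
  by (simp add: vec2_eq_iff)

section \<open>The quartic model\<close>

text \<open>The numbers c and A - b + c are the values of A t^2 + b t + c at 0 and -1. The
  assumptions say that t (t + 1) (A t^2 + b t + c) has degree four and simple roots at 0 and
  -1.\<close>

locale quartic =
  fixes A b c :: complex
  assumes A: "A \<noteq> 0" and c: "c \<noteq> 0" and Abc: "A - b + c \<noteq> 0"
begin

definition g :: "complex poly" where "g = [:0, 1:] * [:1, 1:] * [:c, b, A:]"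

lemma poly_g: "poly g t = t * (t + 1) * (A * t\<^sup>2 + b * t + c)"
  by (simp add: g_def algebra_simps power2_eq_square)

lemma g_split: "g = [:0, 1:] * ([:1, 1:] * [:c, b, A:])" "poly ([:1, 1:] * [:c, b, A:]) 0 \<noteq> 0"
  using c by (simp_all add: g_def)

abbreviation X :: "(complex^(3 option)) set" where "X \<equiv> double_cover_model g"

definition X0 :: "(complex^(3 option)) set" where
  "X0 = affine_chart {v. v$2 = (v$1)\<^sup>2 \<and> (v$3)\<^sup>2 = poly g (v$1)}"

lemma X_eq: "X = proj_closure X0"
  by (simp add: double_cover_model_def X0_def)

lemma X0_iff: "x \<in> X0 \<longleftrightarrow> (\<exists>k t W. k \<noteq> 0 \<and> W\<^sup>2 = poly g t \<and> x = k *s vec3 1 t (t\<^sup>2) W)"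
proof
  assume "x \<in> X0"
  then obtain k and v :: "complex^3" where k: "k \<noteq> 0" "v$2 = (v$1)\<^sup>2" "(v$3)\<^sup>2 = poly g (v$1)" "x = k *s lift_affine v"
    unfolding X0_def affine_chart_iff by auto
  thus "\<exists>k t W. k \<noteq> 0 \<and> W\<^sup>2 = poly g t \<and> x = k *s vec3 1 t (t\<^sup>2) W"
    by (intro exI[of _ k] exI[of _ "v$1"] exI[of _ "v$3"]) (simp add: lift_affine_3)
next
  assume "\<exists>k t W. k \<noteq> 0 \<and> W\<^sup>2 = poly g t \<and> x = k *s vec3 1 t (t\<^sup>2) W"
  then obtain k t W where k: "k \<noteq> 0" "W\<^sup>2 = poly g t" "x = k *s vec3 1 t (t\<^sup>2) W" by blast
  define v :: "complex^3" where "v = vector [t, t\<^sup>2, W]"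
  have "v$1 = t" "v$2 = t\<^sup>2" "v$3 = W" by (simp_all add: v_def vector_3)
  thus "x \<in> X0" unfolding X0_def affine_chart_iff
    using k by (intro exI[of _ k] exI[of _ v]) (simp add: lift_affine_3)
qed

lemma X0I: "W\<^sup>2 = poly g t \<Longrightarrow> k \<noteq> 0 \<Longrightarrow> k *s vec3 1 t (t\<^sup>2) W \<in> X0"
  unfolding X0_iff by blast

lemma curve_like_X0: "curve_like X0"
proof -
  define A' B' :: "3 option \<Rightarrow> complex poly"
    where "A' = (\<lambda>j. case j of None \<Rightarrow> 1 | Some i \<Rightarrow> if i = 1 then [:0, 1:] else if i = 2 then [:0, 0, 1:] else 0)"
      and "B' = (\<lambda>j. case j of None \<Rightarrow> 0 | Some i \<Rightarrow> if i = 3 then 1 else 0)"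
  have cm: "cover_map A' B' (t, W) = vec3 1 t (t\<^sup>2) W" for t W
    by (simp add: cover_map_def vec3_eq_iff A'_def B'_def power2_eq_square)
  show ?thesis
  proof (rule curve_like_cover[OF g_split(2) g_split(1), of "{}" A' B'])
    show "cover_map A' B' z \<noteq> 0" for z by (cases z) (simp add: cm vec3_eq_iff)
    show "z = z'" if "cover_map A' B' z \<in> proj_point (cover_map A' B' z')" for z z'
      using that by (cases z; cases z') (auto simp: cm proj_point_def vec3_eq_iff)
    show "X0 = {c *s cover_map A' B' z |c z. c \<noteq> 0 \<and> z \<in> cover_points g {}}"
    proof (intro equalityI subsetI)
      fix x assume "x \<in> X0"
      then obtain k t W where "k \<noteq> 0" "W\<^sup>2 = poly g t" "x = k *s vec3 1 t (t\<^sup>2) W" unfolding X0_iff by blast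
      thus "x \<in> {c *s cover_map A' B' z |c z. c \<noteq> 0 \<and> z \<in> cover_points g {}}"
        unfolding mem_Collect_eq
        by (intro exI[of _ k] exI[of _ "(t, W)"]) (simp add: cm cover_points_def)
    next
      fix x assume "x \<in> {c *s cover_map A' B' z |c z. c \<noteq> 0 \<and> z \<in> cover_points g {}}"
      then obtain k t W where "k \<noteq> 0" "(t, W) \<in> cover_points g {}" "x = k *s cover_map A' B' (t, W)" by auto
      thus "x \<in> X0" by (auto simp: cm cover_points_def intro: X0I)
    qed
  qed auto
qed

definition F1 :: "complex^(3 option) \<Rightarrow> complex" where
  "F1 x = x $ Some 2 * x $ None - x $ Some 1 * x $ Some 1"

text \<open>The expansion A t^4 + (A + b) t^3 + (b + c) t^2 + c t, written as a quadratic form in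
  t^2, t and 1. Together with \<open>F1\<close> it places the model in an intersection of two
  quadrics.\<close>

definition F2 :: "complex^(3 option) \<Rightarrow> complex" where
  "F2 x = x $ Some 3 * x $ Some 3 - (A * (x $ Some 2 * x $ Some 2) + (A + b) * (x $ Some 2 * x $ Some 1)
     + (b + c) * (x $ Some 1 * x $ Some 1) + c * (x $ Some 1 * x $ None))"

lemma F12_forms: "F1 \<in> forms 2" "F2 \<in> forms 2"
  unfolding F1_def[abs_def] F2_def[abs_def]
  by (intro forms_diff forms_add forms_scale forms_1_1 forms_coord)+

lemma F12_X0: assumes "x \<in> X0" shows "F1 x = 0" "F2 x = 0"
proof -
  obtain k t W where x: "k \<noteq> 0" "W\<^sup>2 = poly g t" "x = k *s vec3 1 t (t\<^sup>2) W" using assms unfolding X0_iff by blast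
  show "F1 x = 0" by (simp add: F1_def x(3) power2_eq_square)
  have "F2 x = k\<^sup>2 * (W\<^sup>2 - poly g t)"
    by (simp add: F2_def x(3) poly_g power2_eq_square algebra_simps)
  thus "F2 x = 0" by (simp add: x(2))
qed

lemma F12_X: assumes "x \<in> X" shows "F1 x = 0" "F2 x = 0"
  using proj_closure_vanish[OF F12_forms(1) F12_X0(1)] proj_closure_vanish[OF F12_forms(2) F12_X0(2)] assms
  unfolding X_eq by blast+

lemma X0_X: "X0 \<subseteq> X"
  unfolding X_eq using proj_closure_extensive curve_likeD(1)[OF curve_like_X0] by blast

lemma X_finite_point:
  assumes x: "x \<in> X" "x $ None \<noteq> 0"
  shows "x \<in> X0"
proof -
  define k t W where "k = x $ None" "t = x $ Some 1 / x $ None" "W = x $ Some 3 / x $ None"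
  have x1: "x $ Some 1 = k * t" "x $ Some 3 = k * W" using x(2) by (simp_all add: k_t_W_def)
  have x2: "x $ Some 2 = k * t\<^sup>2"
    using F12_X(1)[OF x(1)] x(2) unfolding F1_def x1 k_t_W_def(1)[symmetric]
    by (simp add: power2_eq_square)
  have "k\<^sup>2 * (W\<^sup>2 - poly g t) = F2 x"
    unfolding F2_def x1 x2 k_t_W_def(1)[symmetric] by (simp add: poly_g power2_eq_square algebra_simps)
  hence "W\<^sup>2 = poly g t" using F12_X(2)[OF x(1)] x(2) by (simp add: k_t_W_def)
  moreover have "x = k *s vec3 1 t (t\<^sup>2) W" using x1 x2 by (simp add: vec3_eq_iff k_t_W_def(1))
  ultimately show ?thesis using x(2) unfolding X0_iff k_t_W_def(1)[symmetric] by blast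
qed

text \<open>At infinity \<open>F1\<close> forces t = 0 and \<open>F2\<close> reduces to W^2 = A u^2,
  u being the coordinate of t^2. Since A is nonzero this leaves just two points.\<close>

lemma X_infinite_point:
  assumes x: "x \<in> X" "x $ None = 0"
  shows "x $ Some 1 = 0" "(x $ Some 3)\<^sup>2 = A * (x $ Some 2)\<^sup>2" "x $ Some 2 \<noteq> 0"
proof -
  show x1: "x $ Some 1 = 0" using F12_X(1)[OF x(1)] x(2) by (simp add: F1_def)
  show x3: "(x $ Some 3)\<^sup>2 = A * (x $ Some 2)\<^sup>2"
    using F12_X(2)[OF x(1)] x(2) x1 by (simp add: F2_def power2_eq_square)
  show "x $ Some 2 \<noteq> 0"
  proof
    assume "x $ Some 2 = 0"
    hence "x = 0" using x1 x3 x(2) by (simp add: vec3_eq_iff)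
    thus False using x(1) proj_closure_nonzero X_eq by blast
  qed
qed

lemma curve_like_X: "curve_like X"
proof (rule curve_like_superset[OF curve_like_X0 X0_X])
  show "x \<noteq> 0" if "x \<in> X" for x using that proj_closure_nonzero X_eq by blast
  show "c *s x \<in> X" if "x \<in> X" "c \<noteq> 0" for x c using that proj_closure_scale X_eq by metis
  have "proj_point ` (X - X0) \<subseteq> {proj_point (vec3 0 0 1 (csqrt A)), proj_point (vec3 0 0 1 (- csqrt A))}"
  proof (rule image_subsetI)
    fix x assume "x \<in> X - X0"
    hence x: "x \<in> X" "x \<notin> X0" by auto
    have x0: "x $ None = 0" using X_finite_point x by blast
    note i = X_infinite_point[OF x(1) x0]
    have "(x $ Some 3)\<^sup>2 = (csqrt A * x $ Some 2)\<^sup>2" using i(2) by (simp add: power_mult_distrib)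
    hence "x $ Some 3 = csqrt A * x $ Some 2 \<or> x $ Some 3 = - (csqrt A * x $ Some 2)" by (simp only: power2_eq_iff)
    thus "proj_point x \<in> {proj_point (vec3 0 0 1 (csqrt A)), proj_point (vec3 0 0 1 (- csqrt A))}"
    proof
      assume "x $ Some 3 = csqrt A * x $ Some 2"
      hence "x = x $ Some 2 *s vec3 0 0 1 (csqrt A)" using i(1) x0 by (simp add: vec3_eq_iff)
      hence "proj_point x = proj_point (vec3 0 0 1 (csqrt A))" using proj_point_scale[OF i(3)] by metis
      thus ?thesis by simp
    next
      assume "x $ Some 3 = - (csqrt A * x $ Some 2)"
      hence "x = x $ Some 2 *s vec3 0 0 1 (- csqrt A)" using i(1) x0 by (simp add: vec3_eq_iff)
      hence "proj_point x = proj_point (vec3 0 0 1 (- csqrt A))" using proj_point_scale[OF i(3)] by metis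
      thus ?thesis by simp
    qed
  qed
  thus "finite (proj_point ` (X - X0))" by (rule finite_subset) simp
  show "F x = 0" if "F \<in> forms d" "\<And>x. x \<in> X0 \<Longrightarrow> F x = 0" "x \<in> X" for d F x
    using proj_closure_vanish[OF that(1,2)] that(3) unfolding X_eq by blast
qed

lemma projective_curve_X: "projective_curve X"
  by (rule curve_like_projective_curve[OF curve_like_X]) (simp add: X_eq proj_closed_closure)

lemma X_nonzero: "x \<in> X \<Longrightarrow> x \<noteq> 0"
  using curve_likeD(1)[OF curve_like_X] by blast

text \<open>The projection that forgets the coordinate t^2 is inverted by sending (1 : t : W) to (1
  : t : t^2 : W), written with forms of degree two.\<close>

lemma birational_affine_double_cover: "birational X (affine_chart (double_cover_affine g))"
proof -
  define Y where "Y = affine_chart (double_cover_affine g)"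
  have Y_iff: "y \<in> Y \<longleftrightarrow> (\<exists>k t W. k \<noteq> 0 \<and> W\<^sup>2 = poly g t \<and> y = k *s vec2 1 t W)" for y
  proof
    assume "y \<in> Y"
    then obtain k and v :: "complex^2" where "k \<noteq> 0" "(v$2)\<^sup>2 = poly g (v$1)" "y = k *s lift_affine v"
      unfolding Y_def affine_chart_iff double_cover_affine_def by auto
    thus "\<exists>k t W. k \<noteq> 0 \<and> W\<^sup>2 = poly g t \<and> y = k *s vec2 1 t W"
      by (intro exI[of _ k] exI[of _ "v$1"] exI[of _ "v$2"]) (simp add: lift_affine_2)
  next
    assume "\<exists>k t W. k \<noteq> 0 \<and> W\<^sup>2 = poly g t \<and> y = k *s vec2 1 t W"
    then obtain k t W where k: "k \<noteq> 0" "W\<^sup>2 = poly g t" "y = k *s vec2 1 t W" by blast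
    define v :: "complex^2" where "v = vector [t, W]"
    have "v$1 = t" "v$2 = W" by (simp_all add: v_def)
    thus "y \<in> Y" unfolding Y_def affine_chart_iff double_cover_affine_def
      using k by (intro exI[of _ k] exI[of _ v]) (simp add: lift_affine_2)
  qed
  define A' B' :: "2 option \<Rightarrow> complex poly"
    where "A' = (\<lambda>j. case j of None \<Rightarrow> 1 | Some i \<Rightarrow> if i = 1 then [:0, 1:] else 0)"
      and "B' = (\<lambda>j. case j of None \<Rightarrow> 0 | Some i \<Rightarrow> if i = 2 then 1 else 0)"
  have cm: "cover_map A' B' (t, W) = vec2 1 t W" for t W
    by (simp add: cover_map_def vec2_eq_iff A'_def B'_def)
  have "curve_like Y"
  proof (rule curve_like_cover[OF g_split(2) g_split(1), of "{}" A' B'])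
    show "cover_map A' B' z \<noteq> 0" for z by (cases z) (simp add: cm vec2_eq_iff)
    show "z = z'" if "cover_map A' B' z \<in> proj_point (cover_map A' B' z')" for z z'
      using that by (cases z; cases z') (auto simp: cm proj_point_def vec2_eq_iff)
    show "Y = {c *s cover_map A' B' z |c z. c \<noteq> 0 \<and> z \<in> cover_points g {}}"
    proof (intro equalityI subsetI)
      fix x assume "x \<in> Y"
      then obtain k t W where "k \<noteq> 0" "W\<^sup>2 = poly g t" "x = k *s vec2 1 t W" unfolding Y_iff by blast
      thus "x \<in> {c *s cover_map A' B' z |c z. c \<noteq> 0 \<and> z \<in> cover_points g {}}"
        unfolding mem_Collect_eq
        by (intro exI[of _ k] exI[of _ "(t, W)"]) (simp add: cm cover_points_def)
    next
      fix x assume "x \<in> {c *s cover_map A' B' z |c z. c \<noteq> 0 \<and> z \<in> cover_points g {}}"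
      then obtain k t W where "k \<noteq> 0" "(t, W) \<in> cover_points g {}" "x = k *s cover_map A' B' (t, W)" by auto
      thus "x \<in> Y" unfolding Y_iff by (auto simp: cm cover_points_def)
    qed
  qed auto
  note Y = this
  define f where "f = (\<lambda>x :: complex^(3 option). vec2 (x $ None) (x $ Some 1) (x $ Some 3))"
  define k where "k = (\<lambda>y :: complex^(2 option). vec3 (y $ None * y $ None) (y $ None * y $ Some 1) (y $ Some 1 * y $ Some 1) (y $ None * y $ Some 2))"
  have iso: "proj_iso_via f X0 Y"
  proof (rule proj_iso_via_vectors[where g = k])
    show "(\<lambda>x. f x $ j) \<in> forms 1" for j unfolding f_def by (intro forms_vec2 forms_coord)
    show "(\<lambda>x. k x $ j) \<in> forms 2" for j unfolding k_def by (intro forms_vec3 forms_1_1 forms_coord)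
    show "f x \<in> Y" if x: "x \<in> X0" for x
    proof -
      obtain r t W where "r \<noteq> 0" "W\<^sup>2 = poly g t" "x = r *s vec3 1 t (t\<^sup>2) W" using x unfolding X0_iff by blast
      thus ?thesis unfolding Y_iff by (intro exI[of _ r] exI[of _ t] exI[of _ W]) (simp add: f_def vec2_scale)
    qed
    show "k y \<in> X0" if y: "y \<in> Y" for y
    proof -
      obtain r t W where "r \<noteq> 0" "W\<^sup>2 = poly g t" "y = r *s vec2 1 t W" using y unfolding Y_iff by blast
      thus ?thesis unfolding X0_iff by (intro exI[of _ "r\<^sup>2"] exI[of _ t] exI[of _ W]) (simp add: k_def vec3_scale power2_eq_square mult_ac)
    qed
    show "k (f x) \<in> proj_point x" if x: "x \<in> X0" for x
    proof -
      obtain r t W where r: "r \<noteq> 0" "W\<^sup>2 = poly g t" "x = r *s vec3 1 t (t\<^sup>2) W" using x unfolding X0_iff by blast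
      show ?thesis by (rule proj_pointI[OF r(1)]) (simp add: f_def k_def r(3) vec3_eq_iff power2_eq_square mult_ac)
    qed
    show "f (k y) \<in> proj_point y" if y: "y \<in> Y" for y
    proof -
      obtain r t W where r: "r \<noteq> 0" "W\<^sup>2 = poly g t" "y = r *s vec2 1 t W" using y unfolding Y_iff by blast
      show ?thesis by (rule proj_pointI[OF r(1)]) (simp add: f_def k_def r(3) vec2_eq_iff power2_eq_square mult_ac)
    qed
    show "x \<noteq> 0" if "x \<in> X0" for x by (rule curve_likeD(1)[OF curve_like_X0 that])
    show "y \<noteq> 0" if "y \<in> Y" for y by (rule curve_likeD(1)[OF Y that])
  qed
  have "X0 = {x \<in> X. x $ None \<noteq> 0}"
  proof (intro equalityI subsetI)
    fix x assume x: "x \<in> X0"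
    hence "x $ None \<noteq> 0" unfolding X0_iff by auto
    thus "x \<in> {x \<in> X. x $ None \<noteq> 0}" using x X0_X by blast
  qed (use X_finite_point in blast)
  hence "proj_open_in X X0" using proj_open_in_nonvanishing[OF forms_coord X_nonzero] by simp
  moreover have "X0 \<noteq> {}" "Y \<noteq> {}" using curve_like_irreducible[OF curve_like_X0] curve_like_irreducible[OF Y]
    by (auto simp: proj_irreducible_def)
  ultimately show ?thesis
    unfolding birational_def Y_def[symmetric]
    using curve_like_irreducible[OF curve_like_X] curve_like_irreducible[OF Y] iso proj_open_in_self[of Y] by blast
qed

text \<open>On the affine curve a form of degree \<open>d\<close> becomes \<open>a(t) + W b(t)\<close> with \<open>deg a \<le> 2 d\<close> and
  \<open>deg b \<le> 2 d - 2\<close>, and all such pairs occur.\<close>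

definition model_monomial :: "nat \<Rightarrow> nat \<Rightarrow> complex^(3 option) \<Rightarrow> complex" where
  "model_monomial d k x = (x $ Some 1) ^ (k mod 2) * (x $ Some 2) ^ (k div 2) * (x $ None) ^ (d - (k mod 2 + k div 2))"

lemma model_monomial_forms:
  assumes "k \<le> 2 * d" shows "model_monomial d k \<in> forms d"
  unfolding model_monomial_def[abs_def]
proof (rule forms_times[OF forms_times[OF forms_power[OF forms_coord] forms_power[OF forms_coord] refl] forms_power[OF forms_coord]])
  have "k mod 2 + k div 2 \<le> d"
    using assms by presburger
  thus "(k mod 2 * 1 + k div 2 * 1) + (d - (k mod 2 + k div 2)) * 1 = d" by simp
qed

lemma model_monomial_value: "model_monomial d k (vec3 1 t (t\<^sup>2) W) = t ^ k"
proof -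
  have "t ^ (k mod 2) * (t\<^sup>2) ^ (k div 2) = t ^ (k mod 2 + 2 * (k div 2))"
    by (simp only: power_add power_mult)
  also have "k mod 2 + 2 * (k div 2) = k" by presburger
  finally show ?thesis by (simp add: model_monomial_def)
qed

lemma poly_as_sum_le:
  fixes p :: "complex poly"
  assumes "degree p \<le> n" shows "poly p t = (\<Sum>k\<le>n. coeff p k * t ^ k)"
  unfolding poly_altdef using assms
  by (intro sum.mono_neutral_left) (auto simp: coeff_eq_0)

lemma degree_g: "degree g = 4"
proof -
  have "[:0, 1 :: complex:] * [:1, 1:] \<noteq> 0" "[:c, b, A:] \<noteq> 0" using A by simp_all
  hence "degree g = degree ([:0, 1 :: complex:] * [:1, 1:]) + degree [:c, b, A:]"
    unfolding g_def by (rule degree_mult_eq)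
  thus ?thesis using A by simp
qed

text \<open>Give t weight 1 and W weight 2; every coordinate then has weight at most 2, and a form
  of degree d has weight at most 2 d. Replacing W^2 by g, of degree 4, preserves this, so a
  remaining factor W leaves a coefficient of degree at most 2 d - 2.\<close>

lemma form_on_model:
  assumes F: "F \<in> forms d" and d: "d \<ge> 1"
  shows "\<exists>p q. degree p \<le> 2 * d \<and> degree q \<le> 2 * (d - 1) \<and> (\<forall>t W. W\<^sup>2 = poly g t \<longrightarrow> F (vec3 1 t (t\<^sup>2) W) = poly p t + W * poly q t)"
proof -
  define R where "R = (\<lambda>\<phi> :: complex \<Rightarrow> complex \<Rightarrow> complex. \<exists>p q. degree p \<le> 2 * d \<and> degree q \<le> 2 * (d - 1) \<and> (\<forall>t W. W\<^sup>2 = poly g t \<longrightarrow> \<phi> t W = poly p t + W * poly q t))"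
  have R0: "R (\<lambda>t W. 0)" unfolding R_def by (rule exI[of _ 0], rule exI[of _ 0]) auto
  have R_add: "R (\<lambda>t W. f t W + k t W)" if f: "R f" and k: "R k" for f k
  proof -
    obtain p q where pq: "degree p \<le> 2 * d" "degree q \<le> 2 * (d - 1)" "\<forall>t W. W\<^sup>2 = poly g t \<longrightarrow> f t W = poly p t + W * poly q t"
      using f unfolding R_def by blast
    obtain p' q' where pq': "degree p' \<le> 2 * d" "degree q' \<le> 2 * (d - 1)" "\<forall>t W. W\<^sup>2 = poly g t \<longrightarrow> k t W = poly p' t + W * poly q' t"
      using k unfolding R_def by blast
    show ?thesis unfolding R_def
      by (rule exI[of _ "p + p'"], rule exI[of _ "q + q'"]) (use pq pq' in \<open>auto simp: algebra_simps intro!: degree_add_le\<close>)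
  qed
  have R_scale: "R (\<lambda>t W. k * f t W)" if f: "R f" for f k
  proof -
    obtain p q where pq: "degree p \<le> 2 * d" "degree q \<le> 2 * (d - 1)" "\<forall>t W. W\<^sup>2 = poly g t \<longrightarrow> f t W = poly p t + W * poly q t"
      using f unfolding R_def by blast
    show ?thesis unfolding R_def
      by (rule exI[of _ "smult k p"], rule exI[of _ "smult k q"])
         (use pq degree_smult_le in \<open>auto simp: algebra_simps intro: order_trans\<close>)
  qed
  have R_sum: "R (\<lambda>t W. \<Sum>i\<in>I. f i t W)" if "\<And>i. i \<in> I \<Longrightarrow> R (f i)" for f and I :: "(3 option \<Rightarrow> nat) set"
    using that by (induction I rule: infinite_finite_induct) (auto intro: R0 R_add)
  have R_mono: "R (\<lambda>t W. monom_fun \<alpha> (vec3 1 t (t\<^sup>2) W))" if \<alpha>: "sum \<alpha> UNIV = d" for \<alpha>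
  proof -
    define a1 a2 l where "a1 = \<alpha> (Some 1)" "a2 = \<alpha> (Some 2)" "l = \<alpha> (Some 3)"
    have U: "(UNIV :: 3 option set) = {None, Some 1, Some 2, Some 3}"
      using forall_3_option[of "\<lambda>j. j \<in> {None, Some 1, Some 2, Some 3}"] by auto
    have al: "a1 + a2 + l \<le> d" using \<alpha> unfolding U a1_a2_l_def by simp
    have mf: "monom_fun \<alpha> (vec3 1 t (t\<^sup>2) W) = t ^ (a1 + 2 * a2) * W ^ l" for t W
      unfolding monom_fun_def U a1_a2_l_def by (simp add: power_add power_mult)
    define q where "q = monom 1 (a1 + 2 * a2) * g ^ (l div 2)"
    have dq: "degree q \<le> a1 + 2 * a2 + 4 * (l div 2)"
    proof -
      have "degree q \<le> degree (monom (1::complex) (a1 + 2 * a2)) + degree (g ^ (l div 2))"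
        unfolding q_def by (rule degree_mult_le)
      also have "\<dots> \<le> (a1 + 2 * a2) + 4 * (l div 2)"
        using degree_power_le[of g "l div 2"] degree_g by (intro add_mono degree_monom_le) simp
      finally show ?thesis .
    qed
    have qv: "poly q t * W ^ (l mod 2) = t ^ (a1 + 2 * a2) * W ^ l" if "W\<^sup>2 = poly g t" for t W
    proof -
      have "W ^ l = W ^ (2 * (l div 2) + l mod 2)" by simp
      also have "\<dots> = poly g t ^ (l div 2) * W ^ (l mod 2)" by (simp only: power_add power_mult that)
      finally show ?thesis by (simp add: q_def poly_monom)
    qed
    show ?thesis
    proof (cases "l mod 2 = 0")
      case True
      have "2 * (l div 2) \<le> l" by simp
      hence "degree q \<le> 2 * d" using dq al by linarith
      thus ?thesis unfolding R_def mf using qv True by (intro exI[of _ q] exI[of _ 0]) auto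
    next
      case False
      hence l1: "l mod 2 = 1" by simp
      hence "2 * (l div 2) + 1 = l" by presburger
      hence "degree q \<le> 2 * (d - 1)" using dq al by linarith
      thus ?thesis unfolding R_def mf using qv l1 by (intro exI[of _ 0] exI[of _ q]) (auto simp: mult.commute)
    qed
  qed
  obtain a where F': "F = (\<lambda>x. \<Sum>\<alpha> | sum \<alpha> UNIV = d. a \<alpha> * monom_fun \<alpha> x)"
    using F unfolding forms_def by blast
  have "R (\<lambda>t W. F (vec3 1 t (t\<^sup>2) W))"
    unfolding F' by (intro R_sum R_scale R_mono) auto
  thus ?thesis unfolding R_def .
qed

text \<open>The free coefficients of a and b number (2 d + 1) + (2 d - 1). They are independent
  because a(t) + W b(t) vanishes on the whole curve only for a = b = 0.\<close>

lemma hilbert_function_X: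
  assumes d: "d \<ge> 1" shows "hilbert_function X d = 4 * d"
proof -
  define I :: "(nat + nat) set" where "I = {..2 * d} <+> {..2 * (d - 1)}"
  define M where "M = (\<lambda>i :: nat + nat. case i of Inl k \<Rightarrow> model_monomial d k | Inr k \<Rightarrow> (\<lambda>x. model_monomial (d - 1) k x * x $ Some 3))"
  have sumI: "(\<Sum>i\<in>I. f i) = (\<Sum>k\<le>2*d. f (Inl k)) + (\<Sum>k\<le>2*(d-1). f (Inr k))" for f :: "nat + nat \<Rightarrow> complex"
    unfolding I_def by (simp add: sum.Plus)
  have Mv: "(\<Sum>i\<in>I. k i * M i (r *s vec3 1 t (t\<^sup>2) W)) = r ^ d * ((\<Sum>j\<le>2*d. k (Inl j) * t ^ j) + W * (\<Sum>j\<le>2*(d-1). k (Inr j) * t ^ j))" for k r t W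
  proof -
    have 1: "model_monomial d j (r *s vec3 1 t (t\<^sup>2) W) = r ^ d * t ^ j" if "j \<le> 2 * d" for j
      using forms_homogeneous[OF model_monomial_forms[OF that]] by (simp add: model_monomial_value)
    have 2: "model_monomial (d - 1) j (r *s vec3 1 t (t\<^sup>2) W) = r ^ (d - 1) * t ^ j" if "j \<le> 2 * (d - 1)" for j
      using forms_homogeneous[OF model_monomial_forms[OF that]] by (simp add: model_monomial_value)
    have r: "r ^ d = r ^ (d - 1) * r" using d by (metis Suc_diff_1 less_eq_Suc_le One_nat_def power_Suc2)
    show ?thesis unfolding sumI M_def sum_distrib_left distrib_left
      by (intro arg_cong2[of _ _ _ _ "(+)"] sum.cong) (auto simp: 1 2[unfolded One_nat_def] r[unfolded One_nat_def] mult_ac)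
  qed
  have "hilbert_function (proj_closure X0) d = card I"
  proof (rule hilbert_function_closure)
    show "x \<noteq> 0" if "x \<in> X0" for x by (rule curve_likeD(1)[OF curve_like_X0 that])
    show "finite I" by (simp add: I_def)
    show "M i \<in> forms d" if "i \<in> I" for i
    proof (cases i)
      case (Inl k)
      thus ?thesis using that by (auto simp: M_def I_def intro: model_monomial_forms)
    next
      case (Inr k)
      have "(\<lambda>x. model_monomial (d - 1) k x * x $ Some 3) \<in> forms d"
        by (rule forms_times[OF model_monomial_forms forms_coord]) (use that Inr d in \<open>auto simp: I_def\<close>)
      thus ?thesis by (simp add: M_def Inr)
    qed
    show "\<exists>k. \<forall>x\<in>X0. F x = (\<Sum>i\<in>I. k i * M i x)" if F: "F \<in> forms d" for F
    proof -
      obtain p q where pq: "degree p \<le> 2 * d" "degree q \<le> 2 * (d - 1)" "\<And>t W. W\<^sup>2 = poly g t \<Longrightarrow> F (vec3 1 t (t\<^sup>2) W) = poly p t + W * poly q t"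
        using form_on_model[OF F d] by blast
      define k where "k = (\<lambda>i :: nat + nat. case i of Inl j \<Rightarrow> coeff p j | Inr j \<Rightarrow> coeff q j)"
      have "F x = (\<Sum>i\<in>I. k i * M i x)" if x: "x \<in> X0" for x
      proof -
        obtain r t W where r: "r \<noteq> 0" "W\<^sup>2 = poly g t" "x = r *s vec3 1 t (t\<^sup>2) W" using x unfolding X0_iff by blast
        show ?thesis unfolding r(3) Mv forms_homogeneous[OF F] pq(3)[OF r(2)] poly_as_sum_le[OF pq(1)] poly_as_sum_le[OF pq(2)]
          by (simp add: k_def)
      qed
      thus ?thesis by blast
    qed
    show "\<forall>i\<in>I. k i = 0" if zero: "\<And>x. x \<in> X0 \<Longrightarrow> (\<Sum>i\<in>I. k i * M i x) = 0" for k
    proof -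
      define p where "p = (\<Sum>j\<le>2*d. monom (k (Inl j)) j)"
      define q where "q = (\<Sum>j\<le>2*(d-1). monom (k (Inr j)) j)"
      have "poly p t + W * poly q t = 0" if W: "W\<^sup>2 = poly g t" for t W
        using zero[OF X0I[OF W, of 1]] Mv[of k 1 t W] by (simp add: p_def q_def poly_sum poly_monom)
      hence "{(t, W) \<in> cover_points g {}. poly p t + W * poly q t = 0} = cover_points g {}"
        by (auto simp: cover_points_def)
      hence inf: "infinite {(t, W) \<in> cover_points g {}. poly p t + W * poly q t = 0}"
        using infinite_cover_points[of "{}" g] by simp
      have "p = 0" "q = 0" by (rule cover_function_zero[OF g_split(2,1) inf])+
      have "k (Inl j) = 0" if "j \<le> 2 * d" for j
      proof -
        have "coeff p j = k (Inl j)" using that by (simp add: p_def coeff_sum sum.delta)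
        thus ?thesis using \<open>p = 0\<close> by simp
      qed
      moreover have "k (Inr j) = 0" if "j \<le> 2 * (d - 1)" for j
      proof -
        have "coeff q j = k (Inr j)" using that by (simp add: q_def coeff_sum sum.delta)
        thus ?thesis using \<open>q = 0\<close> by simp
      qed
      ultimately show ?thesis by (auto simp: I_def)
    qed
  qed
  also have "card I = 4 * d" using d by (simp add: I_def card_Plus)
  finally show ?thesis by (simp add: X_eq)
qed

lemma arithmetic_genus_X: "arithmetic_genus X = 1"
  using arithmetic_genus_linear[of 1 X 4 0] hilbert_function_X by simp

end

text \<open>Dividing by W^2 moves the argument of the square root to 1 at s = 0, away from the
  branch cut of \<open>csqrt\<close>.\<close>

lemma sqrt_arc:
  fixes p :: "complex poly"
  assumes W: "W\<^sup>2 = poly p t" "W \<noteq> 0"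
  obtains R where "\<And>s. (R s)\<^sup>2 = poly p (t + s)" "R 0 = W"
    "(R has_field_derivative poly (pderiv p) t / (2 * W)) (at 0)"
proof -
  define R where "R = (\<lambda>s. W * csqrt (poly p (t + s) / W\<^sup>2))"
  show ?thesis
  proof (rule that[of R])
    show "(R s)\<^sup>2 = poly p (t + s)" for s using W(2) by (simp add: R_def power_mult_distrib)
    have 1: "poly p (t + 0) / W\<^sup>2 = 1" using W(2) by (simp add: W(1)[symmetric])
    thus "R 0 = W" by (simp add: R_def)
    have "((\<lambda>s. poly p (t + s)) has_field_derivative poly (pderiv p) (t + 0) * 1) (at 0)"
      by (rule DERIV_chain2[OF poly_DERIV]) (auto intro!: derivative_eq_intros)
    hence "((\<lambda>s. poly p (t + s) / W\<^sup>2) has_field_derivative poly (pderiv p) t / W\<^sup>2) (at 0)"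
      by (intro DERIV_cdivide) simp
    moreover have "(csqrt has_field_derivative inverse (2 * csqrt 1)) (at (poly p (t + 0) / W\<^sup>2))"
      unfolding 1 by (rule has_field_derivative_csqrt) auto
    ultimately have "((\<lambda>s. csqrt (poly p (t + s) / W\<^sup>2)) has_field_derivative (inverse (2 * csqrt 1)) * (poly (pderiv p) t / W\<^sup>2)) (at 0)"
      by (rule DERIV_chain2[rotated])
    hence "(R has_field_derivative W * ((inverse (2 * csqrt 1)) * (poly (pderiv p) t / W\<^sup>2))) (at 0)"
      unfolding R_def by (rule DERIV_cmult)
    thus "(R has_field_derivative poly (pderiv p) t / (2 * W)) (at 0)"
      using W(2) by (simp add: power2_eq_square field_simps)
  qed
qed

text \<open>Where W is nonzero, t serves as local parameter. At a branch point W does: p is locally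
  invertible there, so t is a holomorphic function of W^2 and moves with velocity 0.\<close>

lemma double_cover_arc:
  fixes p :: "complex poly"
  assumes W: "W\<^sup>2 = poly p t" and ns: "W \<noteq> 0 \<or> poly (pderiv p) t \<noteq> 0"
  obtains T R a b' where "T 0 = t" "R 0 = W" "(T has_field_derivative a) (at 0)" "(R has_field_derivative b') (at 0)"
    "eventually (\<lambda>s. (R s)\<^sup>2 = poly p (T s)) (at 0)"
    "W \<noteq> 0 \<and> a = 1 \<and> b' = poly (pderiv p) t / (2 * W) \<or> W = 0 \<and> a = 0 \<and> b' = 1"
proof (cases "W = 0")
  case False
  obtain R where R: "\<And>s. (R s)\<^sup>2 = poly p (t + s)" "R 0 = W"
    "(R has_field_derivative poly (pderiv p) t / (2 * W)) (at 0)"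
    by (rule sqrt_arc[OF W False]) blast
  have "((\<lambda>s. t + s) has_field_derivative 1) (at 0)" by (auto intro!: derivative_eq_intros)
  thus ?thesis using that[of "\<lambda>s. t + s" R 1] R False by simp
next
  case True
  hence p': "poly (pderiv p) t \<noteq> 0" and p0: "poly p t = 0" using ns W by auto
  have hol: "poly p holomorphic_on UNIV" by (intro holomorphic_intros)
  have "deriv (poly p) t \<noteq> 0" using p' DERIV_imp_deriv[OF poly_DERIV[of p t]] by simp
  then obtain r where r: "r > 0" "inj_on (poly p) (ball t r)"
    using has_complex_derivative_locally_injective[OF hol UNIV_I open_UNIV] by blast
  have holb: "poly p holomorphic_on ball t r" using hol holomorphic_on_subset by blast
  obtain k where k: "k holomorphic_on (poly p ` ball t r)" "\<And>z. z \<in> ball t r \<Longrightarrow> k (poly p z) = z"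
    by (rule holomorphic_has_inverse[OF holb open_ball r(2)]) blast
  have op: "open (poly p ` ball t r)" by (rule open_mapping_thm3[OF holb open_ball r(2)])
  have in0: "0 \<in> poly p ` ball t r" using p0 r(1) by (intro image_eqI[of _ _ t]) auto
  have k0: "k 0 = t" using k(2)[of t] r(1) p0 by simp
  have dk: "(k has_field_derivative deriv k 0) (at 0)" by (rule holomorphic_derivI[OF k(1) op in0])
  have dT: "((\<lambda>s. k (s\<^sup>2)) has_field_derivative 0) (at 0)"
  proof -
    have "((\<lambda>s. k (s\<^sup>2)) has_field_derivative deriv k 0 * (2 * 0)) (at (0::complex))"
      by (rule DERIV_chain2[of k]) (use dk in \<open>auto intro!: derivative_eq_intros\<close>)
    thus ?thesis by simp
  qed
  have "open ((\<lambda>s::complex. s\<^sup>2) -` (poly p ` ball t r))"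
    by (intro open_vimage op continuous_intros)
  hence "eventually (\<lambda>s::complex. s \<in> (\<lambda>s. s\<^sup>2) -` (poly p ` ball t r)) (nhds 0)"
    by (rule eventually_nhds_in_open) (use in0 in simp)
  hence "eventually (\<lambda>s::complex. s\<^sup>2 = poly p (k (s\<^sup>2))) (nhds 0)"
    by eventually_elim (use k(2) in auto)
  hence ev: "eventually (\<lambda>s::complex. s\<^sup>2 = poly p (k (s\<^sup>2))) (at 0)"
    by (simp add: eventually_nhds_conv_at)
  have dR: "((\<lambda>s::complex. s) has_field_derivative 1) (at 0)" by (auto intro!: derivative_eq_intros)
  show ?thesis using that[of "\<lambda>s. k (s\<^sup>2)" "\<lambda>s. s" 0 1] k0 dT dR ev True by simp
qed

lemma vec3_has_derivative:
  assumes "(f0 has_field_derivative v0) F" "(f1 has_field_derivative v1) F"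
    "(f2 has_field_derivative v2) F" "(f3 has_field_derivative v3) F"
  shows "((\<lambda>s. vec3 (f0 s) (f1 s) (f2 s) (f3 s) $ i) has_field_derivative vec3 v0 v1 v2 v3 $ i) F"
proof -
  have "\<forall>i. ((\<lambda>s. vec3 (f0 s) (f1 s) (f2 s) (f3 s) $ i) has_field_derivative vec3 v0 v1 v2 v3 $ i) F"
    unfolding forall_3_option using assms by simp
  thus ?thesis by blast
qed

text \<open>Homogeneity multiplies each derivative condition by a nonzero constant, so the tangent
  space does not depend on the coordinate vector chosen for the point.\<close>

lemma curve_nonsingular_scale:
  assumes sc: "\<And>x c. x \<in> X \<Longrightarrow> c \<noteq> 0 \<Longrightarrow> c *s x \<in> X" and k: "k \<noteq> 0"
    and ns: "curve_nonsingular_at X x"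
  shows "curve_nonsingular_at X (k *s x)"
proof -
  have eq: "(v \<in> cone_tangent_space X (k *s x)) = (v \<in> cone_tangent_space X x)" for v
  proof -
    have der: "deriv (\<lambda>s. F (k *s x + s *s v)) 0 = k ^ d / k * deriv (\<lambda>s. F (x + s *s v)) 0" if F: "F \<in> forms d" for F :: "complex^'a \<Rightarrow> complex" and d
    proof -
      have "((\<lambda>s. F (x + s *s v)) has_field_derivative deriv (\<lambda>s. F (x + s *s v)) 0) (at 0)"
        by (rule forms_deriv_along[OF F]) (auto intro!: derivative_eq_intros)
      hence "((\<lambda>s. F (x + s *s v)) has_field_derivative deriv (\<lambda>s. F (x + s *s v)) 0) (at (0 / k))" by simp
      hence "((\<lambda>s. F (x + (s / k) *s v)) has_field_derivative deriv (\<lambda>s. F (x + s *s v)) 0 * (1 / k)) (at 0)"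
        by (rule DERIV_chain2) (use k in \<open>auto intro!: derivative_eq_intros\<close>)
      hence "((\<lambda>s. k ^ d * F (x + (s / k) *s v)) has_field_derivative k ^ d * (deriv (\<lambda>s. F (x + s *s v)) 0 * (1 / k))) (at 0)"
        by (rule DERIV_cmult)
      moreover have "k ^ d * F (x + (s / k) *s v) = F (k *s x + s *s v)" for s
      proof -
        have "k *s (x + (s / k) *s v) = k *s x + s *s v" using k by (simp add: vec_eq_iff algebra_simps)
        thus ?thesis using forms_homogeneous[OF F, of k "x + (s / k) *s v"] by (simp only:)
      qed
      ultimately show ?thesis by (simp add: DERIV_imp_deriv)
    qed
    have kd: "k ^ d / k \<noteq> 0" for d using k by simp
    show ?thesis unfolding cone_tangent_space_def mem_Collect_eq using der kd by (metis (no_types, lifting) mult_eq_0_iff)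
  qed
  hence "cone_tangent_space X (k *s x) = cone_tangent_space X x" by blast
  thus ?thesis using ns by (simp add: curve_nonsingular_at_def)
qed

context quartic
begin

lemma poly_pderiv_g: "poly (pderiv g) t = 4 * A * t ^ 3 + 3 * (A + b) * t\<^sup>2 + 2 * (b + c) * t + c"
  by (simp add: g_def pderiv_mult pderiv_pCons algebra_simps power2_eq_square power3_eq_cube)

text \<open>The differentials of \<open>F1\<close> and \<open>F2\<close> bound the tangent space
  from above. No other equations of X are consulted; explicit arcs will supply the matching lower
  bound.\<close>

lemma tangent_equations:
  assumes "w \<in> cone_tangent_space X x"
  shows "w $ Some 2 * x $ None + x $ Some 2 * w $ None - 2 * x $ Some 1 * w $ Some 1 = 0"
    "2 * x $ Some 3 * w $ Some 3 - (2 * A * x $ Some 2 * w $ Some 2 + (A + b) * (x $ Some 2 * w $ Some 1 + w $ Some 2 * x $ Some 1)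
       + 2 * (b + c) * x $ Some 1 * w $ Some 1 + c * (x $ Some 1 * w $ None + w $ Some 1 * x $ None)) = 0"
proof -
  have z: "\<forall>z\<in>X. F1 z = 0" "\<forall>z\<in>X. F2 z = 0" using F12_X by auto
  note t = assms[unfolded cone_tangent_space_def mem_Collect_eq, THEN spec, THEN bspec]
  have d: "deriv (\<lambda>s. F1 (x + s *s w)) 0 = 0" "deriv (\<lambda>s. F2 (x + s *s w)) 0 = 0"
    using t[OF F12_forms(1)] t[OF F12_forms(2)] z by auto
  have "((\<lambda>s. F1 (x + s *s w)) has_field_derivative 
     (w $ Some 2 * x $ None + x $ Some 2 * w $ None - 2 * x $ Some 1 * w $ Some 1)) (at 0)"
    unfolding F1_def vector_add_component vector_smult_component
    by (rule DERIV_cong, (rule derivative_intros)+, simp add: algebra_simps)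
  from DERIV_imp_deriv[OF this] d(1) show "w $ Some 2 * x $ None + x $ Some 2 * w $ None - 2 * x $ Some 1 * w $ Some 1 = 0" by simp
  have "((\<lambda>s. F2 (x + s *s w)) has_field_derivative 
     (2 * x $ Some 3 * w $ Some 3 - (2 * A * x $ Some 2 * w $ Some 2 + (A + b) * (x $ Some 2 * w $ Some 1 + w $ Some 2 * x $ Some 1)
       + 2 * (b + c) * x $ Some 1 * w $ Some 1 + c * (x $ Some 1 * w $ None + w $ Some 1 * x $ None)))) (at 0)"
    unfolding F2_def vector_add_component vector_smult_component
    by (rule DERIV_cong, (rule derivative_intros)+, simp add: algebra_simps)
  from DERIV_imp_deriv[OF this] d(2)
  show "2 * x $ Some 3 * w $ Some 3 - (2 * A * x $ Some 2 * w $ Some 2 + (A + b) * (x $ Some 2 * w $ Some 1 + w $ Some 2 * x $ Some 1)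
       + 2 * (b + c) * x $ Some 1 * w $ Some 1 + c * (x $ Some 1 * w $ None + w $ Some 1 * x $ None)) = 0" by simp
qed

lemma nonsingular_finite_point:
  assumes W: "W\<^sup>2 = poly g t" and ns: "W \<noteq> 0 \<or> poly (pderiv g) t \<noteq> 0"
  shows "curve_nonsingular_at X (vec3 1 t (t\<^sup>2) W)"
proof -
  define x where "x = vec3 1 t (t\<^sup>2) W"
  have xX: "x \<in> X" using X0I[OF W, of 1] X0_X by (auto simp: x_def)
  obtain T R a b' where TR: "T 0 = t" "R 0 = W" "(T has_field_derivative a) (at 0)" "(R has_field_derivative b') (at 0)"
    "eventually (\<lambda>s. (R s)\<^sup>2 = poly g (T s)) (at 0)" 
    and ab: "W \<noteq> 0 \<and> a = 1 \<and> b' = poly (pderiv g) t / (2 * W) \<or> W = 0 \<and> a = 0 \<and> b' = 1"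
    by (rule double_cover_arc[OF W ns]) blast
  define v where "v = vec3 0 a (2 * t * a) b'"
  have "v \<in> cone_tangent_space X x"
  proof (rule tangent_arc[where \<gamma> = "\<lambda>s. vec3 1 (T s) ((T s)\<^sup>2) (R s)"])
    show "((\<lambda>s. vec3 1 (T s) ((T s)\<^sup>2) (R s) $ i) has_field_derivative v $ i) (at 0)" for i
      unfolding v_def by (rule vec3_has_derivative) (auto intro!: derivative_eq_intros TR simp: TR)
    show "eventually (\<lambda>s. vec3 1 (T s) ((T s)\<^sup>2) (R s) \<in> X) (at 0)"
      using TR(5)
    proof eventually_elim
      case (elim s)
      show ?case using X0I[OF elim, of 1] X0_X by auto
    qed
  qed (simp add: TR x_def)
  moreover have "\<exists>\<alpha> \<beta>. w = \<alpha> *s x + \<beta> *s v" if w: "w \<in> cone_tangent_space X x" for w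
  proof -
    \<comment> \<open>Subtracting the multiple \<alpha> of the position vector leaves a vector
      without homogenizing coordinate, to be compared with the velocity v.\<close>
    define \<alpha> w1 w3 where "\<alpha> = w $ None" "w1 = w $ Some 1 - \<alpha> * t" "w3 = w $ Some 3 - \<alpha> * W"
    have ws: "w $ None = \<alpha>" "w $ Some 1 = \<alpha> * t + w1" "w $ Some 3 = \<alpha> * W + w3" by (simp_all add: \<alpha>_w1_w3_def)
    have e1: "w $ Some 2 = \<alpha> * t\<^sup>2 + 2 * t * w1"
      using tangent_equations(1)[OF w] unfolding x_def by (simp add: ws power2_eq_square algebra_simps)
    have "2 * W * w3 - poly (pderiv g) t * w1 = - 2 * \<alpha> * (W\<^sup>2 - poly g t)"
      using tangent_equations(2)[OF w] unfolding x_def poly_pderiv_g poly_g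
      by (simp add: ws e1 power2_eq_square power3_eq_cube) algebra
    hence e2: "2 * W * w3 = poly (pderiv g) t * w1" using W by simp
    from ab show ?thesis
    proof
      assume ab: "W \<noteq> 0 \<and> a = 1 \<and> b' = poly (pderiv g) t / (2 * W)"
      hence "w3 = w1 * b'" using e2 by (simp add: field_simps)
      thus ?thesis using ab e1 by (intro exI[of _ \<alpha>] exI[of _ w1]) (simp add: vec3_eq_iff ws x_def v_def)
    next
      assume ab: "W = 0 \<and> a = 0 \<and> b' = 1"
      hence "w1 = 0" using e2 ns by auto
      thus ?thesis using ab e1 by (intro exI[of _ \<alpha>] exI[of _ w3]) (simp add: vec3_eq_iff ws x_def v_def)
    qed
  qed
  moreover have "\<alpha> = 0 \<and> \<beta> = 0" if "\<alpha> *s x + \<beta> *s v = 0" for \<alpha> \<beta>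
    using that ab by (auto simp: vec3_eq_iff x_def v_def)
  ultimately have "curve_nonsingular_at X x"
    using curve_nonsingularI[OF tangent_self[OF xX]] by blast
  thus ?thesis by (simp add: x_def)
qed

text \<open>In the parameter s = 1/t the curve near infinity is (s^2 : s : 1 : R(s)) with R(0)^2 = A
  nonzero, so R is a smooth branch of a square root.\<close>

lemma nonsingular_infinite_point:
  assumes x: "x \<in> X" "x $ None = 0"
  shows "curve_nonsingular_at X x"
proof -
  note i = X_infinite_point[OF x]
  define u W where "u = x $ Some 2" "W = x $ Some 3 / x $ Some 2"
  have u: "u \<noteq> 0" and W2: "W\<^sup>2 = A" using i by (simp_all add: u_W_def power_divide)
  have W0: "W \<noteq> 0" using W2 A by auto
  have xs: "x $ Some 2 = u" "x $ Some 3 = u * W" using i by (simp_all add: u_W_def)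
  \<comment> \<open>The reversed quartic s^4 g(1/s).\<close>
  define p where "p = [:A, A + b, b + c, c:]"
  have "W\<^sup>2 = poly p 0" using W2 by (simp add: p_def)
  then obtain R where R: "\<And>s. (R s)\<^sup>2 = poly p (0 + s)" "R 0 = W" 
    "(R has_field_derivative poly (pderiv p) 0 / (2 * W)) (at 0)"
    by (rule sqrt_arc[OF _ W0]) blast
  define b' where "b' = (A + b) / (2 * W)"
  have dR: "(R has_field_derivative b') (at 0)" using R(3) by (simp add: p_def b'_def pderiv_pCons)
  define v where "v = vec3 0 1 0 b'"
  define y where "y = vec3 0 0 1 W"
  have xy: "x = u *s y" using i x by (simp add: vec3_eq_iff y_def xs)
  have inX: "vec3 (s\<^sup>2) s 1 (R s) \<in> X" if s: "s \<noteq> 0" for s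
  proof -
    have "(R s / s\<^sup>2)\<^sup>2 = poly g (1 / s)"
      using R(1)[of s] s by (simp add: power_divide poly_g p_def field_simps power2_eq_square)
    from X0I[OF this, of "s\<^sup>2"] have "s\<^sup>2 *s vec3 1 (1 / s) ((1 / s)\<^sup>2) (R s / s\<^sup>2) \<in> X" using X0_X s by auto
    moreover have "s\<^sup>2 *s vec3 1 (1 / s) ((1 / s)\<^sup>2) (R s / s\<^sup>2) = vec3 (s\<^sup>2) s 1 (R s)"
      using s by (simp add: vec3_eq_iff power2_eq_square)
    ultimately show ?thesis by simp
  qed
  have yX: "y \<in> X"
  proof -
    have "(1 / u) *s x \<in> X" using x u curve_likeD(2)[OF curve_like_X] by simp
    moreover have "(1 / u) *s x = y" using u by (simp add: xy vector_smult_assoc)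
    ultimately show ?thesis by simp
  qed
  have "v \<in> cone_tangent_space X y"
  proof (rule tangent_arc[where \<gamma> = "\<lambda>s. vec3 (s\<^sup>2) s 1 (R s)"])
    show "((\<lambda>s. vec3 (s\<^sup>2) s 1 (R s) $ i) has_field_derivative v $ i) (at 0)" for i
      unfolding v_def by (rule vec3_has_derivative) (auto intro!: derivative_eq_intros dR)
    show "eventually (\<lambda>s. vec3 (s\<^sup>2) s 1 (R s) \<in> X) (at 0)"
      unfolding eventually_at by (rule exI[of _ 1]) (use inX in auto)
  qed (simp add: R y_def)
  moreover have "\<exists>\<alpha> \<beta>. w = \<alpha> *s y + \<beta> *s v" if w: "w \<in> cone_tangent_space X y" for w
  proof -
    have w0: "w $ None = 0" using tangent_equations(1)[OF w] by (simp add: y_def)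
    have "2 * W * w $ Some 3 = 2 * W\<^sup>2 * w $ Some 2 + (A + b) * w $ Some 1"
      using tangent_equations(2)[OF w] W2 by (simp add: y_def)
    hence "w $ Some 3 = w $ Some 2 * W + w $ Some 1 * b'"
      using W0 by (simp add: b'_def field_simps power2_eq_square)
    thus ?thesis using w0 by (intro exI[of _ "w $ Some 2"] exI[of _ "w $ Some 1"]) (simp add: vec3_eq_iff y_def v_def)
  qed
  moreover have "\<alpha> = 0 \<and> \<beta> = 0" if "\<alpha> *s y + \<beta> *s v = 0" for \<alpha> \<beta>
    using that by (auto simp: vec3_eq_iff y_def v_def)
  ultimately have "curve_nonsingular_at X y"
    using curve_nonsingularI[OF tangent_self[OF yX]] by blast
  thus ?thesis unfolding xy
    by (rule curve_nonsingular_scale[rotated 2]) (use u curve_likeD(2)[OF curve_like_X] in auto)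
qed

lemma nonsingular_point:
  assumes x: "x \<in> X" and ns: "\<And>k t W. x = k *s vec3 1 t (t\<^sup>2) W \<Longrightarrow> W\<^sup>2 = poly g t \<Longrightarrow> k \<noteq> 0 \<Longrightarrow> W \<noteq> 0 \<or> poly (pderiv g) t \<noteq> 0"
  shows "curve_nonsingular_at X x"
proof (cases "x $ None = 0")
  case False
  obtain k t W where k: "k \<noteq> 0" "W\<^sup>2 = poly g t" "x = k *s vec3 1 t (t\<^sup>2) W"
    using X_finite_point[OF x False] unfolding X0_iff by blast
  show ?thesis unfolding k(3)
    by (rule curve_nonsingular_scale[OF _ k(1) nonsingular_finite_point[OF k(2) ns[OF k(3,2,1)]]])
       (rule curve_likeD(2)[OF curve_like_X])
qed (rule nonsingular_infinite_point[OF x])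

text \<open>At 0 and -1 the derivative of g is c and - (A - b + c). At any other root it is t (t +
  1) times the derivative of the quadratic factor.\<close>

lemma pderiv_g_at_root:
  assumes "poly g t = 0" "A * t\<^sup>2 + b * t + c \<noteq> 0 \<or> 2 * A * t + b \<noteq> 0"
  shows "poly (pderiv g) t \<noteq> 0"
proof -
  have d: "poly (pderiv g) t = (2 * t + 1) * (A * t\<^sup>2 + b * t + c) + t * (t + 1) * (2 * A * t + b)"
    by (simp add: poly_pderiv_g power2_eq_square power3_eq_cube algebra_simps)
  consider "t = 0" | "t = - 1" | "A * t\<^sup>2 + b * t + c = 0" "t \<noteq> 0" "t \<noteq> - 1"
    using assms(1) by (auto simp: poly_g add_eq_0_iff2)
  thus ?thesis
  proof cases
    case 1 thus ?thesis unfolding d using c by simp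
  next
    case 2 
    have "(2 * t + 1) * (A * t\<^sup>2 + b * t + c) + t * (t + 1) * (2 * A * t + b) = - (A - b + c)" unfolding 2 by simp
    hence "poly (pderiv g) t = - (A - b + c)" using d by (simp only:)
    thus ?thesis using Abc by (metis neg_equal_0_iff_equal)
  next
    case 3
    have "t + 1 \<noteq> 0" using 3(3) by (simp add: add_eq_0_iff2)
    thus ?thesis unfolding d 3(1) using assms(2) 3 by simp
  qed
qed

lemma smooth_X:
  assumes disc: "b\<^sup>2 - 4 * A * c \<noteq> 0" shows "smooth_projective_curve X"
  unfolding smooth_projective_curve_def
proof (intro conjI ballI projective_curve_X nonsingular_point)
  fix k t W assume W: "W\<^sup>2 = poly g t"
  show "W \<noteq> 0 \<or> poly (pderiv g) t \<noteq> 0"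
  proof (cases "W = 0")
    case True
    hence "poly g t = 0" using W by simp
    moreover have "A * t\<^sup>2 + b * t + c \<noteq> 0 \<or> 2 * A * t + b \<noteq> 0"
    proof (rule ccontr)
      assume "\<not> ?thesis"
      hence "A * t\<^sup>2 + b * t + c = 0" "2 * A * t + b = 0" by auto
      \<comment> \<open>At a common zero of the quadratic and its derivative the discriminant, a
        combination of the two, would vanish.\<close>
      moreover have "b\<^sup>2 - 4 * A * c = (2 * A * t + b)\<^sup>2 - 4 * A * (A * t\<^sup>2 + b * t + c)"
        by (simp add: power2_eq_square algebra_simps)
      ultimately show False using disc by simp
    qed
    ultimately show ?thesis using pderiv_g_at_root by blast
  qed simp
qed

end

section \<open>The projective line inside three-space\<close>

lemma forall_1_option: "(\<forall>j :: 1 option. P j) \<longleftrightarrow> P None \<and> P (Some 1)"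
  by (simp add: split_option_all forall_1)

lemma coord_line_3: "x \<in> coord_line None (Some 1) \<longleftrightarrow> (\<exists>m n. (m \<noteq> 0 \<or> n \<noteq> 0) \<and> x = vec3 m n 0 0)"
proof
  assume x: "x \<in> coord_line None (Some 1)"
  hence "x $ Some 2 = 0" "x $ Some 3 = 0" by (auto simp: coord_line_def)
  hence e: "x = vec3 (x $ None) (x $ Some 1) 0 0" by (simp add: vec3_eq_iff)
  moreover have "x $ None \<noteq> 0 \<or> x $ Some 1 \<noteq> 0"
  proof (rule ccontr)
    assume "\<not> ?thesis"
    hence "x = 0" using e by (simp add: vec3_eq_iff)
    thus False using x by (simp add: coord_line_def)
  qed
  ultimately show "\<exists>m n. (m \<noteq> 0 \<or> n \<noteq> 0) \<and> x = vec3 m n 0 0" by blast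
next
  assume "\<exists>m n. (m \<noteq> 0 \<or> n \<noteq> 0) \<and> x = vec3 m n 0 0"
  then obtain m n where mn: "m \<noteq> 0 \<or> n \<noteq> 0" "x = vec3 m n 0 0" by blast
  have "\<forall>k. k \<noteq> None \<and> k \<noteq> Some 1 \<longrightarrow> vec3 m n 0 0 $ k = 0"
    unfolding forall_3_option by simp
  moreover have "x \<noteq> 0" using mn by (auto simp: vec3_eq_iff)
  ultimately show "x \<in> coord_line None (Some 1)" unfolding coord_line_def mn(2) by blast
qed

lemma smooth_coord_line_3: "smooth_projective_curve (coord_line None (Some 1) :: (complex^(3 option)) set)"
  unfolding smooth_projective_curve_def
proof (intro conjI ballI)
  let ?L = "coord_line None (Some 1) :: (complex^(3 option)) set"
  have cl: "curve_like ?L" by (rule curve_like_coord_line) simp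
  show "projective_curve ?L" by (rule curve_like_projective_curve[OF cl proj_closed_coord_line])
  fix x assume x: "x \<in> ?L"
  then obtain m n where mn: "m \<noteq> 0 \<or> n \<noteq> 0" and xe: "x = vec3 m n 0 0" unfolding coord_line_3 by blast
  \<comment> \<open>A unit vector independent of (m, n): the determinant is m if n = 0 and -n
    otherwise.\<close>
  define m' n' :: complex where "m' = (if n = 0 then 0 else 1)" "n' = (if n = 0 then 1 else 0)"
  define v where "v = vec3 m' n' 0 0"
  have det: "m * n' - n * m' \<noteq> 0" using mn by (auto simp: m'_n'_def)
  have ind: "\<alpha> = 0 \<and> \<beta> = 0" if "\<alpha> *s x + \<beta> *s v = 0" for \<alpha> \<beta>
  proof -
    have e: "\<alpha> * m + \<beta> * m' = 0" "\<alpha> * n + \<beta> * n' = 0" using that by (simp_all add: vec3_eq_iff xe v_def)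
    have "\<alpha> * (m * n' - n * m') = 0" "\<beta> * (m * n' - n * m') = 0" using e by algebra+
    thus ?thesis using det by simp
  qed
  have v: "v \<in> cone_tangent_space ?L x"
  proof (rule tangent_arc[where \<gamma> = "\<lambda>s. x + s *s v"])
    show "((\<lambda>s. (x + s *s v) $ i) has_field_derivative v $ i) (at 0)" for i
      by (auto intro!: derivative_eq_intros)
    have "x + s *s v \<in> ?L" for s
    proof -
      have "x + s *s v = vec3 (m + s * m') (n + s * n') 0 0" by (simp add: vec3_eq_iff xe v_def)
      moreover have "m + s * m' \<noteq> 0 \<or> n + s * n' \<noteq> 0"
      proof (rule ccontr)
        assume "\<not> ?thesis"
        hence "1 *s x + s *s v = 0" by (simp add: vec3_eq_iff xe v_def)
        thus False using ind[of 1 s] by simp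
      qed
      ultimately show ?thesis unfolding coord_line_3 by blast
    qed
    thus "eventually (\<lambda>s. x + s *s v \<in> ?L) (at 0)" by simp
  qed simp
  show "curve_nonsingular_at ?L x"
  proof (rule curve_nonsingularI[OF tangent_self[OF x] v ind])
    fix w assume w: "w \<in> cone_tangent_space ?L x"
    note t = w[unfolded cone_tangent_space_def mem_Collect_eq, THEN spec, THEN bspec]
    have d: "((\<lambda>s. (x + s *s w) $ i) has_field_derivative w $ i) (at 0)" for i
      by (auto intro!: derivative_eq_intros)
    have "\<forall>z\<in>?L. z $ Some 2 = 0" "\<forall>z\<in>?L. z $ Some 3 = 0" by (auto simp: coord_line_3)
    hence w0: "w $ Some 2 = 0" "w $ Some 3 = 0"
      using t[OF forms_coord[of "Some 2"]] t[OF forms_coord[of "Some 3"]] DERIV_imp_deriv[OF d] by auto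
    define \<alpha> \<beta> where "\<alpha> = (w $ None * n' - w $ Some 1 * m') / (m * n' - n * m')" "\<beta> = (w $ Some 1 * m - w $ None * n) / (m * n' - n * m')"
    have "w $ None * (m * n' - n * m') = (w $ None * n' - w $ Some 1 * m') * m + (w $ Some 1 * m - w $ None * n) * m'"
      "w $ Some 1 * (m * n' - n * m') = (w $ None * n' - w $ Some 1 * m') * n + (w $ Some 1 * m - w $ None * n) * n'"
      by (simp_all add: algebra_simps)
    hence "w $ None = \<alpha> * m + \<beta> * m'" "w $ Some 1 = \<alpha> * n + \<beta> * n'"
      using det by (simp_all add: \<alpha>_\<beta>_def add_divide_distrib[symmetric] eq_divide_eq)
    hence "w = \<alpha> *s x + \<beta> *s v" using w0 by (simp add: vec3_eq_iff xe v_def)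
    thus "\<exists>a b. w = a *s x + b *s v" by blast
  qed
qed

lemma rational_coord_line_3: "rational_curve (coord_line None (Some 1) :: (complex^(3 option)) set)"
proof -
  let ?L = "coord_line None (Some 1) :: (complex^(3 option)) set"
  have pl: "proj_line = coord_line None (Some 1)"
    by (auto simp: proj_line_def coord_line_def forall_1_option)
  have cl: "curve_like ?L" "curve_like proj_line"
    unfolding pl by (rule curve_like_coord_line, simp)+
  define f :: "complex^(3 option) \<Rightarrow> complex^(1 option)" where "f = (\<lambda>x. \<chi> j. if j = None then x $ None else x $ Some 1)"
  define k :: "complex^(1 option) \<Rightarrow> complex^(3 option)" where "k = (\<lambda>y. vec3 (y $ None) (y $ Some 1) 0 0)"
  have eq1: "x = y \<longleftrightarrow> x $ None = y $ None \<and> x $ Some 1 = y $ Some 1" for x y :: "complex^(1 option)"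
    by (simp add: vec_eq_iff forall_1_option)
  have "proj_iso_via f ?L proj_line"
  proof (rule proj_iso_via_vectors[where g = k])
    show "(\<lambda>x. f x $ j) \<in> forms 1" for j
      using forms_coord[of None] forms_coord[of "Some 1"] by (cases "j = None") (auto simp: f_def)
    show "(\<lambda>x. k x $ j) \<in> forms 1" for j
      unfolding k_def by (intro forms_vec3 forms_coord forms_0)
    show "f x \<in> proj_line" if "x \<in> ?L" for x
      using that by (auto simp: coord_line_3 proj_line_def f_def eq1)
    show "k y \<in> ?L" if "y \<in> proj_line" for y
      using that unfolding coord_line_3 by (auto simp: proj_line_def k_def eq1)
    show "k (f x) \<in> proj_point x" if "x \<in> ?L" for x
      by (rule proj_pointI[of 1]) (use that in \<open>auto simp: coord_line_3 f_def k_def vec3_eq_iff\<close>)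
    show "f (k y) \<in> proj_point y" for y
      by (rule proj_pointI[of 1]) (auto simp: f_def k_def eq1)
    show "x \<noteq> 0" if "x \<in> ?L" for x by (rule curve_likeD(1)[OF cl(1) that])
    show "y \<noteq> 0" if "y \<in> proj_line" for y by (rule curve_likeD(1)[OF cl(2) that])
  qed
  moreover have "?L \<noteq> {}" "proj_line \<noteq> {}"
    using curve_like_irreducible[OF cl(1)] curve_like_irreducible[OF cl(2)] by (auto simp: proj_irreducible_def)
  ultimately show ?thesis
    unfolding rational_curve_def birational_def
    using curve_like_irreducible[OF cl(1)] curve_like_irreducible[OF cl(2)]
      proj_open_in_self[of ?L] proj_open_in_self[of proj_line] by blast
qed

section \<open>The nodal case\<close>

locale nodal_quartic = quartic +
  assumes disc: "b\<^sup>2 - 4 * A * c = 0"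
begin

definition t1 where "t1 = - b / (2 * A)"

lemma quadratic_eq: "A * t\<^sup>2 + b * t + c = A * (t - t1)\<^sup>2"
proof -
  have "4 * A * (A * t\<^sup>2 + b * t + c) = (2 * A * t + b)\<^sup>2"
    using disc by (simp add: power2_eq_square algebra_simps)
  also have "2 * A * t + b = 2 * A * (t - t1)" using A by (simp add: t1_def algebra_simps)
  finally have "4 * A * (A * t\<^sup>2 + b * t + c) = 4 * A * (A * (t - t1)\<^sup>2)"
    by (simp add: power2_eq_square algebra_simps)
  thus ?thesis using A by simp
qed

lemma poly_g': "poly g t = A * t * (t + 1) * (t - t1)\<^sup>2"
  unfolding poly_g quadratic_eq by (simp add: mult_ac)

lemma t1: "t1 \<noteq> 0" "t1 + 1 \<noteq> 0"
proof -
  show "t1 \<noteq> 0" using quadratic_eq[of 0] c by auto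
  have "A - b + c = A * (- 1 - t1)\<^sup>2" using quadratic_eq[of "-1"] by simp
  hence "- 1 - t1 \<noteq> 0" using Abc by auto
  thus "t1 + 1 \<noteq> 0" by (metis add.commute add_eq_0_iff diff_0 diff_self minus_diff_eq)
qed

definition node where "node = vec3 1 t1 (t1\<^sup>2) 0"

text \<open>Near t1 the equation is W^2 = A t (t + 1) (t - t1)^2 with A t (t + 1) nonzero. It splits
  into W = s \<kappa>(s) and W = - s \<kappa>(s), s = t - t1, whose tangents differ because
  \<kappa>(0) is nonzero.\<close>

lemma node_X: "node_at X node"
  unfolding node_at_def
proof (intro exI[of _ None] conjI)
  show "node $ None \<noteq> 0" by (simp add: node_def)
  have n1: "(1 / node $ None) *s node = node" by (simp add: node_def)
  define \<kappa>0 where "\<kappa>0 = csqrt (A * t1 * (t1 + 1))"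
  have \<kappa>0: "\<kappa>0\<^sup>2 = A * t1 * (t1 + 1)" "\<kappa>0 \<noteq> 0" using A t1 by (auto simp: \<kappa>0_def)
  \<comment> \<open>Normalized to be 1 at s = 0, so that the principal square root is holomorphic on
    a small ball.\<close>
  define q where "q = (\<lambda>s. A * (t1 + s) * (t1 + s + 1) / \<kappa>0\<^sup>2)"
  define \<kappa> where "\<kappa> = (\<lambda>s. \<kappa>0 * csqrt (q s))"
  have q0: "q 0 = 1" using \<kappa>0(2) unfolding q_def by (simp add: \<kappa>0(1)[symmetric])
  have \<kappa>2: "(\<kappa> s)\<^sup>2 = A * (t1 + s) * (t1 + s + 1)" for s
    using \<kappa>0(2) by (simp add: \<kappa>_def q_def power_mult_distrib)
  have \<kappa>00: "\<kappa> 0 = \<kappa>0" by (simp add: \<kappa>_def q0)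
  have "continuous_on UNIV q" unfolding q_def using \<kappa>0(2) by (intro continuous_intros) auto
  hence "open (q -` (- \<real>\<^sub>\<le>\<^sub>0))" by (intro open_vimage) (auto simp: closed_nonpos_Reals_complex)
  moreover have "0 \<in> q -` (- \<real>\<^sub>\<le>\<^sub>0)" by (simp add: q0)
  ultimately obtain R where R: "R > 0" "ball 0 R \<subseteq> q -` (- \<real>\<^sub>\<le>\<^sub>0)" using openE by blast
  have hol: "\<kappa> holomorphic_on ball 0 R"
  proof -
    have "q holomorphic_on ball 0 R" unfolding q_def using \<kappa>0(2) by (intro holomorphic_intros) auto
    hence "(csqrt \<circ> q) holomorphic_on ball 0 R"
      by (rule holomorphic_on_compose_gen[where t = "- \<real>\<^sub>\<le>\<^sub>0"]) (use R(2) in \<open>auto intro!: holomorphic_on_csqrt\<close>)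
    thus ?thesis unfolding \<kappa>_def o_def by (rule holomorphic_on_mult[OF holomorphic_on_const])
  qed
  have d\<kappa>: "(\<kappa> has_field_derivative deriv \<kappa> 0) (at 0)"
    using holomorphic_derivI[OF hol open_ball, of 0] R(1) by simp
  define br where "br = (\<lambda>e s. vec3 1 (t1 + s) ((t1 + s)\<^sup>2) (e * s * \<kappa> s))"
  have br_hol: "(\<lambda>s. br e s $ j) holomorphic_on ball 0 R" for e j
  proof -
    have "\<forall>j. (\<lambda>s. br e s $ j) holomorphic_on ball 0 R"
      unfolding br_def forall_3_option using hol by (auto intro!: holomorphic_intros)
    thus ?thesis by blast
  qed
  have br0: "br e 0 = node" for e by (simp add: br_def node_def)
  have vel: "velocity (br e) = vec3 0 1 (2 * t1) (e * \<kappa>0)" for e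
  proof -
    have "((\<lambda>s. br e s $ j) has_field_derivative vec3 0 1 (2 * t1) (e * \<kappa>0) $ j) (at 0)" for j
      unfolding br_def by (rule vec3_has_derivative) (auto intro!: derivative_eq_intros d\<kappa> simp: \<kappa>00)
    hence "deriv (\<lambda>s. br e s $ j) 0 = vec3 0 1 (2 * t1) (e * \<kappa>0) $ j" for j by (rule DERIV_imp_deriv)
    thus ?thesis by (simp add: velocity_def vec_lambda_eta)
  qed
  have brX: "br e s \<in> X" if e: "e\<^sup>2 = 1" for e s
  proof -
    have "(e * s * \<kappa> s)\<^sup>2 = poly g (t1 + s)"
      by (simp add: poly_g' power_mult_distrib e \<kappa>2 algebra_simps)
    from X0I[OF this, of 1] X0_X show ?thesis by (auto simp: br_def)
  qed
  have "affine_node {z \<in> X. z $ None = 1} node"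
    unfolding affine_node_def
  proof (rule exI[of _ "br 1"], rule exI[of _ "br (-1)"], rule exI[of _ R], intro conjI allI impI R(1) br_hol br0)
    fix \<alpha> \<beta> :: complex assume "\<alpha> *s velocity (br 1) + \<beta> *s velocity (br (- 1)) = 0"
    hence "\<alpha> + \<beta> = 0" "\<alpha> * \<kappa>0 - \<beta> * \<kappa>0 = 0" unfolding vel by (simp_all add: vec3_eq_iff)
    hence e: "\<beta> = - \<alpha>" "(\<alpha> - \<beta>) * \<kappa>0 = 0" by (simp_all add: add_eq_0_iff left_diff_distrib)
    hence "2 * \<alpha> = 0" using \<kappa>0(2) by simp
    thus "\<alpha> = 0" "\<beta> = 0" using e by simp_all
  next
    fix r :: real assume r: "0 < r \<and> r \<le> R"
    \<comment> \<open>Restricting the t-coordinate alone suffices: every curve point with |t - t1| <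
      r lies on one of the branches, with its parameter s = t - t1 in the same ball.\<close>
    define U where "U = {z :: complex^(3 option). norm (z $ Some 1 - t1) < r}"
    show "\<exists>U. open U \<and> node \<in> U \<and> {z \<in> X. z $ None = 1} \<inter> U = (br 1 ` ball 0 r \<union> br (- 1) ` ball 0 r) \<inter> U"
    proof (intro exI[of _ U] conjI)
      show "open U" unfolding U_def by (intro open_Collect_less continuous_intros)
      show "node \<in> U" using r by (simp add: U_def node_def)
      show "{z \<in> X. z $ None = 1} \<inter> U = (br 1 ` ball 0 r \<union> br (- 1) ` ball 0 r) \<inter> U"
      proof (intro equalityI subsetI)
        fix z assume z: "z \<in> {z \<in> X. z $ None = 1} \<inter> U"
        hence "z \<in> X0" using X_finite_point[of z] by auto
        then obtain k t W where k: "k \<noteq> 0" "W\<^sup>2 = poly g t" "z = k *s vec3 1 t (t\<^sup>2) W" unfolding X0_iff by blast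
        have "k = 1" using z k(3) by simp
        hence ze: "z = vec3 1 t (t\<^sup>2) W" using k(3) by simp
        define s where "s = t - t1"
        have s: "s \<in> ball 0 r" "t = t1 + s" using z by (simp_all add: U_def ze s_def)
        have "W\<^sup>2 = (s * \<kappa> s)\<^sup>2" using k(2) by (simp add: poly_g' s(2) power_mult_distrib \<kappa>2)
        hence "W = s * \<kappa> s \<or> W = - (s * \<kappa> s)" by (simp only: power2_eq_iff)
        hence "z = br 1 s \<or> z = br (-1) s" by (auto simp: ze br_def s(2))
        thus "z \<in> (br 1 ` ball 0 r \<union> br (- 1) ` ball 0 r) \<inter> U" using s z by blast
      next
        fix z assume z: "z \<in> (br 1 ` ball 0 r \<union> br (- 1) ` ball 0 r) \<inter> U"
        then obtain e s where e: "e = 1 \<or> e = -1" "z = br e s" by blast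
        have "e\<^sup>2 = 1" using e(1) by auto
        hence "z \<in> X" using brX e(2) by simp
        moreover have "z $ None = 1" by (simp add: e(2) br_def)
        ultimately show "z \<in> {z \<in> X. z $ None = 1} \<inter> U" using z by blast
      qed
    qed
  qed
  thus "affine_node {z \<in> X. z $ None = 1} ((1 / node $ None) *s node)" unfolding n1 .
qed

lemma node_in_X: "node \<in> X"
proof -
  have "0\<^sup>2 = poly g t1" by (simp add: poly_g')
  from X0I[OF this, of 1] X0_X show ?thesis by (auto simp: node_def)
qed

lemma node_at_scale:
  assumes "k \<noteq> 0" shows "node_at X (k *s node)"
proof -
  obtain i where i: "node $ i \<noteq> 0" "affine_node {z \<in> X. z $ i = 1} ((1 / node $ i) *s node)"
    using node_X unfolding node_at_def by blast
  have "(1 / (k *s node) $ i) *s (k *s node) = (1 / node $ i) *s node"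
    using assms by (simp add: vector_smult_assoc)
  thus ?thesis unfolding node_at_def using i assms by (intro exI[of _ i]) simp
qed

lemma nodal_X: "nodal_curve X"
  unfolding nodal_curve_def
proof (intro conjI ballI projective_curve_X)
  show "\<exists>x\<in>X. node_at X x" using node_X node_in_X by blast
  fix x assume x: "x \<in> X"
  show "curve_nonsingular_at X x \<or> node_at X x"
  proof (cases "\<exists>k. k \<noteq> 0 \<and> x = k *s node")
    case True
    thus ?thesis using node_at_scale by blast
  next
    case False
    have "curve_nonsingular_at X x"
    proof (rule nonsingular_point[OF x])
      fix k t W assume k: "x = k *s vec3 1 t (t\<^sup>2) W" "W\<^sup>2 = poly g t" "k \<noteq> 0"
      show "W \<noteq> 0 \<or> poly (pderiv g) t \<noteq> 0"
      proof (cases "W = 0")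
        case True
        have "t \<noteq> t1"
        proof
          assume "t = t1"
          hence "x = k *s node" using k(1) True by (simp add: node_def)
          thus False using False k(3) by blast
        qed
        hence "A * t\<^sup>2 + b * t + c \<noteq> 0" unfolding quadratic_eq using A by simp
        moreover have "poly g t = 0" using k(2) True by simp
        ultimately show ?thesis using pderiv_g_at_root by blast
      qed simp
    qed
    thus ?thesis ..
  qed
qed

text \<open>Substituting y = (m / n) t into y^2 = A t (t + 1) and cancelling t gives t = A n^2 /
  (m^2 - A n^2); \<open>SS\<close> and \<open>DD\<close> are this numerator and denominator.\<close>

definition DD :: "complex^(3 option) \<Rightarrow> complex" where
  "DD x = x $ None * x $ None - A * (x $ Some 1 * x $ Some 1)"

definition SS :: "complex^(3 option) \<Rightarrow> complex" where
  "SS x = A * (x $ Some 1 * x $ Some 1)"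

text \<open>This is D^2 times (1, t, t^2, W) for t = S/D and W = (t - t1) y, where y = A m n /
  D.\<close>

definition nu :: "complex^(3 option) \<Rightarrow> complex^(3 option)" where
  "nu x = vec3 (DD x * DD x) (SS x * DD x) (SS x * SS x) (A * (x $ None * x $ Some 1) * (SS x - t1 * DD x))"

lemma nu_forms: "DD \<in> forms 2" "SS \<in> forms 2" "(\<lambda>x. nu x $ j) \<in> forms 4"
proof -
  show D: "DD \<in> forms 2" and S: "SS \<in> forms 2" unfolding DD_def[abs_def] SS_def[abs_def]
    by (intro forms_diff forms_scale forms_1_1 forms_coord)+
  show "(\<lambda>x. nu x $ j) \<in> forms 4" unfolding nu_def
    by (intro forms_vec3 forms_2_2 forms_diff forms_scale forms_1_1 forms_coord D S)
qed

text \<open>The parameter is the slope \<open>m / n\<close> of a line through the origin on the conic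
  \<open>y\<^sup>2 = A t (t + 1)\<close>, where \<open>y = W / (t - t1)\<close>.\<close>

lemma nu_X0:
  assumes "DD x \<noteq> 0" shows "nu x \<in> X0"
proof -
  define m n D S where "m = x $ None" "n = x $ Some 1" "D = DD x" "S = SS x"
  note d = this
  have D: "D \<noteq> 0" using assms by (simp add: d)
  have SD: "S = A * n\<^sup>2" "D + S = m\<^sup>2" by (simp_all add: d DD_def SS_def power2_eq_square)
  have nu: "nu x = vec3 (D\<^sup>2) (S * D) (S\<^sup>2) (A * m * n * (S - t1 * D))"
    by (simp add: nu_def d power2_eq_square mult_ac)
  have "(A * m * n * (S - t1 * D) / D\<^sup>2)\<^sup>2 = poly g (S / D)"
  proof -
    have "(A * m * n * (S - t1 * D))\<^sup>2 = A * S * (D + S) * (S - t1 * D)\<^sup>2"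
      unfolding SD(2) unfolding SD(1) by (simp add: power_mult_distrib power2_eq_square mult_ac)
    hence "(A * m * n * (S - t1 * D) / D\<^sup>2)\<^sup>2 = A * S * (D + S) * (S - t1 * D)\<^sup>2 / (D\<^sup>2)\<^sup>2"
      by (simp add: power_divide)
    also have "\<dots> = poly g (S / D)" unfolding poly_g' using D by (simp add: power2_eq_square field_simps)
    finally show ?thesis .
  qed
  from X0I[OF this, of "D\<^sup>2"] have "D\<^sup>2 *s vec3 1 (S / D) ((S / D)\<^sup>2) (A * m * n * (S - t1 * D) / D\<^sup>2) \<in> X0" using D by simp
  moreover have "D\<^sup>2 *s vec3 1 (S / D) ((S / D)\<^sup>2) (A * m * n * (S - t1 * D) / D\<^sup>2) = nu x"
    using D unfolding nu by (simp add: vec3_eq_iff power2_eq_square)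
  ultimately show ?thesis by simp
qed

lemma nu_nonzero:
  assumes "x \<in> coord_line None (Some 1)" shows "nu x \<noteq> 0"
proof
  assume z: "nu x = 0"
  obtain m n where mn: "m \<noteq> 0 \<or> n \<noteq> 0" "x = vec3 m n 0 0" using assms unfolding coord_line_3 by blast
  have "DD x = 0" "SS x = 0" using z by (simp_all add: nu_def vec3_eq_iff)
  hence "n = 0" "m = 0" using A by (auto simp: DD_def SS_def mn(2))
  thus False using mn by simp
qed

text \<open>Where \<open>DD\<close> vanishes the image lies at infinity, outside \<open>X0\<close>.
  A form vanishing on \<open>X0\<close>, pulled back with n fixed, is a polynomial in m that
  vanishes except possibly where m^2 = A n^2; it is therefore zero there too.\<close>

lemma nu_in_X:
  assumes x: "x \<in> coord_line None (Some 1)" shows "nu x \<in> X"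
  unfolding X_eq
proof (rule proj_closureI[OF nu_nonzero[OF x]])
  fix d F assume F: "F \<in> forms d" "\<And>a. a \<in> X0 \<Longrightarrow> F a = 0"
  obtain m n where mn: "m \<noteq> 0 \<or> n \<noteq> 0" "x = vec3 m n 0 0" using x unfolding coord_line_3 by blast
  show "F (nu x) = 0"
  proof (cases "DD x = 0")
    case False
    thus ?thesis using F(2) nu_X0 by blast
  next
    case True
    hence n: "n \<noteq> 0" using mn by (auto simp: DD_def)
    have "(\<lambda>y. F (\<chi> j. nu y $ j)) \<in> forms (d * 4)"
      by (rule forms_compose[OF F(1) nu_forms(3)])
    hence "(\<lambda>y. F (nu y)) \<in> forms (d * 4)" by (simp add: vec_lambda_eta)
    then obtain p where p: "\<And>s. F (nu (\<chi> i. poly (if i = None then [:0, 1:] else if i = Some 1 then [:n:] else 0) s)) = poly p s"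
      using forms_poly_comp[of "\<lambda>y. F (nu y)" "d * 4" "\<lambda>i. if i = None then [:0, 1:] else if i = Some 1 then [:n:] else 0"] by blast
    have v: "(\<chi> i. poly (if i = None then [:0, 1:] else if i = Some 1 then [:n:] else 0) s) = vec3 s n 0 0" for s
      by (simp add: vec3_eq_iff)
    have "p = 0"
    proof (rule poly_zero_of_cofinite)
      show "finite {s. poly [:- A * n\<^sup>2, 0, 1:] s = 0}" by (rule poly_roots_finite) simp
      fix s assume "s \<notin> {s. poly [:- A * n\<^sup>2, 0, 1:] s = 0}"
      hence "DD (vec3 s n 0 0) \<noteq> 0" by (simp add: DD_def power2_eq_square)
      thus "poly p s = 0" using p[of s] F(2)[OF nu_X0] by (simp add: v)
    qed
    thus ?thesis using p[of m] by (simp add: v mn(2))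
  qed
qed

lemma normalization_nu: "normalization nu (coord_line None (Some 1)) X"
  unfolding normalization_def
proof (intro conjI smooth_coord_line_3 projective_curve_X)
  let ?L = "coord_line None (Some 1) :: (complex^(3 option)) set"
  have Lnz: "x \<noteq> 0" if "x \<in> ?L" for x using that by (simp add: coord_line_def)
  show "regular_on ?L nu"
  proof -
    have "regular_on ?L (\<lambda>x. \<chi> j. nu x $ j)"
      by (rule regular_on_forms[OF nu_forms(3)]) (use nu_nonzero in \<open>simp add: vec_lambda_eta\<close>)
    thus ?thesis by (simp add: vec_lambda_eta)
  qed
  show "nu ` ?L \<subseteq> X" using nu_in_X by blast
  \<comment> \<open>The open sets leave out t = 0, the node t = t1 and infinity, where the slope
    formula below may degenerate.\<close>
  define G where "G = (\<lambda>x. x $ Some 1 * (DD x * (SS x - t1 * DD x)))"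
  define K where "K = (\<lambda>y :: complex^(3 option). y $ None * (y $ Some 1 * (y $ Some 1 - t1 * y $ None)))"
  define U where "U = {x \<in> ?L. G x \<noteq> 0}"
  define V where "V = {y \<in> X. K y \<noteq> 0}"
  have Gf: "G \<in> forms 5" unfolding G_def
    by (rule forms_times[OF forms_coord forms_2_2]) (intro forms_diff forms_scale nu_forms | simp)+
  have Kf: "K \<in> forms 3" unfolding K_def
    by (rule forms_times[OF forms_coord forms_1_1]) (intro forms_diff forms_scale forms_coord | simp)+
  \<comment> \<open>The slope recovered from the curve point: m / n = y / t = W / (t (t -
    t1)).\<close>
  define k where "k = (\<lambda>y :: complex^(3 option). vec3 (y $ Some 3 * y $ None) (y $ Some 1 * (y $ Some 1 - t1 * y $ None)) 0 0)"
  have kf: "(\<lambda>y. k y $ j) \<in> forms 2" for j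
    unfolding k_def by (intro forms_vec3 forms_1_1 forms_diff forms_scale forms_coord forms_0)
  have V_rep: "\<exists>r t W. r \<noteq> 0 \<and> W\<^sup>2 = poly g t \<and> y = r *s vec3 1 t (t\<^sup>2) W \<and> t \<noteq> 0 \<and> t \<noteq> t1" if y: "y \<in> V" for y
  proof -
    have "y \<in> X" "y $ None \<noteq> 0" "K y \<noteq> 0" using y by (auto simp: V_def K_def)
    then obtain r t W where r: "r \<noteq> 0" "W\<^sup>2 = poly g t" "y = r *s vec3 1 t (t\<^sup>2) W"
      using X_finite_point unfolding X0_iff by blast
    thus ?thesis using \<open>K y \<noteq> 0\<close> by (auto simp: K_def)
  qed
  have kval: "DD (k y) = r ^ 4 * (A * t * (t - t1)\<^sup>2)" "SS (k y) = r ^ 4 * (A * t * (t - t1)\<^sup>2) * t" 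
      "k y $ None = r\<^sup>2 * W" "k y $ Some 1 = r\<^sup>2 * (t * (t - t1))"
    if r: "W\<^sup>2 = poly g t" "y = r *s vec3 1 t (t\<^sup>2) W" for r t W y
  proof -
    show m: "k y $ None = r\<^sup>2 * W" and n: "k y $ Some 1 = r\<^sup>2 * (t * (t - t1))"
      by (simp_all add: k_def r(2) power2_eq_square algebra_simps)
    show "SS (k y) = r ^ 4 * (A * t * (t - t1)\<^sup>2) * t"
      by (simp add: SS_def n power2_eq_square power4_eq_xxxx mult_ac)
    have "DD (k y) = r ^ 4 * (W\<^sup>2 - A * (t * (t - t1))\<^sup>2)"
      by (simp add: DD_def m n power2_eq_square power4_eq_xxxx algebra_simps)
    also have "\<dots> = r ^ 4 * (A * t * (t - t1)\<^sup>2)"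
      unfolding r(1) poly_g' by (simp add: power2_eq_square algebra_simps)
    finally show "DD (k y) = r ^ 4 * (A * t * (t - t1)\<^sup>2)" .
  qed
  have kU: "k y \<in> U" if y: "y \<in> V" for y
  proof -
    obtain r t W where r: "r \<noteq> 0" "W\<^sup>2 = poly g t" "y = r *s vec3 1 t (t\<^sup>2) W" "t \<noteq> 0" "t \<noteq> t1"
      using V_rep[OF y] by blast
    note kv = kval[OF r(2,3)]
    have "k y $ Some 1 \<noteq> 0" unfolding kv using r(1,4,5) by simp
    moreover have "DD (k y) \<noteq> 0" unfolding kv using r(1,4,5) A by simp
    moreover have "SS (k y) - t1 * DD (k y) = r ^ 4 * (A * t * (t - t1)\<^sup>2) * (t - t1)"
      by (simp add: kv algebra_simps)
    hence "SS (k y) - t1 * DD (k y) \<noteq> 0" using r(1,4,5) A by simp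
    ultimately have "G (k y) \<noteq> 0" by (simp add: G_def)
    moreover have "k y \<in> ?L" unfolding coord_line_3
      by (rule exI[of _ "k y $ None"], rule exI[of _ "k y $ Some 1"])
        (use \<open>k y $ Some 1 \<noteq> 0\<close> in \<open>simp add: vec3_eq_iff, simp add: k_def\<close>)
    ultimately show ?thesis by (simp add: U_def)
  qed
  have "proj_iso_via nu U V"
  proof (rule proj_iso_via_vectors[where g = k])
    show "(\<lambda>x. nu x $ j) \<in> forms 4" for j by (rule nu_forms(3))
    show "(\<lambda>y. k y $ j) \<in> forms 2" for j by (rule kf)
    show "nu x \<in> V" if x: "x \<in> U" for x
    proof -
      have "K (nu x) = DD x ^ 4 * SS x * (SS x - t1 * DD x)"
        by (simp add: K_def nu_def power4_eq_xxxx algebra_simps)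
      moreover have "SS x \<noteq> 0" using x A by (auto simp: U_def G_def SS_def)
      ultimately have "K (nu x) \<noteq> 0" using x by (auto simp: U_def G_def)
      thus ?thesis using x nu_in_X by (auto simp: U_def V_def)
    qed
    show "k y \<in> U" if "y \<in> V" for y by (rule kU[OF that])
    show "k (nu x) \<in> proj_point x" if x: "x \<in> U" for x
    proof -
      have xL: "x \<in> ?L" and G0: "G x \<noteq> 0" using x by (auto simp: U_def)
      obtain m n where mn: "x = vec3 m n 0 0" using xL unfolding coord_line_3 by blast
      have S: "SS x = A * n * n" by (simp add: SS_def mn)
      show ?thesis
      proof (rule proj_pointI[of "A * n * DD x * DD x * (SS x - t1 * DD x)"])
        show "A * n * DD x * DD x * (SS x - t1 * DD x) \<noteq> 0" using G0 A by (simp add: G_def mn)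
        have "k (nu x) = vec3 (A * (m * n) * (SS x - t1 * DD x) * (DD x * DD x)) (SS x * DD x * (SS x * DD x - t1 * (DD x * DD x))) 0 0"
          by (simp add: k_def nu_def mn)
        also have "SS x * DD x * (SS x * DD x - t1 * (DD x * DD x)) = A * n * DD x * DD x * (SS x - t1 * DD x) * n"
          unfolding S by (simp add: algebra_simps)
        finally show "k (nu x) = (A * n * DD x * DD x * (SS x - t1 * DD x)) *s x"
          unfolding mn vec3_scale by (simp add: mult_ac)
      qed
    qed
    show "nu (k y) \<in> proj_point y" if y: "y \<in> V" for y
    proof -
      obtain r t W where r: "r \<noteq> 0" "W\<^sup>2 = poly g t" "y = r *s vec3 1 t (t\<^sup>2) W" "t \<noteq> 0" "t \<noteq> t1"
        using V_rep[OF y] by blast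
      define z where "z = r ^ 4 * (A * t * (t - t1)\<^sup>2)"
      have z: "z \<noteq> 0" using r A by (simp add: z_def)
      note kv = kval[OF r(2,3), folded z_def]
      have 3: "A * (k y $ None * k y $ Some 1) * (SS (k y) - t1 * DD (k y)) = z\<^sup>2 * W"
        unfolding kv by (simp add: z_def power2_eq_square power4_eq_xxxx algebra_simps)
      have "nu (k y) = (z\<^sup>2 / r) *s y"
        unfolding nu_def 3 unfolding kv unfolding r(3) vec3_scale using r(1) by (simp add: vec3_eq_iff power2_eq_square)
      thus ?thesis using z r(1) by (intro proj_pointI[of "z\<^sup>2 / r"]) auto
    qed
    show "x \<noteq> 0" if "x \<in> U" for x using that Lnz by (simp add: U_def)
    show "y \<noteq> 0" if "y \<in> V" for y using that X_nonzero by (simp add: V_def)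
  qed
  moreover have "proj_open_in ?L U" unfolding U_def by (rule proj_open_in_nonvanishing[OF Gf Lnz])
  moreover have "proj_open_in X V" unfolding V_def by (rule proj_open_in_nonvanishing[OF Kf X_nonzero])
  moreover have "V \<noteq> {}"
  proof -
    obtain t where t: "t \<notin> {0, t1}" using infinite_complex_UNIV ex_new_if_finite[of "{0, t1}"] by blast
    have "(csqrt (poly g t))\<^sup>2 = poly g t" by simp
    from X0I[OF this, of 1] have "1 *s vec3 1 t (t\<^sup>2) (csqrt (poly g t)) \<in> X" using X0_X by auto
    hence "vec3 1 t (t\<^sup>2) (csqrt (poly g t)) \<in> V" using t by (simp add: V_def K_def)
    thus ?thesis by blast
  qed
  moreover from this have "U \<noteq> {}" using kU by blast
  ultimately show "\<exists>U V. U \<noteq> {} \<and> proj_open_in ?L U \<and> V \<noteq> {} \<and> proj_open_in X V \<and> proj_iso_via nu U V" by blast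
qed

end

section \<open>The non-even component\<close>

lemma affine_closure_vanish:
  assumes "x \<in> affine_closure A" "F \<in> polys_upto d" "\<forall>a\<in>A. F a = 0" shows "F x = 0"
  using assms by (auto simp: affine_closure_def)

text \<open>The added data are a square root \<kappa> of the leading coefficient and a shift l; they
  define the affine change of coordinates from (T_+, T_-) to (s, t).\<close>

locale tangential_quartic = quartic +
  fixes \<kappa> l :: complex
  assumes \<kappa>0: "\<kappa> \<noteq> 0" and \<kappa>A: "\<kappa>\<^sup>2 = A"
begin

definition tparam :: "complex^3 \<Rightarrow> complex" where
  "tparam T = - (T$2 - T$3 + l) / (2 * \<kappa>)"

definition C0 :: "(complex^3) set" where
  "C0 = {T. T$2 + T$3 \<noteq> 0 \<and> T$1 = tparam T * (T$2 + T$3) \<and>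
     tparam T * (tparam T + 1) * (T$2 + T$3)\<^sup>2 = 4 * (A * (tparam T)\<^sup>2 + b * tparam T + c)}"

text \<open>Linear coordinates \<open>(w, a, s, t)\<close> of projective space, with \<open>a = T\<^sub>1\<close>, \<open>s = T\<^sub>+ + T\<^sub>-\<close>.\<close>

definition pt :: "complex \<Rightarrow> complex \<Rightarrow> complex \<Rightarrow> complex \<Rightarrow> complex^(3 option)" where
  "pt w a s t = vec3 w a ((s - 2 * \<kappa> * t - l * w) / 2) ((s + 2 * \<kappa> * t + l * w) / 2)"

definition ws :: "complex^(3 option) \<Rightarrow> complex" where "ws x = x $ Some 2 + x $ Some 3"

definition wt :: "complex^(3 option) \<Rightarrow> complex" where
  "wt x = - 1 / (2 * \<kappa>) * (x $ Some 2 - x $ Some 3 + l * x $ None)"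

lemma ws_form: "ws \<in> forms 1" and wt_form: "wt \<in> forms 1"
  unfolding ws_def[abs_def] wt_def[abs_def]
  by (intro forms_add forms_diff forms_scale forms_coord)+

lemma forms_pt:
  assumes "f0 \<in> forms d" "f1 \<in> forms d" "f2 \<in> forms d" "f3 \<in> forms d"
  shows "(\<lambda>x. pt (f0 x) (f1 x) (f2 x) (f3 x) $ j) \<in> forms d"
proof -
  have e: "(s - 2 * \<kappa> * t - l * w) / 2 = 1 / 2 * s - \<kappa> * t - l / 2 * w"
    "(s + 2 * \<kappa> * t + l * w) / 2 = 1 / 2 * s + \<kappa> * t + l / 2 * w" for s t w
    by (simp_all add: field_simps)
  show ?thesis unfolding pt_def e
    by (intro forms_vec3 forms_diff forms_add forms_scale assms)
qed

lemma pt_coords [simp]: "pt w a s t $ None = w" "pt w a s t $ Some 1 = a" "ws (pt w a s t) = s" "wt (pt w a s t) = t"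
  using \<kappa>0 by (simp_all add: pt_def ws_def wt_def field_simps)

lemma pt_eta: "pt (x $ None) (x $ Some 1) (ws x) (wt x) = x"
  using \<kappa>0 by (simp add: pt_def ws_def wt_def vec3_eq_iff field_simps)

lemma pt_eq_iff: "x = y \<longleftrightarrow> x $ None = y $ None \<and> x $ Some 1 = y $ Some 1 \<and> ws x = ws y \<and> wt x = wt y"
  by (metis pt_eta)

lemma pt_scale: "k *s pt w a s t = pt (k * w) (k * a) (k * s) (k * t)"
  by (simp add: pt_def vec3_scale algebra_simps)

lemma ws_scale: "ws (k *s x) = k * ws x"
  using forms_homogeneous[OF ws_form] by simp

lemma lift_affine_pt: "lift_affine T = pt 1 (T$1) (T$2 + T$3) (tparam T)"
  using \<kappa>0 by (simp add: lift_affine_3 pt_def tparam_def vec3_eq_iff field_simps)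

lemma exists_lift: "\<exists>T. lift_affine T = pt 1 a s t"
proof -
  have "lift_affine (\<chi> i. pt 1 a s t $ Some i) = pt 1 a s t"
    by (simp add: vec3_eq_iff)
  thus ?thesis by blast
qed

lemma exists_affine: obtains T where "T$1 = a" "T$2 + T$3 = s" "tparam T = t"
proof -
  obtain T where T: "lift_affine T = pt 1 a s t" using exists_lift by blast
  hence "pt 1 (T$1) (T$2 + T$3) (tparam T) = pt 1 a s t" by (simp add: lift_affine_pt)
  hence "T$1 = a \<and> T$2 + T$3 = s \<and> tparam T = t" unfolding pt_eq_iff by simp
  thus ?thesis using that[of T] by blast
qed

abbreviation q where "q t \<equiv> A * t\<^sup>2 + b * t + c"

lemma chart_C0_iff: "x \<in> affine_chart C0 \<longleftrightarrow>
   (\<exists>r s t. r \<noteq> 0 \<and> s \<noteq> 0 \<and> t * (t + 1) * s\<^sup>2 = 4 * q t \<and> x = r *s pt 1 (t * s) s t)"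
proof
  assume "x \<in> affine_chart C0"
  then obtain r T where "r \<noteq> 0" "T \<in> C0" "x = r *s lift_affine T" unfolding affine_chart_iff by blast
  thus "\<exists>r s t. r \<noteq> 0 \<and> s \<noteq> 0 \<and> t * (t + 1) * s\<^sup>2 = 4 * q t \<and> x = r *s pt 1 (t * s) s t"
    by (intro exI[of _ r] exI[of _ "T$2 + T$3"] exI[of _ "tparam T"]) (simp add: C0_def lift_affine_pt)
next
  assume "\<exists>r s t. r \<noteq> 0 \<and> s \<noteq> 0 \<and> t * (t + 1) * s\<^sup>2 = 4 * q t \<and> x = r *s pt 1 (t * s) s t"
  then obtain r s t where r: "r \<noteq> 0" "s \<noteq> 0" "t * (t + 1) * s\<^sup>2 = 4 * q t" "x = r *s pt 1 (t * s) s t" by blast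
  obtain T where T: "T$1 = t * s" "T$2 + T$3 = s" "tparam T = t" by (rule exists_affine)
  show "x \<in> affine_chart C0" unfolding affine_chart_iff
    by (rule exI[of _ r], rule exI[of _ T]) (simp add: r T C0_def lift_affine_pt)
qed

text \<open>At t = 0 and t = -1 the left side of the curve equation vanishes while the quadratic on
  the right does not.\<close>

lemma C0_parameter:
  assumes "t * (t + 1) * s\<^sup>2 = 4 * q t"
  shows "t \<noteq> 0" "t + 1 \<noteq> 0" "(t * (t + 1) * s / 2)\<^sup>2 = poly g t"
proof -
  show "t \<noteq> 0" using assms c by auto
  show "t + 1 \<noteq> 0"
  proof
    assume z: "t + 1 = 0"
    hence "t = - 1" by (simp add: add_eq_0_iff2)
    hence "4 * (A - b + c) = 0" using assms by (simp add: algebra_simps)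
    thus False using Abc by (metis mult_eq_0_iff zero_neq_numeral)
  qed
  have "(t * (t + 1) * s / 2)\<^sup>2 = t * (t + 1) * (t * (t + 1) * s\<^sup>2) / 4"
    by (simp add: power2_eq_square field_simps)
  also have "\<dots> = poly g t" unfolding assms by (simp add: poly_g)
  finally show "(t * (t + 1) * s / 2)\<^sup>2 = poly g t" .
qed

text \<open>Solve W = t (t + 1) s / 2 for s and multiply all homogeneous coordinates by t (t + 1),
  so that they become polynomial in t and W.\<close>

lemma chart_C0_W:
  assumes W: "W\<^sup>2 = poly g t" "W \<noteq> 0" and r: "r \<noteq> 0"
  shows "r *s pt (t * (t + 1)) (2 * t * W) (2 * W) (t\<^sup>2 * (t + 1)) \<in> affine_chart C0"
proof -
  define z where "z = t * (t + 1)"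
  have z: "z \<noteq> 0" using W by (auto simp: poly_g z_def)
  have W2: "W * W = z * q t" using W(1) by (simp add: poly_g z_def power2_eq_square)
  have "z * (2 * W / z)\<^sup>2 = 4 * (W * W) / z" using z by (simp add: power2_eq_square field_simps)
  also have "\<dots> = 4 * q t" unfolding W2 using z by simp
  finally have e: "t * (t + 1) * (2 * W / z)\<^sup>2 = 4 * q t" by (simp add: z_def)
  have zt: "t * (t + 1) = z" "t\<^sup>2 * (t + 1) = z * t" by (simp_all add: z_def power2_eq_square)
  have x: "r *s pt (t * (t + 1)) (2 * t * W) (2 * W) (t\<^sup>2 * (t + 1)) = (r * z) *s pt 1 (t * (2 * W / z)) (2 * W / z) t"
    unfolding zt pt_scale using z by (simp add: pt_eq_iff)
  show ?thesis unfolding chart_C0_iff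
    by (rule exI[of _ "r * z"], rule exI[of _ "2 * W / z"], rule exI[of _ t]) (simp add: x r z e W(2))
qed

lemma curve_like_chart_C0: "curve_like (affine_chart C0)"
proof -
  \<comment> \<open>Roots of g are left out: there the formulas of \<open>chart_C0_W\<close> give s
    = 0 or a vanishing homogenizing coordinate, hence no point over C0.\<close>
  define S where "S = {t. poly g t = 0}"
  have g0: "g \<noteq> 0" using A by (simp add: g_def)
  define pz pt2 :: "complex poly" where "pz = [:0, 1, 1:]" and "pt2 = [:0, 0, 1, 1:]"
  have pz: "poly pz t = t * (t + 1)" and pt2: "poly pt2 t = t\<^sup>2 * (t + 1)" for t
    by (simp_all add: pz_def pt2_def power2_eq_square algebra_simps)
  define A' B' :: "3 option \<Rightarrow> complex poly"
    where "A' = (\<lambda>j. case j of None \<Rightarrow> pz | Some i \<Rightarrow> if i = 1 then 0 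
       else if i = 2 then smult (- \<kappa>) pt2 - smult (l / 2) pz else smult \<kappa> pt2 + smult (l / 2) pz)"
      and "B' = (\<lambda>j. case j of None \<Rightarrow> 0 | Some i \<Rightarrow> if i = 1 then [:0, 2:] else 1)"
  have cm: "cover_map A' B' (t, W) = pt (t * (t + 1)) (2 * t * W) (2 * W) (t\<^sup>2 * (t + 1))" for t W
    by (simp add: cover_map_def vec3_eq_iff A'_def B'_def pt_def pz pt2 field_simps)
  have S: "t \<noteq> 0" "t + 1 \<noteq> 0" "W \<noteq> 0" "W\<^sup>2 = poly g t" if "(t, W) \<in> cover_points g S" for t W
    using that by (auto simp: cover_points_def S_def poly_g)
  show ?thesis
  proof (rule curve_like_cover[OF g_split(2) g_split(1), of S A' B'])
    show "finite S" unfolding S_def by (rule poly_roots_finite[OF g0])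
    show "cover_map A' B' z \<noteq> 0" if "z \<in> cover_points g S" for z
    proof (cases z)
      case (Pair t W)
      hence "cover_map A' B' z $ None \<noteq> 0" using S[of t W] that by (simp add: cm)
      thus ?thesis by auto
    qed
    show "z = z'" if z: "z \<in> cover_points g S" "z' \<in> cover_points g S" "cover_map A' B' z \<in> proj_point (cover_map A' B' z')" for z z'
    proof -
      obtain t W where 1: "z = (t, W)" by (cases z)
      obtain t' W' where 2: "z' = (t', W')" by (cases z')
      note s1 = S[of t W] and s2 = S[of t' W']
      obtain k where k: "k \<noteq> 0" "pt (t * (t + 1)) (2 * t * W) (2 * W) (t\<^sup>2 * (t + 1)) = 
          k *s pt (t' * (t' + 1)) (2 * t' * W') (2 * W') (t'\<^sup>2 * (t' + 1))"
        using z(3) unfolding 1 2 cm proj_point_def by blast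
      have e: "t * (t + 1) = k * (t' * (t' + 1))" using arg_cong[OF k(2), of "\<lambda>x. x $ None"] by simp
      have kW: "k * W' = W" using arg_cong[OF k(2), of ws] by (simp add: ws_scale)
      have "t * W = (k * W') * t'" using arg_cong[OF k(2), of "\<lambda>x. x $ Some 1"] by (simp add: mult_ac)
      also note kW
      finally have t: "t = t'" using s1 z 1 by simp
      hence "k = 1" using e s1 z 1 by simp
      thus ?thesis using t kW 1 2 by simp
    qed
    show "affine_chart C0 = {c *s cover_map A' B' z |c z. c \<noteq> 0 \<and> z \<in> cover_points g S}"
    proof (intro equalityI subsetI)
      fix x assume "x \<in> affine_chart C0"
      then obtain r s t where r: "r \<noteq> 0" "s \<noteq> 0" "t * (t + 1) * s\<^sup>2 = 4 * q t" "x = r *s pt 1 (t * s) s t"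
        unfolding chart_C0_iff by blast
      note p = C0_parameter[OF r(3)]
      define z where "z = t * (t + 1)"
      have z: "z \<noteq> 0" using p by (simp add: z_def)
      have "poly g t \<noteq> 0" using p(3) r(2) z by (metis divide_eq_0_iff mult_eq_0_iff power_eq_0_iff zero_neq_numeral z_def)
      hence "(t, z * s / 2) \<in> cover_points g S" using p(3) by (simp add: cover_points_def S_def z_def)
      moreover have "x = (r / z) *s cover_map A' B' (t, z * s / 2)"
        unfolding cm r(4) pt_scale using z by (simp add: pt_eq_iff z_def power2_eq_square)
      moreover have "r / z \<noteq> 0" using r z by simp
      ultimately show "x \<in> {c *s cover_map A' B' z |c z. c \<noteq> 0 \<and> z \<in> cover_points g S}" by blast
    next
      fix x assume "x \<in> {c *s cover_map A' B' z |c z. c \<noteq> 0 \<and> z \<in> cover_points g S}"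
      then obtain k t W where k: "k \<noteq> 0" "(t, W) \<in> cover_points g S" "x = k *s cover_map A' B' (t, W)" by auto
      show "x \<in> affine_chart C0" unfolding k(3) cm by (rule chart_C0_W[OF S(4)[OF k(2)] S(3)[OF k(2)] k(1)])
    qed
  qed
qed

section \<open>The closure of the non-even part\<close>

definition Y :: "(complex^(3 option)) set" where "Y = affine_chart (affine_closure C0)"

lemma forms_vanish_Y:
  assumes F: "F \<in> forms d" and z: "\<And>x. x \<in> affine_chart C0 \<Longrightarrow> F x = 0" and x: "x \<in> Y"
  shows "F x = 0"
proof (rule forms_vanish_affine_chart[OF F])
  show "x \<in> affine_chart (affine_closure C0)" using x by (simp add: Y_def)
  fix v assume v: "v \<in> affine_closure C0"
  have "\<forall>a\<in>C0. F (lift_affine a) = 0" by (intro ballI z lift_in_affine_chart)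
  thus "F (lift_affine v) = 0" using affine_closure_vanish[OF v dehomogenize[OF F]] by simp
qed

lemma C0_Y: "affine_chart C0 \<subseteq> Y"
  unfolding Y_def affine_chart_def affine_closure_def by auto

definition E1 :: "complex^(3 option) \<Rightarrow> complex" where
  "E1 x = x $ Some 1 * x $ None - wt x * ws x"

text \<open>On C0, where a = t s, the equation t (t + 1) s^2 = 4 (A t^2 + b t + c) becomes
  quadratic, since its left side is a^2 + a s.\<close>

definition E2 :: "complex^(3 option) \<Rightarrow> complex" where
  "E2 x = x $ Some 1 * x $ Some 1 + x $ Some 1 * ws x - 4 * (A * (wt x * wt x) + b * (wt x * x $ None) + c * (x $ None * x $ None))"

lemma E_forms: "E1 \<in> forms 2" "E2 \<in> forms 2"
  unfolding E1_def[abs_def] E2_def[abs_def]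
  by (intro forms_diff forms_add forms_scale forms_1_1 forms_coord ws_form wt_form)+

lemma E_C0: assumes "x \<in> affine_chart C0" shows "E1 x = 0" "E2 x = 0"
proof -
  obtain r s t where r: "r \<noteq> 0" "t * (t + 1) * s\<^sup>2 = 4 * q t" "x = r *s pt 1 (t * s) s t"
    using assms unfolding chart_C0_iff by blast
  show "E1 x = 0" unfolding r(3) pt_scale by (simp add: E1_def)
  have "E2 x = r\<^sup>2 * (t * (t + 1) * s\<^sup>2 - 4 * q t)"
    unfolding r(3) pt_scale by (simp add: E2_def power2_eq_square algebra_simps)
  thus "E2 x = 0" by (simp add: r(2))
qed

lemma E_Y: assumes "x \<in> Y" shows "E1 x = 0" "E2 x = 0"
  using forms_vanish_Y[OF E_forms(1) E_C0(1) assms] forms_vanish_Y[OF E_forms(2) E_C0(2) assms] by auto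

text \<open>The two quadrics hold on the closure and already imply the curve equation. So new points
  can occur only at s = 0, hence over the roots of the quadratic.\<close>

lemma Y_cases:
  assumes x: "x \<in> Y"
  obtains "x \<in> affine_chart C0" | r t where "r \<noteq> 0" "q t = 0" "x = r *s pt 1 0 0 t"
proof -
  define r s t a where "r = x $ None" "s = ws x / x $ None" "t = wt x / x $ None" "a = x $ Some 1 / x $ None"
  note d = this
  have r: "r \<noteq> 0" using x by (auto simp: Y_def affine_chart_def d)
  have xe: "x = r *s pt 1 a s t" unfolding pt_scale using r by (simp add: pt_eq_iff d)
  have "r\<^sup>2 * (a - t * s) = E1 x"
    unfolding xe pt_scale by (simp add: E1_def power2_eq_square algebra_simps)
  hence a: "a = t * s" using E_Y(1)[OF x] r by simp
  have "r\<^sup>2 * (a * a + a * s - 4 * q t) = E2 x"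
    unfolding xe pt_scale by (simp add: E2_def power2_eq_square algebra_simps)
  hence "a * a + a * s - 4 * q t = 0" using E_Y(2)[OF x] r by simp
  hence e: "t * (t + 1) * s\<^sup>2 = 4 * q t" by (simp add: a power2_eq_square algebra_simps)
  show ?thesis
  proof (cases "s = 0")
    case True
    hence "4 * q t = 0" using e by (simp only: power_zero_numeral mult_zero_right)
    hence "q t = 0" by (metis mult_eq_0_iff zero_neq_numeral)
    moreover have "x = r *s pt 1 0 0 t" using xe a True by simp
    ultimately show ?thesis using that(2) r by blast
  next
    case False
    hence "x \<in> affine_chart C0" unfolding chart_C0_iff using r e xe a by blast
    thus ?thesis by (rule that(1))
  qed
qed

lemma Y_nonzero: "x \<in> Y \<Longrightarrow> x \<noteq> 0"
  by (auto simp: Y_def affine_chart_def)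

lemma curve_like_Y: "curve_like Y"
proof (rule curve_like_superset[OF curve_like_chart_C0 C0_Y Y_nonzero])
  show "c *s x \<in> Y" if "x \<in> Y" "c \<noteq> 0" for x c
    using that by (simp add: Y_def affine_chart_def)
  define Z where "Z = {t. q t = 0}"
  have "Z = {t. poly [:c, b, A:] t = 0}" by (simp add: Z_def power2_eq_square algebra_simps)
  moreover have "[:c, b, A:] \<noteq> 0" using A by simp
  ultimately have "finite Z" using poly_roots_finite by metis
  moreover have "proj_point ` (Y - affine_chart C0) \<subseteq> (\<lambda>t. proj_point (pt 1 0 0 t)) ` Z"
  proof (rule image_subsetI)
    fix x assume x: "x \<in> Y - affine_chart C0"
    hence "x \<in> Y" by blast
    thus "proj_point x \<in> (\<lambda>t. proj_point (pt 1 0 0 t)) ` Z"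
    proof (cases rule: Y_cases)
      case 1 thus ?thesis using x by blast
    next
      case (2 r t)
      thus ?thesis by (auto simp: Z_def proj_point_scale)
    qed
  qed
  ultimately show "finite (proj_point ` (Y - affine_chart C0))" using finite_subset by blast
  show "F x = 0" if "F \<in> forms d" "\<And>x. x \<in> affine_chart C0 \<Longrightarrow> F x = 0" "x \<in> Y" for d F x
    by (rule forms_vanish_Y[OF that])
qed

text \<open>The maps are s = 2 W / (t (t + 1)) and W = t (t + 1) s / 2, with denominators cleared;
  they are inverse to each other where W, respectively s, is nonzero.\<close>

lemma birational_Y: "birational X Y"
proof -
  define f where "f = (\<lambda>x :: complex^(3 option). pt ((x $ Some 2 + x $ Some 1) * x $ None)
     (2 * (x $ Some 3 * x $ Some 1)) (2 * (x $ Some 3 * x $ None)) (x $ Some 2 * x $ Some 1 + x $ Some 2 * x $ None))"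
  define h where "h = (\<lambda>y. vec3 (y $ None * y $ None) (wt y * y $ None) (wt y * wt y) 
     (1 / 2 * (y $ Some 1 * (wt y + y $ None))))"
  define U where "U = {x \<in> X. x $ None * x $ Some 3 \<noteq> 0}"
  define V where "V = {y \<in> Y. ws y \<noteq> 0}"
  have fv: "f (r *s vec3 1 t (t\<^sup>2) W) = r\<^sup>2 *s pt (t * (t + 1)) (2 * t * W) (2 * W) (t\<^sup>2 * (t + 1))" for r t W
    unfolding pt_scale vec3_scale by (simp add: f_def pt_eq_iff power2_eq_square algebra_simps)
  have hv: "h (r *s pt 1 (t * s) s t) = r\<^sup>2 *s vec3 1 t (t\<^sup>2) (t * (t + 1) * s / 2)" for r s t
    unfolding pt_scale vec3_scale by (simp add: h_def vec3_eq_iff power2_eq_square algebra_simps)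
  have U_rep: "\<exists>r t W. r \<noteq> 0 \<and> W\<^sup>2 = poly g t \<and> W \<noteq> 0 \<and> x = r *s vec3 1 t (t\<^sup>2) W" if x: "x \<in> U" for x
  proof -
    have "x \<in> X" "x $ None \<noteq> 0" "x $ Some 3 \<noteq> 0" using x by (auto simp: U_def)
    then obtain r t W where r: "r \<noteq> 0" "W\<^sup>2 = poly g t" "x = r *s vec3 1 t (t\<^sup>2) W"
      using X_finite_point unfolding X0_iff by blast
    moreover have "W \<noteq> 0" using \<open>x $ Some 3 \<noteq> 0\<close> r(3) by auto
    ultimately show ?thesis by blast
  qed
  have V_eq: "V = affine_chart C0"
  proof (intro equalityI subsetI)
    fix y assume y: "y \<in> V"
    hence "y \<in> Y" by (simp add: V_def)
    thus "y \<in> affine_chart C0"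
    proof (cases rule: Y_cases)
      case (2 r t) thus ?thesis using y by (simp add: V_def ws_scale)
    qed
  next
    fix y assume y: "y \<in> affine_chart C0"
    then obtain r s t where "r \<noteq> 0" "s \<noteq> 0" "y = r *s pt 1 (t * s) s t" unfolding chart_C0_iff by blast
    thus "y \<in> V" using y C0_Y by (auto simp: V_def ws_scale)
  qed
  have fV: "f x \<in> V" if x: "x \<in> U" for x
  proof -
    obtain r t W where r: "r \<noteq> 0" "W\<^sup>2 = poly g t" "W \<noteq> 0" "x = r *s vec3 1 t (t\<^sup>2) W" using U_rep[OF x] by blast
    show ?thesis unfolding V_eq r(4) fv by (rule chart_C0_W[OF r(2,3)]) (use r(1) in simp)
  qed
  have hU: "h y \<in> U" if y: "y \<in> V" for y
  proof -
    obtain r s t where r: "r \<noteq> 0" "s \<noteq> 0" "t * (t + 1) * s\<^sup>2 = 4 * q t" "y = r *s pt 1 (t * s) s t"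
      using y unfolding V_eq chart_C0_iff by blast
    note p = C0_parameter[OF r(3)]
    have "h y \<in> X0" unfolding r(4) hv by (rule X0I[OF p(3)]) (use r(1) in simp)
    moreover have "h y $ None * h y $ Some 3 \<noteq> 0" unfolding r(4) hv using p(1,2) r(1,2) by simp
    ultimately show ?thesis using X0_X by (auto simp: U_def)
  qed
  have iso: "proj_iso_via f U V"
  proof (rule proj_iso_via_vectors[where g = h])
    show "(\<lambda>x. f x $ j) \<in> forms 2" for j
      unfolding f_def by (intro forms_pt forms_add forms_scale forms_1_1 forms_coord)
    show "(\<lambda>y. h y $ j) \<in> forms 2" for j
      unfolding h_def by (intro forms_vec3 forms_add forms_scale forms_1_1 forms_coord wt_form)
    show "f x \<in> V" if "x \<in> U" for x by (rule fV[OF that])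
    show "h y \<in> U" if "y \<in> V" for y by (rule hU[OF that])
    show "h (f x) \<in> proj_point x" if x: "x \<in> U" for x
    proof -
      obtain r t W where r: "r \<noteq> 0" "W\<^sup>2 = poly g t" "W \<noteq> 0" "x = r *s vec3 1 t (t\<^sup>2) W" using U_rep[OF x] by blast
      define z where "z = t * (t + 1)"
      have z: "z \<noteq> 0" using r by (auto simp: poly_g z_def)
      have zt: "t * (t + 1) = z" "t\<^sup>2 * (t + 1) = z * t" by (simp_all add: z_def power2_eq_square)
      have fx: "f x = (r\<^sup>2 * z) *s pt 1 (t * (2 * W / z)) (2 * W / z) t"
        unfolding r(4) fv zt pt_scale using z by (simp add: pt_eq_iff)
      have "h (f x) = (r\<^sup>2 * z)\<^sup>2 *s vec3 1 t (t\<^sup>2) (z * (2 * W / z) / 2)" unfolding fx hv zt(1) ..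
      also have "z * (2 * W / z) / 2 = W" using z by simp
      also have "(r\<^sup>2 * z)\<^sup>2 *s vec3 1 t (t\<^sup>2) W = ((r\<^sup>2 * z)\<^sup>2 / r) *s x"
        unfolding r(4) vec3_scale using r(1) by (simp add: vec3_eq_iff)
      finally show ?thesis using r(1) z by (intro proj_pointI[of "(r\<^sup>2 * z)\<^sup>2 / r"]) auto
    qed
    show "f (h y) \<in> proj_point y" if y: "y \<in> V" for y
    proof -
      obtain r s t where r: "r \<noteq> 0" "s \<noteq> 0" "t * (t + 1) * s\<^sup>2 = 4 * q t" "y = r *s pt 1 (t * s) s t"
        using y unfolding V_eq chart_C0_iff by blast
      note p = C0_parameter[OF r(3)]
      define z where "z = (r\<^sup>2)\<^sup>2 * (t * (t + 1))"
      have "f (h y) = z *s pt 1 (t * s) s t"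
        unfolding r(4) hv fv unfolding pt_scale by (simp add: pt_eq_iff z_def power2_eq_square algebra_simps)
      also have "\<dots> = (z / r) *s y" unfolding r(4) using r(1) by (simp add: vector_smult_assoc)
      finally show ?thesis using p(1,2) r(1) by (intro proj_pointI[of "z / r"]) (auto simp: z_def)
    qed
    show "x \<noteq> 0" if "x \<in> U" for x using that X_nonzero by (simp add: U_def)
    show "y \<noteq> 0" if "y \<in> V" for y using that Y_nonzero by (simp add: V_def)
  qed
  have "(\<lambda>x :: complex^(3 option). x $ None * x $ Some 3) \<in> forms 2" by (intro forms_1_1 forms_coord)
  hence oU: "proj_open_in X U" unfolding U_def by (rule proj_open_in_nonvanishing) (rule X_nonzero)
  have oV: "proj_open_in Y V" unfolding V_def by (rule proj_open_in_nonvanishing[OF ws_form Y_nonzero])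
  have "V \<noteq> {}" unfolding V_eq
    using curve_like_irreducible[OF curve_like_chart_C0] by (simp add: proj_irreducible_def)
  moreover from this have "U \<noteq> {}" using hU by blast
  ultimately show ?thesis unfolding birational_def
    using curve_like_irreducible[OF curve_like_X] curve_like_irreducible[OF curve_like_Y] iso oU oV by blast
qed

end

section \<open>The compactified log-free curve\<close>

lemma sum_lessThan_double: "(\<Sum>j<2 * n. f j) = (\<Sum>i<n. f (2 * i) + f (2 * i + 1))"
  for f :: "nat \<Rightarrow> 'a::comm_monoid_add"
  by (induction n) (simp_all add: add.assoc)

lemma prod_UNIV_3: "(\<Prod>i\<in>UNIV. f i) = f 1 * f 2 * f (3 :: 3)"
  for f :: "3 \<Rightarrow> 'a::comm_monoid_mult"
  unfolding UNIV_3 by (simp add: ac_simps)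

lemma poly_sum_powers: "poly (\<Sum>i<n. monom (a i) i) t = (\<Sum>i<n. a i * t ^ i)"
  for t :: complex
  by (simp add: poly_sum poly_monom)

lemma sum_powers_eq_0:
  fixes a :: "nat \<Rightarrow> complex"
  assumes "finite S" "\<And>t. t \<notin> S \<Longrightarrow> (\<Sum>i<n. a i * t ^ i) = 0" "i < n"
  shows "a i = 0"
proof -
  have "(\<Sum>i<n. monom (a i) i) = 0"
    by (rule poly_zero_of_cofinite[OF assms(1)]) (simp add: poly_sum_powers assms(2))
  hence "coeff (\<Sum>i<n. monom (a i) i) i = 0" by simp
  thus ?thesis using assms(3) by (simp add: coeff_sum)
qed

lemma sum_powers_poly_eq_0:
  assumes "(\<Sum>i<n. monom (a i) i) = 0" "i < n" shows "a i = 0"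
proof -
  have "coeff (\<Sum>i<n. monom (a i) i) i = 0" using assms(1) by simp
  thus ?thesis using assms(2) by (simp add: coeff_sum)
qed

context quartic
begin

abbreviation Q :: "complex poly" where "Q \<equiv> [:c, b, A:]"

text \<open>The rational function \<open>4 Q / (t (t + 1))\<close> has poles at \<open>0\<close> and \<open>-1\<close>, so the leading
  coefficient of the sum vanishes at both points.\<close>

lemma pole_expansion_zero:
  assumes "(\<Sum>i\<le>n. [:\<alpha> i, \<beta> i:] * smult 4 Q ^ i * [:0, 1, 1:] ^ (n - i)) + [:0, 0, 1:] * \<gamma> * [:0, 1, 1:] ^ n = 0"
  shows "(\<forall>i\<le>n. \<alpha> i = 0 \<and> \<beta> i = 0) \<and> \<gamma> = 0"
  using assms
proof (induction n)
  case 0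
  hence z: "[:\<alpha> 0, \<beta> 0:] + [:0, 0, 1:] * \<gamma> = 0" by simp
  have "[:0, 0, 1:] * \<gamma> = pCons 0 (pCons 0 \<gamma>)" by simp
  thus ?case using z by simp
next
  case (Suc n)
  define D p x2 :: "complex poly" where "D = [:0, 1, 1:]" and "p = smult 4 Q" and "x2 = [:0, 0, 1:]"
  define lin where "lin i = [:\<alpha> i, \<beta> i:]" for i
  define R where "R = (\<Sum>i\<le>n. lin i * p ^ i * D ^ (n - i)) + x2 * \<gamma> * D ^ n"
  have "(\<Sum>i\<le>n. lin i * p ^ i * D ^ (Suc n - i)) = D * (\<Sum>i\<le>n. lin i * p ^ i * D ^ (n - i))"
    unfolding sum_distrib_left by (intro sum.cong) (auto simp: Suc_diff_le mult_ac)
  moreover have "(\<Sum>i\<le>Suc n. lin i * p ^ i * D ^ (Suc n - i)) + x2 * \<gamma> * D ^ Suc n = 0"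
    unfolding lin_def p_def D_def x2_def by (rule Suc.prems)
  ultimately have e: "D * R + lin (Suc n) * p ^ Suc n = 0"
    unfolding R_def by (simp add: distrib_left mult_ac add_ac)
  have D: "poly D 0 = 0" "poly D (- 1) = 0" by (simp_all add: D_def)
  have "poly (lin (Suc n)) t * poly p t ^ Suc n = 0" if "poly D t = 0" for t
    using arg_cong[OF e, of "\<lambda>p. poly p t"] that by simp
  moreover have "poly p 0 = 4 * c" "poly p (- 1) = 4 * (A - b + c)" by (simp_all add: p_def algebra_simps)
  hence "poly p 0 \<noteq> 0" "poly p (- 1) \<noteq> 0" using c Abc by (metis mult_eq_0_iff zero_neq_numeral)+
  ultimately have "poly (lin (Suc n)) 0 = 0" "poly (lin (Suc n)) (- 1) = 0"
    using D by (metis mult_eq_0_iff power_not_zero)+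
  \<comment> \<open>A polynomial of degree at most one with zeros at both 0 and -1 is zero.\<close>
  hence ab: "\<alpha> (Suc n) = 0" "\<beta> (Suc n) = 0" by (auto simp: lin_def)
  hence "D * R = 0" using e by (simp add: lin_def)
  moreover have "D \<noteq> 0" by (simp add: D_def)
  ultimately have "R = 0" by simp
  hence "(\<forall>i\<le>n. \<alpha> i = 0 \<and> \<beta> i = 0) \<and> \<gamma> = 0" by (intro Suc.IH) (simp add: R_def D_def lin_def p_def x2_def)
  thus ?case using ab le_Suc_eq by auto
qed

text \<open>Multiplication by the n-th power of t (t + 1) turns the identity of rational functions,
  valid off a finite set, into one of polynomials.\<close>

lemma pole_expansion_zero_fun:
  assumes S: "finite S" "0 \<in> S" "-1 \<in> S"
    and z: "\<And>t. t \<notin> S \<Longrightarrow> (\<Sum>i\<le>n. (\<alpha> i + \<beta> i * t) * (4 * poly Q t / (t * (t + 1))) ^ i) + t\<^sup>2 * poly \<gamma> t = 0"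
  shows "(\<forall>i\<le>n. \<alpha> i = 0 \<and> \<beta> i = 0) \<and> \<gamma> = 0"
proof (rule pole_expansion_zero, rule poly_zero_of_cofinite[OF S(1)])
  fix t assume t: "t \<notin> S"
  define w where "w = t * (t + 1)"
  have "t + 1 \<noteq> 0" using t S by (metis add_eq_0_iff2)
  hence w: "w \<noteq> 0" using t S by (auto simp: w_def)
  have "(\<Sum>i\<le>n. (\<alpha> i + \<beta> i * t) * (4 * poly Q t) ^ i * w ^ (n - i)) = w ^ n * (\<Sum>i\<le>n. (\<alpha> i + \<beta> i * t) * (4 * poly Q t / w) ^ i)"
    unfolding sum_distrib_left
  proof (rule sum.cong[OF refl])
    fix i assume "i \<in> {..n}"
    hence "w ^ n = w ^ i * w ^ (n - i)" by (simp add: power_add[symmetric])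
    thus "(\<alpha> i + \<beta> i * t) * (4 * poly Q t) ^ i * w ^ (n - i) = w ^ n * ((\<alpha> i + \<beta> i * t) * (4 * poly Q t / w) ^ i)"
      using w by (simp only: power_divide) simp
  qed
  hence "(\<Sum>i\<le>n. (\<alpha> i + \<beta> i * t) * (4 * poly Q t) ^ i * w ^ (n - i)) + t\<^sup>2 * poly \<gamma> t * w ^ n =
      w ^ n * ((\<Sum>i\<le>n. (\<alpha> i + \<beta> i * t) * (4 * poly Q t / w) ^ i) + t\<^sup>2 * poly \<gamma> t)"
    by (simp only: distrib_left mult_ac)
  also have "\<dots> = 0" using z[OF t] unfolding w_def by (simp only: mult_zero_right)
  finally have 0: "(\<Sum>i\<le>n. (\<alpha> i + \<beta> i * t) * (4 * poly Q t) ^ i * w ^ (n - i)) + t\<^sup>2 * poly \<gamma> t * w ^ n = 0" .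
  have e: "poly [:\<alpha> i, \<beta> i:] t = \<alpha> i + \<beta> i * t" "poly [:0, 1, 1:] t = w" "poly [:0, 0, 1:] t = t\<^sup>2" for i
    by (simp_all add: w_def power2_eq_square algebra_simps)
  show "poly ((\<Sum>i\<le>n. [:\<alpha> i, \<beta> i:] * smult 4 Q ^ i * [:0, 1, 1:] ^ (n - i)) + [:0, 0, 1:] * \<gamma> * [:0, 1, 1:] ^ n) t = 0"
    using 0 by (simp only: poly_add poly_sum poly_mult poly_power poly_smult e)
qed

text \<open>Both signs of \<open>s\<close> occur, so the even and the odd part in \<open>s\<close> vanish separately.\<close>

lemma cover_expansion_zero:
  assumes z: "\<And>t s. s \<noteq> 0 \<Longrightarrow> t * (t + 1) * s\<^sup>2 = 4 * poly Q t \<Longrightarrow>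
     (\<Sum>j<n. (\<alpha> j + \<beta> j * t) * s ^ j) + t\<^sup>2 * (poly \<gamma> t + s * poly \<delta> t) = 0"
  shows "(\<forall>j<n. \<alpha> j = 0 \<and> \<beta> j = 0) \<and> \<gamma> = 0 \<and> \<delta> = 0"
proof -
  \<comment> \<open>Extension by zero pads the sum to 2 (n + 1) terms, which then pair up into even
    and odd powers of s.\<close>
  define \<alpha>' \<beta>' where "\<alpha>' = (\<lambda>j. if j < n then \<alpha> j else 0)" and "\<beta>' = (\<lambda>j. if j < n then \<beta> j else 0)"
  define S where "S = {t. poly ([:0, 1, 1:] * Q) t = 0}"
  have "[:0, 1, 1:] * Q \<noteq> 0" using A by simp
  hence fin: "finite S" unfolding S_def by (rule poly_roots_finite)
  have S: "0 \<in> S" "-1 \<in> S" by (simp_all add: S_def)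
  define Ev Od where "Ev = (\<lambda>t r. (\<Sum>i\<le>n. (\<alpha>' (2 * i) + \<beta>' (2 * i) * t) * r ^ i) + t\<^sup>2 * poly \<gamma> t)"
    and "Od = (\<lambda>t r. (\<Sum>i\<le>n. (\<alpha>' (2 * i + 1) + \<beta>' (2 * i + 1) * t) * r ^ i) + t\<^sup>2 * poly \<delta> t)"
  have split: "(\<Sum>j<n. (\<alpha> j + \<beta> j * t) * s ^ j) + t\<^sup>2 * (poly \<gamma> t + s * poly \<delta> t) = Ev t (s\<^sup>2) + s * Od t (s\<^sup>2)" for s t
  proof -
    have "(\<Sum>j<n. (\<alpha> j + \<beta> j * t) * s ^ j) = (\<Sum>j<2 * Suc n. (\<alpha>' j + \<beta>' j * t) * s ^ j)"
      by (rule sum.mono_neutral_cong_left) (auto simp: \<alpha>'_def \<beta>'_def)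
    also have "\<dots> = (\<Sum>i<Suc n. (\<alpha>' (2 * i) + \<beta>' (2 * i) * t) * s ^ (2 * i) + (\<alpha>' (2 * i + 1) + \<beta>' (2 * i + 1) * t) * s ^ (2 * i + 1))"
      by (rule sum_lessThan_double)
    also have "\<dots> = (\<Sum>i\<le>n. (\<alpha>' (2 * i) + \<beta>' (2 * i) * t) * (s\<^sup>2) ^ i) + s * (\<Sum>i\<le>n. (\<alpha>' (2 * i + 1) + \<beta>' (2 * i + 1) * t) * (s\<^sup>2) ^ i)"
      unfolding lessThan_Suc_atMost sum.distrib sum_distrib_left power_mult[symmetric] by (simp add: mult_ac)
    finally show ?thesis unfolding Ev_def Od_def by (simp only: distrib_left add_ac mult_ac)
  qed
  have EO: "Ev t (4 * poly Q t / (t * (t + 1))) = 0 \<and> Od t (4 * poly Q t / (t * (t + 1))) = 0" if t: "t \<notin> S" for t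
  proof -
    define r where "r = 4 * poly Q t / (t * (t + 1))"
    define s where "s = csqrt r"
    have "poly [:0, 1, 1:] t = t * (t + 1)" by (simp add: algebra_simps)
    hence nz: "t * (t + 1) \<noteq> 0" "poly Q t \<noteq> 0" using t unfolding S_def mem_Collect_eq poly_mult
      by (metis mult_zero_left, metis mult_zero_right)
    have "r \<noteq> 0" using nz by (simp add: r_def del: poly_pCons)
    hence s: "s \<noteq> 0" "s\<^sup>2 = r" by (simp_all add: s_def)
    have r: "t * (t + 1) * r = 4 * poly Q t" using nz(1) by (simp add: r_def del: poly_pCons)
    have 1: "Ev t r + s * Od t r = 0" using z[of s t, unfolded split] s r by (simp del: poly_pCons)
    have 2: "Ev t r + (- s) * Od t r = 0" using z[of "- s" t, unfolded split] s r by (simp del: poly_pCons)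
    have "2 * Ev t r = (Ev t r + s * Od t r) + (Ev t r + (- s) * Od t r)" by simp
    hence "Ev t r = 0" unfolding 1 2 by simp
    moreover from this have "Od t r = 0" using 1 s(1) by simp
    ultimately show ?thesis by (simp add: r_def)
  qed
  have "(\<forall>i\<le>n. \<alpha>' (2 * i) = 0 \<and> \<beta>' (2 * i) = 0) \<and> \<gamma> = 0"
    by (rule pole_expansion_zero_fun[OF fin S EO[THEN conjunct1, unfolded Ev_def]])
  moreover have "(\<forall>i\<le>n. \<alpha>' (2 * i + 1) = 0 \<and> \<beta>' (2 * i + 1) = 0) \<and> \<delta> = 0"
    by (rule pole_expansion_zero_fun[OF fin S EO[THEN conjunct2, unfolded Od_def]])
  moreover have "\<alpha> j = 0 \<and> \<beta> j = 0" if ev: "\<forall>i\<le>n. \<alpha>' (2 * i) = 0 \<and> \<beta>' (2 * i) = 0"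
      and od: "\<forall>i\<le>n. \<alpha>' (2 * i + 1) = 0 \<and> \<beta>' (2 * i + 1) = 0" and j: "j < n" for j
  proof -
    have "\<alpha>' j = 0 \<and> \<beta>' j = 0"
    proof (cases "even j")
      case True
      then obtain i where "j = 2 * i" by (auto elim: evenE)
      thus ?thesis using ev[rule_format, of i] j by simp
    next
      case False
      then obtain i where "j = 2 * i + 1" by (auto elim: oddE)
      thus ?thesis using od[rule_format, of i] j by simp
    qed
    thus ?thesis using j by (simp add: \<alpha>'_def \<beta>'_def)
  qed
  ultimately show ?thesis by blast
qed

end

context tangential_quartic
begin

section \<open>The union with the even line and its Hilbert function\<close>

definition L0 :: "(complex^3) set" where "L0 = {T. T$1 = 0 \<and> T$2 + T$3 = 0}"

definition Z0 :: "(complex^(3 option)) set" where "Z0 = affine_chart (L0 \<union> C0)"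

lemma Z0_iff: "x \<in> Z0 \<longleftrightarrow> (\<exists>r t. r \<noteq> 0 \<and> x = r *s pt 1 0 0 t) \<or> x \<in> affine_chart C0"
proof -
  have "x \<in> affine_chart L0 \<longleftrightarrow> (\<exists>r t. r \<noteq> 0 \<and> x = r *s pt 1 0 0 t)"
  proof
    assume "x \<in> affine_chart L0"
    then obtain r T where "r \<noteq> 0" "T \<in> L0" "x = r *s lift_affine T" unfolding affine_chart_iff by blast
    thus "\<exists>r t. r \<noteq> 0 \<and> x = r *s pt 1 0 0 t"
      by (intro exI[of _ r] exI[of _ "tparam T"]) (simp add: L0_def lift_affine_pt)
  next
    assume "\<exists>r t. r \<noteq> 0 \<and> x = r *s pt 1 0 0 t"
    then obtain r t where r: "r \<noteq> 0" "x = r *s pt 1 0 0 t" by blast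
    obtain T where T: "T$1 = 0" "T$2 + T$3 = 0" "tparam T = t" by (rule exists_affine)
    show "x \<in> affine_chart L0" unfolding affine_chart_iff
      by (rule exI[of _ r], rule exI[of _ T]) (simp add: r T L0_def lift_affine_pt)
  qed
  moreover have "x \<in> Z0 \<longleftrightarrow> x \<in> affine_chart L0 \<or> x \<in> affine_chart C0"
    by (auto simp: Z0_def affine_chart_def)
  ultimately show ?thesis by blast
qed

definition monomial :: "nat \<Rightarrow> nat \<Rightarrow> nat \<Rightarrow> nat \<Rightarrow> complex^(3 option) \<Rightarrow> complex" where
  "monomial d i j m x = (x $ Some 1) ^ i * ws x ^ j * wt x ^ m * (x $ None) ^ (d - (i + j + m))"

lemma monomial_forms:
  assumes "i + j + m \<le> d" shows "monomial d i j m \<in> forms d"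
proof -
  have "(\<lambda>x. x $ Some 1 ^ i * ws x ^ j * wt x ^ m * x $ None ^ (d - (i + j + m))) \<in> 
      forms (i * 1 + j * 1 + m * 1 + (d - (i + j + m)) * 1)"
    by (intro forms_mult forms_power forms_coord ws_form wt_form)
  thus ?thesis using assms unfolding monomial_def[abs_def] by simp
qed

text \<open>The line a = s = 0 lies on the quadric \<open>E1\<close>. It does not lie on
  \<open>E2\<close>, but a E2 and s E2 vanish on it and hence on the union. The terms solved for in
  these three relations are s t, a^3 and a^2 s.\<close>

lemma Z0_relations:
  assumes "x \<in> Z0"
  shows "wt x * ws x = x $ Some 1 * x $ None"
    and "(x $ Some 1) ^ 3 = - ((x $ Some 1)\<^sup>2 * ws x) + 4 * x $ Some 1 * (A * (wt x)\<^sup>2 + b * (wt x * x $ None) + c * (x $ None)\<^sup>2)"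
    and "(x $ Some 1)\<^sup>2 * ws x = - (x $ Some 1 * (ws x)\<^sup>2) + 4 * ws x * (A * (wt x)\<^sup>2 + b * (wt x * x $ None) + c * (x $ None)\<^sup>2)"
proof -
  have "E1 x = 0 \<and> x $ Some 1 * E2 x = 0 \<and> ws x * E2 x = 0"
  proof (cases "x \<in> affine_chart C0")
    case True thus ?thesis using E_C0 by simp
  next
    case False
    then obtain r t where "x = r *s pt 1 0 0 t" using assms Z0_iff by blast
    hence "x = pt r 0 0 (r * t)" unfolding pt_scale by simp
    thus ?thesis by (simp add: E1_def)
  qed
  hence e: "E1 x = 0" "x $ Some 1 * E2 x = 0" "ws x * E2 x = 0" by auto
  show "wt x * ws x = x $ Some 1 * x $ None" using e(1) by (simp add: E1_def)
  have "(x $ Some 1) ^ 3 - (- ((x $ Some 1)\<^sup>2 * ws x) + 4 * x $ Some 1 * (A * (wt x)\<^sup>2 + b * (wt x * x $ None) + c * (x $ None)\<^sup>2)) = x $ Some 1 * E2 x"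
    by (simp add: E2_def power2_eq_square power3_eq_cube algebra_simps)
  thus "(x $ Some 1) ^ 3 = - ((x $ Some 1)\<^sup>2 * ws x) + 4 * x $ Some 1 * (A * (wt x)\<^sup>2 + b * (wt x * x $ None) + c * (x $ None)\<^sup>2)"
    unfolding e(2) by (simp only: right_minus_eq)
  have "(x $ Some 1)\<^sup>2 * ws x - (- (x $ Some 1 * (ws x)\<^sup>2) + 4 * ws x * (A * (wt x)\<^sup>2 + b * (wt x * x $ None) + c * (x $ None)\<^sup>2)) = ws x * E2 x"
    by (simp add: E2_def power2_eq_square algebra_simps)
  thus "(x $ Some 1)\<^sup>2 * ws x = - (x $ Some 1 * (ws x)\<^sup>2) + 4 * ws x * (A * (wt x)\<^sup>2 + b * (wt x * x $ None) + c * (x $ None)\<^sup>2)"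
    unfolding e(3) by (simp only: right_minus_eq)
qed

text \<open>The monomials \<open>a\<^sup>i s\<^sup>j t\<^sup>m w\<^bsup>d-i-j-m\<^esup>\<close> that are divisible by none of \<open>s t\<close>, \<open>a\<^sup>3\<close>, \<open>a\<^sup>2 s\<close>, in five
  families: \<open>t\<^sup>n\<close>, \<open>s\<^sup>n\<^sup>+\<^sup>1\<close>, \<open>a s\<^sup>n\<close>, \<open>a t\<^sup>n\<^sup>+\<^sup>1\<close>, \<open>a\<^sup>2 t\<^sup>n\<close>.\<close>

definition normal_index :: "nat \<Rightarrow> (nat \<times> nat) set" where
  "normal_index d = Sigma {..<5} (\<lambda>f. {..<[d + 1, d, d, d - 1, d - 1] ! f})"

definition normal :: "nat \<Rightarrow> nat \<times> nat \<Rightarrow> complex^(3 option) \<Rightarrow> complex" where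
  "normal d = (\<lambda>(f, n). [monomial d 0 0 n, monomial d 0 (n + 1) 0, monomial d 1 n 0,
     monomial d 1 0 (n + 1), monomial d 2 0 n] ! f)"

lemma lessThan_5: "{..<5::nat} = {0, 1, 2, 3, 4}" by auto

lemma finite_normal_index: "finite (normal_index d)"
  by (simp add: normal_index_def)

lemma card_normal_index: "d \<ge> 1 \<Longrightarrow> card (normal_index d) = 5 * d - 1"
  by (simp add: normal_index_def lessThan_5 card_SigmaI numeral_eq_Suc)

lemma normal_index_iff: "(f, n) \<in> normal_index d \<longleftrightarrow> f = 0 \<and> n \<le> d \<or> f = 1 \<and> n < d \<or> f = 2 \<and> n < d \<or> 
    f = 3 \<and> n < d - 1 \<or> f = 4 \<and> n < d - 1"
  by (auto simp: normal_index_def lessThan_5)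

lemma sum_normal_index:
  "(\<Sum>i\<in>normal_index d. F i) = (\<Sum>n<d + 1. F (0, n)) + (\<Sum>n<d. F (1, n)) + (\<Sum>n<d. F (2, n)) 
     + (\<Sum>n<d - 1. F (3, n)) + (\<Sum>n<d - 1. F (4, n))"
  for F :: "nat \<times> nat \<Rightarrow> complex"
proof -
  have "(\<Sum>i\<in>normal_index d. F i) = (\<Sum>f<5. \<Sum>n<[d + 1, d, d, d - 1, d - 1] ! f. F (f, n))"
    unfolding normal_index_def by (subst sum.Sigma) simp_all
  thus ?thesis by (simp add: lessThan_5 add.assoc)
qed

lemma normal_forms:
  assumes "i \<in> normal_index d" shows "normal d i \<in> forms d"
proof -
  obtain f n where i: "i = (f, n)" by (cases i)
  have "f = 0 \<and> n \<le> d \<or> f = 1 \<and> n < d \<or> f = 2 \<and> n < d \<or> f = 3 \<and> n < d - 1 \<or> f = 4 \<and> n < d - 1"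
    using assms unfolding i normal_index_iff .
  thus ?thesis unfolding i normal_def by (auto intro!: monomial_forms)
qed

definition reducible_to_normal :: "nat \<Rightarrow> (complex^(3 option) \<Rightarrow> complex) \<Rightarrow> bool" where
  "reducible_to_normal d F \<longleftrightarrow> (\<exists>k. \<forall>x\<in>Z0. F x = (\<Sum>i\<in>normal_index d. k i * normal d i x))"

lemma reducible_add:
  assumes "reducible_to_normal d F" "reducible_to_normal d G" shows "reducible_to_normal d (\<lambda>x. F x + G x)"
proof -
  obtain k k' where "\<forall>x\<in>Z0. F x = (\<Sum>i\<in>normal_index d. k i * normal d i x)"
    "\<forall>x\<in>Z0. G x = (\<Sum>i\<in>normal_index d. k' i * normal d i x)"
    using assms unfolding reducible_to_normal_def by blast
  thus ?thesis unfolding reducible_to_normal_def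
    by (intro exI[of _ "\<lambda>i. k i + k' i"]) (simp add: distrib_right sum.distrib)
qed

lemma reducible_scale:
  assumes "reducible_to_normal d F" shows "reducible_to_normal d (\<lambda>x. z * F x)"
proof -
  obtain k where "\<forall>x\<in>Z0. F x = (\<Sum>i\<in>normal_index d. k i * normal d i x)"
    using assms unfolding reducible_to_normal_def by blast
  thus ?thesis unfolding reducible_to_normal_def
    by (intro exI[of _ "\<lambda>i. z * k i"]) (simp add: sum_distrib_left mult_ac)
qed

lemma reducible_sum:
  assumes "\<And>i. i \<in> I \<Longrightarrow> reducible_to_normal d (F i)" shows "reducible_to_normal d (\<lambda>x. \<Sum>i\<in>I. F i x)"
proof -
  have "reducible_to_normal d (\<lambda>x. 0)"
    unfolding reducible_to_normal_def by (intro exI[of _ "\<lambda>_. 0"]) simp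
  thus ?thesis using assms by (induction I rule: infinite_finite_induct) (simp_all add: reducible_add)
qed

lemma reducible_cong:
  assumes "reducible_to_normal d G" "\<And>x. x \<in> Z0 \<Longrightarrow> F x = G x" shows "reducible_to_normal d F"
  using assms unfolding reducible_to_normal_def by auto

lemma reducible_normal:
  assumes "i \<in> normal_index d" shows "reducible_to_normal d (normal d i)"
  unfolding reducible_to_normal_def
proof (rule exI[of _ "\<lambda>j. if j = i then 1 else 0"], rule ballI)
  fix x
  have "(\<Sum>j\<in>normal_index d. (if j = i then 1 else 0) * normal d j x) = (\<Sum>j\<in>normal_index d. if j = i then normal d j x else 0)"
    by (intro sum.cong) auto
  thus "normal d i x = (\<Sum>j\<in>normal_index d. (if j = i then 1 else 0) * normal d j x)"
    using assms by (simp add: sum.delta finite_normal_index)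
qed

text \<open>Rewriting with the three relations terminates: with weights 3, 2, 2 for a, s, t and 0
  for w, each step replaces a monomial by monomials of smaller weight.\<close>

lemma reducible_monomial:
  assumes "i + j + m \<le> d" shows "reducible_to_normal d (monomial d i j m)"
  using assms
proof (induction "3 * i + 2 * j + 2 * m" arbitrary: i j m rule: less_induct)
  case less
  consider "j \<ge> 1" "m \<ge> 1" | "i \<ge> 2" "i \<ge> 3 \<or> j \<ge> 1" | "j = 0 \<or> m = 0" "i < 2 \<or> i = 2 \<and> j = 0"
    by linarith
  thus ?case
  proof cases
    case 1
    then obtain j' m' where jm: "j = Suc j'" "m = Suc m'" by (metis Suc_le_D One_nat_def)
    have "d - (i + j' + m' + 1) = Suc (d - (i + j + m))" using less.prems jm by simp
    hence "monomial d i j m x = monomial d (i + 1) j' m' x" if "x \<in> Z0" for x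
    proof -
      define r where "r = d - (i + j + m)"
      have d: "d - (i + 1 + j' + m') = Suc r" using less.prems jm by (simp add: r_def)
      have "monomial d i j m x = x $ Some 1 ^ i * ws x ^ j' * wt x ^ m' * x $ None ^ r * (wt x * ws x)"
        unfolding monomial_def r_def[symmetric] by (simp add: jm mult_ac)
      also have "\<dots> = monomial d (i + 1) j' m' x"
        unfolding Z0_relations(1)[OF that] monomial_def d by (simp add: mult_ac)
      finally show ?thesis .
    qed
    thus ?thesis by (intro reducible_cong[OF less.hyps]) (use less.prems jm in auto)
  next
    case 2
    then obtain i' where i: "i = i' + 2" by (metis add.commute le_Suc_ex)
    define r where "r = d - (i + j + m)"
    have d: "d - (i + j + m) = r" "d - (i' + 1 + (j + 1) + m) = r" "d - (i' + j + (m + 2)) = r"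
      "d - (i' + j + (m + 1)) = Suc r" "d - (i' + j + m) = r + 2" using less.prems i by (simp_all add: r_def)
    have red: "monomial d i j m x = (-1) * monomial d (i' + 1) (j + 1) m x + 4 * A * monomial d i' j (m + 2) x
       + 4 * b * monomial d i' j (m + 1) x + 4 * c * monomial d i' j m x" if x: "x \<in> Z0" for x
    proof -
      define a s t w where "a = x $ Some 1" "s = ws x" "t = wt x" "w = x $ None"
      note v = this
      have rel: "a ^ 3 = - (a\<^sup>2 * s) + 4 * a * (A * t\<^sup>2 + b * (t * w) + c * w\<^sup>2)" 
        "a\<^sup>2 * s = - (a * s\<^sup>2) + 4 * s * (A * t\<^sup>2 + b * (t * w) + c * w\<^sup>2)"
        using Z0_relations(2,3)[OF x] unfolding v by blast+
      \<comment> \<open>Both cubic relations are one quadratic relation for a^2 multiplied by a or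
        by s. The quadratic relation itself fails on the line, and the case assumption provides the
        required factor.\<close>
      have "a ^ i' * s ^ j * a\<^sup>2 = a ^ i' * s ^ j * (- (a * s) + 4 * (A * t\<^sup>2 + b * (t * w) + c * w\<^sup>2))"
        using 2(2)
      proof
        assume "i \<ge> 3"
        then obtain i2 where i2: "i' = Suc i2" using i by (cases i') auto
        have "a ^ i' * s ^ j * a\<^sup>2 = a ^ i2 * s ^ j * a ^ 3" by (simp add: i2 power2_eq_square power3_eq_cube mult_ac)
        also have "\<dots> = a ^ i' * s ^ j * (- (a * s) + 4 * (A * t\<^sup>2 + b * (t * w) + c * w\<^sup>2))"
          unfolding rel(1) by (simp add: i2 power2_eq_square algebra_simps)
        finally show ?thesis .
      next
        assume "j \<ge> 1"
        then obtain j2 where j2: "j = Suc j2" by (cases j) auto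
        have "a ^ i' * s ^ j * a\<^sup>2 = a ^ i' * s ^ j2 * (a\<^sup>2 * s)" by (simp add: j2 mult_ac)
        also have "\<dots> = a ^ i' * s ^ j * (- (a * s) + 4 * (A * t\<^sup>2 + b * (t * w) + c * w\<^sup>2))"
          unfolding rel(2) by (simp add: j2 power2_eq_square algebra_simps)
        finally show ?thesis .
      qed
      hence "a ^ i' * s ^ j * a\<^sup>2 * (t ^ m * w ^ r) = a ^ i' * s ^ j * (- (a * s) + 4 * (A * t\<^sup>2 + b * (t * w) + c * w\<^sup>2)) * (t ^ m * w ^ r)"
        by (simp only:)
      thus ?thesis unfolding monomial_def d v[symmetric] unfolding i by (simp add: power_add power2_eq_square algebra_simps)
    qed
    have "reducible_to_normal d (\<lambda>x. (-1) * monomial d (i' + 1) (j + 1) m x + 4 * A * monomial d i' j (m + 2) x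
       + 4 * b * monomial d i' j (m + 1) x + 4 * c * monomial d i' j m x)"
      by (intro reducible_add reducible_scale less.hyps) (use less.prems i in auto)
    thus ?thesis by (rule reducible_cong) (rule red)
  next
    case 3
    have "\<exists>f n. (f, n) \<in> normal_index d \<and> normal d (f, n) = monomial d i j m"
    proof -
      have i: "i = 0 \<or> i = 1 \<or> i = 2" using 3(2) by linarith
      consider "i = 0" "j = 0" | j' where "i = 0" "j = Suc j'" "m = 0" | "i = 1" "m = 0"
        | m' where "i = 1" "j = 0" "m = Suc m'" | "i = 2" "j = 0"
        using i 3 by (cases j; cases m) auto
      thus ?thesis
      proof cases
        case 1 thus ?thesis using less.prems by (intro exI[of _ 0] exI[of _ m]) (simp add: normal_index_iff normal_def)
      next
        case 2 thus ?thesis using less.prems by (intro exI[of _ 1] exI[of _ j']) (simp add: normal_index_iff normal_def)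
      next
        case 3 thus ?thesis using less.prems by (intro exI[of _ 2] exI[of _ j]) (simp add: normal_index_iff normal_def)
      next
        case 4 thus ?thesis using less.prems by (intro exI[of _ 3] exI[of _ m']) (auto simp: normal_index_iff normal_def)
      next
        case 5 thus ?thesis using less.prems by (intro exI[of _ 4] exI[of _ m]) (auto simp: normal_index_iff normal_def)
      qed
    qed
    then obtain f n where fn: "(f, n) \<in> normal_index d" "normal d (f, n) = monomial d i j m" by blast
    show ?thesis using reducible_normal[OF fn(1)] unfolding fn(2) .
  qed
qed

lemma reducible_form:
  assumes F: "F \<in> forms d" shows "reducible_to_normal d F"
proof -
  \<comment> \<open>The form rewritten in the coordinates (w, a, s, t), so that its monomials are
    the ones just reduced.\<close>
  define G where "G = (\<lambda>z :: complex^(3 option). F (\<chi> j. pt (z $ None) (z $ Some 1) (z $ Some 2) (z $ Some 3) $ j))"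
  have "G \<in> forms (d * 1)" unfolding G_def
    by (rule forms_compose[OF F]) (intro forms_pt forms_coord)
  hence "G \<in> forms d" by simp
  hence "reducible_to_normal d (\<lambda>x. G (vec3 (x $ None) (x $ Some 1) (ws x) (wt x)))"
  proof (induction rule: forms_induct)
    case (sum k)
    show ?case
    proof (intro reducible_sum reducible_scale)
      fix \<alpha> :: "3 option \<Rightarrow> nat" assume "\<alpha> \<in> {\<alpha>. sum \<alpha> UNIV = d}"
      hence s: "\<alpha> None + (\<alpha> (Some 1) + \<alpha> (Some 2) + \<alpha> (Some 3)) = d" by (simp add: sum_UNIV_option sum_3)
      hence n: "d - (\<alpha> (Some 1) + \<alpha> (Some 2) + \<alpha> (Some 3)) = \<alpha> None" by linarith
      have "monom_fun \<alpha> (vec3 (x $ None) (x $ Some 1) (ws x) (wt x)) = monomial d (\<alpha> (Some 1)) (\<alpha> (Some 2)) (\<alpha> (Some 3)) x" for x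
        unfolding monom_fun_def prod_UNIV_option prod_UNIV_3 vec3_nth monomial_def n by (simp only: mult_ac)
      thus "reducible_to_normal d (\<lambda>x. monom_fun \<alpha> (vec3 (x $ None) (x $ Some 1) (ws x) (wt x)))"
        using reducible_monomial[of "\<alpha> (Some 1)" "\<alpha> (Some 2)" "\<alpha> (Some 3)" d] s by simp
    qed
  qed
  moreover have "G (vec3 (x $ None) (x $ Some 1) (ws x) (wt x)) = F x" for x
    by (simp add: G_def vec_lambda_eta pt_eta)
  ultimately show ?thesis by simp
qed

text \<open>On the line all families but the powers of t vanish, which kills their coefficients. On
  C0, where a = t s, the rest is divisible by s, and the quotient has the shape treated by
  \<open>cover_expansion_zero\<close>.\<close>

lemma normal_independent:
  assumes d: "d \<ge> 1" and z: "\<And>x. x \<in> Z0 \<Longrightarrow> (\<Sum>i\<in>normal_index d. k i * normal d i x) = 0"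
  shows "\<forall>i\<in>normal_index d. k i = 0"
proof -
  have val: "(\<Sum>i\<in>normal_index d. k i * normal d i (pt 1 a s t)) = (\<Sum>n<d + 1. k (0, n) * t ^ n) +
     (\<Sum>n<d. k (1, n) * s ^ (n + 1)) + (\<Sum>n<d. k (2, n) * (a * s ^ n)) + (\<Sum>n<d - 1. k (3, n) * (a * t ^ (n + 1))) +
     (\<Sum>n<d - 1. k (4, n) * (a\<^sup>2 * t ^ n))" for a s t
    unfolding sum_normal_index normal_def by (simp add: monomial_def)
  have L: "(\<Sum>n<d + 1. k (0, n) * t ^ n) = 0" for t
  proof -
    have "pt 1 0 0 t \<in> Z0" unfolding Z0_iff by (intro disjI1 exI[of _ 1] exI[of _ t]) simp
    from z[OF this] show ?thesis unfolding val by simp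
  qed
  have k0: "k (0, n) = 0" if "n < d + 1" for n
    by (rule sum_powers_eq_0[where S = "{}" and n = "d + 1" and a = "\<lambda>n. k (0, n)"]) (use L that in auto)
  have "(\<forall>j<d. k (1, j) = 0 \<and> k (2, j) = 0) \<and> (\<Sum>n<d - 1. monom (k (3, n)) n) = 0 \<and> (\<Sum>n<d - 1. monom (k (4, n)) n) = 0"
  proof (rule cover_expansion_zero)
    fix t s assume s: "s \<noteq> 0" and ts: "t * (t + 1) * s\<^sup>2 = 4 * poly Q t"
    have "poly Q t = q t" by (simp add: power2_eq_square algebra_simps)
    hence "pt 1 (t * s) s t \<in> affine_chart C0" unfolding chart_C0_iff
      using s ts by (intro exI[of _ 1] exI[of _ s] exI[of _ t]) simp
    hence "pt 1 (t * s) s t \<in> Z0" unfolding Z0_iff by blast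
    from z[OF this] have 0: "(\<Sum>n<d. k (1, n) * s ^ (n + 1)) + (\<Sum>n<d. k (2, n) * (t * s * s ^ n)) + (\<Sum>n<d - 1. k (3, n) * (t * s * t ^ (n + 1))) +
     (\<Sum>n<d - 1. k (4, n) * ((t * s)\<^sup>2 * t ^ n)) = 0" unfolding val by (simp add: L[simplified])
    \<comment> \<open>After a = t s the families s^(n+1), a s^n, a t^(n+1), a^2 t^n divided by s are
      s^n, t s^n, t^2 t^n and s t^2 t^n.\<close>
    have "s * ((\<Sum>j<d. (k (1, j) + k (2, j) * t) * s ^ j) + t\<^sup>2 * ((\<Sum>n<d - 1. k (3, n) * t ^ n) + s * (\<Sum>n<d - 1. k (4, n) * t ^ n))) = 
       (\<Sum>n<d. k (1, n) * s ^ (n + 1)) + (\<Sum>n<d. k (2, n) * (t * s * s ^ n)) + (\<Sum>n<d - 1. k (3, n) * (t * s * t ^ (n + 1))) +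
     (\<Sum>n<d - 1. k (4, n) * ((t * s)\<^sup>2 * t ^ n))"
      by (simp add: sum_distrib_left distrib_left distrib_right sum.distrib power2_eq_square mult_ac)
    hence "(\<Sum>j<d. (k (1, j) + k (2, j) * t) * s ^ j) + t\<^sup>2 * ((\<Sum>n<d - 1. k (3, n) * t ^ n) + s * (\<Sum>n<d - 1. k (4, n) * t ^ n)) = 0"
      unfolding 0 using s by simp
    thus "(\<Sum>j<d. (k (1, j) + k (2, j) * t) * s ^ j) + t\<^sup>2 * (poly (\<Sum>n<d - 1. monom (k (3, n)) n) t + s * poly (\<Sum>n<d - 1. monom (k (4, n)) n) t) = 0"
      unfolding poly_sum_powers .
  qed
  hence k12: "\<And>j. j < d \<Longrightarrow> k (1, j) = 0" "\<And>j. j < d \<Longrightarrow> k (2, j) = 0"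
    and k3: "(\<Sum>n<d - 1. monom (k (3, n)) n) = 0" and k4: "(\<Sum>n<d - 1. monom (k (4, n)) n) = 0" by auto
  show ?thesis
  proof
    fix i assume "i \<in> normal_index d"
    moreover obtain f n where i: "i = (f, n)" by (cases i)
    ultimately have "f = 0 \<and> n < d + 1 \<or> f = 1 \<and> n < d \<or> f = 2 \<and> n < d \<or> f = 3 \<and> n < d - 1 \<or> f = 4 \<and> n < d - 1"
      unfolding i normal_index_iff by auto
    thus "k i = 0" unfolding i
      using k0 k12 sum_powers_poly_eq_0[OF k3] sum_powers_poly_eq_0[OF k4] by blast
  qed
qed

text \<open>The constant term -1 of 5 d - 1 gives genus 1 - (-1).\<close>

lemma arithmetic_genus_union: "arithmetic_genus (proj_closure Z0) = 2"
proof -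
  have "hilbert_function (proj_closure Z0) d = 5 * d - 1" if d: "d \<ge> 1" for d
  proof -
    have "hilbert_function (proj_closure Z0) d = card (normal_index d)"
    proof (rule hilbert_function_closure[where M = "normal d"])
      show "x \<noteq> 0" if "x \<in> Z0" for x using that by (auto simp: Z0_def affine_chart_def)
      show "\<exists>k. \<forall>x\<in>Z0. F x = (\<Sum>i\<in>normal_index d. k i * normal d i x)" if "F \<in> forms d" for F
        using reducible_form[OF that] unfolding reducible_to_normal_def .
      show "\<forall>i\<in>normal_index d. k i = 0" if "\<And>x. x \<in> Z0 \<Longrightarrow> (\<Sum>i\<in>normal_index d. k i * normal d i x) = 0" for k
        by (rule normal_independent[OF d that])
    qed (auto intro: finite_normal_index normal_forms)
    thus ?thesis using card_normal_index[OF d] by simp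
  qed
  hence "real (hilbert_function (proj_closure Z0) d) = 5 * real d + (- 1)" if "d \<ge> 1" for d
    using that by (simp add: of_nat_diff)
  from arithmetic_genus_linear[OF this] show ?thesis by simp
qed

end

section \<open>Specialization to the log-free curve\<close>

context lattice
begin

text \<open>The values P(0) = e1 - \<wp>(p + 1/2) and P(-1) = e1 - \<wp>(p) are nonzero and the
  leading coefficient is \<kappa>^2, so the algebraic results apply at every p with 2 p off the
  lattice.\<close>

lemma log_free_curve_as_tangential_quartic:
  assumes p: "2 * p \<notin> \<Lambda>"
  defines "A \<equiv> (kap p)\<^sup>2" and "b \<equiv> 2 * wp \<tau> p + e1 \<tau>" and "c \<equiv> e1 \<tau> - wp \<tau> (p + 1/2)"
  shows "tangential_quartic A b c (kap p)" and "model_poly \<tau> p = quartic.g A b c"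
    and "P_disc \<tau> p = b\<^sup>2 - 4 * A * c"
    and "noneven_component \<tau> p = affine_closure (tangential_quartic.C0 A b c (kap p) (lam p))"
    and "log_free_curve \<tau> p = tangential_quartic.L0 \<union> tangential_quartic.C0 A b c (kap p) (lam p)"
proof -
  have A_eq: "A = wp \<tau> p + wp \<tau> (p + 1/2) + e1 \<tau>" unfolding A_def by (rule kap_squared[OF p])
  have "A - b + c = e1 \<tau> - wp \<tau> p" unfolding A_eq b_def c_def by simp
  hence "A - b + c \<noteq> 0" using nonzero_facts(2)[OF p] by simp
  moreover have "A \<noteq> 0" "c \<noteq> 0" "kap p \<noteq> 0" "(kap p)\<^sup>2 = A"
    using nonzero_facts[OF p] by (simp_all add: A_def c_def)
  ultimately show tq: "tangential_quartic A b c (kap p)" by unfold_locales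
  then interpret tangential_quartic A b c "kap p" "lam p" .
  show "model_poly \<tau> p = g" 
    unfolding model_poly_def P_poly_def g_def A_eq[symmetric] b_def[symmetric] c_def[symmetric] ..
  show "P_disc \<tau> p = b\<^sup>2 - 4 * A * c"
    by (simp add: P_disc_def P_poly_def numeral_2_eq_2 A_eq b_def c_def)
  have t: "curve_param p T = tparam T" for T by (simp add: curve_param_def tparam_def)
  have iff: "T \<in> log_free_curve \<tau> p \<longleftrightarrow> T \<in> L0 \<or> T \<in> C0" for T
    unfolding log_free_curve_iff[OF p] poly_P_poly[OF p] t L0_def C0_def mem_Collect_eq
      A_def[symmetric] b_def[symmetric] c_def[symmetric] by (rule refl)
  thus "log_free_curve \<tau> p = L0 \<union> C0" by blast
  have "{T \<in> log_free_curve \<tau> p. T$2 + T$3 \<noteq> 0} = C0"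
    unfolding iff by (auto simp: L0_def C0_def)
  thus "noneven_component \<tau> p = affine_closure C0" by (simp add: noneven_component_def)
qed

end

theorem theorem1p8:
  fixes \<tau> :: complex
  assumes "Im \<tau> > 0"
  shows
    "finite (torus_point \<tau> ` {p. 2 * p \<notin> period_lattice \<tau> \<and> P_disc \<tau> p = 0}) \<and>
     (\<forall>p. 2 * p \<notin> period_lattice \<tau> \<longrightarrow>
        birational (double_cover_model (model_poly \<tau> p))
                   (affine_chart (double_cover_affine (model_poly \<tau> p))) \<and>
        birational (double_cover_model (model_poly \<tau> p))
                   (affine_chart (noneven_component \<tau> p)) \<and>
        (P_disc \<tau> p \<noteq> 0 \<longrightarrow>
           smooth_projective_curve (double_cover_model (model_poly \<tau> p)) \<and>
           arithmetic_genus (double_cover_model (model_poly \<tau> p)) = 1) \<and>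
        (P_disc \<tau> p = 0 \<longrightarrow>
           nodal_curve (double_cover_model (model_poly \<tau> p)) \<and>
           (\<exists>(\<nu> :: complex^(3 option) \<Rightarrow> complex^(3 option)) X.
              normalization \<nu> X (double_cover_model (model_poly \<tau> p)) \<and> rational_curve X)) \<and>
        arithmetic_genus (compactified_log_free_curve \<tau> p) = 2)"
proof -
  interpret lattice \<tau> by unfold_locales (rule assms)
  show ?thesis
  proof (intro conjI finite_P_disc_zeros allI impI)
    fix p assume p: "2 * p \<notin> period_lattice \<tau>"
    define A b c where "A = (kap p)\<^sup>2" and "b = 2 * wp \<tau> p + e1 \<tau>" and "c = e1 \<tau> - wp \<tau> (p + 1/2)"
    note claims = log_free_curve_as_tangential_quartic[OF p, folded A_def b_def c_def]
    interpret tangential_quartic A b c "kap p" "lam p" by (rule claims(1))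
    note model = claims(2)
    show "birational (double_cover_model (model_poly \<tau> p)) (affine_chart (double_cover_affine (model_poly \<tau> p)))"
      unfolding model by (rule birational_affine_double_cover)
    show "birational (double_cover_model (model_poly \<tau> p)) (affine_chart (noneven_component \<tau> p))"
      unfolding model claims(4) using birational_Y by (simp only: Y_def)
    show "arithmetic_genus (compactified_log_free_curve \<tau> p) = 2"
      unfolding compactified_log_free_curve_def claims(5) using arithmetic_genus_union by (simp only: Z0_def)
    show "smooth_projective_curve (double_cover_model (model_poly \<tau> p))"
      "arithmetic_genus (double_cover_model (model_poly \<tau> p)) = 1" if "P_disc \<tau> p \<noteq> 0"
      using that unfolding claims(3) model by (rule smooth_X, intro arithmetic_genus_X)
    assume "P_disc \<tau> p = 0"
    then interpret nodal_quartic A b c by unfold_locales (simp add: claims(3))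
    show "nodal_curve (double_cover_model (model_poly \<tau> p))" unfolding model by (rule nodal_X)
    show "\<exists>(\<nu> :: complex^(3 option) \<Rightarrow> complex^(3 option)) X.
        normalization \<nu> X (double_cover_model (model_poly \<tau> p)) \<and> rational_curve X"
      unfolding model using normalization_nu rational_coord_line_3 by blast
  qed
qed

end
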